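(* (Soundness.) Let $\mathbb C=(p\colon\mathfrak T\to\mathfrak C,\ E\colon\mathfrak T\to\mathfrak C^{\mathbf 2},\dots)$ be a model of two-dimensional type theory, with internal language $\mathrm S(\mathbb C)$. Let $A_1\in\mathfrak T(1)$, $A_2\in\mathfrak T(1.A_1)$, …, $A_n\in\mathfrak T(1.A_1\cdots A_{n-1})$. For any $B,C\in\mathfrak T(1.A_1.A_2\cdots A_n)$, if the judgement $$x:\overline{A_1}.\overline{A_2}\cdots\overline{A_n}\vdash\overline B(x)=\overline C(x)\ \mathsf{type}$$ is derivable in $\mathrm S(\mathbb C)$, then $B=C$. Likewise, for global sections $b,c\in_{1.A_1\cdots A_n}B$, if the judgement $$x:\overline{A_1}.\overline{A_2}\cdots\overline{A_n}\vdash\overline b(x)=\overline c(x):\overline B(x)$$ is derivable in $\mathrm S(\mathbb C)$, then $b=c$.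
   Context: **1. The calculus $\mathrm{ML}_2$.** Judgement forms: $A\ \mathsf{type}$; $a:A$; $A=B\ \mathsf{type}$; $a=b:A$ (definitional equality), each relative to a context $\Gamma=(x_1:A_1,\dots,x_n:A_n)$ with $A_i$ a type in context $(x_1:A_1,\dots,x_{i-1}:A_{i-1})$. There are equality rules (definitional equality is a congruence) and structural rules (weakening, contraction, exchange, substitution). All rules are relative to an arbitrary ambient context, and all operations are stable under substitution in it. Logical rules: - $\Sigma$: from $A$ and $x:A\vdash B(x)$ form $\Sigma(A,B)$; from $a:A$, $b:B(a)$ get $\langle a,b\rangle:\Sigma(A,B)$; from $z:\Sigma(A,B)\vdash C(z)\ \mathsf{type}$ and $x:A,y:B(x)\vdash d(x,y):C(\langle x,y\rangle)$ get $z:\Sigma(A,B)\vdash \mathrm E_d(z):C(z)$ with $\mathrm E_d(\langle x,y\rangle)=d(x,y)$. - Unit: $\mathbf 1\ \mathsf{type}$; $\star:\mathbf 1$; from $z:\mathbf 1\vdash C(z)\ \mathsf{type}$ and $d:C(\star)$ get $z:\mathbf 1\vdash\mathrm U_d(z):C(z)$ with $\mathrm U_d(\star)=d$. - Identity: from $a,b:A$ form $\mathrm{Id}_A(a,b)$; $\mathrm r(a):\mathrm{Id}_A(a,a)$; from $x,y:A,p:\mathrm{Id}_A(x,y)\vdash C(x,y,p)\ \mathsf{type}$ and $x:A\vdash d(x):C(x,x,\mathrm r(x))$ get $x,y:A,p:\mathrm{Id}_A(x,y)\vdash\mathrm J_d(x,y,p):C(x,y,p)$ with $\mathrm J_d(x,x,\mathrm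 r(x))=d(x)$. - $\Pi$: form $\Pi(A,B)$; from $x:A\vdash f(x):B(x)$ get $\lambda f:\Pi(A,B)$; from $m:\Pi(A,B)$ get $y:A\vdash m\cdot y:B(y)$; $(\lambda f)\cdot y=f(y)$. - Discrete identity types: if $p,q:\mathrm{Id}_A(a,b)$ and $\alpha:\mathrm{Id}(p,q)$ then $p=q$ and $\alpha=\mathrm r(p)$. - Function extensionality: from $m,n:\Pi(A,B)$ and $x:A\vdash p(x):\mathrm{Id}(m\cdot x,n\cdot x)$ get $\mathsf{ext}(m,n,p):\mathrm{Id}(m,n)$; $\mathsf{ext}(m,m,[x]\mathrm r(m\cdot x))=\mathrm r(m)$; $\mathsf{ext}(m,n,p)\ast x=p(x)$, where $p\ast a:=\mathrm J_{[x]\mathrm r(x\cdot a)}(m,n,p)$. **2. 2-categorical notions.** A 2-category is *locally groupoidal* if all its 2-cells are invertible. $\mathfrak C^{\mathbf 2}$ is the 2-category of arrows, commutative squares and compatible pairs of 2-cells. The slice $\mathfrak C/\Gamma$ has strictly commuting triangles as 1-cells and, as 2-cells, those whose composite with the structure map to $\Gamma$ is an identity ("over $\Gamma$"). A *normal isofibration* structure on $p\colon X\to Y$ chooses, for each invertible $\alpha\colon f\Rightarrow pg$ (with $f\colon W\to Y$, $g\colon W\to X$), a map $s_\alpha\colon W\to X$ and a 2-cell $\sigma_\alpha\colon s_\alpha\Rightarrow g$ with $ps_\alpha=f$, $p\sigma_\alpha=\alpha$, such that $s_{\alpha k}=s_\alpha k$, $\sigma_{\alpha k}=\sigma_\alpha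 k$ for all $k\colon W'\to W$, and $s_{\mathrm{id}_{pg}}=g$, $\sigma_{\mathrm{id}_{pg}}=\mathrm{id}_g$. An *injective equivalence* structure on $i\colon x\to y$ is a map $k\colon y\to x$ with $ki=\mathrm{id}$ and an invertible $\theta\colon\mathrm{id}_y\Rightarrow ik$ with $\theta i=\mathrm{id}_i$, $k\theta=\mathrm{id}_k$. An *arrow object* for $X$ is an object $Y$ with a 2-cell $\kappa\colon s\Rightarrow t\colon Y\to X$ inducing isomorphisms of categories $\mathbf K(A,Y)\cong\mathbf K(A,X)^{\mathbf 2}$, 2-natural in $A$. Given a square $pf=gi$ with $p$ a normal isofibration and $i$ an injective equivalence, its *canonical filler* is $s_{g\theta}$, the lift of $g\theta\colon g\Rightarrow p(fk)$. **3. Models.** A model of two-dimensional type theory $\mathbb C$ consists of the following. (a) Locally groupoidal 2-categories $\mathfrak C$ (with a specified 2-terminal object $1$) and $\mathfrak T$, and a 2-functor $p\colon\mathfrak T\to\mathfrak C$ such that: its underlying functor is a split fibration; for each cartesian 1-cell $f\colon y\to z$ of $\mathfrak T$ and each 2-cell $\alpha\colon g\Rightarrow h\colon x\to z$ of $\mathfrak T$, any factorisation $p(\alpha)=p(f)\gamma$ lifts uniquely to $\alpha=f\gamma'$ with $p(\gamma')=\gamma$; each $\mathfrak T(x,y)\to\mathfrak C(px,py)$ is a fibration of groupoids. Write $\mathfrak T(\Gamma)$ for the fibre 2-category over $\Gamma$ and $f^*\colon\mathfrak T(\Gamma)\to\mathfrak T(\Delta)$ for reindexing along $f\colon\Delta\to\Gamma$.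 (b) A 2-functor $E\colon\mathfrak T\to\mathfrak C^{\mathbf 2}$ with $\mathrm{cod}\circ E=p$, bijective on 1-cells and 2-cells between given objects, sending cartesian morphisms to 2-pullback squares, with a chosen normal isofibration structure on each $E(A)$. For $A\in\mathfrak T(\Gamma)$ write $E(A)=\pi_A\colon\Gamma.A\to\Gamma$; the chosen cartesian lift of $f\colon\Gamma\to\Delta$ at $B\in\mathfrak T(\Delta)$ gives $f.\iota\colon\Gamma.f^*B\to\Delta.B$. Stability: for $A\in\mathfrak T(\Delta)$, $B\in\mathfrak T(\Delta.A)$, $f\colon\Gamma\to\Delta$, and any $\alpha\colon h\Rightarrow\pi_{f^*B}k$ with $h\colon\Lambda\to\Gamma.f^*A$, $k\colon\Lambda\to\Gamma.f^*A.f^*B$ and $\pi_{f^*A}\alpha$ an identity, the chosen lifts satisfy $s_{(f.\iota)\alpha}=(f.\iota.\iota)s_\alpha$ and $\sigma_{(f.\iota)\alpha}=(f.\iota.\iota)\sigma_\alpha$. A *global section* $a\in_\Gamma A$ is a map $a\colon\Gamma\to\Gamma.A$ with $\pi_Aa=\mathrm{id}$; $f^*a\in_\Delta f^*A$ is its pullback along $f\colon\Delta\to\Gamma$. (c) Identity: for $A\in\mathfrak T(\Gamma)$, an object $\mathrm{Id}_A\in\mathfrak T(\Gamma.A.A)$ (where $\Gamma.A.A$ means $\Gamma.A.\pi_A^*A$) and a 2-cell $\kappa\colon s\Rightarrow t\colon\Gamma.A.A.\mathrm{Id}_A\to\Gamma.A$ over $\Gamma$, with $s,t$ the two projections, forming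 an arrow object for $\Gamma.A$ in $\mathfrak C/\Gamma$; stable: $(f.\iota.\iota)^*\mathrm{Id}_A=\mathrm{Id}_{f^*A}$ and $\kappa_{f^*A}$ is the reindexing of $\kappa_A$. (d) Units: for each $\Gamma$, an object $\mathbf 1_\Gamma\in\mathfrak T(\Gamma)$ and a map $u_\Gamma\colon\Gamma\to\Gamma.\mathbf 1_\Gamma$ over $\Gamma$; for each $f\colon\Gamma\to\Gamma.A$ over $\Gamma$ a chosen $\bar f\colon\Gamma.\mathbf 1_\Gamma\to\Gamma.A$ over $\Gamma$ with $\bar fu_\Gamma=f$; and for $h,k\colon\Gamma.\mathbf 1_\Gamma\to\Gamma.A$ over $\Gamma$ each 2-cell $\alpha\colon hu_\Gamma\Rightarrow ku_\Gamma$ over $\Gamma$ is $\bar\alpha u_\Gamma$ for a unique $\bar\alpha\colon h\Rightarrow k$ over $\Gamma$; $\mathbf 1_\Gamma$, $u_\Gamma$ and $f\mapsto\bar f$ are preserved by reindexing. (e) Sums: for $A\in\mathfrak T(\Gamma)$, $B\in\mathfrak T(\Gamma.A)$, with $\Delta_A:=\pi_A^*$, an object $\Sigma_A(B)\in\mathfrak T(\Gamma)$ and $\eta\colon B\to\Delta_A\Sigma_A(B)$; for each $f\colon B\to\Delta_AC$ a chosen $\bar f\colon\Sigma_A(B)\to C$ with $\Delta_A(\bar f)\eta=f$; and each $\alpha\colon\Delta_A(h)\eta\Rightarrow\Delta_A(k)\eta$ is $\Delta_A(\bar\alpha)\eta$ for a unique $\bar\alpha\colon h\Rightarrow k$. Further,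 a chosen injective equivalence structure in $\mathfrak C/\Gamma$ on the map $i\colon\Gamma.A.B\to\Gamma.\Sigma_A(B)$ corresponding to $\eta$. All preserved by reindexing. (f) Products: for $A,B$ as in (e), an object $\Pi_A(B)\in\mathfrak T(\Gamma)$ and $\epsilon\colon\Delta_A\Pi_A(B)\to B$; for each $f\colon\Delta_AC\to B$ a chosen $\bar f\colon C\to\Pi_A(B)$ with $\epsilon\Delta_A(\bar f)=f$; and each $\alpha\colon\epsilon\Delta_A(h)\Rightarrow\epsilon\Delta_A(k)$ is $\epsilon\Delta_A(\bar\alpha)$ for a unique $\bar\alpha\colon h\Rightarrow k$. All preserved by reindexing. **4. The internal language $\mathrm S(\mathbb C)$.** Semantic operations in a model: $r_A\colon\Gamma.A\to\Gamma.A.A.\mathrm{Id}_A$ is the map with $\kappa r_A=\mathrm{id}$; it is an injective equivalence over $\Gamma$ with retraction $t$ and 2-cell $\theta\colon\mathrm{id}\Rightarrow r_At$ determined by $s\theta=\kappa$, $t\theta=\mathrm{id}_t$. For $C\in\mathfrak T(\Gamma.A.A.\mathrm{Id}_A)$ and $d\colon\Gamma.A\to\Gamma.A.A.\mathrm{Id}_A.C$ with $\pi_Cd=r_A$, $J_d$ is the canonical filler of $\pi_Cd=\mathrm{id}\,r_A$. Likewise $U_d$ is the canonical filler for $u_\Gamma$ (injective equivalence with retraction $\pi_{\mathbf 1_\Gamma}$ and the unique 2-cell $\theta\colon\mathrm{id}\Rightarrow u_\Gamma\pi_{\mathbf 1_\Gamma}$ over $\Gamma$ with $\theta u_\Gamma=\mathrm{id}$)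 and $E_d$ that for $i\colon\Gamma.A.B\to\Gamma.\Sigma_A(B)$; semantic pairing is $i$, the semantic unit element is $u_\Gamma$, semantic application is $\epsilon\colon\Gamma.A.\Pi_A(B)\to\Gamma.A.B$; for $f\in_{\Gamma.A}B$, $\lambda(f)=\bar{\bar f}u_\Gamma$, where $\bar f\colon\mathbf 1_{\Gamma.A}=\Delta_A\mathbf 1_\Gamma\to B$ and $\bar{\bar f}\colon\mathbf 1_\Gamma\to\Pi_A(B)$; for $m,n\in_\Gamma\Pi_A(B)$ and $p\colon\epsilon\Delta_A(m)\Rightarrow\epsilon\Delta_A(n)$ over $\Gamma.A$, $\mathsf{ext}(p)=\bar{\bar p}u_\Gamma\colon m\Rightarrow n$, where $\bar p\colon\epsilon\Delta_A(\bar m)\Rightarrow\epsilon\Delta_A(\bar n)$ is unique with $\bar pu_{\Gamma.A}=p$ and $\bar{\bar p}\colon\bar m\Rightarrow\bar n$ is unique with $\epsilon\Delta_A(\bar{\bar p})=\bar p$ (2-cells over $\Gamma$ between maps into $\Gamma.A$ are identified with maps into $\Gamma.A.A.\mathrm{Id}_A$). $\mathrm S(\mathbb C)$ extends $\mathrm{ML}_2$ by premiss-free rules (axioms), for all $n$ and all $\Gamma=1.A_1\cdots A_n$, with $\overline\Gamma=(x_1:\overline{A_1},\dots,x_n:\overline{A_n}(x_1,\dots,x_{n-1}))$ (written $x:\overline{A_1}\cdots\overline{A_n}$ in the claim): a type $\overline\Gamma\vdash\overline A\ \mathsf{type}$ for each $A\in\mathfrak T(\Gamma)$; a term $\overline\Gamma\vdash\overline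 a:\overline A$ for each $a\in_\Gamma A$; equations identifying syntactic substitution of $\overline a$ in $\overline B$ and in $\overline b$ with $\overline{a^*B}$ and $\overline{a^*b}$ (or with the reindexings along $a.\iota\cdots\iota$ when further variables follow), and similarly identifying weakening, contraction and exchange with reindexing along projections, diagonals and symmetries (variables being given by diagonal sections); and equations identifying each type former, introduction, elimination, abstraction, application and extensionality operation of $\mathrm{ML}_2$ applied to barred data with the bar of the corresponding semantic operation (e.g. $\mathrm{Id}_{\overline A}(x,y)=\overline{\mathrm{Id}_A}(x,y)$, $\mathrm r(x)=\overline{r_A}(x)$, $\mathrm J_{\overline d}(x,y,p)=\overline{J_d}(x,y,p)$).
   Formalization: In clause (b), stability of the chosen lifts is required for B over any iterated extension Δ.A₁⋯Aₙ and 2-cells over Γ, not only over Δ.A; with the one-type clause alone J_d need not be stable under reindexing and the claim fails. *)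

theory Defs
  imports Main
begin

section \<open>Strict 2-categories\<close>

text \<open>Composition is in applicative order: \<open>g \<cdot> f\<close> is \<open>f\<close> followed by \<open>g\<close>, and
  \<open>\<beta> \<bullet> \<alpha>\<close> is the vertical composite \<open>\<alpha>\<close> followed by \<open>\<beta>\<close>.\<close>

record ('o, 'm, 'c) two_cat =
  Ob :: "'o set"
  Arr :: "'m set"
  Dom :: "'m \<Rightarrow> 'o"
  Cod :: "'m \<Rightarrow> 'o"
  Ide :: "'o \<Rightarrow> 'm"
  Cmp :: "'m \<Rightarrow> 'm \<Rightarrow> 'm" (infixr "\<cdot>\<index>" 75)
  Cell :: "'c set"
  Src :: "'c \<Rightarrow> 'm"
  Tgt :: "'c \<Rightarrow> 'm"
  Id2 :: "'m \<Rightarrow> 'c"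
  VCmp :: "'c \<Rightarrow> 'c \<Rightarrow> 'c" (infixr "\<bullet>\<index>" 75)
  HCmp :: "'c \<Rightarrow> 'c \<Rightarrow> 'c" (infixr "\<star>\<index>" 75)

definition hom :: "('o, 'm, 'c) two_cat \<Rightarrow> 'o \<Rightarrow> 'o \<Rightarrow> 'm set" where
  "hom K x y = {f \<in> Arr K. Dom K f = x \<and> Cod K f = y}"

definition cells :: "('o, 'm, 'c) two_cat \<Rightarrow> 'm \<Rightarrow> 'm \<Rightarrow> 'c set" where
  "cells K f g = {\<alpha> \<in> Cell K. Src K \<alpha> = f \<and> Tgt K \<alpha> = g}"

abbreviation whisker_left :: "('o, 'm, 'c) two_cat \<Rightarrow> 'm \<Rightarrow> 'c \<Rightarrow> 'c" where
  "whisker_left K f \<alpha> \<equiv> HCmp K (Id2 K f) \<alpha>"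

abbreviation whisker_right :: "('o, 'm, 'c) two_cat \<Rightarrow> 'c \<Rightarrow> 'm \<Rightarrow> 'c" where
  "whisker_right K \<alpha> f \<equiv> HCmp K \<alpha> (Id2 K f)"

locale two_category =
  fixes K :: "('o, 'm, 'c) two_cat" (structure)
  assumes dom_ob: "f \<in> Arr K \<Longrightarrow> Dom K f \<in> Ob K"
    and cod_ob: "f \<in> Arr K \<Longrightarrow> Cod K f \<in> Ob K"
    and ide_hom: "x \<in> Ob K \<Longrightarrow> Ide K x \<in> hom K x x"
    and cmp_hom: "f \<in> hom K x y \<Longrightarrow> g \<in> hom K y z \<Longrightarrow> g \<cdot> f \<in> hom K x z"
    and cmp_ide_right: "f \<in> Arr K \<Longrightarrow> f \<cdot> Ide K (Dom K f) = f"
    and cmp_ide_left: "f \<in> Arr K \<Longrightarrow> Ide K (Cod K f) \<cdot> f = f"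
    and cmp_assoc: "f \<in> hom K w x \<Longrightarrow> g \<in> hom K x y \<Longrightarrow> h \<in> hom K y z \<Longrightarrow>
          (h \<cdot> g) \<cdot> f = h \<cdot> (g \<cdot> f)"
    and src_arr: "\<alpha> \<in> Cell K \<Longrightarrow> Src K \<alpha> \<in> Arr K"
    and tgt_arr: "\<alpha> \<in> Cell K \<Longrightarrow> Tgt K \<alpha> \<in> Arr K"
    and cell_dom: "\<alpha> \<in> Cell K \<Longrightarrow> Dom K (Src K \<alpha>) = Dom K (Tgt K \<alpha>)"
    and cell_cod: "\<alpha> \<in> Cell K \<Longrightarrow> Cod K (Src K \<alpha>) = Cod K (Tgt K \<alpha>)"
    and id2_cell: "f \<in> Arr K \<Longrightarrow> Id2 K f \<in> cells K f f"
    and vcmp_cell: "\<alpha> \<in> cells K f g \<Longrightarrow> \<beta> \<in> cells K g h \<Longrightarrow> \<beta> \<bullet> \<alpha> \<in> cells K f h"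
    and vcmp_id_right: "\<alpha> \<in> cells K f g \<Longrightarrow> \<alpha> \<bullet> Id2 K f = \<alpha>"
    and vcmp_id_left: "\<alpha> \<in> cells K f g \<Longrightarrow> Id2 K g \<bullet> \<alpha> = \<alpha>"
    and vcmp_assoc: "\<alpha> \<in> cells K f g \<Longrightarrow> \<beta> \<in> cells K g h \<Longrightarrow> \<gamma> \<in> cells K h k \<Longrightarrow>
          (\<gamma> \<bullet> \<beta>) \<bullet> \<alpha> = \<gamma> \<bullet> (\<beta> \<bullet> \<alpha>)"
    and hcmp_cell: "\<alpha> \<in> cells K f f' \<Longrightarrow> \<beta> \<in> cells K g g' \<Longrightarrow> Cod K f = Dom K g \<Longrightarrow>
          \<beta> \<star> \<alpha> \<in> cells K (g \<cdot> f) (g' \<cdot> f')"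
    and hcmp_id_right: "\<alpha> \<in> cells K f f' \<Longrightarrow> \<alpha> \<star> Id2 K (Ide K (Dom K f)) = \<alpha>"
    and hcmp_id_left: "\<alpha> \<in> cells K f f' \<Longrightarrow> Id2 K (Ide K (Cod K f)) \<star> \<alpha> = \<alpha>"
    and hcmp_assoc: "\<alpha> \<in> cells K f f' \<Longrightarrow> \<beta> \<in> cells K g g' \<Longrightarrow> \<gamma> \<in> cells K h h' \<Longrightarrow>
          Cod K f = Dom K g \<Longrightarrow> Cod K g = Dom K h \<Longrightarrow>
          (\<gamma> \<star> \<beta>) \<star> \<alpha> = \<gamma> \<star> (\<beta> \<star> \<alpha>)"
    and hcmp_id2: "f \<in> Arr K \<Longrightarrow> g \<in> Arr K \<Longrightarrow> Cod K f = Dom K g \<Longrightarrow>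
          Id2 K g \<star> Id2 K f = Id2 K (g \<cdot> f)"
    and interchange: "\<alpha> \<in> cells K f f' \<Longrightarrow> \<alpha>' \<in> cells K f' f'' \<Longrightarrow>
          \<beta> \<in> cells K g g' \<Longrightarrow> \<beta>' \<in> cells K g' g'' \<Longrightarrow> Cod K f = Dom K g \<Longrightarrow>
          (\<beta>' \<bullet> \<beta>) \<star> (\<alpha>' \<bullet> \<alpha>) = (\<beta>' \<star> \<alpha>') \<bullet> (\<beta> \<star> \<alpha>)"

definition invertible_cell :: "('o, 'm, 'c) two_cat \<Rightarrow> 'c \<Rightarrow> bool" where
  "invertible_cell K \<alpha> \<longleftrightarrow> \<alpha> \<in> Cell K \<and>
     (\<exists>\<beta> \<in> cells K (Tgt K \<alpha>) (Src K \<alpha>).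
        \<beta> \<bullet>\<^bsub>K\<^esub> \<alpha> = Id2 K (Src K \<alpha>) \<and> \<alpha> \<bullet>\<^bsub>K\<^esub> \<beta> = Id2 K (Tgt K \<alpha>))"

definition locally_groupoidal :: "('o, 'm, 'c) two_cat \<Rightarrow> bool" where
  "locally_groupoidal K \<longleftrightarrow> (\<forall>\<alpha> \<in> Cell K. invertible_cell K \<alpha>)"

record ('o, 'm, 'c, 'o1, 'm1, 'c1) two_fun =
  F0 :: "'o \<Rightarrow> 'o1"
  F1 :: "'m \<Rightarrow> 'm1"
  F2 :: "'c \<Rightarrow> 'c1"

locale two_functor = S: two_category K + T: two_category L
  for K :: "('o, 'm, 'c) two_cat" and L :: "('o1, 'm1, 'c1) two_cat"
    and F :: "('o, 'm, 'c, 'o1, 'm1, 'c1) two_fun" +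
  assumes fun_ob: "x \<in> Ob K \<Longrightarrow> F0 F x \<in> Ob L"
    and fun_hom: "f \<in> hom K x y \<Longrightarrow> F1 F f \<in> hom L (F0 F x) (F0 F y)"
    and fun_ide: "x \<in> Ob K \<Longrightarrow> F1 F (Ide K x) = Ide L (F0 F x)"
    and fun_cmp: "f \<in> hom K x y \<Longrightarrow> g \<in> hom K y z \<Longrightarrow>
          F1 F (g \<cdot>\<^bsub>K\<^esub> f) = F1 F g \<cdot>\<^bsub>L\<^esub> F1 F f"
    and fun_cells: "\<alpha> \<in> cells K f g \<Longrightarrow> F2 F \<alpha> \<in> cells L (F1 F f) (F1 F g)"
    and fun_id2: "f \<in> Arr K \<Longrightarrow> F2 F (Id2 K f) = Id2 L (F1 F f)"
    and fun_vcmp: "\<alpha> \<in> cells K f g \<Longrightarrow> \<beta> \<in> cells K g h \<Longrightarrow>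
          F2 F (\<beta> \<bullet>\<^bsub>K\<^esub> \<alpha>) = F2 F \<beta> \<bullet>\<^bsub>L\<^esub> F2 F \<alpha>"
    and fun_hcmp: "\<alpha> \<in> cells K f f' \<Longrightarrow> \<beta> \<in> cells K g g' \<Longrightarrow> Cod K f = Dom K g \<Longrightarrow>
          F2 F (\<beta> \<star>\<^bsub>K\<^esub> \<alpha>) = F2 F \<beta> \<star>\<^bsub>L\<^esub> F2 F \<alpha>"

text \<open>The arrow 2-category. A 1-cell \<open>(f, g, u, v)\<close> is the commutative square from \<open>f\<close> to \<open>g\<close>
  with upper side \<open>u\<close> (between domains) and lower side \<open>v\<close> (between codomains); a 2-cell
  \<open>(f, g, \<alpha>, \<beta>)\<close> is likewise a compatible pair.\<close>

definition arrow_cat ::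
  "('o, 'm, 'c) two_cat \<Rightarrow> ('m, 'm \<times> 'm \<times> 'm \<times> 'm, 'm \<times> 'm \<times> 'c \<times> 'c) two_cat" where
  "arrow_cat K =
    (let sq = {(f, g, u, v). f \<in> Arr K \<and> g \<in> Arr K \<and>
                 u \<in> hom K (Dom K f) (Dom K g) \<and> v \<in> hom K (Cod K f) (Cod K g) \<and>
                 g \<cdot>\<^bsub>K\<^esub> u = v \<cdot>\<^bsub>K\<^esub> f} in
     \<lparr> Ob = Arr K,
       Arr = sq,
       Dom = (\<lambda>(f, g, u, v). f),
       Cod = (\<lambda>(f, g, u, v). g),
       Ide = (\<lambda>f. (f, f, Ide K (Dom K f), Ide K (Cod K f))),
       Cmp = (\<lambda>(g, h, u', v') (f, g', u, v). (f, h, u' \<cdot>\<^bsub>K\<^esub> u, v' \<cdot>\<^bsub>K\<^esub> v)),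
       Cell = {(f, g, \<alpha>, \<beta>). \<alpha> \<in> Cell K \<and> \<beta> \<in> Cell K \<and>
                 (f, g, Src K \<alpha>, Src K \<beta>) \<in> sq \<and> (f, g, Tgt K \<alpha>, Tgt K \<beta>) \<in> sq \<and>
                 whisker_left K g \<alpha> = whisker_right K \<beta> f},
       Src = (\<lambda>(f, g, \<alpha>, \<beta>). (f, g, Src K \<alpha>, Src K \<beta>)),
       Tgt = (\<lambda>(f, g, \<alpha>, \<beta>). (f, g, Tgt K \<alpha>, Tgt K \<beta>)),
       Id2 = (\<lambda>(f, g, u, v). (f, g, Id2 K u, Id2 K v)),
       VCmp = (\<lambda>(f, g, \<alpha>', \<beta>') (f', g', \<alpha>, \<beta>). (f, g, \<alpha>' \<bullet>\<^bsub>K\<^esub> \<alpha>, \<beta>' \<bullet>\<^bsub>K\<^esub> \<beta>)),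
       HCmp = (\<lambda>(g, h, \<alpha>', \<beta>') (f, g', \<alpha>, \<beta>). (f, h, \<alpha>' \<star>\<^bsub>K\<^esub> \<alpha>, \<beta>' \<star>\<^bsub>K\<^esub> \<beta>)) \<rparr>)"

text \<open>The slice over \<open>X\<close>. A 1-cell \<open>(p, q, f)\<close> is the strictly commuting triangle \<open>q f = p\<close>.\<close>

definition slice ::
  "('o, 'm, 'c) two_cat \<Rightarrow> 'o \<Rightarrow> ('m, 'm \<times> 'm \<times> 'm, 'm \<times> 'm \<times> 'c) two_cat" where
  "slice K X =
    (let tri = {(p, q, f). p \<in> Arr K \<and> q \<in> Arr K \<and> Cod K p = X \<and> Cod K q = X \<and>
                  f \<in> hom K (Dom K p) (Dom K q) \<and> q \<cdot>\<^bsub>K\<^esub> f = p} in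
     \<lparr> Ob = {p \<in> Arr K. Cod K p = X},
       Arr = tri,
       Dom = (\<lambda>(p, q, f). p),
       Cod = (\<lambda>(p, q, f). q),
       Ide = (\<lambda>p. (p, p, Ide K (Dom K p))),
       Cmp = (\<lambda>(q, r, g) (p, q', f). (p, r, g \<cdot>\<^bsub>K\<^esub> f)),
       Cell = {(p, q, \<alpha>). \<alpha> \<in> Cell K \<and> (p, q, Src K \<alpha>) \<in> tri \<and> (p, q, Tgt K \<alpha>) \<in> tri \<and>
                 whisker_left K q \<alpha> = Id2 K p},
       Src = (\<lambda>(p, q, \<alpha>). (p, q, Src K \<alpha>)),
       Tgt = (\<lambda>(p, q, \<alpha>). (p, q, Tgt K \<alpha>)),
       Id2 = (\<lambda>(p, q, f). (p, q, Id2 K f)),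
       VCmp = (\<lambda>(p, q, \<beta>) (p', q', \<alpha>). (p, q, \<beta> \<bullet>\<^bsub>K\<^esub> \<alpha>)),
       HCmp = (\<lambda>(q, r, \<beta>) (p, q', \<alpha>). (p, r, \<beta> \<star>\<^bsub>K\<^esub> \<alpha>)) \<rparr>)"

definition two_terminal :: "('o, 'm, 'c) two_cat \<Rightarrow> 'o \<Rightarrow> bool" where
  "two_terminal K z \<longleftrightarrow> z \<in> Ob K \<and>
     (\<forall>x \<in> Ob K. \<exists>!f. f \<in> hom K x z) \<and>
     (\<forall>\<alpha> \<in> Cell K. Cod K (Src K \<alpha>) = z \<longrightarrow> \<alpha> = Id2 K (Src K \<alpha>))"

text \<open>\<open>p\<close> and \<open>q\<close> are the projections of a 2-pullback of the cospan \<open>f\<close>, \<open>g\<close>.\<close>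

definition two_pullback :: "('o, 'm, 'c) two_cat \<Rightarrow> 'm \<Rightarrow> 'm \<Rightarrow> 'm \<Rightarrow> 'm \<Rightarrow> bool" where
  "two_pullback K p q f g \<longleftrightarrow>
     p \<in> Arr K \<and> q \<in> Arr K \<and> f \<in> Arr K \<and> g \<in> Arr K \<and>
     Dom K p = Dom K q \<and> Cod K p = Dom K f \<and> Cod K q = Dom K g \<and> Cod K f = Cod K g \<and>
     f \<cdot>\<^bsub>K\<^esub> p = g \<cdot>\<^bsub>K\<^esub> q \<and>
     (\<forall>W \<in> Ob K. \<forall>u \<in> hom K W (Dom K f). \<forall>v \<in> hom K W (Dom K g).
        f \<cdot>\<^bsub>K\<^esub> u = g \<cdot>\<^bsub>K\<^esub> v \<longrightarrow>
        (\<exists>!w. w \<in> hom K W (Dom K p) \<and> p \<cdot>\<^bsub>K\<^esub> w = u \<and> q \<cdot>\<^bsub>K\<^esub> w = v)) \<and>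
     (\<forall>W \<in> Ob K. \<forall>w \<in> hom K W (Dom K p). \<forall>w' \<in> hom K W (Dom K p).
        \<forall>\<alpha> \<in> cells K (p \<cdot>\<^bsub>K\<^esub> w) (p \<cdot>\<^bsub>K\<^esub> w'). \<forall>\<beta> \<in> cells K (q \<cdot>\<^bsub>K\<^esub> w) (q \<cdot>\<^bsub>K\<^esub> w').
        whisker_left K f \<alpha> = whisker_left K g \<beta> \<longrightarrow>
        (\<exists>!\<gamma>. \<gamma> \<in> cells K w w' \<and> whisker_left K p \<gamma> = \<alpha> \<and> whisker_left K q \<gamma> = \<beta>))"

text \<open>The lift of \<open>\<alpha> : f \<Rightarrow> p g\<close> depends on \<open>\<alpha>\<close> and on \<open>g\<close>, since \<open>\<alpha>\<close> only determines \<open>p g\<close>;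
  hence \<open>s \<alpha> g\<close> and \<open>\<sigma> \<alpha> g\<close>.\<close>

definition normal_isofibration ::
  "('o, 'm, 'c) two_cat \<Rightarrow> 'm \<Rightarrow> ('c \<Rightarrow> 'm \<Rightarrow> 'm) \<Rightarrow> ('c \<Rightarrow> 'm \<Rightarrow> 'c) \<Rightarrow> bool" where
  "normal_isofibration K p s \<sigma> \<longleftrightarrow> p \<in> Arr K \<and>
     (\<forall>g \<alpha>. g \<in> Arr K \<and> Cod K g = Dom K p \<and> invertible_cell K \<alpha> \<and> Tgt K \<alpha> = p \<cdot>\<^bsub>K\<^esub> g \<longrightarrow>
        s \<alpha> g \<in> hom K (Dom K g) (Dom K p) \<and> \<sigma> \<alpha> g \<in> cells K (s \<alpha> g) g \<and>
        p \<cdot>\<^bsub>K\<^esub> s \<alpha> g = Src K \<alpha> \<and> whisker_left K p (\<sigma> \<alpha> g) = \<alpha> \<and>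
        (\<forall>k \<in> Arr K. Cod K k = Dom K g \<longrightarrow>
           s (whisker_right K \<alpha> k) (g \<cdot>\<^bsub>K\<^esub> k) = s \<alpha> g \<cdot>\<^bsub>K\<^esub> k \<and>
           \<sigma> (whisker_right K \<alpha> k) (g \<cdot>\<^bsub>K\<^esub> k) = whisker_right K (\<sigma> \<alpha> g) k)) \<and>
     (\<forall>g \<in> Arr K. Cod K g = Dom K p \<longrightarrow>
        s (Id2 K (p \<cdot>\<^bsub>K\<^esub> g)) g = g \<and> \<sigma> (Id2 K (p \<cdot>\<^bsub>K\<^esub> g)) g = Id2 K g)"

definition injective_equivalence :: "('o, 'm, 'c) two_cat \<Rightarrow> 'm \<Rightarrow> 'm \<Rightarrow> 'c \<Rightarrow> bool" where
  "injective_equivalence K i k \<theta> \<longleftrightarrow>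
     i \<in> Arr K \<and> k \<in> hom K (Cod K i) (Dom K i) \<and> k \<cdot>\<^bsub>K\<^esub> i = Ide K (Dom K i) \<and>
     \<theta> \<in> cells K (Ide K (Cod K i)) (i \<cdot>\<^bsub>K\<^esub> k) \<and> invertible_cell K \<theta> \<and>
     whisker_right K \<theta> i = Id2 K i \<and> whisker_left K k \<theta> = Id2 K k"

text \<open>The functors \<open>K(A, Y) \<rightarrow> K(A, X)\<^sup>2\<close> induced by whiskering \<open>\<kappa>\<close> are isomorphisms: the last two
  conjuncts say that they are bijective on objects and fully faithful. They are automatically
  2-natural in \<open>A\<close>.\<close>

definition arrow_object :: "('o, 'm, 'c) two_cat \<Rightarrow> 'o \<Rightarrow> 'o \<Rightarrow> 'c \<Rightarrow> bool" where
  "arrow_object K X Y \<kappa> \<longleftrightarrow> X \<in> Ob K \<and> Y \<in> Ob K \<and> \<kappa> \<in> Cell K \<and>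
     Src K \<kappa> \<in> hom K Y X \<and> Tgt K \<kappa> \<in> hom K Y X \<and>
     (\<forall>A \<in> Ob K. \<forall>\<alpha> \<in> Cell K. Src K \<alpha> \<in> hom K A X \<and> Tgt K \<alpha> \<in> hom K A X \<longrightarrow>
        (\<exists>!f. f \<in> hom K A Y \<and> whisker_right K \<kappa> f = \<alpha>)) \<and>
     (\<forall>A \<in> Ob K. \<forall>f \<in> hom K A Y. \<forall>g \<in> hom K A Y.
        \<forall>\<beta> \<in> cells K (Src K \<kappa> \<cdot>\<^bsub>K\<^esub> f) (Src K \<kappa> \<cdot>\<^bsub>K\<^esub> g).
        \<forall>\<gamma> \<in> cells K (Tgt K \<kappa> \<cdot>\<^bsub>K\<^esub> f) (Tgt K \<kappa> \<cdot>\<^bsub>K\<^esub> g).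
        whisker_right K \<kappa> g \<bullet>\<^bsub>K\<^esub> \<beta> = \<gamma> \<bullet>\<^bsub>K\<^esub> whisker_right K \<kappa> f \<longrightarrow>
        (\<exists>!\<delta>. \<delta> \<in> cells K f g \<and>
             whisker_left K (Src K \<kappa>) \<delta> = \<beta> \<and> whisker_left K (Tgt K \<kappa>) \<delta> = \<gamma>))"

definition cartesian ::
  "('a, 't, 'u) two_cat \<Rightarrow> ('o, 'm, 'c) two_cat \<Rightarrow> ('a, 't, 'u, 'o, 'm, 'c) two_fun \<Rightarrow> 't \<Rightarrow> bool"
  where
  "cartesian T C P f \<longleftrightarrow> f \<in> Arr T \<and>
     (\<forall>g w. g \<in> Arr T \<and> Cod T g = Cod T f \<and>
        w \<in> hom C (F0 P (Dom T g)) (F0 P (Dom T f)) \<and> F1 P f \<cdot>\<^bsub>C\<^esub> w = F1 P g \<longrightarrow>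
        (\<exists>!h. h \<in> hom T (Dom T g) (Dom T f) \<and> f \<cdot>\<^bsub>T\<^esub> h = g \<and> F1 P h = w))"


section \<open>Models\<close>

text \<open>In comments, \<open>\<Gamma>\<close> stands for the object of \<open>base\<close> over which a type lies. It is recovered
  as \<open>F0 proj A\<close>, and the context extension \<open>\<Gamma>.A\<close> as the domain of \<open>F0 compr A\<close>, so operations
  taking a type need not take its context.\<close>

record ('o, 'm, 'c, 'a, 't, 'u) model_data =
  base :: "('o, 'm, 'c) two_cat"
  fam :: "('a, 't, 'u) two_cat"
  top1 :: 'o
  proj :: "('a, 't, 'u, 'o, 'm, 'c) two_fun"
  compr :: "('a, 't, 'u, 'm, 'm \<times> 'm \<times> 'm \<times> 'm, 'm \<times> 'm \<times> 'c \<times> 'c) two_fun"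
  clift :: "'m \<Rightarrow> 'a \<Rightarrow> 't"
    \<comment> \<open>chosen cartesian lift of \<open>f\<close> at \<open>B\<close>\<close>
  liftarr :: "'a \<Rightarrow> 'c \<Rightarrow> 'm \<Rightarrow> 'm"
  liftcell :: "'a \<Rightarrow> 'c \<Rightarrow> 'm \<Rightarrow> 'c"
    \<comment> \<open>the isofibration structure \<open>s\<close>, \<open>\<sigma>\<close> on each display map\<close>
  idty :: "'a \<Rightarrow> 'a"
  idcell :: "'a \<Rightarrow> 'c"
  unty :: "'o \<Rightarrow> 'a"
  unmap :: "'o \<Rightarrow> 'm"
  unbar :: "'a \<Rightarrow> 'm \<Rightarrow> 'm"
  sigty :: "'a \<Rightarrow> 'a \<Rightarrow> 'a"
  sigunit :: "'a \<Rightarrow> 'a \<Rightarrow> 't"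
  sigbar :: "'a \<Rightarrow> 'a \<Rightarrow> 'a \<Rightarrow> 't \<Rightarrow> 't"
    \<comment> \<open>\<open>sigbar A B C f : \<Sigma>\<^sub>A(B) \<rightarrow> C\<close> for \<open>f : B \<rightarrow> \<Delta>\<^sub>A C\<close>\<close>
  sigret :: "'a \<Rightarrow> 'a \<Rightarrow> 'm"
  sigcell :: "'a \<Rightarrow> 'a \<Rightarrow> 'c"
    \<comment> \<open>the injective equivalence structure \<open>k\<close>, \<open>\<theta>\<close> on \<open>\<Gamma>.A.B \<rightarrow> \<Gamma>.\<Sigma>\<^sub>A(B)\<close>\<close>
  pity :: "'a \<Rightarrow> 'a \<Rightarrow> 'a"
  picounit :: "'a \<Rightarrow> 'a \<Rightarrow> 't"
  pibar :: "'a \<Rightarrow> 'a \<Rightarrow> 'a \<Rightarrow> 't \<Rightarrow> 't"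
    \<comment> \<open>\<open>pibar A B C f : C \<rightarrow> \<Pi>\<^sub>A(B)\<close> for \<open>f : \<Delta>\<^sub>A C \<rightarrow> B\<close>\<close>

context
  fixes M :: "('o, 'm, 'c, 'a, 't, 'u) model_data"
begin

abbreviation bcmp :: "'m \<Rightarrow> 'm \<Rightarrow> 'm" (infixr "\<odot>" 75) where
  "g \<odot> f \<equiv> Cmp (base M) g f"
abbreviation bwl :: "'m \<Rightarrow> 'c \<Rightarrow> 'c" (infixr "\<rhd>" 75) where
  "f \<rhd> \<alpha> \<equiv> whisker_left (base M) f \<alpha>"
abbreviation bwr :: "'c \<Rightarrow> 'm \<Rightarrow> 'c" (infixl "\<lhd>" 75) where
  "\<alpha> \<lhd> f \<equiv> whisker_right (base M) \<alpha> f"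
abbreviation tcmp :: "'t \<Rightarrow> 't \<Rightarrow> 't" (infixr "\<odot>\<^sub>T" 75) where
  "g \<odot>\<^sub>T f \<equiv> Cmp (fam M) g f"
abbreviation twl :: "'t \<Rightarrow> 'u \<Rightarrow> 'u" (infixr "\<rhd>\<^sub>T" 75) where
  "f \<rhd>\<^sub>T \<alpha> \<equiv> whisker_left (fam M) f \<alpha>"
abbreviation twr :: "'u \<Rightarrow> 't \<Rightarrow> 'u" (infixl "\<lhd>\<^sub>T" 75) where
  "\<alpha> \<lhd>\<^sub>T f \<equiv> whisker_right (fam M) \<alpha> f"

subsection \<open>Fibres, context extension and reindexing\<close>

definition fib :: "'o \<Rightarrow> 'a set" where
  "fib X = {A \<in> Ob (fam M). F0 (proj M) A = X}"

definition fhom :: "'o \<Rightarrow> 'a \<Rightarrow> 'a \<Rightarrow> 't set" where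
  "fhom X A B = {h \<in> hom (fam M) A B. F1 (proj M) h = Ide (base M) X}"

definition fcells :: "'o \<Rightarrow> 't \<Rightarrow> 't \<Rightarrow> 'u set" where
  "fcells X h k = {\<alpha> \<in> cells (fam M) h k. F2 (proj M) \<alpha> = Id2 (base M) (Ide (base M) X)}"

definition disp :: "'a \<Rightarrow> 'm" where
  "disp A = F0 (compr M) A"

definition ext :: "'a \<Rightarrow> 'o" where
  "ext A = Dom (base M) (disp A)"

definition upper :: "'t \<Rightarrow> 'm" where
  "upper h = (case F1 (compr M) h of (_, _, u, _) \<Rightarrow> u)"

definition upper2 :: "'u \<Rightarrow> 'c" where
  "upper2 \<alpha> = (case F2 (compr M) \<alpha> of (_, _, a, _) \<Rightarrow> a)"

text \<open>\<open>reix f B\<close> is \<open>f\<^sup>*B\<close> and \<open>fext f B\<close> is the map \<open>f.\<iota> : \<Gamma>.f\<^sup>*B \<rightarrow> \<Delta>.B\<close>.\<close>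

definition reix :: "'m \<Rightarrow> 'a \<Rightarrow> 'a" where
  "reix f B = Dom (fam M) (clift M f B)"

definition fext :: "'m \<Rightarrow> 'a \<Rightarrow> 'm" where
  "fext f B = upper (clift M f B)"

definition reix1 :: "'m \<Rightarrow> 't \<Rightarrow> 't" where
  "reix1 f h = (THE h'.
     h' \<in> fhom (Dom (base M) f) (reix f (Dom (fam M) h)) (reix f (Cod (fam M) h)) \<and>
     clift M f (Cod (fam M) h) \<odot>\<^sub>T h' = h \<odot>\<^sub>T clift M f (Dom (fam M) h))"

definition reix2 :: "'m \<Rightarrow> 'u \<Rightarrow> 'u" where
  "reix2 f \<alpha> = (let h = Src (fam M) \<alpha>; k = Tgt (fam M) \<alpha> in THE \<beta>.
     \<beta> \<in> fcells (Dom (base M) f) (reix1 f h) (reix1 f k) \<and>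
     clift M f (Cod (fam M) h) \<rhd>\<^sub>T \<beta> = \<alpha> \<lhd>\<^sub>T clift M f (Dom (fam M) h))"

text \<open>Telescopes \<open>X.D\<^sub>1\<cdots>D\<^sub>n\<close> are lists whose head is the \<^emph>\<open>last\<close> type \<open>D\<^sub>n\<close>, in accordance with
  de Bruijn indices. \<open>tend X Ds\<close> is the object \<open>X.D\<^sub>1\<cdots>D\<^sub>n\<close>, \<open>tproj X Ds\<close> its projection to \<open>X\<close>;
  \<open>retel f Ds\<close> is the reindexed telescope and \<open>flift f Ds\<close> the map \<open>f.\<iota>\<cdots>\<iota>\<close> out of its end.\<close>

primrec tend :: "'o \<Rightarrow> 'a list \<Rightarrow> 'o" where
  "tend X [] = X"
| "tend X (D # Ds) = ext D"

primrec tel :: "'o \<Rightarrow> 'a list \<Rightarrow> bool" where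
  "tel X [] \<longleftrightarrow> X \<in> Ob (base M)"
| "tel X (D # Ds) \<longleftrightarrow> tel X Ds \<and> D \<in> fib (tend X Ds)"

primrec tproj :: "'o \<Rightarrow> 'a list \<Rightarrow> 'm" where
  "tproj X [] = Ide (base M) X"
| "tproj X (D # Ds) = tproj X Ds \<odot> disp D"

primrec flift :: "'m \<Rightarrow> 'a list \<Rightarrow> 'm" where
  "flift f [] = f"
| "flift f (D # Ds) = fext (flift f Ds) D"

primrec retel :: "'m \<Rightarrow> 'a list \<Rightarrow> 'a list" where
  "retel f [] = []"
| "retel f (D # Ds) = reix (flift f Ds) D # retel f Ds"

text \<open>Global sections. If \<open>\<pi>\<^sub>B g = f\<close> then \<open>sec f B g\<close> is the global section of \<open>f\<^sup>*B\<close> that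
  corresponds to \<open>g\<close> under the pullback; in particular \<open>resec f B b\<close> is \<open>f\<^sup>*b\<close>.\<close>

definition gsection :: "'a \<Rightarrow> 'm \<Rightarrow> bool" where
  "gsection A a \<longleftrightarrow> a \<in> hom (base M) (F0 (proj M) A) (ext A) \<and>
     disp A \<odot> a = Ide (base M) (F0 (proj M) A)"

definition sec :: "'m \<Rightarrow> 'a \<Rightarrow> 'm \<Rightarrow> 'm" where
  "sec f B g = (THE a. gsection (reix f B) a \<and> fext f B \<odot> a = g)"

definition resec :: "'m \<Rightarrow> 'a \<Rightarrow> 'm \<Rightarrow> 'm" where
  "resec f B b = sec f B (b \<odot> f)"

text \<open>The type \<open>\<pi>\<^sub>A\<^sup>*A\<close> over \<open>\<Gamma>.A\<close>, and the diagonal \<open>\<Gamma>.A \<rightarrow> \<Gamma>.A.A\<close>.\<close>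

definition wkself :: "'a \<Rightarrow> 'a" where
  "wkself A = reix (disp A) A"

definition diag :: "'a \<Rightarrow> 'm" where
  "diag A = sec (disp A) A (Ide (base M) (ext A))"

text \<open>The symmetry \<open>\<Gamma>.B.A \<rightarrow> \<Gamma>.A.B\<close>.\<close>

definition symm :: "'a \<Rightarrow> 'a \<Rightarrow> 'm" where
  "symm A B = (THE f. f \<in> hom (base M) (ext (reix (disp B) A)) (ext (reix (disp A) B)) \<and>
     disp (reix (disp A) B) \<odot> f = fext (disp B) A \<and>
     fext (disp A) B \<odot> f = disp (reix (disp B) A))"

subsection \<open>The axioms of a model\<close>

definition split_fibration :: bool where
  "split_fibration \<longleftrightarrow>
     (\<forall>X Y f B. f \<in> hom (base M) X Y \<and> B \<in> fib Y \<longrightarrow>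
        cartesian (fam M) (base M) (proj M) (clift M f B) \<and>
        Cod (fam M) (clift M f B) = B \<and> F1 (proj M) (clift M f B) = f) \<and>
     (\<forall>B \<in> Ob (fam M). clift M (Ide (base M) (F0 (proj M) B)) B = Ide (fam M) B) \<and>
     (\<forall>X Y Z f g B. f \<in> hom (base M) X Y \<and> g \<in> hom (base M) Y Z \<and> B \<in> fib Z \<longrightarrow>
        clift M (g \<odot> f) B = clift M g B \<odot>\<^sub>T clift M f (reix g B))"

definition cartesian_cells :: bool where
  "cartesian_cells \<longleftrightarrow>
     (\<forall>f \<alpha> \<gamma>. cartesian (fam M) (base M) (proj M) f \<and> \<alpha> \<in> Cell (fam M) \<and>
        Cod (fam M) (Src (fam M) \<alpha>) = Cod (fam M) f \<and> \<gamma> \<in> Cell (base M) \<and>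
        Cod (base M) (Src (base M) \<gamma>) = F0 (proj M) (Dom (fam M) f) \<and>
        F2 (proj M) \<alpha> = F1 (proj M) f \<rhd> \<gamma> \<longrightarrow>
        (\<exists>!\<beta>. \<beta> \<in> Cell (fam M) \<and> Cod (fam M) (Src (fam M) \<beta>) = Dom (fam M) f \<and>
             f \<rhd>\<^sub>T \<beta> = \<alpha> \<and> F2 (proj M) \<beta> = \<gamma>))"

text \<open>Between groupoids every arrow is cartesian, so a functor is a fibration as soon as arrows
  into images can be lifted.\<close>

definition local_fibrations :: bool where
  "local_fibrations \<longleftrightarrow>
     (\<forall>t \<in> Arr (fam M). \<forall>\<gamma> \<in> Cell (base M). Tgt (base M) \<gamma> = F1 (proj M) t \<longrightarrow>
        (\<exists>\<beta> \<in> Cell (fam M). Tgt (fam M) \<beta> = t \<and> F2 (proj M) \<beta> = \<gamma>))"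

definition fibred :: bool where
  "fibred \<longleftrightarrow>
     two_category (base M) \<and> two_category (fam M) \<and>
     locally_groupoidal (base M) \<and> locally_groupoidal (fam M) \<and>
     two_terminal (base M) (top1 M) \<and> two_functor (fam M) (base M) (proj M) \<and>
     split_fibration \<and> cartesian_cells \<and> local_fibrations"

text \<open>Stability of the chosen lifts under reindexing along \<open>f : X \<rightarrow> Y\<close>, for 2-cells over \<open>X\<close>.
  The clause is stated for a type \<open>B\<close> over an extension \<open>Y.Ds\<close> of \<open>Y\<close> by any telescope, the case
  of a single type being \<open>Ds = [A]\<close>. One type suffices for the eliminators of \<open>1\<close> and \<open>\<Sigma>\<close>,
  but the eliminator \<open>J\<close> is a lift of a 2-cell on \<open>\<Gamma>.A.A.Id\<^sub>A\<close> that lies over \<open>\<Gamma>\<close> and not over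
  \<open>\<Gamma>.A.A\<close>, and its stability under reindexing needs \<open>Ds = [Id\<^sub>A, A, A]\<close>.\<close>

definition stable_lifts :: bool where
  "stable_lifts \<longleftrightarrow>
     (\<forall>X Y f Ds B k \<alpha>.
        f \<in> hom (base M) X Y \<and> tel Y Ds \<and> B \<in> fib (tend Y Ds) \<and>
        k \<in> Arr (base M) \<and> Cod (base M) k = ext (reix (flift f Ds) B) \<and>
        \<alpha> \<in> Cell (base M) \<and> Tgt (base M) \<alpha> = disp (reix (flift f Ds) B) \<odot> k \<and>
        tproj X (retel f Ds) \<rhd> \<alpha> =
          Id2 (base M) (tproj X (retel f Ds) \<odot> Src (base M) \<alpha>) \<longrightarrow>
        liftarr M B (flift f Ds \<rhd> \<alpha>) (fext (flift f Ds) B \<odot> k) =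
          fext (flift f Ds) B \<odot> liftarr M (reix (flift f Ds) B) \<alpha> k \<and>
        liftcell M B (flift f Ds \<rhd> \<alpha>) (fext (flift f Ds) B \<odot> k) =
          fext (flift f Ds) B \<rhd> liftcell M (reix (flift f Ds) B) \<alpha> k)"

definition comprehension :: bool where
  "comprehension \<longleftrightarrow>
     two_functor (fam M) (arrow_cat (base M)) (compr M) \<and>
     (\<forall>A \<in> Ob (fam M). Cod (base M) (disp A) = F0 (proj M) A) \<and>
     (\<forall>h \<in> Arr (fam M). (case F1 (compr M) h of (_, _, _, v) \<Rightarrow> v) = F1 (proj M) h) \<and>
     (\<forall>\<alpha> \<in> Cell (fam M). (case F2 (compr M) \<alpha> of (_, _, _, b) \<Rightarrow> b) = F2 (proj M) \<alpha>) \<and>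
     (\<forall>A \<in> Ob (fam M). \<forall>B \<in> Ob (fam M).
        bij_betw (F1 (compr M)) (hom (fam M) A B) (hom (arrow_cat (base M)) (disp A) (disp B)) \<and>
        bij_betw (F2 (compr M)) {\<alpha> \<in> Cell (fam M). Src (fam M) \<alpha> \<in> hom (fam M) A B}
          {\<alpha> \<in> Cell (arrow_cat (base M)).
             Src (arrow_cat (base M)) \<alpha> \<in> hom (arrow_cat (base M)) (disp A) (disp B)}) \<and>
     (\<forall>h. cartesian (fam M) (base M) (proj M) h \<longrightarrow>
        two_pullback (base M) (disp (Dom (fam M) h)) (upper h)
          (F1 (proj M) h) (disp (Cod (fam M) h))) \<and>
     (\<forall>A \<in> Ob (fam M).
        normal_isofibration (base M) (disp A) (liftarr M A) (liftcell M A)) \<and>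
     stable_lifts"

definition idsrc :: "'a \<Rightarrow> 'm" where
  "idsrc A = disp (wkself A) \<odot> disp (idty M A)"

definition idtgt :: "'a \<Rightarrow> 'm" where
  "idtgt A = fext (disp A) A \<odot> disp (idty M A)"

definition identities :: bool where
  "identities \<longleftrightarrow>
     (\<forall>A \<in> Ob (fam M).
        idty M A \<in> fib (ext (wkself A)) \<and>
        idcell M A \<in> cells (base M) (idsrc A) (idtgt A) \<and>
        arrow_object (slice (base M) (F0 (proj M) A)) (disp A) (disp A \<odot> idsrc A)
          (disp A \<odot> idsrc A, disp A, idcell M A)) \<and>
     (\<forall>X Y f A. f \<in> hom (base M) X Y \<and> A \<in> fib Y \<longrightarrow>
        reix (flift f [wkself A, A]) (idty M A) = idty M (reix f A) \<and>
        fext f A \<rhd> idcell M (reix f A) = idcell M A \<lhd> flift f [idty M A, wkself A, A])"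

definition units :: bool where
  "units \<longleftrightarrow>
     (\<forall>X \<in> Ob (base M). unty M X \<in> fib X \<and> gsection (unty M X) (unmap M X)) \<and>
     (\<forall>X A. A \<in> fib X \<longrightarrow>
        (\<forall>f. gsection A f \<longrightarrow>
           unbar M A f \<in> hom (base M) (ext (unty M X)) (ext A) \<and>
           disp A \<odot> unbar M A f = disp (unty M X) \<and> unbar M A f \<odot> unmap M X = f) \<and>
        (\<forall>h k. h \<in> hom (base M) (ext (unty M X)) (ext A) \<and> disp A \<odot> h = disp (unty M X) \<and>
           k \<in> hom (base M) (ext (unty M X)) (ext A) \<and> disp A \<odot> k = disp (unty M X) \<longrightarrow>
           (\<forall>\<alpha> \<in> cells (base M) (h \<odot> unmap M X) (k \<odot> unmap M X).
              disp A \<rhd> \<alpha> = Id2 (base M) (Ide (base M) X) \<longrightarrow>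
              (\<exists>!\<beta>. \<beta> \<in> cells (base M) h k \<and> disp A \<rhd> \<beta> = Id2 (base M) (disp (unty M X)) \<and>
                   \<beta> \<lhd> unmap M X = \<alpha>)))) \<and>
     (\<forall>X Y f. f \<in> hom (base M) X Y \<longrightarrow>
        reix f (unty M Y) = unty M X \<and>
        fext f (unty M Y) \<odot> unmap M X = unmap M Y \<odot> f \<and>
        (\<forall>A a. A \<in> fib Y \<and> gsection A a \<longrightarrow>
           fext f A \<odot> unbar M (reix f A) (resec f A a) = unbar M A a \<odot> fext f (unty M Y)))"

text \<open>The map \<open>i : \<Gamma>.A.B \<rightarrow> \<Gamma>.\<Sigma>\<^sub>A(B)\<close> corresponding to the unit \<open>\<eta> : B \<rightarrow> \<Delta>\<^sub>A \<Sigma>\<^sub>A(B)\<close>.\<close>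

definition sigin :: "'a \<Rightarrow> 'a \<Rightarrow> 'm" where
  "sigin A B = fext (disp A) (sigty M A B) \<odot> upper (sigunit M A B)"

definition sums :: bool where
  "sums \<longleftrightarrow>
     (\<forall>X A B. A \<in> fib X \<and> B \<in> fib (ext A) \<longrightarrow>
        sigty M A B \<in> fib X \<and>
        sigunit M A B \<in> fhom (ext A) B (reix (disp A) (sigty M A B)) \<and>
        (\<forall>C f. C \<in> fib X \<and> f \<in> fhom (ext A) B (reix (disp A) C) \<longrightarrow>
           sigbar M A B C f \<in> fhom X (sigty M A B) C \<and>
           reix1 (disp A) (sigbar M A B C f) \<odot>\<^sub>T sigunit M A B = f) \<and>
        (\<forall>C h k \<alpha>. C \<in> fib X \<and> h \<in> fhom X (sigty M A B) C \<and> k \<in> fhom X (sigty M A B) C \<and>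
           \<alpha> \<in> fcells (ext A) (reix1 (disp A) h \<odot>\<^sub>T sigunit M A B)
                 (reix1 (disp A) k \<odot>\<^sub>T sigunit M A B) \<longrightarrow>
           (\<exists>!\<beta>. \<beta> \<in> fcells X h k \<and> reix2 (disp A) \<beta> \<lhd>\<^sub>T sigunit M A B = \<alpha>)) \<and>
        injective_equivalence (slice (base M) X)
          (disp A \<odot> disp B, disp (sigty M A B), sigin A B)
          (disp (sigty M A B), disp A \<odot> disp B, sigret M A B)
          (disp (sigty M A B), disp (sigty M A B), sigcell M A B)) \<and>
     (\<forall>X Y f A B. f \<in> hom (base M) X Y \<and> A \<in> fib Y \<and> B \<in> fib (ext A) \<longrightarrow>
        (let A' = reix f A; B' = reix (fext f A) B in
         reix f (sigty M A B) = sigty M A' B' \<and>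
         reix1 (fext f A) (sigunit M A B) = sigunit M A' B' \<and>
         (\<forall>C g. C \<in> fib Y \<and> g \<in> fhom (ext A) B (reix (disp A) C) \<longrightarrow>
            reix1 f (sigbar M A B C g) = sigbar M A' B' (reix f C) (reix1 (fext f A) g)) \<and>
         flift f [B, A] \<odot> sigret M A' B' = sigret M A B \<odot> fext f (sigty M A B) \<and>
         fext f (sigty M A B) \<rhd> sigcell M A' B' = sigcell M A B \<lhd> fext f (sigty M A B)))"

definition products :: bool where
  "products \<longleftrightarrow>
     (\<forall>X A B. A \<in> fib X \<and> B \<in> fib (ext A) \<longrightarrow>
        pity M A B \<in> fib X \<and>
        picounit M A B \<in> fhom (ext A) (reix (disp A) (pity M A B)) B \<and>
        (\<forall>C f. C \<in> fib X \<and> f \<in> fhom (ext A) (reix (disp A) C) B \<longrightarrow>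
           pibar M A B C f \<in> fhom X C (pity M A B) \<and>
           picounit M A B \<odot>\<^sub>T reix1 (disp A) (pibar M A B C f) = f) \<and>
        (\<forall>C h k \<alpha>. C \<in> fib X \<and> h \<in> fhom X C (pity M A B) \<and> k \<in> fhom X C (pity M A B) \<and>
           \<alpha> \<in> fcells (ext A) (picounit M A B \<odot>\<^sub>T reix1 (disp A) h)
                 (picounit M A B \<odot>\<^sub>T reix1 (disp A) k) \<longrightarrow>
           (\<exists>!\<beta>. \<beta> \<in> fcells X h k \<and> picounit M A B \<rhd>\<^sub>T reix2 (disp A) \<beta> = \<alpha>))) \<and>
     (\<forall>X Y f A B. f \<in> hom (base M) X Y \<and> A \<in> fib Y \<and> B \<in> fib (ext A) \<longrightarrow>
        (let A' = reix f A; B' = reix (fext f A) B in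
         reix f (pity M A B) = pity M A' B' \<and>
         reix1 (fext f A) (picounit M A B) = picounit M A' B' \<and>
         (\<forall>C g. C \<in> fib Y \<and> g \<in> fhom (ext A) (reix (disp A) C) B \<longrightarrow>
            reix1 f (pibar M A B C g) = pibar M A' B' (reix f C) (reix1 (fext f A) g))))"

definition two_dim_model :: bool where
  "two_dim_model \<longleftrightarrow> fibred \<and> comprehension \<and> identities \<and> units \<and> sums \<and> products"

subsection \<open>Semantic operations\<close>

text \<open>The filler of a square \<open>\<pi>\<^sub>C d = g i\<close> is taken with respect to the retraction \<open>k\<close> and the
  2-cell \<open>\<theta> : id \<Rightarrow> i k\<close> of \<open>i\<close>.\<close>

definition canonical_filler :: "'a \<Rightarrow> 'm \<Rightarrow> 'm \<Rightarrow> 'm \<Rightarrow> 'c \<Rightarrow> 'm" where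
  "canonical_filler C d g k \<theta> = liftarr M C (g \<rhd> \<theta>) (d \<odot> k)"

text \<open>The map into \<open>\<Gamma>.A.A.Id\<^sub>A\<close> classifying a 2-cell \<open>\<alpha>\<close> over \<open>\<Gamma>\<close> between maps into \<open>\<Gamma>.A\<close>.
  For \<open>\<alpha> : m \<Rightarrow> n\<close> between global sections, \<open>cellty A \<alpha>\<close> is the type \<open>Id\<^sub>A(m, n)\<close> over \<open>\<Gamma>\<close> and
  \<open>cellsec A \<alpha>\<close> is \<open>\<alpha>\<close> regarded as a global section of it.\<close>

definition classify :: "'a \<Rightarrow> 'c \<Rightarrow> 'm" where
  "classify A \<alpha> = (THE q. q \<in> Arr (base M) \<and> Cod (base M) q = ext (idty M A) \<and>
     idcell M A \<lhd> q = \<alpha>)"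

definition cellty :: "'a \<Rightarrow> 'c \<Rightarrow> 'a" where
  "cellty A \<alpha> = reix (disp (idty M A) \<odot> classify A \<alpha>) (idty M A)"

definition cellsec :: "'a \<Rightarrow> 'c \<Rightarrow> 'm" where
  "cellsec A \<alpha> = sec (disp (idty M A) \<odot> classify A \<alpha>) (idty M A) (classify A \<alpha>)"

definition reflmap :: "'a \<Rightarrow> 'm" where
  "reflmap A = classify A (Id2 (base M) (Ide (base M) (ext A)))"

definition reflcell :: "'a \<Rightarrow> 'c" where
  "reflcell A = (THE \<theta>.
     \<theta> \<in> cells (base M) (Ide (base M) (ext (idty M A))) (reflmap A \<odot> idtgt A) \<and>
     idsrc A \<rhd> \<theta> = idcell M A \<and> idtgt A \<rhd> \<theta> = Id2 (base M) (idtgt A))"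

definition Jmap :: "'a \<Rightarrow> 'a \<Rightarrow> 'm \<Rightarrow> 'm" where
  "Jmap A C d = canonical_filler C d (Ide (base M) (ext (idty M A))) (idtgt A) (reflcell A)"

definition uncell :: "'o \<Rightarrow> 'c" where
  "uncell X = (THE \<theta>.
     \<theta> \<in> cells (base M) (Ide (base M) (ext (unty M X))) (unmap M X \<odot> disp (unty M X)) \<and>
     disp (unty M X) \<rhd> \<theta> = Id2 (base M) (disp (unty M X)) \<and>
     \<theta> \<lhd> unmap M X = Id2 (base M) (unmap M X))"

definition Umap :: "'o \<Rightarrow> 'a \<Rightarrow> 'm \<Rightarrow> 'm" where
  "Umap X C d =
     canonical_filler C d (Ide (base M) (ext (unty M X))) (disp (unty M X)) (uncell X)"

definition Emap :: "'a \<Rightarrow> 'a \<Rightarrow> 'a \<Rightarrow> 'm \<Rightarrow> 'm" where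
  "Emap A B C d =
     canonical_filler C d (Ide (base M) (ext (sigty M A B))) (sigret M A B) (sigcell M A B)"

text \<open>The fibre 1-cell \<open>A \<rightarrow> B\<close> corresponding to a map \<open>\<Gamma>.A \<rightarrow> \<Gamma>.B\<close> over \<open>\<Gamma>\<close>, and the fibre 1-cell
  \<open>1 \<rightarrow> A\<close> corresponding to a global section of \<open>A\<close>.\<close>

definition fibmap :: "'a \<Rightarrow> 'a \<Rightarrow> 'm \<Rightarrow> 't" where
  "fibmap A B u = (THE h. h \<in> fhom (F0 (proj M) A) A B \<and> upper h = u)"

definition elt :: "'a \<Rightarrow> 'm \<Rightarrow> 't" where
  "elt A a = fibmap (unty M (F0 (proj M) A)) A (unbar M A a)"

definition lammap :: "'a \<Rightarrow> 'a \<Rightarrow> 'm \<Rightarrow> 'm" where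
  "lammap A B f = (let X = F0 (proj M) A in
     upper (pibar M A B (unty M X) (elt B f)) \<odot> unmap M X)"

definition appmap :: "'a \<Rightarrow> 'a \<Rightarrow> 'm" where
  "appmap A B = upper (picounit M A B)"

text \<open>The global section \<open>\<epsilon> \<Delta>\<^sub>A(m)\<close> of \<open>B\<close>, for a global section \<open>m\<close> of \<open>\<Pi>\<^sub>A(B)\<close>.\<close>

definition appsec :: "'a \<Rightarrow> 'a \<Rightarrow> 'm \<Rightarrow> 'm" where
  "appsec A B m = appmap A B \<odot> resec (disp A) (pity M A B) m"

definition extcell :: "'a \<Rightarrow> 'a \<Rightarrow> 'm \<Rightarrow> 'm \<Rightarrow> 'c \<Rightarrow> 'c" where
  "extcell A B m n p =
    (let X = F0 (proj M) A; mb = elt (pity M A B) m; nb = elt (pity M A B) n;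
         pb = (THE \<beta>. \<beta> \<in> fcells (ext A) (picounit M A B \<odot>\<^sub>T reix1 (disp A) mb)
                        (picounit M A B \<odot>\<^sub>T reix1 (disp A) nb) \<and>
                 upper2 \<beta> \<lhd> unmap M (ext A) = p);
         pbb = (THE \<gamma>. \<gamma> \<in> fcells X mb nb \<and> picounit M A B \<rhd>\<^sub>T reix2 (disp A) \<gamma> = pb)
     in upper2 pbb \<lhd> unmap M X)"

end


section \<open>Raw syntax\<close>

text \<open>De Bruijn syntax, annotated with the types involved. The constant \<open>TCon As A\<close> is the bar of
  the type \<open>A\<close> over \<open>1.A\<^sub>1\<cdots>A\<^sub>n\<close> and takes \<open>n\<close> arguments; \<open>Con As A a\<close> is the bar of the global
  section \<open>a\<close> of \<open>A\<close>. The telescope belongs to the name of the constant, because an object need not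
  determine a decomposition as \<open>1.A\<^sub>1\<cdots>A\<^sub>n\<close>. Like telescopes, argument lists and contexts have the
  entry for the last variable, \<open>Var 0\<close>, at their head.

  Variables bound: one in the second argument of \<open>Sigma\<close>, \<open>Pi\<close>, \<open>Pair\<close>, \<open>Lam\<close>, \<open>App\<close>, \<open>Ext\<close>;
  in \<open>SplitE A B C d c\<close>, one in \<open>B\<close> and \<open>C\<close>, two in \<open>d\<close>; in \<open>UnitE C d c\<close>, one in \<open>C\<close>; in
  \<open>J A C d a b p\<close>, three in \<open>C\<close>, one in \<open>d\<close>; in \<open>Lam A B f\<close> and \<open>Ext A B m n p\<close>, one in \<open>f\<close>
  and \<open>p\<close> respectively.\<close>

datatype ('a, 'm) ty =
    TCon "'a list" 'a "('a, 'm) tm list"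
  | Sigma "('a, 'm) ty" "('a, 'm) ty"
  | Unit
  | Id "('a, 'm) ty" "('a, 'm) tm" "('a, 'm) tm"
  | Pi "('a, 'm) ty" "('a, 'm) ty"
and ('a, 'm) tm =
    Var nat
  | Con "'a list" 'a 'm "('a, 'm) tm list"
  | Pair "('a, 'm) ty" "('a, 'm) ty" "('a, 'm) tm" "('a, 'm) tm"
  | SplitE "('a, 'm) ty" "('a, 'm) ty" "('a, 'm) ty" "('a, 'm) tm" "('a, 'm) tm"
  | Star
  | UnitE "('a, 'm) ty" "('a, 'm) tm" "('a, 'm) tm"
  | Refl "('a, 'm) ty" "('a, 'm) tm"
  | J "('a, 'm) ty" "('a, 'm) ty" "('a, 'm) tm" "('a, 'm) tm" "('a, 'm) tm" "('a, 'm) tm"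
  | Lam "('a, 'm) ty" "('a, 'm) ty" "('a, 'm) tm"
  | App "('a, 'm) ty" "('a, 'm) ty" "('a, 'm) tm" "('a, 'm) tm"
  | Ext "('a, 'm) ty" "('a, 'm) ty" "('a, 'm) tm" "('a, 'm) tm" "('a, 'm) tm"

datatype ('a, 'm) judgement =
    IsTy "('a, 'm) ty"
  | HasTy "('a, 'm) tm" "('a, 'm) ty"
  | EqTy "('a, 'm) ty" "('a, 'm) ty"
  | EqTm "('a, 'm) tm" "('a, 'm) tm" "('a, 'm) ty"

type_synonym ('a, 'm) ctx = "('a, 'm) ty list"

subsection \<open>Renaming and substitution\<close>

definition upr :: "(nat \<Rightarrow> nat) \<Rightarrow> nat \<Rightarrow> nat" where
  "upr r = (\<lambda>n. case n of 0 \<Rightarrow> 0 | Suc i \<Rightarrow> Suc (r i))"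

primrec ren_ty :: "(nat \<Rightarrow> nat) \<Rightarrow> ('a, 'm) ty \<Rightarrow> ('a, 'm) ty"
  and ren_tm :: "(nat \<Rightarrow> nat) \<Rightarrow> ('a, 'm) tm \<Rightarrow> ('a, 'm) tm" where
  "ren_ty r (TCon As A ts) = TCon As A (map (ren_tm r) ts)"
| "ren_ty r (Sigma A B) = Sigma (ren_ty r A) (ren_ty (upr r) B)"
| "ren_ty r Unit = Unit"
| "ren_ty r (Id A a b) = Id (ren_ty r A) (ren_tm r a) (ren_tm r b)"
| "ren_ty r (Pi A B) = Pi (ren_ty r A) (ren_ty (upr r) B)"
| "ren_tm r (Var n) = Var (r n)"
| "ren_tm r (Con As A a ts) = Con As A a (map (ren_tm r) ts)"
| "ren_tm r (Pair A B a b) = Pair (ren_ty r A) (ren_ty (upr r) B) (ren_tm r a) (ren_tm r b)"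
| "ren_tm r (SplitE A B C d c) =
     SplitE (ren_ty r A) (ren_ty (upr r) B) (ren_ty (upr r) C) (ren_tm (upr (upr r)) d) (ren_tm r c)"
| "ren_tm r Star = Star"
| "ren_tm r (UnitE C d c) = UnitE (ren_ty (upr r) C) (ren_tm r d) (ren_tm r c)"
| "ren_tm r (Refl A a) = Refl (ren_ty r A) (ren_tm r a)"
| "ren_tm r (J A C d a b p) =
     J (ren_ty r A) (ren_ty (upr (upr (upr r))) C) (ren_tm (upr r) d)
       (ren_tm r a) (ren_tm r b) (ren_tm r p)"
| "ren_tm r (Lam A B f) = Lam (ren_ty r A) (ren_ty (upr r) B) (ren_tm (upr r) f)"
| "ren_tm r (App A B m a) = App (ren_ty r A) (ren_ty (upr r) B) (ren_tm r m) (ren_tm r a)"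
| "ren_tm r (Ext A B m n p) =
     Ext (ren_ty r A) (ren_ty (upr r) B) (ren_tm r m) (ren_tm r n) (ren_tm (upr r) p)"

definition ups :: "(nat \<Rightarrow> ('a, 'm) tm) \<Rightarrow> nat \<Rightarrow> ('a, 'm) tm" where
  "ups s = (\<lambda>n. case n of 0 \<Rightarrow> Var 0 | Suc i \<Rightarrow> ren_tm Suc (s i))"

primrec sub_ty :: "(nat \<Rightarrow> ('a, 'm) tm) \<Rightarrow> ('a, 'm) ty \<Rightarrow> ('a, 'm) ty"
  and sub_tm :: "(nat \<Rightarrow> ('a, 'm) tm) \<Rightarrow> ('a, 'm) tm \<Rightarrow> ('a, 'm) tm" where
  "sub_ty s (TCon As A ts) = TCon As A (map (sub_tm s) ts)"
| "sub_ty s (Sigma A B) = Sigma (sub_ty s A) (sub_ty (ups s) B)"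
| "sub_ty s Unit = Unit"
| "sub_ty s (Id A a b) = Id (sub_ty s A) (sub_tm s a) (sub_tm s b)"
| "sub_ty s (Pi A B) = Pi (sub_ty s A) (sub_ty (ups s) B)"
| "sub_tm s (Var n) = s n"
| "sub_tm s (Con As A a ts) = Con As A a (map (sub_tm s) ts)"
| "sub_tm s (Pair A B a b) = Pair (sub_ty s A) (sub_ty (ups s) B) (sub_tm s a) (sub_tm s b)"
| "sub_tm s (SplitE A B C d c) =
     SplitE (sub_ty s A) (sub_ty (ups s) B) (sub_ty (ups s) C) (sub_tm (ups (ups s)) d) (sub_tm s c)"
| "sub_tm s Star = Star"
| "sub_tm s (UnitE C d c) = UnitE (sub_ty (ups s) C) (sub_tm s d) (sub_tm s c)"
| "sub_tm s (Refl A a) = Refl (sub_ty s A) (sub_tm s a)"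
| "sub_tm s (J A C d a b p) =
     J (sub_ty s A) (sub_ty (ups (ups (ups s))) C) (sub_tm (ups s) d)
       (sub_tm s a) (sub_tm s b) (sub_tm s p)"
| "sub_tm s (Lam A B f) = Lam (sub_ty s A) (sub_ty (ups s) B) (sub_tm (ups s) f)"
| "sub_tm s (App A B m a) = App (sub_ty s A) (sub_ty (ups s) B) (sub_tm s m) (sub_tm s a)"
| "sub_tm s (Ext A B m n p) =
     Ext (sub_ty s A) (sub_ty (ups s) B) (sub_tm s m) (sub_tm s n) (sub_tm (ups s) p)"

primrec ren_jdg :: "(nat \<Rightarrow> nat) \<Rightarrow> ('a, 'm) judgement \<Rightarrow> ('a, 'm) judgement" where
  "ren_jdg r (IsTy A) = IsTy (ren_ty r A)"
| "ren_jdg r (HasTy a A) = HasTy (ren_tm r a) (ren_ty r A)"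
| "ren_jdg r (EqTy A B) = EqTy (ren_ty r A) (ren_ty r B)"
| "ren_jdg r (EqTm a b A) = EqTm (ren_tm r a) (ren_tm r b) (ren_ty r A)"

primrec sub_jdg :: "(nat \<Rightarrow> ('a, 'm) tm) \<Rightarrow> ('a, 'm) judgement \<Rightarrow> ('a, 'm) judgement" where
  "sub_jdg s (IsTy A) = IsTy (sub_ty s A)"
| "sub_jdg s (HasTy a A) = HasTy (sub_tm s a) (sub_ty s A)"
| "sub_jdg s (EqTy A B) = EqTy (sub_ty s A) (sub_ty s B)"
| "sub_jdg s (EqTm a b A) = EqTm (sub_tm s a) (sub_tm s b) (sub_ty s A)"

text \<open>Action on the part \<open>D\<close> of a context \<open>G, D\<close> of a renaming or substitution of the variables
  of \<open>G\<close>.\<close>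

primrec ren_ctx :: "(nat \<Rightarrow> nat) \<Rightarrow> ('a, 'm) ctx \<Rightarrow> ('a, 'm) ctx" where
  "ren_ctx r [] = []"
| "ren_ctx r (A # D) = ren_ty ((upr ^^ length D) r) A # ren_ctx r D"

primrec sub_ctx :: "(nat \<Rightarrow> ('a, 'm) tm) \<Rightarrow> ('a, 'm) ctx \<Rightarrow> ('a, 'm) ctx" where
  "sub_ctx s [] = []"
| "sub_ctx s (A # D) = sub_ty ((ups ^^ length D) s) A # sub_ctx s D"

text \<open>\<open>insts ts\<close> replaces the last \<open>length ts\<close> variables by \<open>ts\<close>, with the term for \<open>Var 0\<close> at the
  head of \<open>ts\<close>. \<open>wk_ty n j\<close> and \<open>wk_tm n j\<close> weaken by \<open>n\<close> variables below \<open>j\<close> bound ones.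
  \<open>contract\<close> merges \<open>Var 0\<close> and \<open>Var 1\<close>; \<open>exchange\<close> swaps them.\<close>

definition insts :: "('a, 'm) tm list \<Rightarrow> nat \<Rightarrow> ('a, 'm) tm" where
  "insts ts = (\<lambda>n. if n < length ts then ts ! n else Var (n - length ts))"

definition wk_ty :: "nat \<Rightarrow> nat \<Rightarrow> ('a, 'm) ty \<Rightarrow> ('a, 'm) ty" where
  "wk_ty n j = ren_ty ((upr ^^ j) (\<lambda>i. i + n))"

definition wk_tm :: "nat \<Rightarrow> nat \<Rightarrow> ('a, 'm) tm \<Rightarrow> ('a, 'm) tm" where
  "wk_tm n j = ren_tm ((upr ^^ j) (\<lambda>i. i + n))"

definition contract :: "nat \<Rightarrow> nat" where
  "contract n = n - 1"

definition exchange :: "nat \<Rightarrow> nat" where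
  "exchange n = (if n = 0 then 1 else if n = 1 then 0 else n)"

text \<open>The types of \<open>d\<close> in \<open>SplitE A B C d c\<close> and \<open>J A C d a b p\<close>: \<open>C(\<langle>x, y\<rangle>)\<close> for
  \<open>x : A, y : B(x)\<close>, and \<open>C(x, x, r(x))\<close> for \<open>x : A\<close>.\<close>

definition split_branch :: "('a, 'm) ty \<Rightarrow> ('a, 'm) ty \<Rightarrow> ('a, 'm) ty \<Rightarrow> ('a, 'm) ty" where
  "split_branch A B C =
     sub_ty (insts [Pair (wk_ty 2 0 A) (wk_ty 2 1 B) (Var 1) (Var 0)]) (wk_ty 2 1 C)"

definition J_branch :: "('a, 'm) ty \<Rightarrow> ('a, 'm) ty \<Rightarrow> ('a, 'm) ty" where
  "J_branch A C =
     sub_ty (insts [Refl (wk_ty 1 0 A) (Var 0), Var 0, Var 0]) (wk_ty 1 3 C)"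

definition Id_tel :: "('a, 'm) ty \<Rightarrow> ('a, 'm) ctx" where
  "Id_tel A = [Id (wk_ty 2 0 A) (Var 1) (Var 0), wk_ty 1 0 A, A]"

text \<open>\<open>m \<cdot> x\<close> in the context extended by \<open>x : A\<close>, and the term \<open>q * a\<close>, that is
  \<open>J\<close> with \<open>d(x) = r(x \<cdot> a)\<close> at \<open>m, n, q\<close>.\<close>

definition appvar :: "('a, 'm) ty \<Rightarrow> ('a, 'm) ty \<Rightarrow> ('a, 'm) tm \<Rightarrow> ('a, 'm) tm" where
  "appvar A B m = App (wk_ty 1 0 A) (wk_ty 1 1 B) (wk_tm 1 0 m) (Var 0)"

definition idapp ::
  "('a, 'm) ty \<Rightarrow> ('a, 'm) ty \<Rightarrow> ('a, 'm) tm \<Rightarrow> ('a, 'm) tm \<Rightarrow> ('a, 'm) tm \<Rightarrow> ('a, 'm) tm \<Rightarrow>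
   ('a, 'm) tm" where
  "idapp A B m n q a =
    (let Ba = sub_ty (insts [a]) B in
     J (Pi A B)
       (Id (wk_ty 3 0 Ba)
         (App (wk_ty 3 0 A) (wk_ty 3 1 B) (Var 2) (wk_tm 3 0 a))
         (App (wk_ty 3 0 A) (wk_ty 3 1 B) (Var 1) (wk_tm 3 0 a)))
       (Refl (wk_ty 1 0 Ba) (App (wk_ty 1 0 A) (wk_ty 1 1 B) (Var 0) (wk_tm 1 0 a)))
       m n q)"

subsection \<open>Barred data\<close>

definition vars :: "nat \<Rightarrow> ('a, 'm) tm list" where
  "vars n = map Var [0..<n]"

definition bar_ty :: "'a list \<Rightarrow> 'a \<Rightarrow> ('a, 'm) ty" where
  "bar_ty As A = TCon As A (vars (length As))"

definition bar_tm :: "'a list \<Rightarrow> 'a \<Rightarrow> 'm \<Rightarrow> ('a, 'm) tm" where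
  "bar_tm As A a = Con As A a (vars (length As))"

primrec bar_ctx :: "'a list \<Rightarrow> ('a, 'm) ctx" where
  "bar_ctx [] = []"
| "bar_ctx (A # As) = bar_ty As A # bar_ctx As"


section \<open>The calculus \<open>ML\<^sub>2\<close> and the internal language of a model\<close>

text \<open>The rules up to \<open>ext_comp\<close> are those of \<open>ML\<^sub>2\<close>; the remaining ones are the axioms contributed
  by the model, applied to variables. Elimination and computation rules are given at arbitrary
  arguments instead of at variables, which amounts to the same by substitution.\<close>

inductive is_ctx :: "('o, 'm, 'c, 'a, 't, 'u) model_data \<Rightarrow> ('a, 'm) ctx \<Rightarrow> bool"
  and derivable ::
    "('o, 'm, 'c, 'a, 't, 'u) model_data \<Rightarrow> ('a, 'm) ctx \<Rightarrow> ('a, 'm) judgement \<Rightarrow> bool"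
    ("(_ \<tturnstile>/ _ \<turnstile>/ _)" [51, 51, 51] 50)
  for M :: "('o, 'm, 'c, 'a, 't, 'u) model_data"
where
  ctx_nil: "is_ctx M []"
| ctx_cons: "is_ctx M G \<Longrightarrow> M \<tturnstile> G \<turnstile> IsTy A \<Longrightarrow> is_ctx M (A # G)"

| assumption: "is_ctx M (A # G) \<Longrightarrow> M \<tturnstile> A # G \<turnstile> HasTy (Var 0) (wk_ty 1 0 A)"
| weakening: "M \<tturnstile> D @ G \<turnstile> \<J> \<Longrightarrow> M \<tturnstile> G \<turnstile> IsTy A \<Longrightarrow>
    M \<tturnstile> ren_ctx Suc D @ A # G \<turnstile> ren_jdg ((upr ^^ length D) Suc) \<J>"
| contraction: "M \<tturnstile> D @ wk_ty 1 0 A # A # G \<turnstile> \<J> \<Longrightarrow>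
    M \<tturnstile> ren_ctx contract D @ A # G \<turnstile> ren_jdg ((upr ^^ length D) contract) \<J>"
| exchanging: "M \<tturnstile> D @ wk_ty 1 0 B # A # G \<turnstile> \<J> \<Longrightarrow> M \<tturnstile> G \<turnstile> IsTy B \<Longrightarrow>
    M \<tturnstile> ren_ctx exchange D @ wk_ty 1 0 A # B # G
      \<turnstile> ren_jdg ((upr ^^ length D) exchange) \<J>"
| substitution: "M \<tturnstile> D @ A # G \<turnstile> \<J> \<Longrightarrow> M \<tturnstile> G \<turnstile> HasTy a A \<Longrightarrow>
    M \<tturnstile> sub_ctx (insts [a]) D @ G \<turnstile> sub_jdg ((ups ^^ length D) (insts [a])) \<J>"
| substitution_eq_ty: "M \<tturnstile> D @ A # G \<turnstile> IsTy B \<Longrightarrow> M \<tturnstile> G \<turnstile> EqTm a a' A \<Longrightarrow>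
    M \<tturnstile> sub_ctx (insts [a]) D @ G
      \<turnstile> EqTy (sub_ty ((ups ^^ length D) (insts [a])) B)
             (sub_ty ((ups ^^ length D) (insts [a'])) B)"
| substitution_eq_tm: "M \<tturnstile> D @ A # G \<turnstile> HasTy b B \<Longrightarrow> M \<tturnstile> G \<turnstile> EqTm a a' A \<Longrightarrow>
    M \<tturnstile> sub_ctx (insts [a]) D @ G
      \<turnstile> EqTm (sub_tm ((ups ^^ length D) (insts [a])) b)
             (sub_tm ((ups ^^ length D) (insts [a'])) b)
             (sub_ty ((ups ^^ length D) (insts [a])) B)"

| ty_refl: "M \<tturnstile> G \<turnstile> IsTy A \<Longrightarrow> M \<tturnstile> G \<turnstile> EqTy A A"
| ty_sym: "M \<tturnstile> G \<turnstile> EqTy A B \<Longrightarrow> M \<tturnstile> G \<turnstile> EqTy B A"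
| ty_trans: "M \<tturnstile> G \<turnstile> EqTy A B \<Longrightarrow> M \<tturnstile> G \<turnstile> EqTy B C \<Longrightarrow> M \<tturnstile> G \<turnstile> EqTy A C"
| tm_refl: "M \<tturnstile> G \<turnstile> HasTy a A \<Longrightarrow> M \<tturnstile> G \<turnstile> EqTm a a A"
| tm_sym: "M \<tturnstile> G \<turnstile> EqTm a b A \<Longrightarrow> M \<tturnstile> G \<turnstile> EqTm b a A"
| tm_trans: "M \<tturnstile> G \<turnstile> EqTm a b A \<Longrightarrow> M \<tturnstile> G \<turnstile> EqTm b c A \<Longrightarrow> M \<tturnstile> G \<turnstile> EqTm a c A"
| conv: "M \<tturnstile> G \<turnstile> HasTy a A \<Longrightarrow> M \<tturnstile> G \<turnstile> EqTy A B \<Longrightarrow> M \<tturnstile> G \<turnstile> HasTy a B"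
| conv_eq: "M \<tturnstile> G \<turnstile> EqTm a b A \<Longrightarrow> M \<tturnstile> G \<turnstile> EqTy A B \<Longrightarrow> M \<tturnstile> G \<turnstile> EqTm a b B"

| Sigma_form: "M \<tturnstile> G \<turnstile> IsTy A \<Longrightarrow> M \<tturnstile> A # G \<turnstile> IsTy B \<Longrightarrow> M \<tturnstile> G \<turnstile> IsTy (Sigma A B)"
| Sigma_cong: "M \<tturnstile> G \<turnstile> EqTy A A' \<Longrightarrow> M \<tturnstile> A # G \<turnstile> EqTy B B' \<Longrightarrow>
    M \<tturnstile> G \<turnstile> EqTy (Sigma A B) (Sigma A' B')"
| Pair_intro: "M \<tturnstile> A # G \<turnstile> IsTy B \<Longrightarrow> M \<tturnstile> G \<turnstile> HasTy a A \<Longrightarrow>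
    M \<tturnstile> G \<turnstile> HasTy b (sub_ty (insts [a]) B) \<Longrightarrow>
    M \<tturnstile> G \<turnstile> HasTy (Pair A B a b) (Sigma A B)"
| Pair_cong: "M \<tturnstile> G \<turnstile> EqTy A A' \<Longrightarrow> M \<tturnstile> A # G \<turnstile> EqTy B B' \<Longrightarrow> M \<tturnstile> G \<turnstile> EqTm a a' A \<Longrightarrow>
    M \<tturnstile> G \<turnstile> EqTm b b' (sub_ty (insts [a]) B) \<Longrightarrow>
    M \<tturnstile> G \<turnstile> EqTm (Pair A B a b) (Pair A' B' a' b') (Sigma A B)"
| SplitE_elim: "M \<tturnstile> Sigma A B # G \<turnstile> IsTy C \<Longrightarrow>
    M \<tturnstile> B # A # G \<turnstile> HasTy d (split_branch A B C) \<Longrightarrow> M \<tturnstile> G \<turnstile> HasTy c (Sigma A B) \<Longrightarrow>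
    M \<tturnstile> G \<turnstile> HasTy (SplitE A B C d c) (sub_ty (insts [c]) C)"
| SplitE_cong: "M \<tturnstile> G \<turnstile> EqTy A A' \<Longrightarrow> M \<tturnstile> A # G \<turnstile> EqTy B B' \<Longrightarrow>
    M \<tturnstile> Sigma A B # G \<turnstile> EqTy C C' \<Longrightarrow> M \<tturnstile> B # A # G \<turnstile> EqTm d d' (split_branch A B C) \<Longrightarrow>
    M \<tturnstile> G \<turnstile> EqTm c c' (Sigma A B) \<Longrightarrow>
    M \<tturnstile> G \<turnstile> EqTm (SplitE A B C d c) (SplitE A' B' C' d' c') (sub_ty (insts [c]) C)"
| SplitE_comp: "M \<tturnstile> Sigma A B # G \<turnstile> IsTy C \<Longrightarrow>
    M \<tturnstile> B # A # G \<turnstile> HasTy d (split_branch A B C) \<Longrightarrow> M \<tturnstile> G \<turnstile> HasTy a A \<Longrightarrow>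
    M \<tturnstile> G \<turnstile> HasTy b (sub_ty (insts [a]) B) \<Longrightarrow>
    M \<tturnstile> G \<turnstile> EqTm (SplitE A B C d (Pair A B a b)) (sub_tm (insts [b, a]) d)
      (sub_ty (insts [Pair A B a b]) C)"

| Unit_form: "is_ctx M G \<Longrightarrow> M \<tturnstile> G \<turnstile> IsTy Unit"
| Star_intro: "is_ctx M G \<Longrightarrow> M \<tturnstile> G \<turnstile> HasTy Star Unit"
| UnitE_elim: "M \<tturnstile> Unit # G \<turnstile> IsTy C \<Longrightarrow> M \<tturnstile> G \<turnstile> HasTy d (sub_ty (insts [Star]) C) \<Longrightarrow>
    M \<tturnstile> G \<turnstile> HasTy c Unit \<Longrightarrow> M \<tturnstile> G \<turnstile> HasTy (UnitE C d c) (sub_ty (insts [c]) C)"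
| UnitE_cong: "M \<tturnstile> Unit # G \<turnstile> EqTy C C' \<Longrightarrow> M \<tturnstile> G \<turnstile> EqTm d d' (sub_ty (insts [Star]) C) \<Longrightarrow>
    M \<tturnstile> G \<turnstile> EqTm c c' Unit \<Longrightarrow>
    M \<tturnstile> G \<turnstile> EqTm (UnitE C d c) (UnitE C' d' c') (sub_ty (insts [c]) C)"
| UnitE_comp: "M \<tturnstile> Unit # G \<turnstile> IsTy C \<Longrightarrow> M \<tturnstile> G \<turnstile> HasTy d (sub_ty (insts [Star]) C) \<Longrightarrow>
    M \<tturnstile> G \<turnstile> EqTm (UnitE C d Star) d (sub_ty (insts [Star]) C)"

| Id_form: "M \<tturnstile> G \<turnstile> HasTy a A \<Longrightarrow> M \<tturnstile> G \<turnstile> HasTy b A \<Longrightarrow> M \<tturnstile> G \<turnstile> IsTy (Id A a b)"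
| Id_cong: "M \<tturnstile> G \<turnstile> EqTy A A' \<Longrightarrow> M \<tturnstile> G \<turnstile> EqTm a a' A \<Longrightarrow> M \<tturnstile> G \<turnstile> EqTm b b' A \<Longrightarrow>
    M \<tturnstile> G \<turnstile> EqTy (Id A a b) (Id A' a' b')"
| Refl_intro: "M \<tturnstile> G \<turnstile> HasTy a A \<Longrightarrow> M \<tturnstile> G \<turnstile> HasTy (Refl A a) (Id A a a)"
| Refl_cong: "M \<tturnstile> G \<turnstile> EqTy A A' \<Longrightarrow> M \<tturnstile> G \<turnstile> EqTm a a' A \<Longrightarrow>
    M \<tturnstile> G \<turnstile> EqTm (Refl A a) (Refl A' a') (Id A a a)"
| J_elim: "M \<tturnstile> Id_tel A @ G \<turnstile> IsTy C \<Longrightarrow> M \<tturnstile> A # G \<turnstile> HasTy d (J_branch A C) \<Longrightarrow>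
    M \<tturnstile> G \<turnstile> HasTy a A \<Longrightarrow> M \<tturnstile> G \<turnstile> HasTy b A \<Longrightarrow> M \<tturnstile> G \<turnstile> HasTy p (Id A a b) \<Longrightarrow>
    M \<tturnstile> G \<turnstile> HasTy (J A C d a b p) (sub_ty (insts [p, b, a]) C)"
| J_cong: "M \<tturnstile> G \<turnstile> EqTy A A' \<Longrightarrow> M \<tturnstile> Id_tel A @ G \<turnstile> EqTy C C' \<Longrightarrow>
    M \<tturnstile> A # G \<turnstile> EqTm d d' (J_branch A C) \<Longrightarrow> M \<tturnstile> G \<turnstile> EqTm a a' A \<Longrightarrow>
    M \<tturnstile> G \<turnstile> EqTm b b' A \<Longrightarrow> M \<tturnstile> G \<turnstile> EqTm p p' (Id A a b) \<Longrightarrow>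
    M \<tturnstile> G \<turnstile> EqTm (J A C d a b p) (J A' C' d' a' b' p') (sub_ty (insts [p, b, a]) C)"
| J_comp: "M \<tturnstile> Id_tel A @ G \<turnstile> IsTy C \<Longrightarrow> M \<tturnstile> A # G \<turnstile> HasTy d (J_branch A C) \<Longrightarrow>
    M \<tturnstile> G \<turnstile> HasTy a A \<Longrightarrow>
    M \<tturnstile> G \<turnstile> EqTm (J A C d a a (Refl A a)) (sub_tm (insts [a]) d)
      (sub_ty (insts [Refl A a, a, a]) C)"

| discrete_eq: "M \<tturnstile> G \<turnstile> HasTy p (Id A a b) \<Longrightarrow> M \<tturnstile> G \<turnstile> HasTy q (Id A a b) \<Longrightarrow>
    M \<tturnstile> G \<turnstile> HasTy e (Id (Id A a b) p q) \<Longrightarrow> M \<tturnstile> G \<turnstile> EqTm p q (Id A a b)"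
| discrete_refl: "M \<tturnstile> G \<turnstile> HasTy p (Id A a b) \<Longrightarrow> M \<tturnstile> G \<turnstile> HasTy q (Id A a b) \<Longrightarrow>
    M \<tturnstile> G \<turnstile> HasTy e (Id (Id A a b) p q) \<Longrightarrow>
    M \<tturnstile> G \<turnstile> EqTm e (Refl (Id A a b) p) (Id (Id A a b) p q)"

| Pi_form: "M \<tturnstile> G \<turnstile> IsTy A \<Longrightarrow> M \<tturnstile> A # G \<turnstile> IsTy B \<Longrightarrow> M \<tturnstile> G \<turnstile> IsTy (Pi A B)"
| Pi_cong: "M \<tturnstile> G \<turnstile> EqTy A A' \<Longrightarrow> M \<tturnstile> A # G \<turnstile> EqTy B B' \<Longrightarrow>
    M \<tturnstile> G \<turnstile> EqTy (Pi A B) (Pi A' B')"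
| Lam_intro: "M \<tturnstile> G \<turnstile> IsTy A \<Longrightarrow> M \<tturnstile> A # G \<turnstile> HasTy f B \<Longrightarrow>
    M \<tturnstile> G \<turnstile> HasTy (Lam A B f) (Pi A B)"
| Lam_cong: "M \<tturnstile> G \<turnstile> EqTy A A' \<Longrightarrow> M \<tturnstile> A # G \<turnstile> EqTy B B' \<Longrightarrow> M \<tturnstile> A # G \<turnstile> EqTm f f' B \<Longrightarrow>
    M \<tturnstile> G \<turnstile> EqTm (Lam A B f) (Lam A' B' f') (Pi A B)"
| App_elim: "M \<tturnstile> G \<turnstile> HasTy m (Pi A B) \<Longrightarrow> M \<tturnstile> G \<turnstile> HasTy a A \<Longrightarrow>
    M \<tturnstile> G \<turnstile> HasTy (App A B m a) (sub_ty (insts [a]) B)"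
| App_cong: "M \<tturnstile> G \<turnstile> EqTy A A' \<Longrightarrow> M \<tturnstile> A # G \<turnstile> EqTy B B' \<Longrightarrow>
    M \<tturnstile> G \<turnstile> EqTm m m' (Pi A B) \<Longrightarrow> M \<tturnstile> G \<turnstile> EqTm a a' A \<Longrightarrow>
    M \<tturnstile> G \<turnstile> EqTm (App A B m a) (App A' B' m' a') (sub_ty (insts [a]) B)"
| App_comp: "M \<tturnstile> A # G \<turnstile> HasTy f B \<Longrightarrow> M \<tturnstile> G \<turnstile> HasTy a A \<Longrightarrow>
    M \<tturnstile> G \<turnstile> EqTm (App A B (Lam A B f) a) (sub_tm (insts [a]) f) (sub_ty (insts [a]) B)"

| ext_intro: "M \<tturnstile> G \<turnstile> HasTy m (Pi A B) \<Longrightarrow> M \<tturnstile> G \<turnstile> HasTy n (Pi A B) \<Longrightarrow>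
    M \<tturnstile> A # G \<turnstile> HasTy p (Id B (appvar A B m) (appvar A B n)) \<Longrightarrow>
    M \<tturnstile> G \<turnstile> HasTy (Ext A B m n p) (Id (Pi A B) m n)"
| ext_cong: "M \<tturnstile> G \<turnstile> EqTy A A' \<Longrightarrow> M \<tturnstile> A # G \<turnstile> EqTy B B' \<Longrightarrow>
    M \<tturnstile> G \<turnstile> EqTm m m' (Pi A B) \<Longrightarrow> M \<tturnstile> G \<turnstile> EqTm n n' (Pi A B) \<Longrightarrow>
    M \<tturnstile> A # G \<turnstile> EqTm p p' (Id B (appvar A B m) (appvar A B n)) \<Longrightarrow>
    M \<tturnstile> G \<turnstile> EqTm (Ext A B m n p) (Ext A' B' m' n' p') (Id (Pi A B) m n)"
| ext_refl: "M \<tturnstile> G \<turnstile> HasTy m (Pi A B) \<Longrightarrow>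
    M \<tturnstile> G \<turnstile> EqTm (Ext A B m m (Refl B (appvar A B m))) (Refl (Pi A B) m) (Id (Pi A B) m m)"
| ext_comp: "M \<tturnstile> G \<turnstile> HasTy m (Pi A B) \<Longrightarrow> M \<tturnstile> G \<turnstile> HasTy n (Pi A B) \<Longrightarrow>
    M \<tturnstile> A # G \<turnstile> HasTy p (Id B (appvar A B m) (appvar A B n)) \<Longrightarrow> M \<tturnstile> G \<turnstile> HasTy a A \<Longrightarrow>
    M \<tturnstile> G \<turnstile> EqTm (idapp A B m n (Ext A B m n p) a) (sub_tm (insts [a]) p)
      (Id (sub_ty (insts [a]) B) (App A B m a) (App A B n a))"

| ax_ty: "tel M (top1 M) As \<Longrightarrow> A \<in> fib M (tend M (top1 M) As) \<Longrightarrow>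
    M \<tturnstile> bar_ctx As \<turnstile> IsTy (bar_ty As A)"
| ax_tm: "tel M (top1 M) As \<Longrightarrow> A \<in> fib M (tend M (top1 M) As) \<Longrightarrow> gsection M A a \<Longrightarrow>
    M \<tturnstile> bar_ctx As \<turnstile> HasTy (bar_tm As A a) (bar_ty As A)"

| ax_var: "tel M (top1 M) (A # As) \<Longrightarrow>
    M \<tturnstile> bar_ctx (A # As)
      \<turnstile> EqTm (Var 0) (bar_tm (A # As) (wkself M A) (diag M A)) (bar_ty (A # As) (wkself M A))"
| ax_subst_ty: "tel M (top1 M) (Ds @ A # As) \<Longrightarrow> gsection M A a \<Longrightarrow>
    B \<in> fib M (tend M (top1 M) (Ds @ A # As)) \<Longrightarrow>
    M \<tturnstile> bar_ctx (retel M a Ds @ As)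
      \<turnstile> EqTy (sub_ty ((ups ^^ length Ds) (insts [bar_tm As A a])) (bar_ty (Ds @ A # As) B))
             (bar_ty (retel M a Ds @ As) (reix M (flift M a Ds) B))"
| ax_subst_tm: "tel M (top1 M) (Ds @ A # As) \<Longrightarrow> gsection M A a \<Longrightarrow>
    B \<in> fib M (tend M (top1 M) (Ds @ A # As)) \<Longrightarrow> gsection M B b \<Longrightarrow>
    M \<tturnstile> bar_ctx (retel M a Ds @ As)
      \<turnstile> EqTm (sub_tm ((ups ^^ length Ds) (insts [bar_tm As A a])) (bar_tm (Ds @ A # As) B b))
             (bar_tm (retel M a Ds @ As) (reix M (flift M a Ds) B) (resec M (flift M a Ds) B b))
             (bar_ty (retel M a Ds @ As) (reix M (flift M a Ds) B))"
| ax_weaken_ty: "tel M (top1 M) (Ds @ As) \<Longrightarrow> A \<in> fib M (tend M (top1 M) As) \<Longrightarrow>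
    B \<in> fib M (tend M (top1 M) (Ds @ As)) \<Longrightarrow> f = disp M A \<Longrightarrow>
    M \<tturnstile> bar_ctx (retel M f Ds @ A # As)
      \<turnstile> EqTy (ren_ty ((upr ^^ length Ds) Suc) (bar_ty (Ds @ As) B))
             (bar_ty (retel M f Ds @ A # As) (reix M (flift M f Ds) B))"
| ax_weaken_tm: "tel M (top1 M) (Ds @ As) \<Longrightarrow> A \<in> fib M (tend M (top1 M) As) \<Longrightarrow>
    B \<in> fib M (tend M (top1 M) (Ds @ As)) \<Longrightarrow> gsection M B b \<Longrightarrow> f = disp M A \<Longrightarrow>
    M \<tturnstile> bar_ctx (retel M f Ds @ A # As)
      \<turnstile> EqTm (ren_tm ((upr ^^ length Ds) Suc) (bar_tm (Ds @ As) B b))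
             (bar_tm (retel M f Ds @ A # As) (reix M (flift M f Ds) B) (resec M (flift M f Ds) B b))
             (bar_ty (retel M f Ds @ A # As) (reix M (flift M f Ds) B))"
| ax_contract_ty: "tel M (top1 M) (Ds @ wkself M A # A # As) \<Longrightarrow>
    B \<in> fib M (tend M (top1 M) (Ds @ wkself M A # A # As)) \<Longrightarrow> f = diag M A \<Longrightarrow>
    M \<tturnstile> bar_ctx (retel M f Ds @ A # As)
      \<turnstile> EqTy (ren_ty ((upr ^^ length Ds) contract) (bar_ty (Ds @ wkself M A # A # As) B))
             (bar_ty (retel M f Ds @ A # As) (reix M (flift M f Ds) B))"
| ax_contract_tm: "tel M (top1 M) (Ds @ wkself M A # A # As) \<Longrightarrow>
    B \<in> fib M (tend M (top1 M) (Ds @ wkself M A # A # As)) \<Longrightarrow> gsection M B b \<Longrightarrow>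
    f = diag M A \<Longrightarrow>
    M \<tturnstile> bar_ctx (retel M f Ds @ A # As)
      \<turnstile> EqTm (ren_tm ((upr ^^ length Ds) contract) (bar_tm (Ds @ wkself M A # A # As) B b))
             (bar_tm (retel M f Ds @ A # As) (reix M (flift M f Ds) B) (resec M (flift M f Ds) B b))
             (bar_ty (retel M f Ds @ A # As) (reix M (flift M f Ds) B))"
| ax_exchange_ty: "tel M (top1 M) (A # As) \<Longrightarrow> tel M (top1 M) (B # As) \<Longrightarrow>
    tel M (top1 M) (Ds @ reix M (disp M A) B # A # As) \<Longrightarrow>
    C \<in> fib M (tend M (top1 M) (Ds @ reix M (disp M A) B # A # As)) \<Longrightarrow> f = symm M A B \<Longrightarrow>
    M \<tturnstile> bar_ctx (retel M f Ds @ reix M (disp M B) A # B # As)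
      \<turnstile> EqTy (ren_ty ((upr ^^ length Ds) exchange) (bar_ty (Ds @ reix M (disp M A) B # A # As) C))
             (bar_ty (retel M f Ds @ reix M (disp M B) A # B # As) (reix M (flift M f Ds) C))"
| ax_exchange_tm: "tel M (top1 M) (A # As) \<Longrightarrow> tel M (top1 M) (B # As) \<Longrightarrow>
    tel M (top1 M) (Ds @ reix M (disp M A) B # A # As) \<Longrightarrow>
    C \<in> fib M (tend M (top1 M) (Ds @ reix M (disp M A) B # A # As)) \<Longrightarrow> gsection M C c \<Longrightarrow>
    f = symm M A B \<Longrightarrow>
    M \<tturnstile> bar_ctx (retel M f Ds @ reix M (disp M B) A # B # As)
      \<turnstile> EqTm (ren_tm ((upr ^^ length Ds) exchange)
                (bar_tm (Ds @ reix M (disp M A) B # A # As) C c))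
             (bar_tm (retel M f Ds @ reix M (disp M B) A # B # As)
                (reix M (flift M f Ds) C) (resec M (flift M f Ds) C c))
             (bar_ty (retel M f Ds @ reix M (disp M B) A # B # As) (reix M (flift M f Ds) C))"

| ax_Sigma: "tel M (top1 M) (B # A # As) \<Longrightarrow>
    M \<tturnstile> bar_ctx As
      \<turnstile> EqTy (Sigma (bar_ty As A) (bar_ty (A # As) B)) (bar_ty As (sigty M A B))"
| ax_Pair: "tel M (top1 M) (B # A # As) \<Longrightarrow> Gs = B # A # As \<Longrightarrow>
    f = disp M A \<cdot>\<^bsub>base M\<^esub> disp M B \<Longrightarrow> S = reix M f (sigty M A B) \<Longrightarrow>
    M \<tturnstile> bar_ctx Gs
      \<turnstile> EqTm (Pair (wk_ty 2 0 (bar_ty As A)) (wk_ty 2 1 (bar_ty (A # As) B)) (Var 1) (Var 0))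
             (bar_tm Gs S (sec M f (sigty M A B) (sigin M A B))) (bar_ty Gs S)"
| ax_SplitE: "tel M (top1 M) (B # A # As) \<Longrightarrow> S = sigty M A B \<Longrightarrow> C \<in> fib M (ext M S) \<Longrightarrow>
    d \<in> hom (base M) (ext M B) (ext M C) \<Longrightarrow> disp M C \<cdot>\<^bsub>base M\<^esub> d = sigin M A B \<Longrightarrow>
    M \<tturnstile> bar_ctx (S # As)
      \<turnstile> EqTm (SplitE (wk_ty 1 0 (bar_ty As A)) (wk_ty 1 1 (bar_ty (A # As) B))
                (wk_ty 1 1 (bar_ty (S # As) C))
                (wk_tm 1 2 (bar_tm (B # A # As) (reix M (sigin M A B) C) (sec M (sigin M A B) C d)))
                (Var 0))
             (bar_tm (S # As) C (Emap M A B C d)) (bar_ty (S # As) C)"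
| ax_Unit: "tel M (top1 M) As \<Longrightarrow> X = tend M (top1 M) As \<Longrightarrow>
    M \<tturnstile> bar_ctx As \<turnstile> EqTy Unit (bar_ty As (unty M X))"
| ax_Star: "tel M (top1 M) As \<Longrightarrow> X = tend M (top1 M) As \<Longrightarrow>
    M \<tturnstile> bar_ctx As \<turnstile> EqTm Star (bar_tm As (unty M X) (unmap M X)) (bar_ty As (unty M X))"
| ax_UnitE: "tel M (top1 M) As \<Longrightarrow> X = tend M (top1 M) As \<Longrightarrow> U = unty M X \<Longrightarrow>
    C \<in> fib M (ext M U) \<Longrightarrow> d \<in> hom (base M) X (ext M C) \<Longrightarrow>
    disp M C \<cdot>\<^bsub>base M\<^esub> d = unmap M X \<Longrightarrow>
    M \<tturnstile> bar_ctx (U # As)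
      \<turnstile> EqTm (UnitE (wk_ty 1 1 (bar_ty (U # As) C))
                (wk_tm 1 0 (bar_tm As (reix M (unmap M X) C) (sec M (unmap M X) C d))) (Var 0))
             (bar_tm (U # As) C (Umap M X C d)) (bar_ty (U # As) C)"
| ax_Id: "tel M (top1 M) (A # As) \<Longrightarrow> Gs = wkself M A # A # As \<Longrightarrow>
    M \<tturnstile> bar_ctx Gs
      \<turnstile> EqTy (Id (wk_ty 2 0 (bar_ty As A)) (Var 1) (Var 0)) (bar_ty Gs (idty M A))"
| ax_Refl: "tel M (top1 M) (A # As) \<Longrightarrow> I = reix M (diag M A) (idty M A) \<Longrightarrow>
    M \<tturnstile> bar_ctx (A # As)
      \<turnstile> EqTm (Refl (wk_ty 1 0 (bar_ty As A)) (Var 0))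
             (bar_tm (A # As) I (sec M (diag M A) (idty M A) (reflmap M A)))
             (bar_ty (A # As) I)"
| ax_J: "tel M (top1 M) (A # As) \<Longrightarrow> Gs = idty M A # wkself M A # A # As \<Longrightarrow>
    C \<in> fib M (ext M (idty M A)) \<Longrightarrow> d \<in> hom (base M) (ext M A) (ext M C) \<Longrightarrow>
    disp M C \<cdot>\<^bsub>base M\<^esub> d = reflmap M A \<Longrightarrow>
    M \<tturnstile> bar_ctx Gs
      \<turnstile> EqTm (J (wk_ty 3 0 (bar_ty As A)) (wk_ty 3 3 (bar_ty Gs C))
                (wk_tm 3 1 (bar_tm (A # As) (reix M (reflmap M A) C) (sec M (reflmap M A) C d)))
                (Var 2) (Var 1) (Var 0))
             (bar_tm Gs C (Jmap M A C d)) (bar_ty Gs C)"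
| ax_Pi: "tel M (top1 M) (B # A # As) \<Longrightarrow>
    M \<tturnstile> bar_ctx As
      \<turnstile> EqTy (Pi (bar_ty As A) (bar_ty (A # As) B)) (bar_ty As (pity M A B))"
| ax_Lam: "tel M (top1 M) (B # A # As) \<Longrightarrow> gsection M B f \<Longrightarrow>
    M \<tturnstile> bar_ctx As
      \<turnstile> EqTm (Lam (bar_ty As A) (bar_ty (A # As) B) (bar_tm (A # As) B f))
             (bar_tm As (pity M A B) (lammap M A B f)) (bar_ty As (pity M A B))"
| ax_App: "tel M (top1 M) (B # A # As) \<Longrightarrow> P = reix M (disp M A) (pity M A B) \<Longrightarrow>
    Gs = P # A # As \<Longrightarrow> B' = reix M (disp M P) B \<Longrightarrow>
    M \<tturnstile> bar_ctx Gs
      \<turnstile> EqTm (App (wk_ty 2 0 (bar_ty As A)) (wk_ty 2 1 (bar_ty (A # As) B)) (Var 0) (Var 1))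
             (bar_tm Gs B' (sec M (disp M P) B (appmap M A B))) (bar_ty Gs B')"
| ax_Ext: "tel M (top1 M) (B # A # As) \<Longrightarrow>
    gsection M (pity M A B) m \<Longrightarrow> gsection M (pity M A B) n \<Longrightarrow>
    p \<in> cells (base M) (appsec M A B m) (appsec M A B n) \<Longrightarrow>
    whisker_left (base M) (disp M B) p = Id2 (base M) (Ide (base M) (ext M A)) \<Longrightarrow>
    e = extcell M A B m n p \<Longrightarrow>
    M \<tturnstile> bar_ctx As
      \<turnstile> EqTm (Ext (bar_ty As A) (bar_ty (A # As) B)
                (bar_tm As (pity M A B) m) (bar_tm As (pity M A B) n)
                (bar_tm (A # As) (cellty M B p) (cellsec M B p)))
             (bar_tm As (cellty M (pity M A B) e) (cellsec M (pity M A B) e))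
             (bar_ty As (cellty M (pity M A B) e))"

end

theory Submission
  imports Defs
begin

text \<open>Variables are interpreted by arbitrary global sections over an arbitrary object \<open>X\<close> instead of by the
  projections of a context. Then reindexing along \<open>X' \<rightarrow> X\<close> and substitution both merely change the
  environment, and a judgement is valid if it holds in every environment satisfying its context. Stability
  of the semantic operations makes the interpretation commute with reindexing, and validity is preserved by
  all rules. The one rule whose validity is not immediate is \<open>ext(m, n, p) * a = p(a)\<close>: naturality of the
  path objects turns \<open>J\<close> with \<open>d(x) = r(x \<cdot> a)\<close> into whiskering with \<open>x \<mapsto> x \<cdot> a\<close>, and the 2-cell
  \<open>ext(p)\<close> is characterised by its whiskering with \<open>\<epsilon>\<close> being \<open>p\<close>. In the generic environment of
  \<open>1.A\<^sub>1\<cdots>A\<^sub>n\<close>, whose variables denote the diagonal sections, a barred type or term denotes the very datum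
  it names, so that provably equal bars name the same datum.\<close>

section \<open>Computing in a 2-category\<close>

text \<open>Contexts in a derivation are arbitrary lists of raw types, and many rules do not record
  that the types they mention are well formed; what the semantics needs must be recovered from the
  meaning of the premises. Hence the interpretation is a relation, definedness is part of soundness,
  and a semantic judgement includes that its context and its type denote. That the relation is
  functional rests on the type annotations in raw terms. Since the fibration is split and the
  structure strictly stable, provably equal types denote the same object, and no coercions between
  isomorphic reindexings arise; this is what lets a plain function on de Bruijn indices replace a
  morphism of contexts. Stability is assumed for chosen data only. For 2-cells given by uniqueness
  (the contractions of unit and path objects, the cell of extensionality) it is proved, by
  characterising the cell through its projections and reindexing the characterisation. Identity
  proofs are treated throughout as 2-cells, so that equations between them can be tested on
  projections.\<close>

lemma hom_iff [simp]: "f \<in> hom K x y \<longleftrightarrow> f \<in> Arr K \<and> Dom K f = x \<and> Cod K f = y"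
  by (simp add: hom_def)

lemma cells_iff [simp]: "\<alpha> \<in> cells K f g \<longleftrightarrow> \<alpha> \<in> Cell K \<and> Src K \<alpha> = f \<and> Tgt K \<alpha> = g"
  by (simp add: cells_def)

context two_category
begin

lemmas [simp] = dom_ob cod_ob src_arr tgt_arr

lemma cmp_simps [simp]:
  assumes "f \<in> Arr K" "g \<in> Arr K" "Cod K f = Dom K g"
  shows "g \<cdot> f \<in> Arr K" "Dom K (g \<cdot> f) = Dom K f" "Cod K (g \<cdot> f) = Cod K g"
  using cmp_hom[of f "Dom K f" "Cod K f" g "Cod K g"] assms by auto

lemma ide_simps [simp]:
  assumes "x \<in> Ob K"
  shows "Ide K x \<in> Arr K" "Dom K (Ide K x) = x" "Cod K (Ide K x) = x"
  using ide_hom[OF assms] by auto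

lemma cmp_ide [simp]:
  "f \<in> Arr K \<Longrightarrow> Dom K f = x \<Longrightarrow> f \<cdot> Ide K x = f"
  "f \<in> Arr K \<Longrightarrow> Cod K f = x \<Longrightarrow> Ide K x \<cdot> f = f"
  using cmp_ide_left cmp_ide_right by auto

lemma cmp_assoc' [simp]:
  assumes "f \<in> Arr K" "g \<in> Arr K" "h \<in> Arr K" "Cod K f = Dom K g" "Cod K g = Dom K h"
  shows "(h \<cdot> g) \<cdot> f = h \<cdot> (g \<cdot> f)"
  using cmp_assoc[of f "Dom K f" "Cod K f" g "Cod K g" h "Cod K h"] assms by auto

lemma tgt_simps [simp]:
  assumes "\<alpha> \<in> Cell K"
  shows "Dom K (Tgt K \<alpha>) = Dom K (Src K \<alpha>)" "Cod K (Tgt K \<alpha>) = Cod K (Src K \<alpha>)"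
  using cell_dom cell_cod assms by auto

lemma id2_simps [simp]:
  assumes "f \<in> Arr K"
  shows "Id2 K f \<in> Cell K" "Src K (Id2 K f) = f" "Tgt K (Id2 K f) = f"
  using id2_cell[OF assms] by auto

lemma vcmp_simps [simp]:
  assumes "\<alpha> \<in> Cell K" "\<beta> \<in> Cell K" "Tgt K \<alpha> = Src K \<beta>"
  shows "\<beta> \<bullet> \<alpha> \<in> Cell K" "Src K (\<beta> \<bullet> \<alpha>) = Src K \<alpha>" "Tgt K (\<beta> \<bullet> \<alpha>) = Tgt K \<beta>"
  using vcmp_cell[of \<alpha> "Src K \<alpha>" "Src K \<beta>" \<beta> "Tgt K \<beta>"] assms by auto

lemma hcmp_simps [simp]:
  assumes "\<alpha> \<in> Cell K" "\<beta> \<in> Cell K" "Cod K (Src K \<alpha>) = Dom K (Src K \<beta>)"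
  shows "\<beta> \<star> \<alpha> \<in> Cell K" "Src K (\<beta> \<star> \<alpha>) = Src K \<beta> \<cdot> Src K \<alpha>"
    "Tgt K (\<beta> \<star> \<alpha>) = Tgt K \<beta> \<cdot> Tgt K \<alpha>"
  using hcmp_cell[of \<alpha> "Src K \<alpha>" "Tgt K \<alpha>" \<beta> "Src K \<beta>" "Tgt K \<beta>"] assms by auto

lemma vcmp_id2 [simp]:
  "\<alpha> \<in> Cell K \<Longrightarrow> Src K \<alpha> = f \<Longrightarrow> \<alpha> \<bullet> Id2 K f = \<alpha>"
  "\<alpha> \<in> Cell K \<Longrightarrow> Tgt K \<alpha> = f \<Longrightarrow> Id2 K f \<bullet> \<alpha> = \<alpha>"
  using vcmp_id_right[of \<alpha> "Src K \<alpha>" "Tgt K \<alpha>"] vcmp_id_left[of \<alpha> "Src K \<alpha>" "Tgt K \<alpha>"] by auto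

lemma hcmp_ide [simp]:
  "\<alpha> \<in> Cell K \<Longrightarrow> Dom K (Src K \<alpha>) = x \<Longrightarrow> \<alpha> \<star> Id2 K (Ide K x) = \<alpha>"
  "\<alpha> \<in> Cell K \<Longrightarrow> Cod K (Src K \<alpha>) = x \<Longrightarrow> Id2 K (Ide K x) \<star> \<alpha> = \<alpha>"
  using hcmp_id_right[of \<alpha> "Src K \<alpha>" "Tgt K \<alpha>"] hcmp_id_left[of \<alpha> "Src K \<alpha>" "Tgt K \<alpha>"] by auto

lemma hcmp_assoc' [simp]:
  assumes "\<alpha> \<in> Cell K" "\<beta> \<in> Cell K" "\<gamma> \<in> Cell K"
    "Cod K (Src K \<alpha>) = Dom K (Src K \<beta>)" "Cod K (Src K \<beta>) = Dom K (Src K \<gamma>)"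
  shows "(\<gamma> \<star> \<beta>) \<star> \<alpha> = \<gamma> \<star> (\<beta> \<star> \<alpha>)"
  using hcmp_assoc[of \<alpha> "Src K \<alpha>" "Tgt K \<alpha>" \<beta> "Src K \<beta>" "Tgt K \<beta>" \<gamma> "Src K \<gamma>" "Tgt K \<gamma>"] assms
  by auto

lemma hcmp_id2_merge [simp]:
  assumes "f \<in> Arr K" "g \<in> Arr K" "Cod K f = Dom K g"
  shows "Id2 K g \<star> Id2 K f = Id2 K (g \<cdot> f)"
    "\<alpha> \<in> Cell K \<Longrightarrow> Cod K (Src K \<alpha>) = Dom K f \<Longrightarrow>
       Id2 K g \<star> Id2 K f \<star> \<alpha> = Id2 K (g \<cdot> f) \<star> \<alpha>"
proof -
  show 1: "Id2 K g \<star> Id2 K f = Id2 K (g \<cdot> f)" using hcmp_id2 assms by auto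
  assume a: "\<alpha> \<in> Cell K" "Cod K (Src K \<alpha>) = Dom K f"
  then show "Id2 K g \<star> Id2 K f \<star> \<alpha> = Id2 K (g \<cdot> f) \<star> \<alpha>"
    using hcmp_assoc'[of \<alpha> "Id2 K f" "Id2 K g"] assms unfolding 1 by simp
qed

text \<open>Both sides are \<open>\<beta> \<star> \<alpha>\<close>, by interchange against
  identities. Naturality of \<open>idcell\<close>, and of the cell given by an eliminator in
  \<open>Jsec_whisker\<close>, are instances.\<close>

lemma whisker_exchange:
  assumes "\<alpha> \<in> Cell K" "\<beta> \<in> Cell K" "Cod K (Src K \<alpha>) = Dom K (Src K \<beta>)"
  shows "whisker_right K \<beta> (Tgt K \<alpha>) \<bullet> whisker_left K (Src K \<beta>) \<alpha> =
         whisker_left K (Tgt K \<beta>) \<alpha> \<bullet> whisker_right K \<beta> (Src K \<alpha>)"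
proof -
  have "(\<beta> \<bullet> Id2 K (Src K \<beta>)) \<star> (Id2 K (Tgt K \<alpha>) \<bullet> \<alpha>) =
        whisker_right K \<beta> (Tgt K \<alpha>) \<bullet> whisker_left K (Src K \<beta>) \<alpha>"
    by (rule interchange) (use assms in auto)
  moreover have "(Id2 K (Tgt K \<beta>) \<bullet> \<beta>) \<star> (\<alpha> \<bullet> Id2 K (Src K \<alpha>)) =
        whisker_left K (Tgt K \<beta>) \<alpha> \<bullet> whisker_right K \<beta> (Src K \<alpha>)"
    by (rule interchange) (use assms in auto)
  ultimately show ?thesis using assms by simp
qed

lemma whisker_vcmp:
  assumes "\<alpha> \<in> Cell K" "\<beta> \<in> Cell K" "Tgt K \<alpha> = Src K \<beta>" "f \<in> Arr K" "Cod K (Src K \<alpha>) = Dom K f"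
  shows "whisker_left K f (\<beta> \<bullet> \<alpha>) = whisker_left K f \<beta> \<bullet> whisker_left K f \<alpha>"
proof -
  have "(Id2 K f \<bullet> Id2 K f) \<star> (\<beta> \<bullet> \<alpha>) = (Id2 K f \<star> \<beta>) \<bullet> (Id2 K f \<star> \<alpha>)"
    by (rule interchange) (use assms in auto)
  then show ?thesis using assms(4) by simp
qed

end

section \<open>The fibration of types\<close>

locale model =
  fixes M :: "('o, 'm, 'c, 'a, 't, 'u) model_data"
  assumes model: "two_dim_model M"
begin

abbreviation cmp :: "'m \<Rightarrow> 'm \<Rightarrow> 'm" (infixr "\<odot>" 75) where "g \<odot> f \<equiv> Cmp (base M) g f"
abbreviation lwhisk :: "'m \<Rightarrow> 'c \<Rightarrow> 'c" (infixr "\<rhd>" 75) where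
  "f \<rhd> \<alpha> \<equiv> whisker_left (base M) f \<alpha>"
abbreviation rwhisk :: "'c \<Rightarrow> 'm \<Rightarrow> 'c" (infixl "\<lhd>" 75) where
  "\<alpha> \<lhd> f \<equiv> whisker_right (base M) \<alpha> f"
abbreviation tcmp :: "'t \<Rightarrow> 't \<Rightarrow> 't" (infixr "\<odot>\<^sub>T" 75) where "g \<odot>\<^sub>T f \<equiv> Cmp (fam M) g f"
abbreviation tlwhisk :: "'t \<Rightarrow> 'u \<Rightarrow> 'u" (infixr "\<rhd>\<^sub>T" 75) where
  "f \<rhd>\<^sub>T \<alpha> \<equiv> whisker_left (fam M) f \<alpha>"
abbreviation trwhisk :: "'u \<Rightarrow> 't \<Rightarrow> 'u" (infixl "\<lhd>\<^sub>T" 75) where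
  "\<alpha> \<lhd>\<^sub>T f \<equiv> whisker_right (fam M) \<alpha> f"
abbreviation arr :: "'m \<Rightarrow> bool" where "arr f \<equiv> f \<in> Arr (base M)"
abbreviation dm :: "'m \<Rightarrow> 'o" where "dm \<equiv> Dom (base M)"
abbreviation cd :: "'m \<Rightarrow> 'o" where "cd \<equiv> Cod (base M)"
abbreviation ide :: "'o \<Rightarrow> 'm" where "ide \<equiv> Ide (base M)"
abbreviation id2 :: "'m \<Rightarrow> 'c" where "id2 \<equiv> Id2 (base M)"
abbreviation cell :: "'c \<Rightarrow> bool" where "cell \<alpha> \<equiv> \<alpha> \<in> Cell (base M)"
abbreviation sr :: "'c \<Rightarrow> 'm" where "sr \<equiv> Src (base M)"
abbreviation tg :: "'c \<Rightarrow> 'm" where "tg \<equiv> Tgt (base M)"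
abbreviation isty :: "'a \<Rightarrow> bool" where "isty A \<equiv> A \<in> Ob (fam M)"
abbreviation cx :: "'a \<Rightarrow> 'o" where "cx \<equiv> F0 (proj M)"
abbreviation cend :: "'a list \<Rightarrow> 'o" where "cend \<equiv> tend M (top1 M)"
abbreviation ctel :: "'a list \<Rightarrow> bool" where "ctel \<equiv> tel M (top1 M)"
abbreviation reix where "reix \<equiv> Defs.reix M"
abbreviation disp where "disp \<equiv> Defs.disp M"
abbreviation fext where "fext \<equiv> Defs.fext M"
abbreviation ext where "ext \<equiv> Defs.ext M"
abbreviation resec where "resec \<equiv> Defs.resec M"
abbreviation upper where "upper \<equiv> Defs.upper M"
abbreviation upper2 where "upper2 \<equiv> Defs.upper2 M"
abbreviation fhom where "fhom \<equiv> Defs.fhom M"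
abbreviation fcells where "fcells \<equiv> Defs.fcells M"
abbreviation reix1 where "reix1 \<equiv> Defs.reix1 M"
abbreviation reix2 where "reix2 \<equiv> Defs.reix2 M"
abbreviation flift where "flift \<equiv> Defs.flift M"
abbreviation retel where "retel \<equiv> Defs.retel M"
abbreviation sec where "sec \<equiv> Defs.sec M"
abbreviation wkself where "wkself \<equiv> Defs.wkself M"
abbreviation diag where "diag \<equiv> Defs.diag M"
abbreviation gsection where "gsection \<equiv> Defs.gsection M"
abbreviation idsrc where "idsrc \<equiv> Defs.idsrc M"
abbreviation idtgt where "idtgt \<equiv> Defs.idtgt M"
abbreviation sigin where "sigin \<equiv> Defs.sigin M"
abbreviation classify where "classify \<equiv> Defs.classify M"
abbreviation cellty where "cellty \<equiv> Defs.cellty M"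
abbreviation cellsec where "cellsec \<equiv> Defs.cellsec M"
abbreviation reflmap where "reflmap \<equiv> Defs.reflmap M"
abbreviation reflcell where "reflcell \<equiv> Defs.reflcell M"
abbreviation uncell where "uncell \<equiv> Defs.uncell M"
abbreviation elt where "elt \<equiv> Defs.elt M"
abbreviation lammap where "lammap \<equiv> Defs.lammap M"
abbreviation appmap where "appmap \<equiv> Defs.appmap M"
abbreviation appsec where "appsec \<equiv> Defs.appsec M"
abbreviation extcell where "extcell \<equiv> Defs.extcell M"
abbreviation idty where "idty \<equiv> model_data.idty M"
abbreviation idcell where "idcell \<equiv> model_data.idcell M"
abbreviation unty where "unty \<equiv> model_data.unty M"
abbreviation unmap where "unmap \<equiv> model_data.unmap M"
abbreviation unbar where "unbar \<equiv> model_data.unbar M"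
abbreviation sigty where "sigty \<equiv> model_data.sigty M"
abbreviation sigunit where "sigunit \<equiv> model_data.sigunit M"
abbreviation sigret where "sigret \<equiv> model_data.sigret M"
abbreviation sigcell where "sigcell \<equiv> model_data.sigcell M"
abbreviation pity where "pity \<equiv> model_data.pity M"
abbreviation picounit where "picounit \<equiv> model_data.picounit M"
abbreviation pibar where "pibar \<equiv> model_data.pibar M"
abbreviation clift where "clift \<equiv> model_data.clift M"
abbreviation liftarr where "liftarr \<equiv> model_data.liftarr M"
abbreviation liftcell where "liftcell \<equiv> model_data.liftcell M"

lemma fib_iff [simp]: "A \<in> fib M X \<longleftrightarrow> isty A \<and> cx A = X"
  by (simp add: fib_def)

lemma fibred: "fibred M" and comprehension: "comprehension M" and identities: "identities M"
  and units: "units M" and sums: "sums M" and products: "products M"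
  using model by (auto simp: two_dim_model_def)

sublocale base: two_category "base M" using fibred by (simp add: fibred_def)
sublocale fam: two_category "fam M" using fibred by (simp add: fibred_def)
sublocale proj: two_functor "fam M" "base M" "proj M" using fibred by (simp add: fibred_def)
sublocale compr: two_functor "fam M" "arrow_cat (base M)" "compr M"
  using comprehension by (simp add: comprehension_def)

lemma groupoid: "cell \<alpha> \<Longrightarrow> invertible_cell (base M) \<alpha>"
  using fibred by (simp add: fibred_def locally_groupoidal_def)

lemma proj_arr [simp]:
  assumes "h \<in> Arr (fam M)"
  shows "arr (F1 (proj M) h)" "dm (F1 (proj M) h) = cx (Dom (fam M) h)"
    "cd (F1 (proj M) h) = cx (Cod (fam M) h)"
  using proj.fun_hom[of h "Dom (fam M) h" "Cod (fam M) h"] assms by auto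

lemma cx_ob [simp]: "isty A \<Longrightarrow> cx A \<in> Ob (base M)"
  by (rule proj.fun_ob)

lemma disp_simps [simp]:
  assumes "isty A"
  shows "arr (disp A)" "dm (disp A) = ext A" "cd (disp A) = cx A"
    "ext A \<in> Ob (base M)"
proof -
  show 1: "arr (disp A)"
    using compr.fun_ob[OF assms] by (simp add: disp_def arrow_cat_def Let_def)
  show "dm (disp A) = ext A" by (simp add: ext_def)
  show "cd (disp A) = cx A" using comprehension assms unfolding comprehension_def by blast
  show "ext A \<in> Ob (base M)" using 1 by (simp add: ext_def)
qed

lemma compr_arr:
  assumes "h \<in> Arr (fam M)"
  shows "F1 (compr M) h =
    (disp (Dom (fam M) h), disp (Cod (fam M) h), upper h, F1 (proj M) h)"
proof -
  have "F1 (compr M) h \<in> hom (arrow_cat (base M)) (disp (Dom (fam M) h)) (disp (Cod (fam M) h))"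
    unfolding disp_def by (rule compr.fun_hom) (use assms in auto)
  moreover have "(case F1 (compr M) h of (_, _, _, v) \<Rightarrow> v) = F1 (proj M) h"
    using comprehension assms unfolding comprehension_def by blast
  ultimately show ?thesis
    by (auto simp: arrow_cat_def Let_def upper_def split: prod.splits)
qed

lemma upper_simps [simp]:
  assumes "h \<in> Arr (fam M)"
  shows "arr (upper h)" "dm (upper h) = ext (Dom (fam M) h)"
    "cd (upper h) = ext (Cod (fam M) h)"
    "disp (Cod (fam M) h) \<odot> upper h = F1 (proj M) h \<odot> disp (Dom (fam M) h)"
proof -
  have "F1 (compr M) h \<in> hom (arrow_cat (base M)) (disp (Dom (fam M) h)) (disp (Cod (fam M) h))"
    unfolding disp_def by (rule compr.fun_hom) (use assms in auto)
  then show "arr (upper h)" "dm (upper h) = ext (Dom (fam M) h)"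
    "cd (upper h) = ext (Cod (fam M) h)"
    "disp (Cod (fam M) h) \<odot> upper h = F1 (proj M) h \<odot> disp (Dom (fam M) h)"
    using assms by (auto simp: compr_arr arrow_cat_def Let_def)
qed

lemma upper_cmp:
  assumes "h \<in> Arr (fam M)" "k \<in> Arr (fam M)" "Cod (fam M) h = Dom (fam M) k"
  shows "upper (k \<odot>\<^sub>T h) = upper k \<odot> upper h"
  using compr.fun_cmp[of h "Dom (fam M) h" "Cod (fam M) h" k "Cod (fam M) k"] assms
  by (simp add: compr_arr arrow_cat_def)

lemma upper_ide: "isty A \<Longrightarrow> upper (Ide (fam M) A) = ide (ext A)"
  using compr.fun_ide[of A] by (simp add: compr_arr arrow_cat_def flip: disp_def)

section \<open>Comprehension is bijective on 1-cells and 2-cells\<close>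

lemma compr_bij:
  assumes "isty A" "isty B"
  shows "bij_betw (F1 (compr M)) (hom (fam M) A B) (hom (arrow_cat (base M)) (disp A) (disp B))"
    "bij_betw (F2 (compr M)) {\<alpha> \<in> Cell (fam M). Src (fam M) \<alpha> \<in> hom (fam M) A B}
      {\<alpha> \<in> Cell (arrow_cat (base M)).
         Src (arrow_cat (base M)) \<alpha> \<in> hom (arrow_cat (base M)) (disp A) (disp B)}"
  using comprehension assms unfolding comprehension_def by blast+

text \<open>The square \<open>F1 (compr M) h\<close> consists of the two display maps,
  \<open>upper h\<close> and the base map of \<open>h\<close>. Bijectivity on 1-cells therefore
  makes the last two a complete invariant of a map between given types.\<close>

lemma upper_inj:
  assumes "h \<in> Arr (fam M)" "k \<in> Arr (fam M)" "Dom (fam M) h = Dom (fam M) k"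
    "Cod (fam M) h = Cod (fam M) k" "F1 (proj M) h = F1 (proj M) k" "upper h = upper k"
  shows "h = k"
proof -
  have "inj_on (F1 (compr M)) (hom (fam M) (Dom (fam M) h) (Cod (fam M) h))"
    using bij_betw_imp_inj_on[OF compr_bij(1)] assms(1) by auto
  moreover have "F1 (compr M) h = F1 (compr M) k" using assms by (simp add: compr_arr)
  ultimately show ?thesis using assms by (auto dest: inj_onD)
qed

lemma upper_surj:
  assumes "isty A" "isty B" "arr u" "dm u = ext A" "cd u = ext B" "arr v" "dm v = cx A"
    "cd v = cx B" "disp B \<odot> u = v \<odot> disp A"
  obtains h where "h \<in> hom (fam M) A B" "upper h = u" "F1 (proj M) h = v"
proof -
  have "(disp A, disp B, u, v) \<in> hom (arrow_cat (base M)) (disp A) (disp B)"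
    using assms by (simp add: arrow_cat_def)
  then have "(disp A, disp B, u, v) \<in> F1 (compr M) ` hom (fam M) A B"
    unfolding bij_betw_imp_surj_on[OF compr_bij(1)[OF assms(1,2)]] .
  then obtain h where h: "h \<in> hom (fam M) A B" "(disp A, disp B, u, v) = F1 (compr M) h"
    by (rule imageE)
  have "upper h = u" unfolding upper_def h(2)[symmetric] by simp
  moreover have "F1 (proj M) h = v" using h compr_arr[of h] by auto
  ultimately show ?thesis using that[of h] h(1) by blast
qed

lemma upper2_facts:
  assumes "\<alpha> \<in> Cell (fam M)"
  shows "F2 (compr M) \<alpha> = (disp (Dom (fam M) (Src (fam M) \<alpha>)),
      disp (Cod (fam M) (Src (fam M) \<alpha>)), upper2 \<alpha>, F2 (proj M) \<alpha>)"
    "cell (upper2 \<alpha>)" "sr (upper2 \<alpha>) = upper (Src (fam M) \<alpha>)"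
    "tg (upper2 \<alpha>) = upper (Tgt (fam M) \<alpha>)"
    "disp (Cod (fam M) (Src (fam M) \<alpha>)) \<rhd> upper2 \<alpha> =
       F2 (proj M) \<alpha> \<lhd> disp (Dom (fam M) (Src (fam M) \<alpha>))"
proof -
  let ?F = "F2 (compr M) \<alpha>"
  have "?F \<in> cells (arrow_cat (base M)) (F1 (compr M) (Src (fam M) \<alpha>)) (F1 (compr M) (Tgt (fam M) \<alpha>))"
    by (rule compr.fun_cells) (use assms in auto)
  moreover have "(case ?F of (_, _, _, b) \<Rightarrow> b) = F2 (proj M) \<alpha>"
    using comprehension assms unfolding comprehension_def by blast
  ultimately show "F2 (compr M) \<alpha> = (disp (Dom (fam M) (Src (fam M) \<alpha>)),
      disp (Cod (fam M) (Src (fam M) \<alpha>)), upper2 \<alpha>, F2 (proj M) \<alpha>)"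
    "cell (upper2 \<alpha>)" "sr (upper2 \<alpha>) = upper (Src (fam M) \<alpha>)"
    "tg (upper2 \<alpha>) = upper (Tgt (fam M) \<alpha>)"
    "disp (Cod (fam M) (Src (fam M) \<alpha>)) \<rhd> upper2 \<alpha> =
       F2 (proj M) \<alpha> \<lhd> disp (Dom (fam M) (Src (fam M) \<alpha>))"
    using assms by (auto simp: arrow_cat_def Let_def upper2_def compr_arr split: prod.splits)
qed

lemmas upper2_simps [simp] = upper2_facts(2-4)

lemma proj_cell [simp]:
  assumes "\<alpha> \<in> Cell (fam M)"
  shows "cell (F2 (proj M) \<alpha>)" "sr (F2 (proj M) \<alpha>) = F1 (proj M) (Src (fam M) \<alpha>)"
    "tg (F2 (proj M) \<alpha>) = F1 (proj M) (Tgt (fam M) \<alpha>)"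
  using proj.fun_cells[of \<alpha> "Src (fam M) \<alpha>" "Tgt (fam M) \<alpha>"] assms by auto

lemma upper2_hcmp:
  assumes "\<alpha> \<in> Cell (fam M)" "\<beta> \<in> Cell (fam M)"
    "Cod (fam M) (Src (fam M) \<alpha>) = Dom (fam M) (Src (fam M) \<beta>)"
  shows "upper2 (HCmp (fam M) \<beta> \<alpha>) = HCmp (base M) (upper2 \<beta>) (upper2 \<alpha>)"
  using compr.fun_hcmp[of \<alpha> "Src (fam M) \<alpha>" "Tgt (fam M) \<alpha>" \<beta> "Src (fam M) \<beta>" "Tgt (fam M) \<beta>"] assms
  by (simp add: upper2_facts(1) arrow_cat_def)

lemma upper2_id2:
  assumes "h \<in> Arr (fam M)"
  shows "upper2 (Id2 (fam M) h) = id2 (upper h)"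
  using compr.fun_id2[OF assms] assms by (simp add: upper2_facts(1) compr_arr arrow_cat_def)

lemma upper2_inj:
  assumes "\<alpha> \<in> Cell (fam M)" "\<beta> \<in> Cell (fam M)" "Src (fam M) \<alpha> = Src (fam M) \<beta>"
    "F2 (proj M) \<alpha> = F2 (proj M) \<beta>" "upper2 \<alpha> = upper2 \<beta>"
  shows "\<alpha> = \<beta>"
proof -
  let ?S = "Src (fam M) \<alpha>"
  have "inj_on (F2 (compr M)) {\<gamma> \<in> Cell (fam M). Src (fam M) \<gamma> \<in> hom (fam M) (Dom (fam M) ?S) (Cod (fam M) ?S)}"
    by (rule bij_betw_imp_inj_on[OF compr_bij(2)]) (use assms(1) in auto)
  moreover have "F2 (compr M) \<alpha> = F2 (compr M) \<beta>" using assms by (simp add: upper2_facts(1))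
  ultimately show ?thesis using assms by (auto dest: inj_onD)
qed

lemma upper2_surj:
  assumes "h \<in> Arr (fam M)" "k \<in> Arr (fam M)" "Dom (fam M) h = Dom (fam M) k"
    "Cod (fam M) h = Cod (fam M) k" "cell a" "sr a = upper h" "tg a = upper k"
    "cell b" "sr b = F1 (proj M) h" "tg b = F1 (proj M) k"
    "disp (Cod (fam M) h) \<rhd> a = b \<lhd> disp (Dom (fam M) h)"
  obtains \<alpha> where "\<alpha> \<in> cells (fam M) h k" "upper2 \<alpha> = a" "F2 (proj M) \<alpha> = b"
proof -
  let ?A = "Dom (fam M) h" and ?B = "Cod (fam M) h"
  note [simp] = upper_simps(4)[OF assms(1), unfolded assms(3,4)] upper_simps(4)[OF assms(2)]
  have "(disp ?A, disp ?B, a, b) \<in> {\<alpha> \<in> Cell (arrow_cat (base M)).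
             Src (arrow_cat (base M)) \<alpha> \<in> hom (arrow_cat (base M)) (disp ?A) (disp ?B)}"
    using assms by (simp add: arrow_cat_def)
  then have "(disp ?A, disp ?B, a, b) \<in>
      F2 (compr M) ` {\<gamma> \<in> Cell (fam M). Src (fam M) \<gamma> \<in> hom (fam M) ?A ?B}"
    unfolding bij_betw_imp_surj_on[OF compr_bij(2)[OF fam.dom_ob[OF assms(1)] fam.cod_ob[OF assms(1)]]] .
  then obtain \<alpha> where h: "\<alpha> \<in> {\<gamma> \<in> Cell (fam M). Src (fam M) \<gamma> \<in> hom (fam M) ?A ?B}"
      "(disp ?A, disp ?B, a, b) = F2 (compr M) \<alpha>"
    by (rule imageE)
  then have \<alpha>: "\<alpha> \<in> Cell (fam M)" "Src (fam M) \<alpha> \<in> hom (fam M) ?A ?B" by auto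
  have e1: "upper2 \<alpha> = a" unfolding upper2_def h(2)[symmetric] by simp
  have e2: "F2 (proj M) \<alpha> = b" using h(2) upper2_facts(1)[OF \<alpha>(1)] by auto
  note e = e1 e2
  \<comment> \<open>Surjectivity yields a cell between some parallel maps of the two types, not yet
    between \<open>h\<close> and \<open>k\<close>; its ends are recovered from their upper and base
    parts.\<close>
  have 1: "Src (fam M) \<alpha> = h"
  proof (rule upper_inj)
    show "upper (Src (fam M) \<alpha>) = upper h"
      using upper2_facts(3)[OF \<alpha>(1), unfolded e1 assms(6)] ..
    show "F1 (proj M) (Src (fam M) \<alpha>) = F1 (proj M) h"
      using proj_cell(2)[OF \<alpha>(1), unfolded e2 assms(9)] ..
  qed (use \<alpha> assms(1) in auto)
  have 2: "Tgt (fam M) \<alpha> = k"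
  proof (rule upper_inj)
    show "upper (Tgt (fam M) \<alpha>) = upper k"
      using upper2_facts(4)[OF \<alpha>(1), unfolded e1 assms(7)] ..
    show "F1 (proj M) (Tgt (fam M) \<alpha>) = F1 (proj M) k"
      using proj_cell(3)[OF \<alpha>(1), unfolded e2 assms(10)] ..
  qed (use \<alpha> assms(2-4) in auto)
  show ?thesis by (rule that[of \<alpha>]) (use \<alpha>(1) 1 2 e1 e2 in auto)
qed

subsection \<open>Reindexing\<close>

lemma clift_facts:
  assumes "arr f" "isty B" "cd f = cx B"
  shows "cartesian (fam M) (base M) (proj M) (clift f B)" "clift f B \<in> Arr (fam M)"
    "Dom (fam M) (clift f B) = reix f B"
    "Cod (fam M) (clift f B) = B" "F1 (proj M) (clift f B) = f" "upper (clift f B) = fext f B"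
proof -
  have "\<forall>X Y f B. f \<in> hom (base M) X Y \<and> B \<in> fib M Y \<longrightarrow>
        cartesian (fam M) (base M) (proj M) (clift f B) \<and>
        Cod (fam M) (clift f B) = B \<and> F1 (proj M) (clift f B) = f"
    using fibred unfolding fibred_def split_fibration_def by blast
  from this[rule_format, of f "dm f" "cx B" B]
  show c: "cartesian (fam M) (base M) (proj M) (clift f B)"
    "Cod (fam M) (clift f B) = B" "F1 (proj M) (clift f B) = f"
    using assms by auto
  from c(1) show "clift f B \<in> Arr (fam M)" unfolding cartesian_def by blast
qed (simp_all add: reix_def fext_def)

lemma reix_simps [simp]:
  assumes "arr f" "isty B" "cd f = cx B"
  shows "isty (reix f B)" "cx (reix f B) = dm f"
    "arr (fext f B)" "dm (fext f B) = ext (reix f B)" "cd (fext f B) = ext B"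
    "disp B \<odot> fext f B = f \<odot> disp (reix f B)"
proof -
  note c = clift_facts[OF assms]
  show "isty (reix f B)" using fam.dom_ob[OF c(2)] c(3) by simp
  show "cx (reix f B) = dm f" using proj_arr(2)[OF c(2)] c(3,5) by simp
  show "arr (fext f B)" "dm (fext f B) = ext (reix f B)" "cd (fext f B) = ext B"
    using upper_simps(1-3)[OF c(2)] unfolding c(3-6) by auto
  show "disp B \<odot> fext f B = f \<odot> disp (reix f B)"
    using upper_simps(4)[OF c(2)] unfolding c(3-6) .
qed

text \<open>Composites are normalised to the right, where an equation for a two-fold composite no
  longer matches once a further map precedes it. Many rewrite rules below therefore come with such a
  second form, carrying a tail \<open>h\<close>.\<close>

lemma disp_fext_cmp [simp]:
  assumes "arr f" "isty B" "cd f = cx B" "arr h" "cd h = ext (reix f B)"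
  shows "disp B \<odot> fext f B \<odot> h = f \<odot> disp (reix f B) \<odot> h"
proof -
  have "(disp B \<odot> fext f B) \<odot> h = disp B \<odot> fext f B \<odot> h"
    by (rule base.cmp_assoc') (use assms in auto)
  moreover have "(f \<odot> disp (reix f B)) \<odot> h = f \<odot> disp (reix f B) \<odot> h"
    by (rule base.cmp_assoc') (use assms in auto)
  ultimately show ?thesis unfolding reix_simps(6)[OF assms(1-3)] by simp
qed

lemma reix_ide [simp]:
  assumes "isty B" "cx B = X"
  shows "reix (ide X) B = B" "fext (ide X) B = ide (ext B)"
proof -
  have "\<forall>B \<in> Ob (fam M). clift (ide (cx B)) B = Ide (fam M) B"
    using fibred unfolding fibred_def split_fibration_def by blast
  then have "clift (ide X) B = Ide (fam M) B" using assms by blast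
  then show "reix (ide X) B = B" "fext (ide X) B = ide (ext B)"
    using assms by (auto simp: reix_def fext_def upper_ide)
qed

lemma reix_cmp [simp]:
  assumes "arr f" "arr g" "isty B" "cd f = dm g" "cd g = cx B"
  shows "reix f (reix g B) = reix (g \<odot> f) B"
    "fext g B \<odot> fext f (reix g B) = fext (g \<odot> f) B"
    "arr h \<Longrightarrow> cd h = ext (reix (g \<odot> f) B) \<Longrightarrow>
       fext g B \<odot> fext f (reix g B) \<odot> h = fext (g \<odot> f) B \<odot> h"
proof -
  have "\<forall>X Y Z f g B. f \<in> hom (base M) X Y \<and> g \<in> hom (base M) Y Z \<and> B \<in> fib M Z \<longrightarrow>
        clift (g \<odot> f) B = clift g B \<odot>\<^sub>T clift f (reix g B)"
    using fibred unfolding fibred_def split_fibration_def by blast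
  from this[rule_format, of f "dm f" "cd f" g "cd g" B]
  have 1: "clift (g \<odot> f) B = clift g B \<odot>\<^sub>T clift f (reix g B)" using assms by auto
  note c = clift_facts[of g B] clift_facts[of f "reix g B"]
  show 2: "reix f (reix g B) = reix (g \<odot> f) B"
    using assms c by (subst (3) reix_def) (simp add: 1)
  show 3: "fext g B \<odot> fext f (reix g B) = fext (g \<odot> f) B"
    using assms c by (subst (3) fext_def) (simp add: 1 upper_cmp)
  show "fext g B \<odot> fext f (reix g B) \<odot> h = fext (g \<odot> f) B \<odot> h"
    if "arr h" "cd h = ext (reix (g \<odot> f) B)"
    using base.cmp_assoc'[of h "fext f (reix g B)" "fext g B"] assms that 2 unfolding 3 by simp
qed

lemma pullback:
  assumes "arr f" "isty B" "cd f = cx B"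
  shows "two_pullback (base M) (disp (reix f B)) (fext f B) f (disp B)"
proof -
  have "\<forall>h. cartesian (fam M) (base M) (proj M) h \<longrightarrow>
        two_pullback (base M) (disp (Dom (fam M) h)) (upper h)
          (F1 (proj M) h) (disp (Cod (fam M) h))"
    using comprehension unfolding comprehension_def by blast
  from this[rule_format, OF clift_facts(1)[OF assms]] show ?thesis
    unfolding clift_facts(3-6)[OF assms] .
qed

lemma pullback_ex1:
  assumes "arr f" "isty B" "cd f = cx B" "arr u" "arr v" "dm u = dm v" "cd u = dm f"
    "cd v = ext B" "f \<odot> u = disp B \<odot> v"
  shows "\<exists>!w. w \<in> hom (base M) (dm u) (ext (reix f B)) \<and>
    disp (reix f B) \<odot> w = u \<and> fext f B \<odot> w = v"
proof -
  have 1: "\<forall>W \<in> Ob (base M). \<forall>u \<in> hom (base M) W (dm f). \<forall>v \<in> hom (base M) W (ext B).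
        f \<odot> u = disp B \<odot> v \<longrightarrow>
        (\<exists>!w. w \<in> hom (base M) W (ext (reix f B)) \<and>
           disp (reix f B) \<odot> w = u \<and> fext f B \<odot> w = v)"
    using pullback[OF assms(1-3)] unfolding two_pullback_def ext_def[symmetric] by blast
  show ?thesis by (rule 1[rule_format]) (use assms in auto)
qed

lemma pullback_ex:
  assumes "arr f" "isty B" "cd f = cx B" "arr u" "arr v" "dm u = dm v" "cd u = dm f"
    "cd v = ext B" "f \<odot> u = disp B \<odot> v"
  obtains w where "arr w" "dm w = dm u" "cd w = ext (reix f B)"
    "disp (reix f B) \<odot> w = u" "fext f B \<odot> w = v"
  using ex1_implies_ex[OF pullback_ex1[OF assms]] by auto

lemma pullback_eqI:
  assumes "arr f" "isty B" "cd f = cx B" "arr w" "arr w'" "cd w = ext (reix f B)"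
    "cd w' = ext (reix f B)" "dm w = dm w'"
    "disp (reix f B) \<odot> w = disp (reix f B) \<odot> w'" "fext f B \<odot> w = fext f B \<odot> w'"
  shows "w = w'"
proof -
  let ?P = "\<lambda>z. z \<in> hom (base M) (dm (disp (reix f B) \<odot> w)) (ext (reix f B)) \<and>
    disp (reix f B) \<odot> z = disp (reix f B) \<odot> w \<and> fext f B \<odot> z = fext f B \<odot> w"
  have 1: "\<exists>!z. ?P z"
    by (rule pullback_ex1) (use assms(1-8) in auto)
  have 2: "?P w" using assms(1-8) by auto
  have 3: "?P w'" unfolding assms(9,10) using assms(1-8) by auto
  from 1 2 3 show ?thesis by blast
qed

lemma pullback_cell:
  assumes "arr f" "isty B" "cd f = cx B" "arr w" "arr w'" "cd w = ext (reix f B)"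
    "cd w' = ext (reix f B)" "dm w = dm w'"
    "cell \<alpha>" "sr \<alpha> = disp (reix f B) \<odot> w" "tg \<alpha> = disp (reix f B) \<odot> w'"
    "cell \<beta>" "sr \<beta> = fext f B \<odot> w" "tg \<beta> = fext f B \<odot> w'" "f \<rhd> \<alpha> = disp B \<rhd> \<beta>"
  shows "\<exists>!\<gamma>. \<gamma> \<in> cells (base M) w w' \<and> disp (reix f B) \<rhd> \<gamma> = \<alpha> \<and> fext f B \<rhd> \<gamma> = \<beta>"
proof -
  let ?d = "disp (reix f B)" and ?e = "fext f B"
  have 1: "\<forall>W \<in> Ob (base M). \<forall>w \<in> hom (base M) W (ext (reix f B)).
        \<forall>w' \<in> hom (base M) W (ext (reix f B)).
        \<forall>\<alpha> \<in> cells (base M) (?d \<odot> w) (?d \<odot> w'). \<forall>\<beta> \<in> cells (base M) (?e \<odot> w) (?e \<odot> w').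
        f \<rhd> \<alpha> = disp B \<rhd> \<beta> \<longrightarrow>
        (\<exists>!\<gamma>. \<gamma> \<in> cells (base M) w w' \<and> ?d \<rhd> \<gamma> = \<alpha> \<and> ?e \<rhd> \<gamma> = \<beta>)"
    using pullback[OF assms(1-3)] unfolding two_pullback_def ext_def[symmetric] by blast
  show ?thesis by (rule 1[rule_format, where W = "dm w"]) (use assms in \<open>simp_all\<close>)
qed

lemma pullback_cell_eqI:
  assumes "arr f" "isty B" "cd f = cx B" "cell \<gamma>" "cell \<gamma>'" "cd (sr \<gamma>) = ext (reix f B)"
    "sr \<gamma> = sr \<gamma>'" "tg \<gamma> = tg \<gamma>'"
    "disp (reix f B) \<rhd> \<gamma> = disp (reix f B) \<rhd> \<gamma>'" "fext f B \<rhd> \<gamma> = fext f B \<rhd> \<gamma>'"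
  shows "\<gamma> = \<gamma>'"
proof -
  let ?P = "\<lambda>\<delta>. \<delta> \<in> cells (base M) (sr \<gamma>) (tg \<gamma>) \<and>
    disp (reix f B) \<rhd> \<delta> = disp (reix f B) \<rhd> \<gamma> \<and> fext f B \<rhd> \<delta> = fext f B \<rhd> \<gamma>"
  have "\<exists>!\<delta>. ?P \<delta>"
  proof (rule pullback_cell)
    show "f \<rhd> disp (reix f B) \<rhd> \<gamma> = disp B \<rhd> fext f B \<rhd> \<gamma>" using assms(1-4,6) by simp
  qed (use assms(1-4,6) in simp_all)
  moreover have "?P \<gamma>" using assms(4) by simp
  moreover have "?P \<gamma>'" unfolding assms(7-10) using assms(5) by auto
  ultimately show ?thesis by blast
qed

section \<open>Global sections and environments\<close>

lemma gsection_iff: "gsection A a \<longleftrightarrow>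
    arr a \<and> dm a = cx A \<and> cd a = ext A \<and> disp A \<odot> a = ide (cx A)"
  by (auto simp: gsection_def)

lemma gsectionD:
  assumes "gsection A a"
  shows "arr a" "dm a = cx A" "cd a = ext A" "disp A \<odot> a = ide (cx A)"
  using assms by (auto simp: gsection_iff)

lemma gsection_cmp:
  assumes "gsection A a" "isty A" "arr h" "cd h = cx A"
  shows "disp A \<odot> a \<odot> h = h"
proof -
  have "(disp A \<odot> a) \<odot> h = disp A \<odot> a \<odot> h"
    by (rule base.cmp_assoc') (use assms in \<open>auto simp: gsection_iff\<close>)
  then show ?thesis using assms by (simp add: gsection_iff)
qed

lemma gsection_eqI:
  assumes "arr f" "isty B" "cd f = cx B" "gsection (reix f B) a" "gsection (reix f B) b"
    "fext f B \<odot> a = fext f B \<odot> b"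
  shows "a = b"
  by (rule pullback_eqI[OF assms(1-3)])
    (use assms(1-3) gsectionD[OF assms(4)] gsectionD[OF assms(5)] assms(6) in auto)

lemma sec_facts:
  assumes "arr f" "isty B" "cd f = cx B" "arr g" "dm g = dm f" "cd g = ext B" "disp B \<odot> g = f"
  shows "gsection (reix f B) (sec f B g)" "fext f B \<odot> sec f B g = g"
proof -
  obtain w where w: "arr w" "dm w = dm (ide (dm f))" "cd w = ext (reix f B)"
    "disp (reix f B) \<odot> w = ide (dm f)" "fext f B \<odot> w = g"
    by (rule pullback_ex[OF assms(1-3), of "ide (dm f)" g]) (use assms in auto)
  have 1: "gsection (reix f B) w"
    using w(1-4) assms(1-3) by (auto simp: gsection_iff)
  have "gsection (reix f B) (sec f B g) \<and> fext f B \<odot> sec f B g = g"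
    unfolding sec_def
    by (rule theI[of _ w]) (use 1 w(5) gsection_eqI[OF assms(1-3)] in auto)
  then show "gsection (reix f B) (sec f B g)" "fext f B \<odot> sec f B g = g" by auto
qed

lemma sec_unique:
  assumes "arr f" "isty B" "cd f = cx B" "gsection (reix f B) a" "fext f B \<odot> a = g"
  shows "sec f B g = a"
  unfolding sec_def
  by (rule the_equality) (use assms(4,5) gsection_eqI[OF assms(1-3)] in auto)

lemma resec_facts:
  assumes "arr f" "isty B" "cd f = cx B" "gsection B b"
  shows "gsection (reix f B) (resec f B b)" "fext f B \<odot> resec f B b = b \<odot> f"
  unfolding resec_def
  using sec_facts[OF assms(1-3), of "b \<odot> f"] assms gsectionD[OF assms(4)]
    gsection_cmp[OF assms(4)] by auto

lemma resec_simps [simp]: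
  assumes "arr f" "isty B" "cd f = cx B" "gsection B b"
  shows "gsection (reix f B) (resec f B b)"
    "arr (resec f B b)" "dm (resec f B b) = dm f" "cd (resec f B b) = ext (reix f B)"
    "disp (reix f B) \<odot> resec f B b = ide (dm f)"
    "fext f B \<odot> resec f B b = b \<odot> f"
  using resec_facts[OF assms] gsectionD[OF resec_facts(1)[OF assms]] assms by auto

lemma resec_cmp_simps [simp]:
  assumes "arr f" "isty B" "cd f = cx B" "gsection B b" "arr h" "cd h = dm f"
  shows "disp (reix f B) \<odot> resec f B b \<odot> h = h"
    "fext f B \<odot> resec f B b \<odot> h = b \<odot> f \<odot> h"
proof -
  show "disp (reix f B) \<odot> resec f B b \<odot> h = h"
    by (rule gsection_cmp) (use assms in auto)
  have "(fext f B \<odot> resec f B b) \<odot> h = fext f B \<odot> resec f B b \<odot> h"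
    by (rule base.cmp_assoc') (use assms in auto)
  moreover have "(b \<odot> f) \<odot> h = b \<odot> f \<odot> h"
    by (rule base.cmp_assoc') (use assms gsectionD[OF assms(4)] in auto)
  ultimately show "fext f B \<odot> resec f B b \<odot> h = b \<odot> f \<odot> h"
    unfolding resec_simps(6)[OF assms(1-4)] by simp
qed

lemma resec_ide [simp]: "isty B \<Longrightarrow> gsection B b \<Longrightarrow> cx B = X \<Longrightarrow> resec (ide X) B b = b"
  unfolding resec_def using gsectionD[of B b] by (intro sec_unique) auto

text \<open>A section of a reindexed type is best handled through the map into the original
  extension that it names; on these maps reindexing is plain precomposition.\<close>

lemma resec_sec:
  assumes "arr f" "arr g" "isty B" "cd f = dm g" "cd g = cx B"
    "arr h" "dm h = dm g" "cd h = ext B" "disp B \<odot> h = g"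
  shows "resec f (reix g B) (sec g B h) = sec (g \<odot> f) B (h \<odot> f)"
proof (rule sec_unique[symmetric])
  note s = sec_facts[OF assms(2,3,5,6-9)]
  let ?r = "resec f (reix g B) (sec g B h)"
  have r: "gsection (reix f (reix g B)) ?r" "fext f (reix g B) \<odot> ?r = sec g B h \<odot> f"
    using resec_facts[OF _ _ _ s(1), of f] assms by auto
  then show "gsection (reix (g \<odot> f) B) ?r" using assms by simp
  have "fext (g \<odot> f) B \<odot> ?r = (fext g B \<odot> fext f (reix g B)) \<odot> ?r"
    using assms by simp
  also have "\<dots> = fext g B \<odot> fext f (reix g B) \<odot> ?r"
    by (rule base.cmp_assoc') (use assms gsectionD[OF r(1)] in auto)
  also have "\<dots> = (fext g B \<odot> sec g B h) \<odot> f"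
    unfolding r(2) by (rule base.cmp_assoc'[symmetric]) (use assms gsectionD[OF s(1)] in auto)
  finally show "fext (g \<odot> f) B \<odot> ?r = h \<odot> f" unfolding s(2) .
qed (use assms in auto)

lemma resec_cmp [simp]:
  assumes "arr f" "arr g" "isty B" "cd f = dm g" "cd g = cx B" "gsection B b"
  shows "resec f (reix g B) (resec g B b) = resec (g \<odot> f) B b"
proof -
  note b = gsectionD[OF assms(6)]
  show ?thesis
    unfolding resec_def[of M g B b] resec_def[of M "g \<odot> f" B b]
    by (subst resec_sec) (use assms b gsection_cmp[OF assms(6)] in auto)
qed

declare wkself_def [simp]

lemma diag_simps [simp]:
  assumes "isty A"
  shows "gsection (reix (disp A) A) (diag A)" "arr (diag A)" "dm (diag A) = ext A"
    "cd (diag A) = ext (reix (disp A) A)"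
    "disp (reix (disp A) A) \<odot> diag A = ide (ext A)"
    "fext (disp A) A \<odot> diag A = ide (ext A)"
proof -
  note s = sec_facts[of "disp A" A "ide (ext A)", folded diag_def]
  show 1: "gsection (reix (disp A) A) (diag A)" "fext (disp A) A \<odot> diag A = ide (ext A)"
    using s assms by auto
  show "arr (diag A)" "dm (diag A) = ext A"
    "cd (diag A) = ext (reix (disp A) A)"
    "disp (reix (disp A) A) \<odot> diag A = ide (ext A)"
    using gsectionD[OF 1(1)] assms by auto
qed

section \<open>Environments\<close>

type_synonym ('x, 'y) env = "nat \<Rightarrow> 'x \<times> 'y"

text \<open>Each entry records its type, because the object \<open>ext A\<close> need not determine
  \<open>A\<close> and a variable must denote a term together with its type. Every index has a
  value, also those beyond a context, so that environments can be composed freely with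
  renamings.\<close>

definition wfenv :: "'o \<Rightarrow> ('a, 'm) env \<Rightarrow> bool" where
  "wfenv X \<rho> \<longleftrightarrow> X \<in> Ob (base M) \<and>
     (\<forall>n. isty (fst (\<rho> n)) \<and> cx (fst (\<rho> n)) = X \<and> gsection (fst (\<rho> n)) (snd (\<rho> n)))"

definition renv :: "'m \<Rightarrow> ('a, 'm) env \<Rightarrow> ('a, 'm) env" where
  "renv f \<rho> = (\<lambda>n. (reix f (fst (\<rho> n)), resec f (fst (\<rho> n)) (snd (\<rho> n))))"

definition scons :: "'a \<times> 'm \<Rightarrow> ('a, 'm) env \<Rightarrow> ('a, 'm) env" where
  "scons e \<rho> = (\<lambda>n. case n of 0 \<Rightarrow> e | Suc i \<Rightarrow> \<rho> i)"

text \<open>The environment under a binder: the old entries are weakened along the display map, and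
  the new variable is the generic element of \<open>A\<close>, that is, the diagonal.\<close>

definition xenv :: "'a \<Rightarrow> ('a, 'm) env \<Rightarrow> ('a, 'm) env" where
  "xenv A \<rho> = scons (wkself A, diag A) (renv (disp A) \<rho>)"

lemma scons_simps [simp]: "scons e \<rho> 0 = e" "scons e \<rho> (Suc n) = \<rho> n" "scons e \<rho> \<circ> Suc = \<rho>"
  by (auto simp: scons_def)

lemma scons_eta: "scons (\<rho> 0) (\<rho> \<circ> Suc) = \<rho>"
  by (auto simp: scons_def fun_eq_iff split: nat.split)

lemma wfenv_ob: "wfenv X \<rho> \<Longrightarrow> X \<in> Ob (base M)"
  by (simp add: wfenv_def)

lemma wfenvD:
  assumes "wfenv X \<rho>"
  shows "isty (fst (\<rho> n))" "cx (fst (\<rho> n)) = X" "gsection (fst (\<rho> n)) (snd (\<rho> n))"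
  using assms by (auto simp: wfenv_def)

lemma wfenv_renv: "wfenv X \<rho> \<Longrightarrow> arr f \<Longrightarrow> cd f = X \<Longrightarrow> dm f = Y \<Longrightarrow> wfenv Y (renv f \<rho>)"
  by (auto simp: wfenv_def renv_def)

lemma wfenv_scons:
  "wfenv X \<rho> \<Longrightarrow> isty A \<Longrightarrow> cx A = X \<Longrightarrow> gsection A a \<Longrightarrow> wfenv X (scons (A, a) \<rho>)"
  by (auto simp: wfenv_def scons_def split: nat.split)

lemma renv_scons: "renv f (scons (A, a) \<rho>) = scons (reix f A, resec f A a) (renv f \<rho>)"
  by (auto simp: renv_def scons_def fun_eq_iff split: nat.split)

lemma renv_comp: "renv f (\<rho> \<circ> r) = renv f \<rho> \<circ> r"
  by (auto simp: renv_def)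

lemma renv_ide: "wfenv X \<rho> \<Longrightarrow> renv (ide X) \<rho> = \<rho>"
  by (auto simp: wfenv_def renv_def fun_eq_iff)

lemma renv_cmp:
  "wfenv X \<rho> \<Longrightarrow> arr f \<Longrightarrow> arr g \<Longrightarrow> cd f = dm g \<Longrightarrow> cd g = X \<Longrightarrow>
     renv f (renv g \<rho>) = renv (g \<odot> f) \<rho>"
  by (auto simp: wfenv_def renv_def fun_eq_iff)

lemma wfenv_xenv: "wfenv (cx A) \<rho> \<Longrightarrow> isty A \<Longrightarrow> wfenv (ext A) (xenv A \<rho>)"
  unfolding xenv_def by (rule wfenv_scons) (auto intro: wfenv_renv)

text \<open>A map into the extension by \<open>A\<close> amounts to a map into its base together
  with a section of \<open>A\<close> reindexed along it. Reindexing the generic environment along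
  \<open>h\<close> therefore instantiates the new variable by the section that \<open>h\<close>
  names.\<close>

lemma renv_xenv:
  assumes "wfenv (cx A) \<rho>" "isty A" "arr h" "cd h = ext A"
  shows "renv h (xenv A \<rho>) =
    scons (reix (disp A \<odot> h) A, sec (disp A \<odot> h) A h) (renv (disp A \<odot> h) \<rho>)"
  unfolding xenv_def renv_scons diag_def using assms
  by (simp add: resec_sec renv_cmp)

text \<open>Semantic substitution: instantiating the bound variable by \<open>a\<close> is
  reindexing along \<open>a\<close>.\<close>

lemma renv_xenv_section:
  assumes "wfenv (cx A) \<rho>" "isty A" "gsection A a"
  shows "renv a (xenv A \<rho>) = scons (A, a) \<rho>"
proof -
  note a = gsectionD[OF assms(3)]
  have "sec (ide (cx A)) A a = a" by (rule sec_unique) (use assms a in auto)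
  then show ?thesis using assms a by (simp add: renv_xenv renv_ide)
qed

text \<open>This is how reindexing passes under a binder: \<open>f\<close> becomes
  \<open>fext f A\<close>, and the generic element goes to the generic element.\<close>

lemma renv_xenv_fext:
  assumes "wfenv (cx A) \<rho>" "isty A" "arr f" "cd f = cx A"
  shows "renv (fext f A) (xenv A \<rho>) = xenv (reix f A) (renv f \<rho>)"
proof -
  let ?A = "reix f A"
  have "sec (f \<odot> disp ?A) A (fext f A) = diag ?A"
  proof (rule sec_unique)
    show "gsection (reix (f \<odot> disp ?A) A) (diag ?A)"
      using diag_simps(1)[of ?A] assms by simp
    have "(fext f A \<odot> fext (disp ?A) ?A) \<odot> diag ?A =
        fext f A \<odot> fext (disp ?A) ?A \<odot> diag ?A"
      by (rule base.cmp_assoc') (use assms diag_simps[of ?A] in auto)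
    then show "fext (f \<odot> disp ?A) A \<odot> diag ?A = fext f A"
      using diag_simps(6)[of ?A] assms by simp
  qed (use assms in auto)
  then show ?thesis using assms by (simp add: renv_xenv) (simp add: xenv_def renv_cmp)
qed

section \<open>Identity types\<close>

text \<open>The map from \<Gamma> to \<Gamma>.A.A with components \<open>a\<close> and
  \<open>b\<close>. It has this form because reindexing the weakened type along the section
  \<open>a\<close> returns \<open>A\<close> strictly, so \<open>b\<close> is already a section of
  it.\<close>

definition pairmap :: "'a \<Rightarrow> 'm \<Rightarrow> 'm \<Rightarrow> 'm" where
  "pairmap A a b = fext a (wkself A) \<odot> b"

lemma pairmap_simps [simp]:
  assumes "isty A" "gsection A a" "gsection A b"
  shows "arr (pairmap A a b)" "dm (pairmap A a b) = cx A"
    "cd (pairmap A a b) = ext (reix (disp A) A)"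
    "disp (reix (disp A) A) \<odot> pairmap A a b = a"
    "fext (disp A) A \<odot> pairmap A a b = b"
    "arr h \<Longrightarrow> cd h = cx A \<Longrightarrow> disp (reix (disp A) A) \<odot> pairmap A a b \<odot> h = a \<odot> h"
    "arr h \<Longrightarrow> cd h = cx A \<Longrightarrow> fext (disp A) A \<odot> pairmap A a b \<odot> h = b \<odot> h"
proof -
  note a = gsectionD[OF assms(2)] and b = gsectionD[OF assms(3)]
  have w: "reix a (reix (disp A) A) = A" using assms a by simp
  show 1: "arr (pairmap A a b)" "dm (pairmap A a b) = cx A"
    "cd (pairmap A a b) = ext (reix (disp A) A)"
    unfolding pairmap_def wkself_def using a b w assms(1) by auto
  show 2: "disp (reix (disp A) A) \<odot> pairmap A a b = a"
    unfolding pairmap_def wkself_def using a b w assms(1) by simp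
  show 3: "fext (disp A) A \<odot> pairmap A a b = b"
    unfolding pairmap_def wkself_def using a b w assms(1) by simp
  assume h: "arr h" "cd h = cx A"
  have "(disp (reix (disp A) A) \<odot> pairmap A a b) \<odot> h = disp (reix (disp A) A) \<odot> pairmap A a b \<odot> h"
    by (rule base.cmp_assoc') (use 1 h assms(1) in auto)
  then show "disp (reix (disp A) A) \<odot> pairmap A a b \<odot> h = a \<odot> h" unfolding 2 by simp
  have "(fext (disp A) A \<odot> pairmap A a b) \<odot> h = fext (disp A) A \<odot> pairmap A a b \<odot> h"
    by (rule base.cmp_assoc') (use 1 h assms(1) in auto)
  then show "fext (disp A) A \<odot> pairmap A a b \<odot> h = b \<odot> h" unfolding 3 by simp
qed

lemma pairmap_eqI:
  assumes "isty A" "gsection A a" "gsection A b" "arr w" "dm w = cx A"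
    "cd w = ext (reix (disp A) A)" "disp (reix (disp A) A) \<odot> w = a"
    "fext (disp A) A \<odot> w = b"
  shows "w = pairmap A a b"
  by (rule pullback_eqI[of "disp A" A]) (use assms in simp_all)

lemma pairmap_reix:
  assumes "isty A" "gsection A a" "gsection A b" "arr f" "cd f = cx A"
  shows "fext (fext f A) (reix (disp A) A) \<odot>
      pairmap (reix f A) (resec f A a) (resec f A b) = pairmap A a b \<odot> f"
proof (rule pullback_eqI[of "disp A" A])
  note a = gsectionD[OF assms(2)] and b = gsectionD[OF assms(3)]
  let ?A = "reix f A" and ?a = "resec f A a" and ?b = "resec f A b"
  note p = pairmap_simps[of ?A ?a ?b] and q = pairmap_simps[OF assms(1-3)]
  have w: "reix (fext f A) (reix (disp A) A) = reix (disp ?A) ?A"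
    using assms by simp
  show "disp (reix (disp A) A) \<odot> fext (fext f A) (reix (disp A) A) \<odot> pairmap ?A ?a ?b =
    disp (reix (disp A) A) \<odot> pairmap A a b \<odot> f"
    using assms a b p q by simp
  have "fext (disp A) A \<odot> fext (fext f A) (reix (disp A) A) \<odot> pairmap ?A ?a ?b =
    fext (f \<odot> disp ?A) A \<odot> pairmap ?A ?a ?b" using assms p by simp
  also have "\<dots> = fext f A \<odot> fext (disp ?A) ?A \<odot> pairmap ?A ?a ?b"
    by (rule reix_cmp(3)[symmetric]) (use assms p in simp_all)
  also have "fext (disp ?A) ?A \<odot> pairmap ?A ?a ?b = ?b"
    by (rule p(5)) (use assms in simp_all)
  finally show "fext (disp A) A \<odot> fext (fext f A) (reix (disp A) A) \<odot> pairmap ?A ?a ?b =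
    fext (disp A) A \<odot> pairmap A a b \<odot> f" using assms b q by simp
qed (use assms pairmap_simps[of "reix f A" "resec f A a" "resec f A b"] in simp_all)

section \<open>Path objects\<close>

lemma idty_facts:
  assumes "isty A"
  shows "isty (idty A)" "cx (idty A) = ext (reix (disp A) A)" "cell (idcell A)"
    "sr (idcell A) = idsrc A" "tg (idcell A) = idtgt A"
    "arrow_object (slice (base M) (cx A)) (disp A) (disp A \<odot> idsrc A)
          (disp A \<odot> idsrc A, disp A, idcell A)"
proof -
  have 1: "idty A \<in> fib M (ext (wkself A)) \<and>
        idcell A \<in> cells (base M) (idsrc A) (idtgt A) \<and>
        arrow_object (slice (base M) (F0 (proj M) A)) (disp A) (disp A \<odot> idsrc A)
          (disp A \<odot> idsrc A, disp A, idcell A)"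
    using identities assms unfolding identities_def by blast
  then show "isty (idty A)" "cx (idty A) = ext (reix (disp A) A)" "cell (idcell A)"
    "sr (idcell A) = idsrc A" "tg (idcell A) = idtgt A"
    "arrow_object (slice (base M) (cx A)) (disp A) (disp A \<odot> idsrc A)
          (disp A \<odot> idsrc A, disp A, idcell A)"
    by (simp_all only: fib_iff cells_iff wkself_def)
qed

lemmas idty_simps [simp] = idty_facts(1-5)

lemma idsrc_simps [simp]:
  assumes "isty A"
  shows "arr (idsrc A)" "dm (idsrc A) = ext (idty A)" "cd (idsrc A) = ext A"
  using assms by (simp_all add: idsrc_def)

lemma idtgt_simps [simp]:
  assumes "isty A"
  shows "arr (idtgt A)" "dm (idtgt A) = ext (idty A)" "cd (idtgt A) = ext A"
    "disp A \<odot> idtgt A = disp A \<odot> idsrc A"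
    "arr h \<Longrightarrow> cd h = ext (idty A) \<Longrightarrow> disp A \<odot> idtgt A \<odot> h = disp A \<odot> idsrc A \<odot> h"
proof -
  show "arr (idtgt A)" "dm (idtgt A) = ext (idty A)" "cd (idtgt A) = ext A"
    "disp A \<odot> idtgt A = disp A \<odot> idsrc A"
    using assms by (simp_all add: idtgt_def idsrc_def)
  show "disp A \<odot> idtgt A \<odot> h = disp A \<odot> idsrc A \<odot> h"
    if "arr h" "cd h = ext (idty A)"
    using assms that by (simp add: idtgt_def idsrc_def)
qed

lemma idcell_over [simp]:
  assumes "isty A"
  shows "disp A \<rhd> idcell A = id2 (disp A \<odot> idsrc A)"
  using idty_facts(6)[OF assms] unfolding arrow_object_def slice_def Let_def by simp

text \<open>The arrow object lives in the slice over \<Gamma>, where maps are triples recording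
  their structure maps. This translates its one-dimensional universal property to plain maps of the
  base.\<close>

lemma idcell_classifies:
  assumes "isty A" "cell \<alpha>" "cd (sr \<alpha>) = ext A" "disp A \<rhd> \<alpha> = id2 (disp A \<odot> sr \<alpha>)"
  shows "\<exists>!q. arr q \<and> cd q = ext (idty A) \<and> idcell A \<lhd> q = \<alpha>"
proof -
  let ?S = "slice (base M) (cx A)" and ?P = "disp A \<odot> sr \<alpha>" and ?Y = "disp A \<odot> idsrc A"
  let ?k = "(?Y, disp A, idcell A)"
  have tg: "disp A \<odot> tg \<alpha> = ?P"
    using arg_cong[OF assms(4), of tg] assms(1-3) by simp
  have 1: "\<forall>B \<in> Ob ?S. \<forall>\<beta> \<in> Cell ?S. Src ?S \<beta> \<in> hom ?S B (disp A) \<and> Tgt ?S \<beta> \<in> hom ?S B (disp A) \<longrightarrow>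
        (\<exists>!f. f \<in> hom ?S B ?Y \<and> whisker_right ?S ?k f = \<beta>)"
    using idty_facts(6)[OF assms(1)] unfolding arrow_object_def by blast
  have "\<exists>!f. f \<in> hom ?S ?P ?Y \<and> whisker_right ?S ?k f = (?P, disp A, \<alpha>)"
    by (rule 1[rule_format]) (use assms tg in \<open>simp_all add: slice_def\<close>)
  then obtain f where f: "f \<in> hom ?S ?P ?Y" "whisker_right ?S ?k f = (?P, disp A, \<alpha>)"
    and u: "\<And>g. g \<in> hom ?S ?P ?Y \<Longrightarrow> whisker_right ?S ?k g = (?P, disp A, \<alpha>) \<Longrightarrow> g = f"
    by blast
  obtain q where q: "f = (?P, ?Y, q)" using f(1) by (cases f) (auto simp: slice_def)
  show ?thesis
  proof (rule ex1I[of _ q])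
    show "arr q \<and> cd q = ext (idty A) \<and> idcell A \<lhd> q = \<alpha>"
      using f assms(1) unfolding q by (auto simp: slice_def)
    \<comment> \<open>The structure map of a competitor need not be prescribed: whiskering
      determines its source projection and thereby its triangle over \<Gamma>.\<close>
    fix r assume r: "arr r \<and> cd r = ext (idty A) \<and> idcell A \<lhd> r = \<alpha>"
    then have s: "sr \<alpha> = idsrc A \<odot> r" using assms(1) by auto
    have "(?P, ?Y, r) = f"
      by (rule u) (use r s assms(1) in \<open>auto simp: slice_def\<close>)
    then show "r = q" using q by simp
  qed
qed

lemma classify_facts:
  assumes "isty A" "cell \<alpha>" "cd (sr \<alpha>) = ext A" "disp A \<rhd> \<alpha> = id2 (disp A \<odot> sr \<alpha>)"
  shows "arr (classify A \<alpha>)" "dm (classify A \<alpha>) = dm (sr \<alpha>)"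
    "cd (classify A \<alpha>) = ext (idty A)" "idcell A \<lhd> classify A \<alpha> = \<alpha>"
    "idsrc A \<odot> classify A \<alpha> = sr \<alpha>" "idtgt A \<odot> classify A \<alpha> = tg \<alpha>"
proof -
  have 1: "arr (classify A \<alpha>) \<and> cd (classify A \<alpha>) = ext (idty A) \<and> idcell A \<lhd> classify A \<alpha> = \<alpha>"
    unfolding classify_def by (rule theI'[OF idcell_classifies[OF assms]])
  then show 2: "arr (classify A \<alpha>)" "cd (classify A \<alpha>) = ext (idty A)"
    "idcell A \<lhd> classify A \<alpha> = \<alpha>" by auto
  show 3: "idsrc A \<odot> classify A \<alpha> = sr \<alpha>"
    using arg_cong[OF 2(3), of sr] 2(1,2) assms(1) by simp
  show "idtgt A \<odot> classify A \<alpha> = tg \<alpha>"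
    using arg_cong[OF 2(3), of tg] 2(1,2) assms(1) by simp
  show "dm (classify A \<alpha>) = dm (sr \<alpha>)"
    using arg_cong[OF 3, of dm] 2(1,2) assms(1) by simp
qed

text \<open>Any whiskering of \<open>idcell A\<close> again lies over \<Gamma>, so the uniqueness of
  the classifying map applies to it.\<close>

lemma idcell_inj:
  assumes "isty A" "arr q" "arr r" "cd q = ext (idty A)" "cd r = ext (idty A)"
    "idcell A \<lhd> q = idcell A \<lhd> r"
  shows "q = r"
proof -
  have "disp A \<rhd> (idcell A \<lhd> q) = (disp A \<rhd> idcell A) \<lhd> q"
    by (rule base.hcmp_assoc'[symmetric]) (use assms(1-5) in simp_all)
  also have "\<dots> = id2 (disp A \<odot> idsrc A \<odot> q)" using assms(1-5) by simp
  finally have "\<exists>!s. arr s \<and> cd s = ext (idty A) \<and> idcell A \<lhd> s = idcell A \<lhd> q"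
    by (intro idcell_classifies) (use assms(1-5) in simp_all)
  moreover note assms(2-6)
  ultimately show ?thesis by metis
qed

lemma classify_unique:
  assumes "isty A" "arr q" "cd q = ext (idty A)" "idcell A \<lhd> q = \<alpha>"
  shows "classify A \<alpha> = q"
  unfolding classify_def
  by (rule the_equality) (use assms(2-4) idcell_inj[OF assms(1)] in blast)+

lemma idcell_cell:
  assumes "isty A" "arr f" "arr g" "dm f = dm g" "cd f = ext (idty A)" "cd g = ext (idty A)"
    "disp A \<odot> idsrc A \<odot> f = disp A \<odot> idsrc A \<odot> g"
    "cell \<beta>" "sr \<beta> = idsrc A \<odot> f" "tg \<beta> = idsrc A \<odot> g"
    "cell \<gamma>" "sr \<gamma> = idtgt A \<odot> f" "tg \<gamma> = idtgt A \<odot> g"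
    "disp A \<rhd> \<beta> = id2 (disp A \<odot> idsrc A \<odot> f)"
    "disp A \<rhd> \<gamma> = id2 (disp A \<odot> idsrc A \<odot> f)"
    "VCmp (base M) (idcell A \<lhd> g) \<beta> = VCmp (base M) \<gamma> (idcell A \<lhd> f)"
  shows "\<exists>!\<delta>. \<delta> \<in> cells (base M) f g \<and> idsrc A \<rhd> \<delta> = \<beta> \<and> idtgt A \<rhd> \<delta> = \<gamma>"
proof -
  let ?S = "slice (base M) (cx A)" and ?P = "disp A \<odot> idsrc A \<odot> f"
    and ?Y = "disp A \<odot> idsrc A"
  let ?k = "(?Y, disp A, idcell A)"
  let ?Q = "\<lambda>\<delta>. \<delta> \<in> cells ?S (?P, ?Y, f) (?P, ?Y, g) \<and>
     whisker_left ?S (Src ?S ?k) \<delta> = (?P, disp A, \<beta>) \<and> whisker_left ?S (Tgt ?S ?k) \<delta> = (?P, disp A, \<gamma>)"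
  have 1: "\<forall>B \<in> Ob ?S. \<forall>f \<in> hom ?S B ?Y. \<forall>g \<in> hom ?S B ?Y.
        \<forall>\<beta> \<in> cells ?S (Cmp ?S (Src ?S ?k) f) (Cmp ?S (Src ?S ?k) g).
        \<forall>\<gamma> \<in> cells ?S (Cmp ?S (Tgt ?S ?k) f) (Cmp ?S (Tgt ?S ?k) g).
        VCmp ?S (whisker_right ?S ?k g) \<beta> = VCmp ?S \<gamma> (whisker_right ?S ?k f) \<longrightarrow>
        (\<exists>!\<delta>. \<delta> \<in> cells ?S f g \<and>
             whisker_left ?S (Src ?S ?k) \<delta> = \<beta> \<and> whisker_left ?S (Tgt ?S ?k) \<delta> = \<gamma>)"
    using idty_facts(6)[OF assms(1)] unfolding arrow_object_def by blast
  have "\<exists>!\<delta>. ?Q \<delta>"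
    by (rule 1[rule_format, where B = ?P]) (use assms in \<open>simp_all add: slice_def\<close>)
  then obtain \<delta>' where d: "?Q \<delta>'" and u: "\<And>\<epsilon>. ?Q \<epsilon> \<Longrightarrow> \<epsilon> = \<delta>'" by blast
  obtain \<delta> where \<delta>: "\<delta>' = (?P, ?Y, \<delta>)" using d by (cases \<delta>') (auto simp: slice_def)
  show ?thesis
  proof (rule ex1I[of _ \<delta>])
    show "\<delta> \<in> cells (base M) f g \<and> idsrc A \<rhd> \<delta> = \<beta> \<and> idtgt A \<rhd> \<delta> = \<gamma>"
      using d assms(1) unfolding \<delta> by (simp add: slice_def)
    fix \<epsilon> assume e: "\<epsilon> \<in> cells (base M) f g \<and> idsrc A \<rhd> \<epsilon> = \<beta> \<and> idtgt A \<rhd> \<epsilon> = \<gamma>"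
    have "(disp A \<odot> idsrc A) \<in> Arr (base M)" using assms(1) by simp
    have "?Y \<in> Arr (base M)" using assms(1) by simp
    have "whisker_left (base M) ?Y \<epsilon> = disp A \<rhd> (idsrc A \<rhd> \<epsilon>)"
      by (rule base.hcmp_id2_merge(2)[symmetric]) (use e assms(1,2,5) in simp_all)
    then have y: "whisker_left (base M) ?Y \<epsilon> = id2 ?P" using e assms(14) by simp
    have "(?P, ?Y, \<epsilon>) = \<delta>'"
      by (rule u) (use e y assms(1-7) in \<open>simp add: slice_def\<close>)
    then show "\<epsilon> = \<delta>" using \<delta> by simp
  qed
qed

text \<open>The two projections of the path object are jointly faithful on cells over \<Gamma>. The
  compatibility square that its universal property asks for holds for projections of an actual cell
  by interchange.\<close>

lemma idcell_cell_eqI: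
  assumes "isty A" "cell \<delta>" "cell \<epsilon>" "sr \<delta> = sr \<epsilon>" "tg \<delta> = tg \<epsilon>" "cd (sr \<delta>) = ext (idty A)"
    "idsrc A \<rhd> \<delta> = idsrc A \<rhd> \<epsilon>" "idtgt A \<rhd> \<delta> = idtgt A \<rhd> \<epsilon>"
    "disp A \<rhd> idsrc A \<rhd> \<delta> = id2 (disp A \<odot> idsrc A \<odot> sr \<delta>)"
  shows "\<delta> = \<epsilon>"
proof -
  have t: "disp A \<odot> idsrc A \<odot> tg \<delta> = disp A \<odot> idsrc A \<odot> sr \<delta>"
    using arg_cong[OF assms(9), of tg] assms(1,2,6) by simp
  have e: "disp A \<rhd> idtgt A \<rhd> \<delta> = disp A \<rhd> idsrc A \<rhd> \<delta>"
    using assms(1,2,6) by simp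
  have "\<exists>!\<zeta>. \<zeta> \<in> cells (base M) (sr \<delta>) (tg \<delta>) \<and> idsrc A \<rhd> \<zeta> = idsrc A \<rhd> \<delta> \<and>
      idtgt A \<rhd> \<zeta> = idtgt A \<rhd> \<delta>"
  proof (rule idcell_cell)
    show "disp A \<rhd> idtgt A \<rhd> \<delta> = id2 (disp A \<odot> idsrc A \<odot> sr \<delta>)"
      unfolding e by (rule assms(9))
    show "VCmp (base M) (idcell A \<lhd> tg \<delta>) (idsrc A \<rhd> \<delta>) =
          VCmp (base M) (idtgt A \<rhd> \<delta>) (idcell A \<lhd> sr \<delta>)"
      using base.whisker_exchange[of \<delta> "idcell A"] assms(1,2,6) by simp
  qed (use assms(1,2,6) t assms(9) in \<open>simp_all del: base.hcmp_id2_merge\<close>)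
  moreover have "\<delta> \<in> cells (base M) (sr \<delta>) (tg \<delta>)" using assms(2) by simp
  moreover have "\<epsilon> \<in> cells (base M) (sr \<delta>) (tg \<delta>)" using assms(3-5) by simp
  moreover note assms(7,8)
  ultimately show ?thesis by metis
qed

text \<open>The map \<Delta>.A.A.Id to \<Gamma>.A.A.Id over \<open>f\<close>; it is
  \<open>flift f [idty A, wkself A, A]\<close>, kept folded so that simplification treats it as one
  map.\<close>

definition idext :: "'m \<Rightarrow> 'a \<Rightarrow> 'm" where
  "idext f A = fext (fext (fext f A) (reix (disp A) A)) (idty A)"

lemma idty_reix:
  assumes "isty A" "arr f" "cd f = cx A"
  shows "reix (fext (fext f A) (reix (disp A) A)) (idty A) = idty (reix f A)"
    "fext f A \<rhd> idcell (reix f A) = idcell A \<lhd> idext f A"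
proof -
  have 1: "\<forall>X Y f A. f \<in> hom (base M) X Y \<and> A \<in> fib M Y \<longrightarrow>
        reix (flift f [wkself A, A]) (idty A) = idty (reix f A) \<and>
        fext f A \<rhd> idcell (reix f A) = idcell A \<lhd> flift f [idty A, wkself A, A]"
    using identities unfolding identities_def by blast
  have f: "f \<in> hom (base M) (dm f) (cx A) \<and> A \<in> fib M (cx A)" using assms by simp
  show "reix (fext (fext f A) (reix (disp A) A)) (idty A) = idty (reix f A)"
    "fext f A \<rhd> idcell (reix f A) = idcell A \<lhd> idext f A"
    using 1[rule_format, OF f] unfolding flift.simps wkself_def idext_def by blast+
qed

lemma idext_simps [simp]:
  assumes "isty A" "arr f" "cd f = cx A"
  shows "arr (idext f A)" "dm (idext f A) = ext (idty (reix f A))" "cd (idext f A) = ext (idty A)"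
  using assms by (simp_all add: idext_def idty_reix)

lemma idext_src_tgt:
  assumes "isty A" "arr f" "cd f = cx A"
  shows "idsrc A \<odot> idext f A = fext f A \<odot> idsrc (reix f A)"
    "idtgt A \<odot> idext f A = fext f A \<odot> idtgt (reix f A)"
  using arg_cong[OF idty_reix(2)[OF assms], of sr] arg_cong[OF idty_reix(2)[OF assms], of tg] assms
  by simp_all

lemma idcell_idext:
  assumes "isty A" "arr f" "cd f = cx A" "arr h" "cd h = ext (idty (reix f A))"
  shows "idcell A \<lhd> (idext f A \<odot> h) = fext f A \<rhd> (idcell (reix f A) \<lhd> h)"
proof -
  have "idcell A \<lhd> (idext f A \<odot> h) = (idcell A \<lhd> idext f A) \<lhd> h" using assms by simp
  also have "\<dots> = (fext f A \<rhd> idcell (reix f A)) \<lhd> h" using idty_reix(2)[OF assms(1-3)] by simp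
  also have "\<dots> = fext f A \<rhd> (idcell (reix f A) \<lhd> h)"
    by (rule base.hcmp_assoc') (use assms in simp_all)
  finally show ?thesis .
qed

section \<open>Sections of identity types as 2-cells\<close>

definition IdT :: "'a \<Rightarrow> 'm \<Rightarrow> 'm \<Rightarrow> 'a" where
  "IdT A a b = reix (pairmap A a b) (idty A)"

definition idmap :: "'a \<Rightarrow> 'm \<Rightarrow> 'm \<Rightarrow> 'm \<Rightarrow> 'm" where
  "idmap A a b p = fext (pairmap A a b) (idty A) \<odot> p"

text \<open>The 2-cell from \<open>a\<close> to \<open>b\<close> that the identity proof
  \<open>p\<close> stands for. With \<open>cell_sec\<close> it gives a bijection between sections of
  \<open>IdT A a b\<close> and 2-cells over \<Gamma>.\<close>

definition sec_cell :: "'a \<Rightarrow> 'm \<Rightarrow> 'm \<Rightarrow> 'm \<Rightarrow> 'c" where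
  "sec_cell A a b p = idcell A \<lhd> idmap A a b p"

definition cell_sec :: "'a \<Rightarrow> 'm \<Rightarrow> 'm \<Rightarrow> 'c \<Rightarrow> 'm" where
  "cell_sec A a b \<alpha> = sec (pairmap A a b) (idty A) (classify A \<alpha>)"

lemma IdT_simps [simp]:
  assumes "isty A" "gsection A a" "gsection A b"
  shows "isty (IdT A a b)" "cx (IdT A a b) = cx A"
  using assms by (simp_all add: IdT_def)

lemma IdT_reix:
  assumes "isty A" "gsection A a" "gsection A b" "arr f" "cd f = cx A"
  shows "reix f (IdT A a b) = IdT (reix f A) (resec f A a) (resec f A b)"
proof -
  note p = pairmap_simps[of "reix f A" "resec f A a" "resec f A b"]
  have "reix f (IdT A a b) = reix (pairmap A a b \<odot> f) (idty A)"
    unfolding IdT_def using assms by simp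
  also have "\<dots> = reix (pairmap (reix f A) (resec f A a) (resec f A b))
      (reix (fext (fext f A) (reix (disp A) A)) (idty A))"
    unfolding pairmap_reix[OF assms, symmetric]
    by (rule reix_cmp(1)[symmetric]) (use assms p in simp_all)
  finally show ?thesis unfolding idty_reix(1)[OF assms(1,4,5)] IdT_def .
qed

lemma idmap_simps [simp]:
  assumes "isty A" "gsection A a" "gsection A b" "gsection (IdT A a b) p"
  shows "arr (idmap A a b p)" "dm (idmap A a b p) = cx A" "cd (idmap A a b p) = ext (idty A)"
    "disp (idty A) \<odot> idmap A a b p = pairmap A a b"
    "idsrc A \<odot> idmap A a b p = a" "idtgt A \<odot> idmap A a b p = b"
proof -
  note p = gsectionD[OF assms(4)[unfolded IdT_def]]
  show "arr (idmap A a b p)" "dm (idmap A a b p) = cx A" "cd (idmap A a b p) = ext (idty A)"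
    using p assms by (simp_all add: idmap_def)
  show 1: "disp (idty A) \<odot> idmap A a b p = pairmap A a b"
    unfolding idmap_def using p assms by simp
  show "idsrc A \<odot> idmap A a b p = a" "idtgt A \<odot> idmap A a b p = b"
    using p assms 1 by (simp_all add: idmap_def idsrc_def idtgt_def)
qed

lemma idmap_cmp_simps [simp]:
  assumes "isty A" "gsection A a" "gsection A b" "gsection (IdT A a b) p" "arr h" "cd h = cx A"
  shows "idsrc A \<odot> idmap A a b p \<odot> h = a \<odot> h" "idtgt A \<odot> idmap A a b p \<odot> h = b \<odot> h"
  using base.cmp_assoc'[of h "idmap A a b p" "idsrc A"] base.cmp_assoc'[of h "idmap A a b p" "idtgt A"]
    assms by simp_all

lemma sec_cell_simps [simp]:
  assumes "isty A" "gsection A a" "gsection A b" "gsection (IdT A a b) p"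
  shows "cell (sec_cell A a b p)" "sr (sec_cell A a b p) = a" "tg (sec_cell A a b p) = b"
    "disp A \<rhd> sec_cell A a b p = id2 (ide (cx A))"
proof -
  show "cell (sec_cell A a b p)" "sr (sec_cell A a b p) = a" "tg (sec_cell A a b p) = b"
    using assms by (simp_all add: sec_cell_def)
  have "disp A \<rhd> sec_cell A a b p = (disp A \<rhd> idcell A) \<lhd> idmap A a b p"
    unfolding sec_cell_def by (rule base.hcmp_assoc'[symmetric]) (use assms in simp_all)
  then show "disp A \<rhd> sec_cell A a b p = id2 (ide (cx A))"
    using assms gsectionD[OF assms(2)] by simp
qed

text \<open>A section of \<open>IdT A a b\<close> is determined by its map into the path object, and
  that map by the cell it classifies. Equations between identity proofs are from here on reduced to
  equations between 2-cells.\<close>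

lemma sec_cell_inj:
  assumes "isty A" "gsection A a" "gsection A b" "gsection (IdT A a b) p"
    "gsection (IdT A a b) q" "sec_cell A a b p = sec_cell A a b q"
  shows "p = q"
proof (rule gsection_eqI[of "pairmap A a b" "idty A"])
  have "idmap A a b p = idmap A a b q"
    by (rule idcell_inj) (use assms in \<open>simp_all add: sec_cell_def\<close>)
  then show "fext (pairmap A a b) (idty A) \<odot> p = fext (pairmap A a b) (idty A) \<odot> q"
    by (simp add: idmap_def)
qed (use assms in \<open>simp_all add: IdT_def\<close>)

lemma cell_sec_facts:
  assumes "isty A" "gsection A a" "gsection A b" "cell \<alpha>" "sr \<alpha> = a" "tg \<alpha> = b"
    "disp A \<rhd> \<alpha> = id2 (ide (cx A))"
  shows "gsection (IdT A a b) (cell_sec A a b \<alpha>)" "idmap A a b (cell_sec A a b \<alpha>) = classify A \<alpha>"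
    "sec_cell A a b (cell_sec A a b \<alpha>) = \<alpha>" "disp (idty A) \<odot> classify A \<alpha> = pairmap A a b"
proof -
  note a = gsectionD[OF assms(2)]
  note c = classify_facts[OF assms(1,4)]
  have c: "arr (classify A \<alpha>)" "dm (classify A \<alpha>) = cx A"
    "cd (classify A \<alpha>) = ext (idty A)" "idcell A \<lhd> classify A \<alpha> = \<alpha>"
    "idsrc A \<odot> classify A \<alpha> = a" "idtgt A \<odot> classify A \<alpha> = b"
    using c assms a by auto
  show 1: "disp (idty A) \<odot> classify A \<alpha> = pairmap A a b"
    by (rule pairmap_eqI[OF assms(1-3)])
      (use c(1-3,5,6) assms(1) in \<open>simp_all add: idsrc_def idtgt_def\<close>)
  note s = sec_facts[of "pairmap A a b" "idty A" "classify A \<alpha>", folded cell_sec_def IdT_def idmap_def]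
  show 2: "gsection (IdT A a b) (cell_sec A a b \<alpha>)" and 3: "idmap A a b (cell_sec A a b \<alpha>) = classify A \<alpha>"
    using s c(1-3) 1 assms(1-3) by auto
  then show "sec_cell A a b (cell_sec A a b \<alpha>) = \<alpha>" unfolding sec_cell_def using c(4) by simp
qed

lemma cell_sec_sec_cell:
  assumes "isty A" "gsection A a" "gsection A b" "gsection (IdT A a b) p"
  shows "cell_sec A a b (sec_cell A a b p) = p"
  by (rule sec_cell_inj[OF assms(1-3) _ assms(4)])
    (use cell_sec_facts[OF assms(1-3), of "sec_cell A a b p"] assms in simp_all)

lemma idmap_reix:
  assumes "isty A" "gsection A a" "gsection A b" "gsection (IdT A a b) p" "arr f" "cd f = cx A"
  shows "idext f A \<odot> idmap (reix f A) (resec f A a) (resec f A b) (resec f (IdT A a b) p) =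
    idmap A a b p \<odot> f"
proof -
  let ?A = "reix f A" and ?a = "resec f A a" and ?b = "resec f A b"
    and ?p = "resec f (IdT A a b) p"
    and ?F = "fext (fext f A) (reix (disp A) A)"
  note p = pairmap_simps[of ?A ?a ?b]
  have g: "gsection (IdT ?A ?a ?b) ?p"
    using IdT_reix[OF assms(1-3,5,6)] assms resec_facts(1)[of f "IdT A a b" p] by simp
  note G = gsectionD[OF g] and P = gsectionD[OF assms(4)[unfolded IdT_def]]
  have "reix (pairmap ?A ?a ?b) (reix ?F (idty A)) = reix (?F \<odot> pairmap ?A ?a ?b) (idty A)"
    by (rule reix_cmp(1)) (use assms p in simp_all)
  then have e: "reix (?F \<odot> pairmap ?A ?a ?b) (idty A) = IdT ?A ?a ?b"
    unfolding idty_reix(1)[OF assms(1,5,6)] IdT_def by (rule sym)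
  have "idext f A \<odot> idmap ?A ?a ?b ?p = fext ?F (idty A) \<odot> fext (pairmap ?A ?a ?b) (reix ?F (idty A)) \<odot> ?p"
    unfolding idext_def idmap_def idty_reix(1)[OF assms(1,5,6)] ..
  also have "\<dots> = fext (?F \<odot> pairmap ?A ?a ?b) (idty A) \<odot> ?p"
    by (rule reix_cmp(3)) (use assms p G(1) e G(3) IdT_reix[OF assms(1-3,5,6)] in simp_all)
  also have "\<dots> = fext (pairmap A a b \<odot> f) (idty A) \<odot> ?p"
    unfolding pairmap_reix[OF assms(1-3,5,6)] ..
  also have "\<dots> = fext (pairmap A a b) (idty A) \<odot> fext f (IdT A a b) \<odot> ?p"
    unfolding IdT_def
    by (rule reix_cmp(3)[symmetric]) (use assms resec_facts(1)[of f "IdT A a b" p] in \<open>simp_all add: IdT_def\<close>)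
  also have "\<dots> = fext (pairmap A a b) (idty A) \<odot> p \<odot> f"
    using resec_facts(2)[of f "IdT A a b" p] assms by simp
  finally show ?thesis using assms P by (simp add: idmap_def)
qed

text \<open>Stability of \<open>idcell\<close>, restricted along the map into the path object that
  \<open>p\<close> names.\<close>

lemma sec_cell_reix:
  assumes "isty A" "gsection A a" "gsection A b" "gsection (IdT A a b) p" "arr f" "cd f = cx A"
  shows "fext f A \<rhd> sec_cell (reix f A) (resec f A a) (resec f A b) (resec f (IdT A a b) p) =
    sec_cell A a b p \<lhd> f"
proof -
  let ?A = "reix f A" and ?a = "resec f A a" and ?b = "resec f A b"
    and ?p = "resec f (IdT A a b) p"
  have g: "gsection (IdT ?A ?a ?b) ?p"
    using IdT_reix[OF assms(1-3,5,6)] assms resec_facts(1)[of f "IdT A a b" p] by simp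
  have "idcell A \<lhd> (idext f A \<odot> idmap ?A ?a ?b ?p) = fext f A \<rhd> sec_cell ?A ?a ?b ?p"
    unfolding sec_cell_def by (rule idcell_idext) (use assms g in simp_all)
  then show ?thesis
    unfolding idmap_reix[OF assms] unfolding sec_cell_def using assms by simp
qed

text \<open>There is no chosen reindexing of a 2-cell between sections. The reindexed cell is
  therefore a parameter \<open>\<beta>\<close>, pinned down by its two pullback projections.\<close>

lemma cell_sec_reix:
  assumes "isty A" "gsection A a" "gsection A b" "arr f" "cd f = cx A"
    "cell \<alpha>" "sr \<alpha> = a" "tg \<alpha> = b" "disp A \<rhd> \<alpha> = id2 (ide (cx A))"
    "cell \<beta>" "sr \<beta> = resec f A a" "tg \<beta> = resec f A b"
    "disp (reix f A) \<rhd> \<beta> = id2 (ide (dm f))" "fext f A \<rhd> \<beta> = \<alpha> \<lhd> f"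
  shows "resec f (IdT A a b) (cell_sec A a b \<alpha>) =
    cell_sec (reix f A) (resec f A a) (resec f A b) \<beta>"
proof -
  let ?A = "reix f A" and ?a = "resec f A a" and ?b = "resec f A b"
    and ?p = "resec f (IdT A a b) (cell_sec A a b \<alpha>)"
  note c = cell_sec_facts[OF assms(1-3,6-9)]
  have g: "gsection (IdT ?A ?a ?b) ?p"
    using IdT_reix[OF assms(1-5)] assms(1-5) c(1) resec_facts(1)[of f "IdT A a b" "cell_sec A a b \<alpha>"] by simp
  have ab: "isty ?A" "gsection ?A ?a" "gsection ?A ?b" using assms(1-5) by simp_all
  note s = sec_cell_simps[OF ab g]
  have "sec_cell ?A ?a ?b ?p = \<beta>"
  proof (rule pullback_cell_eqI[of f A])
    show "fext f A \<rhd> sec_cell ?A ?a ?b ?p = fext f A \<rhd> \<beta>"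
      unfolding sec_cell_reix[OF assms(1-3) c(1) assms(4,5)] c(3) assms(14) ..
    show "disp ?A \<rhd> sec_cell ?A ?a ?b ?p = disp ?A \<rhd> \<beta>"
      unfolding s(4) assms(13) using assms(1,4,5) by simp
    show "cd (sr (sec_cell ?A ?a ?b ?p)) = ext ?A" unfolding s(2) using assms(1-5) by simp
  qed (use assms(1,4,5,10-12) s(1-3) in simp_all)
  then show ?thesis using cell_sec_sec_cell[OF ab g] by (simp only:)
qed

section \<open>Reflexivity and discreteness\<close>

definition reflsec :: "'a \<Rightarrow> 'm \<Rightarrow> 'm" where
  "reflsec A a = cell_sec A a a (id2 a)"

lemma reflsec_facts:
  assumes "isty A" "gsection A a"
  shows "gsection (IdT A a a) (reflsec A a)" "sec_cell A a a (reflsec A a) = id2 a"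
    "idmap A a a (reflsec A a) = classify A (id2 a)"
proof -
  note a = gsectionD[OF assms(2)]
  note c = cell_sec_facts[OF assms(1,2,2), of "id2 a", folded reflsec_def]
  show "gsection (IdT A a a) (reflsec A a)" "sec_cell A a a (reflsec A a) = id2 a"
    "idmap A a a (reflsec A a) = classify A (id2 a)"
    using c a assms(1) by simp_all
qed

lemma reflsec_reix:
  assumes "isty A" "gsection A a" "arr f" "cd f = cx A"
  shows "resec f (IdT A a a) (reflsec A a) = reflsec (reix f A) (resec f A a)"
  unfolding reflsec_def
  by (rule cell_sec_reix[OF assms(1,2,2-4)])
    (use assms gsectionD[OF assms(2)] in simp_all)

text \<open>A cell into \<Gamma>.A.A.Id that is vertical over \<Gamma>.A.A has identities as its
  projections to \<open>A\<close>. Interchange with \<open>idcell\<close> then equates the cells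
  classified by its two ends, hence the ends; joint faithfulness of the projections makes the cell
  an identity.\<close>

lemma discrete_cell:
  assumes "isty A" "cell \<delta>" "cd (sr \<delta>) = ext (idty A)"
    "disp (idty A) \<rhd> \<delta> = id2 (disp (idty A) \<odot> sr \<delta>)"
  shows "\<delta> = id2 (sr \<delta>)" "tg \<delta> = sr \<delta>"
proof -
  let ?D = "disp (idty A)"
  have "idsrc A \<rhd> \<delta> = disp (reix (disp A) A) \<rhd> (?D \<rhd> \<delta>)"
    using assms(1-3) by (simp add: idsrc_def)
  then have s: "idsrc A \<rhd> \<delta> = id2 (idsrc A \<odot> sr \<delta>)"
    unfolding assms(4) using assms(1-3) by (simp add: idsrc_def)
  have "idtgt A \<rhd> \<delta> = fext (disp A) A \<rhd> (?D \<rhd> \<delta>)"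
    using assms(1-3) by (simp add: idtgt_def)
  then have t: "idtgt A \<rhd> \<delta> = id2 (idtgt A \<odot> sr \<delta>)"
    unfolding assms(4) using assms(1-3) by (simp add: idtgt_def)
  have ts: "idsrc A \<odot> tg \<delta> = idsrc A \<odot> sr \<delta>"
    using arg_cong[OF s, of tg] assms(1-3) by simp
  have tt: "idtgt A \<odot> tg \<delta> = idtgt A \<odot> sr \<delta>"
    using arg_cong[OF t, of tg] assms(1-3) by simp
  have "VCmp (base M) (idcell A \<lhd> tg \<delta>) (idsrc A \<rhd> \<delta>) =
      VCmp (base M) (idtgt A \<rhd> \<delta>) (idcell A \<lhd> sr \<delta>)"
    using base.whisker_exchange[of \<delta> "idcell A"] assms(1-3) by simp
  then have "idcell A \<lhd> tg \<delta> = idcell A \<lhd> sr \<delta>"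
    unfolding s t using assms(1-3) ts tt by simp
  then show 1: "tg \<delta> = sr \<delta>"
    by (intro idcell_inj[OF assms(1)]) (use assms(1-3) in simp_all)
  show "\<delta> = id2 (sr \<delta>)"
  proof (rule idcell_cell_eqI[OF assms(1)])
    show "disp A \<rhd> idsrc A \<rhd> \<delta> = id2 (disp A \<odot> idsrc A \<odot> sr \<delta>)"
      unfolding s using assms(1-3) by simp
  qed (use assms(1-3) s t 1 in simp_all)
qed

text \<open>Discreteness of the path object, carried to its reindexing \<open>IdT A a b\<close>
  through the pullback projections.\<close>

lemma discrete_identity:
  assumes "isty A" "gsection A a" "gsection A b" "gsection (IdT A a b) p"
    "gsection (IdT A a b) q" "cell \<delta>" "sr \<delta> = p" "tg \<delta> = q"
    "disp (IdT A a b) \<rhd> \<delta> = id2 (ide (cx A))"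
  shows "p = q" "\<delta> = id2 p"
proof -
  let ?I = "IdT A a b" and ?e = "fext (pairmap A a b) (idty A)"
  note p = gsectionD[OF assms(4)] and q = gsectionD[OF assms(5)]
  have e: "arr ?e" "dm ?e = ext ?I" "cd ?e = ext (idty A)"
    using assms(1-3) by (simp_all add: IdT_def)
  have ep: "?e \<odot> p = idmap A a b p" "?e \<odot> q = idmap A a b q" by (simp_all add: idmap_def)
  have c: "cell (?e \<rhd> \<delta>)" "sr (?e \<rhd> \<delta>) = idmap A a b p" "tg (?e \<rhd> \<delta>) = idmap A a b q"
    using assms(1-3,6-8) e p ep by simp_all
  have "disp (idty A) \<rhd> ?e \<rhd> \<delta> = (disp (idty A) \<odot> ?e) \<rhd> \<delta>"
    by (rule base.hcmp_id2_merge(2)) (use assms(1-3,6,7) e p in simp_all)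
  also have "\<dots> = (pairmap A a b \<odot> disp ?I) \<rhd> \<delta>"
    using assms(1-3) by (simp add: IdT_def)
  also have "\<dots> = pairmap A a b \<rhd> (disp ?I \<rhd> \<delta>)"
    by (rule base.hcmp_id2_merge(2)[symmetric]) (use assms(1-3,6,7) p in simp_all)
  also have "\<dots> = id2 (pairmap A a b)" unfolding assms(9) using assms(1-3) by simp
  finally have d: "disp (idty A) \<rhd> ?e \<rhd> \<delta> = id2 (disp (idty A) \<odot> sr (?e \<rhd> \<delta>))"
    unfolding c(2) using assms(1-4) by simp
  note D = discrete_cell[OF assms(1) c(1) _ d, unfolded c(2,3)]
  have "idmap A a b p = idmap A a b q"
    using D(2) assms(1-4) by simp
  then show pq: "p = q"
    by (intro sec_cell_inj[OF assms(1-5)]) (simp add: sec_cell_def)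
  show "\<delta> = id2 p"
  proof (rule pullback_cell_eqI[of "pairmap A a b" "idty A"])
    show "?e \<rhd> \<delta> = ?e \<rhd> id2 p" using D(1) e p ep assms(1-4) by simp
    show "disp (reix (pairmap A a b) (idty A)) \<rhd> \<delta> = disp (reix (pairmap A a b) (idty A)) \<rhd> id2 p"
      using assms(9) p assms(1-3) by (simp flip: IdT_def)
  qed (use assms(1-3,6-8) p pq in \<open>simp_all flip: IdT_def\<close>)
qed

text \<open>An element of an iterated identity type stands for a 2-cell between sections of
  \<open>IdT A a b\<close>, and those are all identities.\<close>

lemma discrete_section:
  assumes "isty A" "gsection A a" "gsection A b" "gsection (IdT A a b) p"
    "gsection (IdT A a b) q" "gsection (IdT (IdT A a b) p q) e"
  shows "p = q" "e = reflsec (IdT A a b) p"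
proof -
  let ?I = "IdT A a b"
  have I: "isty ?I" "cx ?I = cx A" using assms by simp_all
  note s = sec_cell_simps[OF I(1) assms(4-6)]
  show pq: "p = q"
    by (rule discrete_identity(1)[OF assms(1-5) s(1-3)]) (use s(4) I(2) in simp)
  have c: "sec_cell ?I p q e = id2 p"
    by (rule discrete_identity(2)[OF assms(1-5) s(1-3)]) (use s(4) I(2) in simp)
  show "e = reflsec ?I p"
    using cell_sec_sec_cell[OF I(1) assms(4-6), unfolded c] pq by (simp add: reflsec_def)
qed

section \<open>Canonical fillers\<close>

lemma lift_facts:
  assumes "isty C" "arr g" "cd g = ext C" "cell \<alpha>" "tg \<alpha> = disp C \<odot> g"
  shows "arr (liftarr C \<alpha> g)" "dm (liftarr C \<alpha> g) = dm g" "cd (liftarr C \<alpha> g) = ext C"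
    "disp C \<odot> liftarr C \<alpha> g = sr \<alpha>"
    "arr k \<Longrightarrow> cd k = dm g \<Longrightarrow> liftarr C (\<alpha> \<lhd> k) (g \<odot> k) = liftarr C \<alpha> g \<odot> k"
proof -
  have n: "normal_isofibration (base M) (disp C) (liftarr C) (liftcell C)"
    using comprehension assms(1) unfolding comprehension_def by blast
  then have "\<forall>g \<alpha>. g \<in> Arr (base M) \<and> cd g = dm (disp C) \<and>
        invertible_cell (base M) \<alpha> \<and> tg \<alpha> = disp C \<odot> g \<longrightarrow>
        liftarr C \<alpha> g \<in> hom (base M) (dm g) (dm (disp C)) \<and>
        disp C \<odot> liftarr C \<alpha> g = sr \<alpha> \<and>
        (\<forall>k \<in> Arr (base M). cd k = dm g \<longrightarrow>
           liftarr C (\<alpha> \<lhd> k) (g \<odot> k) = liftarr C \<alpha> g \<odot> k)"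
    unfolding normal_isofibration_def by blast
  from this[rule_format, of g \<alpha>] show "arr (liftarr C \<alpha> g)" "dm (liftarr C \<alpha> g) = dm g"
    "cd (liftarr C \<alpha> g) = ext C" "disp C \<odot> liftarr C \<alpha> g = sr \<alpha>"
    "arr k \<Longrightarrow> cd k = dm g \<Longrightarrow> liftarr C (\<alpha> \<lhd> k) (g \<odot> k) = liftarr C \<alpha> g \<odot> k"
    using assms groupoid[OF assms(4)] by auto
qed

lemma lift_id2:
  assumes "isty C" "arr g" "cd g = ext C"
  shows "liftarr C (id2 (disp C \<odot> g)) g = g"
proof -
  have n: "normal_isofibration (base M) (disp C) (liftarr C) (liftcell C)"
    using comprehension assms(1) unfolding comprehension_def by blast
  then have "\<forall>g \<in> Arr (base M). cd g = dm (disp C) \<longrightarrow> liftarr C (id2 (disp C \<odot> g)) g = g"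
    unfolding normal_isofibration_def by blast
  then show ?thesis using assms by simp
qed

text \<open>The canonical filler of a square whose lower side is an identity.\<close>

definition fil :: "'a \<Rightarrow> 'm \<Rightarrow> 'm \<Rightarrow> 'c \<Rightarrow> 'm" where
  "fil C d k \<theta> = liftarr C \<theta> (d \<odot> k)"

lemma fil_section:
  assumes "isty C" "arr d" "cd d = ext C" "disp C \<odot> d = i" "arr i" "arr k" "cd k = dm i"
    "cell \<theta>" "sr \<theta> = ide (cx C)" "tg \<theta> = i \<odot> k" "dm k = cx C"
  shows "gsection C (fil C d k \<theta>)"
proof -
  have dd: "dm d = dm i" using arg_cong[OF assms(4), of dm] assms(1-3) by simp
  have dk: "disp C \<odot> d \<odot> k = i \<odot> k"
  proof -
    have "(disp C \<odot> d) \<odot> k = disp C \<odot> d \<odot> k"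
      by (rule base.cmp_assoc') (use assms dd in simp_all)
    then show ?thesis using assms by (simp only:)
  qed
  show ?thesis
    using lift_facts(1-4)[of C "d \<odot> k" \<theta>] assms dd dk by (simp add: fil_def gsection_iff)
qed

text \<open>Precomposition with \<open>i\<close> commutes with the chosen lifts. As \<theta>
  restricts to an identity along \<open>i\<close>, normality of the isofibration leaves
  \<open>d\<close>.\<close>

lemma fil_comp:
  assumes "isty C" "arr d" "cd d = ext C" "disp C \<odot> d = i" "arr i" "arr k" "cd k = dm i"
    "cell \<theta>" "sr \<theta> = ide (cx C)" "tg \<theta> = i \<odot> k" "dm k = cx C"
    "\<theta> \<lhd> i = id2 i" "k \<odot> i = ide (dm i)"
  shows "fil C d k \<theta> \<odot> i = d"
proof -
  have dd: "dm d = dm i" using arg_cong[OF assms(4), of dm] assms(1-3) by simp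
  have ci: "cd i = cx C" using arg_cong[OF assms(4), of cd] assms(1-3) by simp
  have dk: "disp C \<odot> d \<odot> k = i \<odot> k"
  proof -
    have "(disp C \<odot> d) \<odot> k = disp C \<odot> d \<odot> k"
      by (rule base.cmp_assoc') (use assms dd in simp_all)
    then show ?thesis using assms by (simp only:)
  qed
  have "fil C d k \<theta> \<odot> i = liftarr C (\<theta> \<lhd> i) ((d \<odot> k) \<odot> i)"
    unfolding fil_def
    by (rule lift_facts(5)[symmetric]) (use assms dd dk ci in simp_all)
  also have "(d \<odot> k) \<odot> i = d" using assms dd ci by simp
  finally show ?thesis using lift_id2[OF assms(1-3)] assms(4,12) by simp
qed

lemma stable_lift:
  assumes "arr f" "tel M (cd f) Ds" "isty C" "cx C = tend M (cd f) Ds" "arr k"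
    "cd k = ext (reix (flift f Ds) C)" "cell \<alpha>" "tg \<alpha> = disp (reix (flift f Ds) C) \<odot> k"
    "tproj M (dm f) (retel f Ds) \<rhd> \<alpha> = id2 (tproj M (dm f) (retel f Ds) \<odot> sr \<alpha>)"
  shows "liftarr C (flift f Ds \<rhd> \<alpha>) (fext (flift f Ds) C \<odot> k) =
          fext (flift f Ds) C \<odot> liftarr (reix (flift f Ds) C) \<alpha> k"
proof -
  have "stable_lifts M" using comprehension unfolding comprehension_def by blast
  then have 1: "\<forall>X Y f Ds B k \<alpha>.
        f \<in> hom (base M) X Y \<and> tel M Y Ds \<and> B \<in> fib M (tend M Y Ds) \<and>
        k \<in> Arr (base M) \<and> Cod (base M) k = ext (reix (flift f Ds) B) \<and>
        \<alpha> \<in> Cell (base M) \<and> Tgt (base M) \<alpha> = disp (reix (flift f Ds) B) \<odot> k \<and>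
        tproj M X (retel f Ds) \<rhd> \<alpha> =
          Id2 (base M) (tproj M X (retel f Ds) \<odot> Src (base M) \<alpha>) \<longrightarrow>
        liftarr B (flift f Ds \<rhd> \<alpha>) (fext (flift f Ds) B \<odot> k) =
          fext (flift f Ds) B \<odot> liftarr (reix (flift f Ds) B) \<alpha> k"
    unfolding stable_lifts_def by blast
  show ?thesis
    by (rule 1[rule_format, of f "dm f" "cd f" Ds C k \<alpha>]) (use assms in simp)
qed

text \<open>After composition with \<open>fext F C\<close>, the lift of \<theta>' becomes the lift
  of \<open>F \<rhd> \<theta>'\<close> by stability, which is the lift of
  \<open>\<theta> \<lhd> F\<close>, which is the lift of \<theta> followed after \<open>F\<close> by
  naturality. Stability asks that \<theta>' lie over \<open>dm f\<close>; this is the purpose of the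
  hypotheses on \<open>tproj\<close>.\<close>

lemma fil_reix:
  assumes "arr f" "tel M (cd f) Ds" "isty C" "cx C = tend M (cd f) Ds"
    and F: "F = flift f Ds" "arr F" "cd F = cx C"
    and "arr d" "cd d = ext C" "arr k" "cd k = dm d"
    and "arr d'" "cd d' = ext (reix F C)" "arr k'" "cd k' = dm d'"
    and "disp (reix F C) \<odot> d' = i'" "cell \<theta>'" "sr \<theta>' = ide (dm F)" "tg \<theta>' = i' \<odot> k'" "arr i'"
    and "tproj M (dm f) (retel f Ds) \<rhd> \<theta>' = id2 (tproj M (dm f) (retel f Ds))"
    and "arr (tproj M (dm f) (retel f Ds))" "dm (tproj M (dm f) (retel f Ds)) = dm F"
    and "F \<rhd> \<theta>' = \<theta> \<lhd> F" "fext F C \<odot> d' \<odot> k' = d \<odot> k \<odot> F"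
    and "disp C \<odot> d = i" "cell \<theta>" "sr \<theta> = ide (cx C)" "tg \<theta> = i \<odot> k" "arr i" "dm k = cx C"
  shows "fil (reix F C) d' k' \<theta>' = resec F C (fil C d k \<theta>)"
proof -
  have dd: "dm d = dm i" "cd i = cx C" using arg_cong[OF assms(26), of dm] arg_cong[OF assms(26), of cd] assms(3,8,9) by simp_all
  have dk: "disp C \<odot> d \<odot> k = i \<odot> k"
  proof -
    have "(disp C \<odot> d) \<odot> k = disp C \<odot> d \<odot> k"
      by (rule base.cmp_assoc') (use assms dd in simp_all)
    then show ?thesis using assms by (simp only:)
  qed
  have dd': "dm d' = dm i'" "cd i' = dm F" using arg_cong[OF assms(16), of dm] arg_cong[OF assms(16), of cd] assms(3,6,7,12,13) by simp_all
  have dm': "dm k' = dm F" using arg_cong[OF assms(19), of dm] assms(6,14,15,17,18,20) dd' by simp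
  have dk': "disp (reix F C) \<odot> d' \<odot> k' = i' \<odot> k'"
  proof -
    have "(disp (reix F C) \<odot> d') \<odot> k' = disp (reix F C) \<odot> d' \<odot> k'"
      by (rule base.cmp_assoc') (use assms(3,6,7,12-15) in simp_all)
    then show ?thesis unfolding assms(16) by (rule sym)
  qed
  have "fext F C \<odot> fil (reix F C) d' k' \<theta>' = liftarr C (F \<rhd> \<theta>') (fext F C \<odot> d' \<odot> k')"
    unfolding fil_def F(1)
    by (rule stable_lift[symmetric]) (use assms dk' dm' in \<open>simp_all flip: F(1)\<close>)
  also have "\<dots> = liftarr C (\<theta> \<lhd> F) ((d \<odot> k) \<odot> F)" using assms by simp
  also have "\<dots> = fil C d k \<theta> \<odot> F"
    unfolding fil_def by (rule lift_facts(5)) (use assms dk dd in simp_all)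
  finally have e: "fext F C \<odot> fil (reix F C) d' k' \<theta>' = fil C d k \<theta> \<odot> F" .
  show ?thesis
  proof (rule gsection_eqI[of F C])
    have s: "gsection C (fil C d k \<theta>)"
      by (rule fil_section[of C d i k]) (use assms dd in simp_all)
    show "gsection (reix F C) (fil (reix F C) d' k' \<theta>')"
      by (rule fil_section[of _ d' i' k']) (use assms dd' dm' in simp_all)
    show "gsection (reix F C) (resec F C (fil C d k \<theta>))" using s assms by simp
    show "fext F C \<odot> fil (reix F C) d' k' \<theta>' = fext F C \<odot> resec F C (fil C d k \<theta>)"
      using e s assms by simp
  qed (use assms in simp_all)
qed

section \<open>Elimination\<close>

text \<open>The shape shared by reflexivity, the unit element and pairing: with it elimination, its
  computation rule and its stability are proved once for \<open>J\<close>, \<open>U\<close> and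
  \<open>E\<close>.\<close>

definition retraction :: "'m \<Rightarrow> 'm \<Rightarrow> 'c \<Rightarrow> bool" where
  "retraction i k \<theta> \<longleftrightarrow> arr i \<and> arr k \<and> dm k = cd i \<and> cd k = dm i \<and> k \<odot> i = ide (dm i) \<and>
     cell \<theta> \<and> sr \<theta> = ide (cd i) \<and> tg \<theta> = i \<odot> k \<and> \<theta> \<lhd> i = id2 i"

text \<open>The branch \<open>d\<close> is taken as a section of \<open>C\<close> reindexed along
  \<open>i\<close>, as in the premise of an elimination rule; composing with \<open>fext i C\<close>
  turns it into the upper side of the square to be filled.\<close>

definition elim :: "'m \<Rightarrow> 'm \<Rightarrow> 'c \<Rightarrow> 'a \<Rightarrow> 'm \<Rightarrow> 'm" where
  "elim i k \<theta> C d = fil C (fext i C \<odot> d) k \<theta>"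

lemma retractionD:
  assumes "retraction i k \<theta>"
  shows "arr i" "arr k" "dm k = cd i" "cd k = dm i" "k \<odot> i = ide (dm i)"
     "cell \<theta>" "sr \<theta> = ide (cd i)" "tg \<theta> = i \<odot> k" "\<theta> \<lhd> i = id2 i"
  using assms by (auto simp: retraction_def)

lemma elim_branch:
  assumes "arr i" "isty C" "cx C = cd i" "gsection (reix i C) d"
  shows "arr (fext i C \<odot> d)" "dm (fext i C \<odot> d) = dm i" "cd (fext i C \<odot> d) = ext C"
    "disp C \<odot> fext i C \<odot> d = i"
  using gsectionD[OF assms(4)] assms(1-3) by simp_all

lemma elim_section:
  assumes "retraction i k \<theta>" "isty C" "cx C = cd i" "gsection (reix i C) d"
  shows "gsection C (elim i k \<theta> C d)"
  unfolding elim_def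
  by (rule fil_section[of C _ i]) (use retractionD[OF assms(1)] elim_branch[OF _ assms(2-4)] assms(2,3) in simp_all)

lemma elim_comp:
  assumes "retraction i k \<theta>" "isty C" "cx C = cd i" "gsection (reix i C) d"
  shows "elim i k \<theta> C d \<odot> i = fext i C \<odot> d" "resec i C (elim i k \<theta> C d) = d"
proof -
  note r = retractionD[OF assms(1)]
  show 1: "elim i k \<theta> C d \<odot> i = fext i C \<odot> d"
    unfolding elim_def
    by (rule fil_comp[of C _ i]) (use r elim_branch[OF _ assms(2-4)] assms(2,3) in simp_all)
  show "resec i C (elim i k \<theta> C d) = d"
    unfolding resec_def 1 by (rule sec_unique) (use r assms in simp_all)
qed

text \<open>Here \<open>g\<close> compares the domains of \<open>i'\<close> and \<open>i\<close>,
  and \<open>F\<close> their codomains. The hypotheses say that inclusion, retraction and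
  contraction are natural for this pair; the telescope \<open>Ds\<close> tells over which context
  the contraction is vertical.\<close>

lemma elim_reix:
  assumes "retraction i k \<theta>" "retraction i' k' \<theta>'" "isty C" "cx C = cd i" "gsection (reix i C) d"
    and "arr f" "tel M (cd f) Ds" "tend M (cd f) Ds = cd i"
    and F: "F = flift f Ds" "arr F" "cd F = cd i" "dm F = cd i'"
    and g: "arr g" "dm g = dm i'" "cd g = dm i" and "F \<odot> i' = i \<odot> g" "k \<odot> F = g \<odot> k'"
    and "F \<rhd> \<theta>' = \<theta> \<lhd> F"
    and "tproj M (dm f) (retel f Ds) \<rhd> \<theta>' = id2 (tproj M (dm f) (retel f Ds))"
    and "arr (tproj M (dm f) (retel f Ds))" "dm (tproj M (dm f) (retel f Ds)) = dm F"
  shows "elim i' k' \<theta>' (reix F C) (resec g (reix i C) d) = resec F C (elim i k \<theta> C d)"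
proof -
  note r = retractionD[OF assms(1)] and r' = retractionD[OF assms(2)]
  let ?d = "resec g (reix i C) d"
  note d = gsectionD[OF assms(5)]
  have e: "reix i' (reix F C) = reix g (reix i C)"
    using r r' assms(3,4,16) F g by simp
  have d': "gsection (reix i' (reix F C)) ?d"
    unfolding e using resec_facts(1)[of g "reix i C" d] assms(3-5) g r by simp
  note D = gsectionD[OF d']
  note b = elim_branch[OF r(1) assms(3-5)]
  have b': "arr (fext i' (reix F C) \<odot> ?d)" "dm (fext i' (reix F C) \<odot> ?d) = dm i'"
    "cd (fext i' (reix F C) \<odot> ?d) = ext (reix F C)"
    "disp (reix F C) \<odot> fext i' (reix F C) \<odot> ?d = i'"
    using elim_branch[OF r'(1) _ _ d'] assms(3,4) F by simp_all
  have "fext F C \<odot> fext i' (reix F C) \<odot> ?d = fext (i \<odot> g) C \<odot> ?d"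
    unfolding assms(16)[symmetric]
    by (rule reix_cmp(3)) (use r' assms(3,4) F D in simp_all)
  also have "\<dots> = fext i C \<odot> fext g (reix i C) \<odot> ?d"
    by (rule reix_cmp(3)[symmetric]) (use r assms(3,4,5) F g D in simp_all)
  also have "\<dots> = fext i C \<odot> d \<odot> g" using assms(3-5) g r by simp
  finally have fd: "fext F C \<odot> fext i' (reix F C) \<odot> ?d = (fext i C \<odot> d) \<odot> g"
    using assms(3-5) g r d by simp
  have "fext F C \<odot> (fext i' (reix F C) \<odot> ?d) \<odot> k' = (fext F C \<odot> (fext i' (reix F C) \<odot> ?d)) \<odot> k'"
    by (rule base.cmp_assoc'[symmetric]) (use b' r' assms(3,4) F in simp_all)
  also have "\<dots> = (fext i C \<odot> d) \<odot> g \<odot> k'"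
    unfolding fd by (rule base.cmp_assoc') (use b r' g in simp_all)
  finally have fk: "fext F C \<odot> (fext i' (reix F C) \<odot> ?d) \<odot> k' = (fext i C \<odot> d) \<odot> k \<odot> F"
    unfolding assms(17) .
  show ?thesis
    unfolding elim_def
    by (rule fil_reix[OF assms(6,7,3) _ F(1,2), where i = i and i' = i'])
      (use fk b b' r r' F assms(3,4,8,18-21) in simp_all)
qed

subsection \<open>Identity elimination\<close>

lemma reflmap_simps [simp]:
  assumes "isty A"
  shows "arr (reflmap A)" "dm (reflmap A) = ext A" "cd (reflmap A) = ext (idty A)"
    "idcell A \<lhd> reflmap A = id2 (ide (ext A))"
    "idsrc A \<odot> reflmap A = ide (ext A)" "idtgt A \<odot> reflmap A = ide (ext A)"
    "arr h \<Longrightarrow> cd h = ext A \<Longrightarrow> idsrc A \<odot> reflmap A \<odot> h = h"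
    "arr h \<Longrightarrow> cd h = ext A \<Longrightarrow> idtgt A \<odot> reflmap A \<odot> h = h"
proof -
  note c = classify_facts[of A "id2 (ide (ext A))", folded reflmap_def]
  show 1: "arr (reflmap A)" "dm (reflmap A) = ext A" "cd (reflmap A) = ext (idty A)"
    "idcell A \<lhd> reflmap A = id2 (ide (ext A))"
    and 2: "idsrc A \<odot> reflmap A = ide (ext A)" and 3: "idtgt A \<odot> reflmap A = ide (ext A)"
    using c assms by simp_all
  assume h: "arr h" "cd h = ext A"
  have "(idsrc A \<odot> reflmap A) \<odot> h = idsrc A \<odot> reflmap A \<odot> h"
    by (rule base.cmp_assoc') (use 1 h assms in simp_all)
  then show "idsrc A \<odot> reflmap A \<odot> h = h" unfolding 2 using h by simp
  have "(idtgt A \<odot> reflmap A) \<odot> h = idtgt A \<odot> reflmap A \<odot> h"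
    by (rule base.cmp_assoc') (use 1 h assms in simp_all)
  then show "idtgt A \<odot> reflmap A \<odot> h = h" unfolding 3 using h by simp
qed

lemma idcell_reflmap_cmp:
  assumes "isty A" "arr h" "cd h = ext A"
  shows "idcell A \<lhd> (reflmap A \<odot> h) = id2 h"
proof -
  have "(idcell A \<lhd> reflmap A) \<lhd> h = HCmp (base M) (idcell A) (id2 (reflmap A) \<lhd> h)"
    by (rule base.hcmp_assoc') (use assms in simp_all)
  then show ?thesis using assms by simp
qed

lemma idmap_reflsec:
  assumes "isty A" "gsection A a"
  shows "idmap A a a (reflsec A a) = reflmap A \<odot> a"
  unfolding reflsec_facts(3)[OF assms]
  by (rule classify_unique[OF assms(1)])
    (use assms gsectionD[OF assms(2)] idcell_reflmap_cmp[OF assms(1)] in simp_all)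

text \<open>The contraction comes from the two-dimensional property of the path object, applied to
  \<open>idcell A\<close> at the source and an identity at the target. The compatibility square
  commutes because \<open>idcell A\<close> whiskered with \<open>reflmap A \<odot> idtgt A\<close>
  is an identity.\<close>

lemma reflcell_facts:
  assumes "isty A"
  shows "cell (reflcell A)" "sr (reflcell A) = ide (ext (idty A))"
    "tg (reflcell A) = reflmap A \<odot> idtgt A" "idsrc A \<rhd> reflcell A = idcell A"
    "idtgt A \<rhd> reflcell A = id2 (idtgt A)"
proof -
  have "\<exists>!\<theta>. \<theta> \<in> cells (base M) (ide (ext (idty A))) (reflmap A \<odot> idtgt A) \<and>
     idsrc A \<rhd> \<theta> = idcell A \<and> idtgt A \<rhd> \<theta> = id2 (idtgt A)"
    by (rule idcell_cell) (use assms idcell_reflmap_cmp[OF assms] in simp_all)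
  from theI'[OF this] show "cell (reflcell A)" "sr (reflcell A) = ide (ext (idty A))"
    "tg (reflcell A) = reflmap A \<odot> idtgt A" "idsrc A \<rhd> reflcell A = idcell A"
    "idtgt A \<rhd> reflcell A = id2 (idtgt A)"
    unfolding reflcell_def by simp_all
qed

text \<open>That the contraction is an identity along \<open>reflmap A\<close> is tested on the two
  projections of the path object.\<close>

lemma retraction_J:
  assumes "isty A"
  shows "retraction (reflmap A) (idtgt A) (reflcell A)"
proof -
  note c = reflcell_facts[OF assms]
  have "reflcell A \<lhd> reflmap A = id2 (reflmap A)"
  proof (rule idcell_cell_eqI[OF assms])
    have "idsrc A \<rhd> (reflcell A \<lhd> reflmap A) = (idsrc A \<rhd> reflcell A) \<lhd> reflmap A"
      by (rule base.hcmp_assoc'[symmetric]) (use assms c(1-3) in simp_all)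
    then show s: "idsrc A \<rhd> (reflcell A \<lhd> reflmap A) = idsrc A \<rhd> id2 (reflmap A)"
      unfolding c(4) using assms by simp
    have "idtgt A \<rhd> (reflcell A \<lhd> reflmap A) = (idtgt A \<rhd> reflcell A) \<lhd> reflmap A"
      by (rule base.hcmp_assoc'[symmetric]) (use assms c(1-3) in simp_all)
    then show "idtgt A \<rhd> (reflcell A \<lhd> reflmap A) = idtgt A \<rhd> id2 (reflmap A)"
      unfolding c(5) using assms by simp
    show "disp A \<rhd> idsrc A \<rhd> (reflcell A \<lhd> reflmap A) = id2 (disp A \<odot> idsrc A \<odot> sr (reflcell A \<lhd> reflmap A))"
      unfolding s using assms c(1-3) by simp
  qed (use assms c(1-3) in simp_all)
  then show ?thesis using assms c(1-3) by (simp add: retraction_def)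
qed

text \<open>\<open>J\<close> at arbitrary arguments: the generic eliminator, a section over the
  whole path object, reindexed along the map that names the arguments.\<close>

definition Jsec :: "'a \<Rightarrow> 'a \<Rightarrow> 'm \<Rightarrow> 'm \<Rightarrow> 'm \<Rightarrow> 'm \<Rightarrow> 'm" where
  "Jsec A C d a b p = resec (idmap A a b p) C (elim (reflmap A) (idtgt A) (reflcell A) C d)"

lemma Jsec_section:
  assumes "isty A" "isty C" "cx C = ext (idty A)" "gsection (reix (reflmap A) C) d"
    "gsection A a" "gsection A b" "gsection (IdT A a b) p"
  shows "gsection (reix (idmap A a b p) C) (Jsec A C d a b p)"
  unfolding Jsec_def
  by (rule resec_facts(1)) (use assms elim_section[OF retraction_J[OF assms(1)] assms(2)] in simp_all)

lemma Jsec_comp: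
  assumes "isty A" "isty C" "cx C = ext (idty A)" "gsection (reix (reflmap A) C) d"
    "gsection A a"
  shows "Jsec A C d a a (reflsec A a) = resec a (reix (reflmap A) C) d"
proof -
  note r = retraction_J[OF assms(1)] and a = gsectionD[OF assms(5)]
  let ?e = "elim (reflmap A) (idtgt A) (reflcell A) C d"
  have e: "gsection C ?e" "resec (reflmap A) C ?e = d"
    using elim_section[OF r] elim_comp(2)[OF r] assms by simp_all
  have "Jsec A C d a a (reflsec A a) = resec (reflmap A \<odot> a) C ?e"
    unfolding Jsec_def idmap_reflsec[OF assms(1,5)] ..
  also have "\<dots> = resec a (reix (reflmap A) C) (resec (reflmap A) C ?e)"
    by (rule resec_cmp[symmetric]) (use assms(1-3) a e in simp_all)
  finally show ?thesis unfolding e(2) .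
qed

text \<open>Both composites classify the same identity 2-cell.\<close>

lemma reflmap_reix:
  assumes "isty A" "arr f" "cd f = cx A"
  shows "idext f A \<odot> reflmap (reix f A) = reflmap A \<odot> fext f A"
  by (rule idcell_inj[OF assms(1)])
    (use assms idcell_idext[OF assms, of "reflmap (reix f A)"] idcell_reflmap_cmp[OF assms(1), of "fext f A"] in simp_all)

text \<open>Stability is assumed for \<open>idcell\<close> only. The contraction inherits it because
  it is determined by its projections, which are \<open>idcell\<close> and an identity.\<close>

lemma J_elim_reix:
  assumes "isty A" "isty C" "cx C = ext (idty A)" "gsection (reix (reflmap A) C) d"
    "arr f" "cd f = cx A"
  shows "elim (reflmap (reix f A)) (idtgt (reix f A)) (reflcell (reix f A))
      (reix (idext f A) C) (resec (fext f A) (reix (reflmap A) C) d) =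
    resec (idext f A) C (elim (reflmap A) (idtgt A) (reflcell A) C d)"
proof -
  let ?A = "reix f A"
  have A: "isty ?A" "cx ?A = dm f" using assms by simp_all
  note r = retraction_J[OF assms(1)] and r' = retraction_J[OF A(1)]
  note c = reflcell_facts[OF assms(1)] and c' = reflcell_facts[OF A(1)]
  note x = idext_simps[OF assms(1,5,6)] and st = idext_src_tgt[OF assms(1,5,6)]
  have F: "idext f A = flift f [idty A, wkself A, A]" by (simp add: idext_def)
  have w: "reix (fext f A) (reix (disp A) A) = reix (disp ?A) ?A" using assms by simp
  have t: "tproj M (dm f) (retel f [idty A, wkself A, A]) = disp ?A \<odot> idsrc ?A"
    using assms A idty_reix(1)[OF assms(1,5,6)] by (simp add: idsrc_def)
  have k: "idext f A \<rhd> reflcell ?A = reflcell A \<lhd> idext f A"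
  proof (rule idcell_cell_eqI[OF assms(1)])
    have "idsrc A \<rhd> idext f A \<rhd> reflcell ?A = (idsrc A \<odot> idext f A) \<rhd> reflcell ?A"
      by (rule base.hcmp_id2_merge(2)) (use assms(1) A x c' in simp_all)
    also have "\<dots> = fext f A \<rhd> (idsrc ?A \<rhd> reflcell ?A)"
      unfolding st by (rule base.hcmp_id2_merge(2)[symmetric]) (use assms A c' in simp_all)
    also have "\<dots> = idcell A \<lhd> idext f A" unfolding c'(4) by (rule idty_reix(2)[OF assms(1,5,6)])
    also have "\<dots> = (idsrc A \<rhd> reflcell A) \<lhd> idext f A" unfolding c(4) ..
    finally have s: "idsrc A \<rhd> idext f A \<rhd> reflcell ?A = (idsrc A \<rhd> reflcell A) \<lhd> idext f A" .
    then show "idsrc A \<rhd> idext f A \<rhd> reflcell ?A = idsrc A \<rhd> (reflcell A \<lhd> idext f A)"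
      using base.hcmp_assoc'[of "id2 (idext f A)" "reflcell A" "id2 (idsrc A)"] assms(1) x c(1-3) by simp
    have "disp A \<rhd> (idcell A \<lhd> idext f A) = (disp A \<rhd> idcell A) \<lhd> idext f A"
      by (rule base.hcmp_assoc'[symmetric]) (use assms(1) x in simp_all)
    then show "disp A \<rhd> idsrc A \<rhd> idext f A \<rhd> reflcell ?A =
        id2 (disp A \<odot> idsrc A \<odot> sr (idext f A \<rhd> reflcell ?A))"
      unfolding s c(4) using assms(1) A x c'(1-3) by simp
    have "idtgt A \<rhd> idext f A \<rhd> reflcell ?A = (idtgt A \<odot> idext f A) \<rhd> reflcell ?A"
      by (rule base.hcmp_id2_merge(2)) (use assms(1) A x c' in simp_all)
    also have "\<dots> = fext f A \<rhd> (idtgt ?A \<rhd> reflcell ?A)"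
      unfolding st by (rule base.hcmp_id2_merge(2)[symmetric]) (use assms A c' in simp_all)
    also have "\<dots> = id2 (idtgt A \<odot> idext f A)" unfolding c'(5) st using assms A by simp
    also have "\<dots> = (idtgt A \<rhd> reflcell A) \<lhd> idext f A" unfolding c(5) using assms(1) x by simp
    also have "\<dots> = idtgt A \<rhd> (reflcell A \<lhd> idext f A)"
      by (rule base.hcmp_assoc') (use assms(1) x c(1-3) in simp_all)
    finally show "idtgt A \<rhd> idext f A \<rhd> reflcell ?A = idtgt A \<rhd> (reflcell A \<lhd> idext f A)" .
    have "idext f A \<odot> reflmap ?A \<odot> idtgt ?A = (idext f A \<odot> reflmap ?A) \<odot> idtgt ?A"
      by (rule base.cmp_assoc'[symmetric]) (use x A in simp_all)
    also have "\<dots> = reflmap A \<odot> idtgt A \<odot> idext f A"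
      unfolding reflmap_reix[OF assms(1,5,6)] st using assms A by simp
    finally show "tg (idext f A \<rhd> reflcell ?A) = tg (reflcell A \<lhd> idext f A)"
      using assms(1) A x c(1-3) c'(1-3) by simp
  qed (use assms A x c(1-3) c'(1-3) in simp_all)
  \<comment> \<open>The contraction moves the source endpoint along \<open>idcell\<close>, so it is
    vertical over \<Gamma> although not over \<Gamma>.A.A; this is why stability of lifts is applied
    with a telescope of length three.\<close>
  have "disp ?A \<rhd> (idsrc ?A \<rhd> reflcell ?A) = (disp ?A \<odot> idsrc ?A) \<rhd> reflcell ?A"
    by (rule base.hcmp_id2_merge(2)) (use A c' in simp_all)
  then have tp: "(disp ?A \<odot> idsrc ?A) \<rhd> reflcell ?A = id2 (disp ?A \<odot> idsrc ?A)"
    unfolding c'(4) using A by simp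
  show ?thesis
    by (rule elim_reix[OF r r' assms(2) _ _ assms(5) _ _ F x(1) _ _ _ _ _ reflmap_reix[OF assms(1,5,6)] st(2) k])
      (use assms A tp x in \<open>simp_all add: t[unfolded wkself_def] del: tproj.simps retel.simps\<close>)
qed

lemma Jsec_reix:
  assumes "isty A" "isty C" "cx C = ext (idty A)" "gsection (reix (reflmap A) C) d"
    "gsection A a" "gsection A b" "gsection (IdT A a b) p" "arr f" "cd f = cx A"
  shows "reix f (reix (idmap A a b p) C) =
      reix (idmap (reix f A) (resec f A a) (resec f A b) (resec f (IdT A a b) p)) (reix (idext f A) C)"
    "resec f (reix (idmap A a b p) C) (Jsec A C d a b p) =
      Jsec (reix f A) (reix (idext f A) C) (resec (fext f A) (reix (reflmap A) C) d)
        (resec f A a) (resec f A b) (resec f (IdT A a b) p)"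
proof -
  let ?A = "reix f A" and ?a = "resec f A a" and ?b = "resec f A b" and ?p = "resec f (IdT A a b) p"
  let ?e = "elim (reflmap A) (idtgt A) (reflcell A) C d"
  have g: "gsection (IdT ?A ?a ?b) ?p"
    using resec_facts(1)[of f "IdT A a b" p] IdT_reix[OF assms(1,5,6,8,9)] assms by simp
  have i: "arr (idmap ?A ?a ?b ?p)" "cd (idmap ?A ?a ?b ?p) = ext (idty ?A)"
    using idmap_simps[OF _ _ _ g] assms by simp_all
  note n = idmap_reix[OF assms(1,5-9)]
  have e: "gsection C ?e" by (rule elim_section[OF retraction_J]) (use assms in simp_all)
  show "reix f (reix (idmap A a b p) C) = reix (idmap ?A ?a ?b ?p) (reix (idext f A) C)"
    using assms i n by simp
  have "resec f (reix (idmap A a b p) C) (Jsec A C d a b p) = resec (idmap A a b p \<odot> f) C ?e"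
    unfolding Jsec_def by (rule resec_cmp) (use assms e in simp_all)
  also have "\<dots> = resec (idmap ?A ?a ?b ?p) (reix (idext f A) C) (resec (idext f A) C ?e)"
    unfolding n[symmetric] by (rule resec_cmp[symmetric]) (use assms e i in simp_all)
  finally show "resec f (reix (idmap A a b p) C) (Jsec A C d a b p) =
      Jsec ?A (reix (idext f A) C) (resec (fext f A) (reix (reflmap A) C) d) ?a ?b ?p"
    unfolding Jsec_def J_elim_reix[OF assms(1-4,8,9)] .
qed

lemma Jmap_elim:
  assumes "isty A" "isty C" "cx C = ext (idty A)" "arr d" "dm d = ext A" "cd d = ext C"
    "disp C \<odot> d = reflmap A"
  shows "Jmap M A C d = elim (reflmap A) (idtgt A) (reflcell A) C (sec (reflmap A) C d)"
  using sec_facts(2)[of "reflmap A" C d] assms reflcell_facts[OF assms(1)]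
  by (simp add: Jmap_def canonical_filler_def elim_def fil_def)

text \<open>The generic eliminator or application, instantiated at \<open>c\<close>, is reindexed
  along \<open>f\<close> by going around the square \<open>F \<odot> c' = c \<odot> f\<close> the
  other way.\<close>

lemma resec_natural:
  assumes "isty C" "gsection C e" "arr c" "cd c = cx C" "arr f" "cd f = dm c"
    "arr F" "cd F = cx C" "arr c'" "cd c' = dm F" "F \<odot> c' = c \<odot> f"
  shows "reix f (reix c C) = reix c' (reix F C)"
    "resec f (reix c C) (resec c C e) = resec c' (reix F C) (resec F C e)"
  using assms by simp_all

subsection \<open>Units\<close>

lemma unty_simps [simp]:
  assumes "X \<in> Ob (base M)"
  shows "isty (unty X)" "cx (unty X) = X" "gsection (unty X) (unmap X)"
    "arr (unmap X)" "dm (unmap X) = X" "cd (unmap X) = ext (unty X)"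
    "disp (unty X) \<odot> unmap X = ide X"
proof -
  have "unty X \<in> fib M X \<and> gsection (unty X) (unmap X)"
    using units assms unfolding units_def by blast
  then have 1: "isty (unty X)" "cx (unty X) = X" "gsection (unty X) (unmap X)"
    by simp_all
  then show "isty (unty X)" "cx (unty X) = X" "gsection (unty X) (unmap X)"
    "arr (unmap X)" "dm (unmap X) = X" "cd (unmap X) = ext (unty X)"
    "disp (unty X) \<odot> unmap X = ide X"
    using gsectionD[OF 1(3)] by simp_all
qed

lemma unbar_simps:
  assumes "isty A" "gsection A a"
  shows "arr (unbar A a)" "dm (unbar A a) = ext (unty (cx A))" "cd (unbar A a) = ext A"
    "disp A \<odot> unbar A a = disp (unty (cx A))" "unbar A a \<odot> unmap (cx A) = a"
proof -
  have "\<forall>X A. A \<in> fib M X \<longrightarrow> (\<forall>f. gsection A f \<longrightarrow>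
           unbar A f \<in> hom (base M) (ext (unty X)) (ext A) \<and>
           disp A \<odot> unbar A f = disp (unty X) \<and> unbar A f \<odot> unmap X = f)"
    using units unfolding units_def by blast
  from this[rule_format, of A "cx A" a] show
    "arr (unbar A a)" "dm (unbar A a) = ext (unty (cx A))" "cd (unbar A a) = ext A"
    "disp A \<odot> unbar A a = disp (unty (cx A))" "unbar A a \<odot> unmap (cx A) = a"
    using assms by auto
qed

lemma unit_cell:
  assumes "isty A" "cx A = X" "arr h" "dm h = ext (unty X)" "cd h = ext A"
    "disp A \<odot> h = disp (unty X)" "arr k" "dm k = ext (unty X)" "cd k = ext A"
    "disp A \<odot> k = disp (unty X)" "cell \<alpha>" "sr \<alpha> = h \<odot> unmap X" "tg \<alpha> = k \<odot> unmap X"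
    "disp A \<rhd> \<alpha> = id2 (ide X)"
  shows "\<exists>!\<beta>. \<beta> \<in> cells (base M) h k \<and> disp A \<rhd> \<beta> = id2 (disp (unty X)) \<and> \<beta> \<lhd> unmap X = \<alpha>"
proof -
  have 1: "\<forall>X A. A \<in> fib M X \<longrightarrow>
        (\<forall>h k. h \<in> hom (base M) (ext (unty X)) (ext A) \<and> disp A \<odot> h = disp (unty X) \<and>
           k \<in> hom (base M) (ext (unty X)) (ext A) \<and> disp A \<odot> k = disp (unty X) \<longrightarrow>
           (\<forall>\<alpha> \<in> cells (base M) (h \<odot> unmap X) (k \<odot> unmap X).
              disp A \<rhd> \<alpha> = Id2 (base M) (ide X) \<longrightarrow>
              (\<exists>!\<beta>. \<beta> \<in> cells (base M) h k \<and> disp A \<rhd> \<beta> = Id2 (base M) (disp (unty X)) \<and>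
                   \<beta> \<lhd> unmap X = \<alpha>)))"
    using units unfolding units_def by blast
  show ?thesis
    by (rule 1[rule_format, of A X h k \<alpha>]) (use assms in simp_all)
qed

lemma unty_reix:
  assumes "arr f"
  shows "reix f (unty (cd f)) = unty (dm f)"
    "fext f (unty (cd f)) \<odot> unmap (dm f) = unmap (cd f) \<odot> f"
    "isty A \<Longrightarrow> cx A = cd f \<Longrightarrow> gsection A a \<Longrightarrow>
      fext f A \<odot> unbar (reix f A) (resec f A a) = unbar A a \<odot> fext f (unty (cd f))"
proof -
  have 1: "\<forall>X Y f. f \<in> hom (base M) X Y \<longrightarrow>
        reix f (unty Y) = unty X \<and>
        fext f (unty Y) \<odot> unmap X = unmap Y \<odot> f \<and>
        (\<forall>A a. A \<in> fib M Y \<and> gsection A a \<longrightarrow>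
           fext f A \<odot> unbar (reix f A) (resec f A a) = unbar A a \<odot> fext f (unty Y))"
    using units unfolding units_def by blast
  have f: "f \<in> hom (base M) (dm f) (cd f)" using assms by simp
  note 2 = 1[rule_format, OF f]
  show "reix f (unty (cd f)) = unty (dm f)"
    "fext f (unty (cd f)) \<odot> unmap (dm f) = unmap (cd f) \<odot> f" using 2 by blast+
  show "fext f A \<odot> unbar (reix f A) (resec f A a) = unbar A a \<odot> fext f (unty (cd f))"
    if "isty A" "cx A = cd f" "gsection A a" using 2 that by simp
qed

lemma unmap_reix:
  assumes "arr f"
  shows "resec f (unty (cd f)) (unmap (cd f)) = unmap (dm f)"
  unfolding resec_def
  by (rule sec_unique) (use assms unty_reix(1,2)[OF assms] in simp_all)

text \<open>The identity and \<open>unmap X \<odot> disp (unty X)\<close> agree at the unit element,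
  and the identity cell there extends uniquely.\<close>

lemma uncell_ex1:
  assumes "X \<in> Ob (base M)"
  shows "\<exists>!\<theta>. \<theta> \<in> cells (base M) (ide (ext (unty X))) (unmap X \<odot> disp (unty X)) \<and>
     disp (unty X) \<rhd> \<theta> = id2 (disp (unty X)) \<and> \<theta> \<lhd> unmap X = id2 (unmap X)"
proof (rule unit_cell)
  show "disp (unty X) \<odot> unmap X \<odot> disp (unty X) = disp (unty X)"
    using gsection_cmp[of "unty X" "unmap X" "disp (unty X)"] assms by simp
qed (use assms in simp_all)

lemmas uncell_facts = theI'[OF uncell_ex1, folded uncell_def]

lemma retraction_unit:
  assumes "X \<in> Ob (base M)"
  shows "retraction (unmap X) (disp (unty X)) (uncell X)"
  using uncell_facts[OF assms] assms by (simp add: retraction_def)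

text \<open>The contraction of the unit type is not among the data assumed stable. A cell with the
  required projections is built through the pullback, shown to be an identity at the unit element,
  and identified with \<open>uncell (dm f)\<close> by uniqueness.\<close>

lemma uncell_reix:
  assumes "arr f"
  shows "fext f (unty (cd f)) \<rhd> uncell (dm f) = uncell (cd f) \<lhd> fext f (unty (cd f))"
proof -
  let ?U = "unty (cd f)" and ?F = "fext f (unty (cd f))"
  have u: "reix f ?U = unty (dm f)" by (rule unty_reix(1)[OF assms])
  have F: "arr ?F" "dm ?F = ext (unty (dm f))" "cd ?F = ext ?U"
    "disp ?U \<odot> ?F = f \<odot> disp (unty (dm f))"
    using assms u by simp_all
  have X: "dm f \<in> Ob (base M)" "cd f \<in> Ob (base M)" using assms by simp_all
  note c = uncell_facts[OF X(2)]
  have nat: "?F \<odot> unmap (dm f) = unmap (cd f) \<odot> f" by (rule unty_reix(2)[OF assms])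
  have nat': "?F \<odot> unmap (dm f) \<odot> disp (unty (dm f)) = unmap (cd f) \<odot> f \<odot> disp (unty (dm f))"
  proof -
    have "(?F \<odot> unmap (dm f)) \<odot> disp (unty (dm f)) = ?F \<odot> unmap (dm f) \<odot> disp (unty (dm f))"
      by (rule base.cmp_assoc') (use F X in simp_all)
    then show ?thesis unfolding nat using F X assms by simp
  qed
  have dd: "disp (unty (dm f)) \<odot> unmap (dm f) \<odot> disp (unty (dm f)) = disp (unty (dm f))"
    using gsection_cmp[of "unty (dm f)" "unmap (dm f)" "disp (unty (dm f))"] X by simp
  have "disp ?U \<rhd> (uncell (cd f) \<lhd> ?F) = (disp ?U \<rhd> uncell (cd f)) \<lhd> ?F"
    by (rule base.hcmp_assoc'[symmetric]) (use c F X in simp_all)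
  then have over: "disp ?U \<rhd> (uncell (cd f) \<lhd> ?F) = id2 (f \<odot> disp (unty (dm f)))"
    using c F X by simp
  have "\<exists>!\<gamma>. \<gamma> \<in> cells (base M) (ide (ext (unty (dm f)))) (unmap (dm f) \<odot> disp (unty (dm f))) \<and>
      disp (reix f ?U) \<rhd> \<gamma> = id2 (disp (unty (dm f))) \<and> ?F \<rhd> \<gamma> = uncell (cd f) \<lhd> ?F"
    by (rule pullback_cell) (use assms u F X c over nat' dd in simp_all)
  then obtain \<gamma> where g: "cell \<gamma>" "sr \<gamma> = ide (ext (unty (dm f)))"
      "tg \<gamma> = unmap (dm f) \<odot> disp (unty (dm f))"
      "disp (unty (dm f)) \<rhd> \<gamma> = id2 (disp (unty (dm f)))" "?F \<rhd> \<gamma> = uncell (cd f) \<lhd> ?F"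
    unfolding u by auto
  \<comment> \<open>Checked on both pullback projections; on the second, naturality of the unit
    element moves the whiskering to \<open>uncell (cd f)\<close>.\<close>
  have "\<gamma> \<lhd> unmap (dm f) = id2 (unmap (dm f))"
  proof (rule pullback_cell_eqI[of f ?U])
    have "disp (unty (dm f)) \<rhd> (\<gamma> \<lhd> unmap (dm f)) = (disp (unty (dm f)) \<rhd> \<gamma>) \<lhd> unmap (dm f)"
      by (rule base.hcmp_assoc'[symmetric]) (use g(1-3) X in simp_all)
    then show "disp (reix f ?U) \<rhd> (\<gamma> \<lhd> unmap (dm f)) = disp (reix f ?U) \<rhd> id2 (unmap (dm f))"
      unfolding u g(4) using X by simp
    have "?F \<rhd> (\<gamma> \<lhd> unmap (dm f)) = (?F \<rhd> \<gamma>) \<lhd> unmap (dm f)"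
      by (rule base.hcmp_assoc'[symmetric]) (use g(1-3) X F in simp_all)
    also have "\<dots> = uncell (cd f) \<lhd> (?F \<odot> unmap (dm f))"
      unfolding g(5) using c X F by simp
    also have "\<dots> = (uncell (cd f) \<lhd> unmap (cd f)) \<lhd> f"
      unfolding nat using base.hcmp_assoc'[of "id2 f" "id2 (unmap (cd f))" "uncell (cd f)"] c X assms by simp
    also have "\<dots> = ?F \<rhd> id2 (unmap (dm f))" using c X F assms nat by simp
    finally show "?F \<rhd> (\<gamma> \<lhd> unmap (dm f)) = ?F \<rhd> id2 (unmap (dm f))" .
  qed (use assms u g(1-3) X dd in \<open>simp_all\<close>)
  then have "\<gamma> = uncell (dm f)"
    using uncell_ex1[OF X(1)] uncell_facts[OF X(1)] g(1-4) by auto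
  then show ?thesis using g(5) by simp
qed

text \<open>The context is recovered as the domain of the argument \<open>c\<close>.\<close>

definition Usec :: "'a \<Rightarrow> 'm \<Rightarrow> 'm \<Rightarrow> 'm" where
  "Usec C d c = (let X = dm c in
     resec c C (elim (unmap X) (disp (unty X)) (uncell X) C d))"

context
  fixes X C d
  assumes X: "X \<in> Ob (base M)" and C: "isty C" "cx C = ext (unty X)"
    and d: "gsection (reix (unmap X) C) d"
begin

lemma Umap_section: "gsection C (elim (unmap X) (disp (unty X)) (uncell X) C d)"
  by (rule elim_section[OF retraction_unit]) (use X C d in simp_all)

lemma Usec_section:
  assumes "gsection (unty X) c"
  shows "gsection (reix c C) (Usec C d c)"
  using gsectionD[OF assms] X C Umap_section by (simp add: Usec_def)

lemma Usec_comp: "Usec C d (unmap X) = d"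
  using elim_comp(2)[OF retraction_unit] X C d by (simp add: Usec_def)

lemma U_elim_reix:
  assumes "arr f" "cd f = X"
  shows "elim (unmap (dm f)) (disp (unty (dm f))) (uncell (dm f))
      (reix (fext f (unty X)) C) (resec f (reix (unmap X) C) d) =
    resec (fext f (unty X)) C (elim (unmap X) (disp (unty X)) (uncell X) C d)"
proof -
  have Y: "dm f \<in> Ob (base M)" using assms by simp
  note u = unty_reix(1,2)[OF assms(1), unfolded assms(2)]
  note c = uncell_facts[OF Y]
  show ?thesis
    by (rule elim_reix[OF retraction_unit[OF X] retraction_unit[OF Y] C(1), where f = f and Ds = "[unty X]"])
      (use X Y C d assms u c uncell_reix[OF assms(1)] in \<open>simp_all\<close>)
qed

lemma Usec_reix:
  assumes "gsection (unty X) c" "arr f" "cd f = X"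
  shows "reix f (reix c C) = reix (resec f (unty X) c) (reix (fext f (unty X)) C)"
    "resec f (reix c C) (Usec C d c) =
      Usec (reix (fext f (unty X)) C) (resec f (reix (unmap X) C) d) (resec f (unty X) c)"
proof -
  note c = gsectionD[OF assms(1)] and u = unty_reix(1)[OF assms(2), unfolded assms(3)]
  note n = resec_natural[OF C(1) Umap_section, of c f "fext f (unty X)" "resec f (unty X) c"]
  show "reix f (reix c C) = reix (resec f (unty X) c) (reix (fext f (unty X)) C)"
    by (rule n(1)) (use X C assms c in simp_all)
  have "resec f (reix c C) (resec c C (elim (unmap X) (disp (unty X)) (uncell X) C d)) =
    resec (resec f (unty X) c) (reix (fext f (unty X)) C)
      (resec (fext f (unty X)) C (elim (unmap X) (disp (unty X)) (uncell X) C d))"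
    by (rule n(2)) (use X C assms c in simp_all)
  then show "resec f (reix c C) (Usec C d c) =
      Usec (reix (fext f (unty X)) C) (resec f (reix (unmap X) C) d) (resec f (unty X) c)"
    unfolding Usec_def Let_def using c X U_elim_reix[OF assms(2,3)] assms by simp
qed

end

lemma Umap_elim:
  assumes "X \<in> Ob (base M)" "isty C" "cx C = ext (unty X)" "arr d" "dm d = X" "cd d = ext C"
    "disp C \<odot> d = unmap X"
  shows "Umap M X C d = elim (unmap X) (disp (unty X)) (uncell X) C (sec (unmap X) C d)"
  using sec_facts(2)[of "unmap X" C d] assms uncell_facts[OF assms(1)]
  by (simp add: Umap_def canonical_filler_def elim_def fil_def)

subsection \<open>Reindexing fibre maps\<close>

lemma fhom_iff [simp]:
  "h \<in> fhom X A B \<longleftrightarrow> h \<in> Arr (fam M) \<and> Dom (fam M) h = A \<and> Cod (fam M) h = B \<and> F1 (proj M) h = ide X"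
  by (auto simp: fhom_def)

text \<open>The chosen lift at \<open>B\<close> is cartesian, so \<open>h\<close> composed with the
  lift at \<open>A\<close> factors through it uniquely over an identity.\<close>

lemma reix1_ex1:
  assumes "h \<in> fhom X A B" "cx A = X" "cx B = X" "arr f" "cd f = X"
  shows "\<exists>!h'. h' \<in> fhom (dm f) (reix f A) (reix f B) \<and> clift f B \<odot>\<^sub>T h' = h \<odot>\<^sub>T clift f A"
proof -
  have AB: "isty A" "isty B" using assms(1) fam.dom_ob fam.cod_ob by auto
  have fAB: "cd f = cx A" "cd f = cx B" using assms by simp_all
  note a = clift_facts[OF assms(4) AB(1) fAB(1)] and b = clift_facts[OF assms(4) AB(2) fAB(2)]
  let ?g = "h \<odot>\<^sub>T clift f A"
  have g: "?g \<in> Arr (fam M)" "Dom (fam M) ?g = reix f A" "Cod (fam M) ?g = B"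
    using a(2-4) assms by simp_all
  have "F1 (proj M) ?g = F1 (proj M) h \<odot> f"
    using proj.fun_cmp[of "clift f A" "reix f A" A h B] a(2-5) assms by simp
  then have pg: "F1 (proj M) ?g = f" using assms by simp
  have "\<forall>g w. g \<in> Arr (fam M) \<and> Cod (fam M) g = Cod (fam M) (clift f B) \<and>
        w \<in> hom (base M) (cx (Dom (fam M) g)) (cx (Dom (fam M) (clift f B))) \<and>
        F1 (proj M) (clift f B) \<odot> w = F1 (proj M) g \<longrightarrow>
        (\<exists>!h. h \<in> hom (fam M) (Dom (fam M) g) (Dom (fam M) (clift f B)) \<and> clift f B \<odot>\<^sub>T h = g \<and> F1 (proj M) h = w)"
    using b(1) assms unfolding cartesian_def by blast
  from this[rule_format, of ?g "ide (dm f)"]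
  have "\<exists>!h. h \<in> hom (fam M) (reix f A) (reix f B) \<and> clift f B \<odot>\<^sub>T h = ?g \<and> F1 (proj M) h = ide (dm f)"
    unfolding g pg b(3-5) using g(1) assms(2-5) AB by simp
  then show ?thesis unfolding fhom_iff hom_iff by (simp add: conj_ac)
qed

lemma reix1_facts:
  assumes "h \<in> fhom X A B" "cx A = X" "cx B = X" "arr f" "cd f = X"
  shows "reix1 f h \<in> fhom (dm f) (reix f A) (reix f B)"
    "clift f B \<odot>\<^sub>T reix1 f h = h \<odot>\<^sub>T clift f A"
    "fext f B \<odot> upper (reix1 f h) = upper h \<odot> fext f A"
proof -
  have AB: "isty A" "isty B" using assms(1) fam.dom_ob fam.cod_ob by auto
  have fAB: "cd f = cx A" "cd f = cx B" using assms by simp_all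
  note a = clift_facts[OF assms(4) AB(1) fAB(1)] and b = clift_facts[OF assms(4) AB(2) fAB(2)]
  have d: "Dom (fam M) h = A" "Cod (fam M) h = B" using assms(1) by simp_all
  have 1: "reix1 f h \<in> fhom (dm f) (reix f A) (reix f B) \<and> clift f B \<odot>\<^sub>T reix1 f h = h \<odot>\<^sub>T clift f A"
    unfolding reix1_def d by (rule theI'[OF reix1_ex1[OF assms]])
  then show r: "reix1 f h \<in> fhom (dm f) (reix f A) (reix f B)"
    and e: "clift f B \<odot>\<^sub>T reix1 f h = h \<odot>\<^sub>T clift f A" by blast+
  have "upper (clift f B \<odot>\<^sub>T reix1 f h) = upper (clift f B) \<odot> upper (reix1 f h)"
    by (rule upper_cmp) (use r b(2-4) assms(2-5) in simp_all)
  moreover have "upper (h \<odot>\<^sub>T clift f A) = upper h \<odot> upper (clift f A)"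
    by (rule upper_cmp) (use a(2-4) assms in simp_all)
  ultimately show "fext f B \<odot> upper (reix1 f h) = upper h \<odot> fext f A"
    unfolding e a(6) b(6) by simp
qed

lemma upper_fhom:
  assumes "h \<in> fhom X A B" "cx A = X" "cx B = X"
  shows "arr (upper h)" "dm (upper h) = ext A" "cd (upper h) = ext B"
    "disp B \<odot> upper h = disp A"
proof -
  have AB: "isty A" using assms(1) fam.dom_ob by auto
  have h: "h \<in> Arr (fam M)" "Dom (fam M) h = A" "Cod (fam M) h = B" "F1 (proj M) h = ide X"
    using assms(1) by simp_all
  show "arr (upper h)" "dm (upper h) = ext A" "cd (upper h) = ext B"
    "disp B \<odot> upper h = disp A"
    using upper_simps[OF h(1), unfolded h(2-4)] assms(2) AB by simp_all
qed

subsection \<open>Sums\<close>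

lemma sigty_facts:
  assumes "isty A" "isty B" "cx B = ext A"
  shows "isty (sigty A B)" "cx (sigty A B) = cx A"
    "sigunit A B \<in> fhom (ext A) B (reix (disp A) (sigty A B))"
    "injective_equivalence (slice (base M) (cx A))
          (disp A \<odot> disp B, disp (sigty A B), sigin A B)
          (disp (sigty A B), disp A \<odot> disp B, sigret A B)
          (disp (sigty A B), disp (sigty A B), sigcell A B)"
proof -
  have 1: "\<forall>X A B. A \<in> fib M X \<and> B \<in> fib M (ext A) \<longrightarrow>
        sigty A B \<in> fib M X \<and>
        sigunit A B \<in> fhom (ext A) B (reix (disp A) (sigty A B)) \<and>
        injective_equivalence (slice (base M) X)
          (disp A \<odot> disp B, disp (sigty A B), sigin A B)
          (disp (sigty A B), disp A \<odot> disp B, sigret A B)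
          (disp (sigty A B), disp (sigty A B), sigcell A B)"
    using sums unfolding sums_def by blast
  have AB: "A \<in> fib M (cx A) \<and> B \<in> fib M (ext A)" using assms by simp
  note 2 = 1[rule_format, OF AB]
  from 2 have "sigty A B \<in> fib M (cx A)" by blast
  then show "isty (sigty A B)" "cx (sigty A B) = cx A" by simp_all
  show "sigunit A B \<in> fhom (ext A) B (reix (disp A) (sigty A B))" using 2 by blast
  show "injective_equivalence (slice (base M) (cx A))
          (disp A \<odot> disp B, disp (sigty A B), sigin A B)
          (disp (sigty A B), disp A \<odot> disp B, sigret A B)
          (disp (sigty A B), disp (sigty A B), sigcell A B)" using 2 by blast
qed

lemmas sigty_simps [simp] = sigty_facts(1,2)

lemma sigin_simps [simp]:
  assumes "isty A" "isty B" "cx B = ext A"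
  shows "arr (sigin A B)" "dm (sigin A B) = ext B" "cd (sigin A B) = ext (sigty A B)"
    "disp (sigty A B) \<odot> sigin A B = disp A \<odot> disp B"
    "arr h \<Longrightarrow> cd h = ext B \<Longrightarrow> disp (sigty A B) \<odot> sigin A B \<odot> h = disp A \<odot> disp B \<odot> h"
proof -
  note u = upper_fhom[OF sigty_facts(3)[OF assms]]
  show 1: "arr (sigin A B)" "dm (sigin A B) = ext B" "cd (sigin A B) = ext (sigty A B)"
    and 2: "disp (sigty A B) \<odot> sigin A B = disp A \<odot> disp B"
    using u assms by (simp_all add: sigin_def)
  assume h: "arr h" "cd h = ext B"
  have "(disp (sigty A B) \<odot> sigin A B) \<odot> h = disp (sigty A B) \<odot> sigin A B \<odot> h"
    by (rule base.cmp_assoc') (use 1 h assms in simp_all)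
  then show "disp (sigty A B) \<odot> sigin A B \<odot> h = disp A \<odot> disp B \<odot> h"
    unfolding 2 using h assms by simp
qed

lemma retraction_sum:
  assumes "isty A" "isty B" "cx B = ext A"
  shows "retraction (sigin A B) (sigret A B) (sigcell A B)"
    "disp (sigty A B) \<rhd> sigcell A B = id2 (disp (sigty A B))"
proof -
  note i = sigty_facts(4)[OF assms]
  show "disp (sigty A B) \<rhd> sigcell A B = id2 (disp (sigty A B))"
    using i assms unfolding injective_equivalence_def slice_def Let_def by simp
  show "retraction (sigin A B) (sigret A B) (sigcell A B)"
    using i assms unfolding injective_equivalence_def slice_def Let_def retraction_def by auto
qed

text \<open>The second equation is the one without its own axiom: it combines stability of
  \<open>sigunit\<close> with functoriality of reindexing, because \<open>sigin\<close> is the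
  transpose of \<open>sigunit\<close>.\<close>

lemma sigty_reix:
  assumes "isty A" "isty B" "cx B = ext A" "arr f" "cd f = cx A"
  shows "reix f (sigty A B) = sigty (reix f A) (reix (fext f A) B)"
    "fext f (sigty A B) \<odot> sigin (reix f A) (reix (fext f A) B) =
       sigin A B \<odot> fext (fext f A) B"
    "fext (fext f A) B \<odot> sigret (reix f A) (reix (fext f A) B) =
       sigret A B \<odot> fext f (sigty A B)"
    "fext f (sigty A B) \<rhd> sigcell (reix f A) (reix (fext f A) B) =
       sigcell A B \<lhd> fext f (sigty A B)"
proof -
  let ?A = "reix f A" and ?B = "reix (fext f A) B" and ?S = "sigty A B"
  have 1: "\<forall>X Y f A B. f \<in> hom (base M) X Y \<and> A \<in> fib M Y \<and> B \<in> fib M (ext A) \<longrightarrow>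
      reix f (sigty A B) = sigty (reix f A) (reix (fext f A) B) \<and>
      reix1 (fext f A) (sigunit A B) = sigunit (reix f A) (reix (fext f A) B) \<and>
      flift f [B, A] \<odot> sigret (reix f A) (reix (fext f A) B) = sigret A B \<odot> fext f (sigty A B) \<and>
      fext f (sigty A B) \<rhd> sigcell (reix f A) (reix (fext f A) B) = sigcell A B \<lhd> fext f (sigty A B)"
    using sums unfolding sums_def Let_def by blast
  have AB: "f \<in> hom (base M) (dm f) (cx A) \<and> A \<in> fib M (cx A) \<and> B \<in> fib M (ext A)" using assms by simp
  note 2 = 1[rule_format, OF AB, unfolded flift.simps]
  show e: "reix f ?S = sigty ?A ?B"
    and "fext (fext f A) B \<odot> sigret ?A ?B = sigret A B \<odot> fext f ?S"
    and "fext f ?S \<rhd> sigcell ?A ?B = sigcell A B \<lhd> fext f ?S" using 2 by blast+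
  have u: "reix1 (fext f A) (sigunit A B) = sigunit ?A ?B" using 2 by blast
  note h = sigty_facts(3)[OF assms(1-3)]
  note r = reix1_facts(3)[OF h _ _ reix_simps(3)[OF assms(4,1,5)], unfolded u]
  note U = upper_fhom[OF h] and U' = upper_fhom[OF sigty_facts(3)[of ?A ?B]]
  have "fext f ?S \<odot> sigin ?A ?B = fext f ?S \<odot> fext (disp ?A) (reix f ?S) \<odot> upper (sigunit ?A ?B)"
    unfolding sigin_def e ..
  also have "\<dots> = fext (f \<odot> disp ?A) ?S \<odot> upper (sigunit ?A ?B)"
    by (rule reix_cmp(3)) (use assms U' e[symmetric] in simp_all)
  also have "\<dots> = fext (disp A \<odot> fext f A) ?S \<odot> upper (sigunit ?A ?B)"
    using assms by simp
  also have "\<dots> = fext (disp A) ?S \<odot> fext (fext f A) (reix (disp A) ?S) \<odot> upper (sigunit ?A ?B)"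
    by (rule reix_cmp(3)[symmetric]) (use assms U' e[symmetric] in simp_all)
  also have "fext (fext f A) (reix (disp A) ?S) \<odot> upper (sigunit ?A ?B) =
      upper (sigunit A B) \<odot> fext (fext f A) B"
    by (rule r) (use assms in simp_all)
  also have "fext (disp A) ?S \<odot> upper (sigunit A B) \<odot> fext (fext f A) B =
      sigin A B \<odot> fext (fext f A) B"
    unfolding sigin_def by (rule base.cmp_assoc'[symmetric]) (use assms U in simp_all)
  finally show "fext f ?S \<odot> sigin ?A ?B = sigin A B \<odot> fext (fext f A) B" .
qed

text \<open>\<open>fext a B \<odot> b\<close> is the map from \<Gamma> to \<Gamma>.A.B naming
  \<open>a\<close> and \<open>b\<close>; semantic pairing is applied after it.\<close>

definition pairsec :: "'a \<Rightarrow> 'a \<Rightarrow> 'm \<Rightarrow> 'm \<Rightarrow> 'm" where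
  "pairsec A B a b = sigin A B \<odot> fext a B \<odot> b"

lemma pairsec_section:
  assumes "isty A" "isty B" "cx B = ext A" "gsection A a" "gsection (reix a B) b"
  shows "gsection (sigty A B) (pairsec A B a b)"
  using gsectionD[OF assms(4)] gsectionD[OF assms(5)] assms(1-3)
  by (simp add: gsection_iff pairsec_def)

lemma pairsec_reix:
  assumes "isty A" "isty B" "cx B = ext A" "gsection A a" "gsection (reix a B) b"
    "arr f" "cd f = cx A"
  shows "resec f (sigty A B) (pairsec A B a b) =
    pairsec (reix f A) (reix (fext f A) B) (resec f A a) (resec f (reix a B) b)"
    "reix f (reix a B) = reix (resec f A a) (reix (fext f A) B)"
proof -
  let ?A = "reix f A" and ?B = "reix (fext f A) B" and ?S = "sigty A B"
    and ?a = "resec f A a" and ?b = "resec f (reix a B) b"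
  note a = gsectionD[OF assms(4)] and b = gsectionD[OF assms(5)]
  show e: "reix f (reix a B) = reix ?a ?B" using assms a by simp
  have B: "gsection (reix ?a ?B) ?b"
    unfolding e[symmetric] by (rule resec_facts(1)) (use assms a in simp_all)
  note bd = gsectionD[OF B]
  have ab: "isty ?A" "isty ?B" "cx ?B = ext ?A" "gsection ?A ?a" using assms by simp_all
  note s = sigty_reix[OF assms(1-3,6,7)]
  have ee: "arr (fext ?a ?B \<odot> ?b)" "cd (fext ?a ?B \<odot> ?b) = ext ?B"
    using ab bd gsectionD[OF ab(4)] by simp_all
  have "fext f ?S \<odot> pairsec ?A ?B ?a ?b = (fext f ?S \<odot> sigin ?A ?B) \<odot> fext ?a ?B \<odot> ?b"
    unfolding pairsec_def by (rule base.cmp_assoc'[symmetric]) (use ab ee s(1) assms in simp_all)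
  also have "\<dots> = sigin A B \<odot> fext (fext f A) B \<odot> fext ?a ?B \<odot> ?b"
    unfolding s(2) by (rule base.cmp_assoc') (use ab ee assms in simp_all)
  also have "fext (fext f A) B \<odot> fext ?a ?B \<odot> ?b = fext (a \<odot> f) B \<odot> ?b"
    using assms a bd by simp
  also have "\<dots> = fext a B \<odot> fext f (reix a B) \<odot> ?b"
    by (rule reix_cmp(3)[symmetric]) (use assms a in simp_all)
  also have "\<dots> = fext a B \<odot> b \<odot> f" using assms a by simp
  finally have "fext f ?S \<odot> pairsec ?A ?B ?a ?b = pairsec A B a b \<odot> f"
    using assms a b by (simp add: pairsec_def)
  then show "resec f ?S (pairsec A B a b) = pairsec ?A ?B ?a ?b"
    unfolding resec_def[of M f ?S] by (intro sec_unique) (use assms s(1) pairsec_section[OF ab B] in simp_all)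
qed

definition Esec :: "'a \<Rightarrow> 'a \<Rightarrow> 'a \<Rightarrow> 'm \<Rightarrow> 'm \<Rightarrow> 'm" where
  "Esec A B C d c = resec c C (elim (sigin A B) (sigret A B) (sigcell A B) C d)"

context
  fixes A B C d
  assumes A: "isty A" and B: "isty B" "cx B = ext A"
    and C: "isty C" "cx C = ext (sigty A B)"
    and d: "gsection (reix (sigin A B) C) d"
begin

lemma Emap_section: "gsection C (elim (sigin A B) (sigret A B) (sigcell A B) C d)"
  by (rule elim_section[OF retraction_sum(1)]) (use A B C d in simp_all)

lemma Esec_section:
  assumes "gsection (sigty A B) c"
  shows "gsection (reix c C) (Esec A B C d c)"
  using gsectionD[OF assms] A B C Emap_section by (simp add: Esec_def)

text \<open>The pair factors through \<open>sigin A B\<close>, along which the eliminator restricts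
  to its branch. What remains is the branch instantiated at the two components.\<close>

lemma Esec_comp:
  assumes "gsection A a" "gsection (reix a B) b"
  shows "reix (pairsec A B a b) C = reix (fext a B \<odot> b) (reix (sigin A B) C)"
    "Esec A B C d (pairsec A B a b) = resec (fext a B \<odot> b) (reix (sigin A B) C) d"
proof -
  note a = gsectionD[OF assms(1)] and b = gsectionD[OF assms(2)]
  let ?e = "elim (sigin A B) (sigret A B) (sigcell A B) C d"
  show "reix (pairsec A B a b) C = reix (fext a B \<odot> b) (reix (sigin A B) C)"
    using A B C a b by (simp add: pairsec_def)
  have c: "resec (sigin A B) C ?e = d"
    by (rule elim_comp(2)[OF retraction_sum(1)]) (use A B C d in simp_all)
  have "Esec A B C d (pairsec A B a b) =
      resec (fext a B \<odot> b) (reix (sigin A B) C) (resec (sigin A B) C ?e)"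
    unfolding Esec_def pairsec_def
    by (rule resec_cmp[symmetric]) (use A B C a b Emap_section in simp_all)
  then show "Esec A B C d (pairsec A B a b) = resec (fext a B \<odot> b) (reix (sigin A B) C) d"
    unfolding c .
qed

lemma E_elim_reix:
  assumes f: "arr f" "cd f = cx A"
  shows "elim (sigin (reix f A) (reix (fext f A) B)) (sigret (reix f A) (reix (fext f A) B))
      (sigcell (reix f A) (reix (fext f A) B)) (reix (fext f (sigty A B)) C)
      (resec (fext (fext f A) B) (reix (sigin A B) C) d) =
    resec (fext f (sigty A B)) C (elim (sigin A B) (sigret A B) (sigcell A B) C d)"
proof -
  let ?A = "reix f A" and ?B = "reix (fext f A) B" and ?S = "sigty A B"
  have ab: "isty ?A" "isty ?B" "cx ?B = ext ?A" using A B f by simp_all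
  note s = sigty_reix[OF A B f]
  note r' = retraction_sum[OF ab]
  show ?thesis
    by (rule elim_reix[OF retraction_sum(1)[OF A B] r'(1) C(1), where f = f and Ds = "[?S]"])
      (use A B C d f ab s r'(2) in simp_all)
qed

lemma Esec_reix:
  assumes "gsection (sigty A B) c" "arr f" "cd f = cx A"
  shows "reix f (reix c C) = reix (resec f (sigty A B) c) (reix (fext f (sigty A B)) C)"
    "resec f (reix c C) (Esec A B C d c) =
      Esec (reix f A) (reix (fext f A) B) (reix (fext f (sigty A B)) C)
        (resec (fext (fext f A) B) (reix (sigin A B) C) d) (resec f (sigty A B) c)"
proof -
  note c = gsectionD[OF assms(1)]
  note n = resec_natural[OF C(1) Emap_section, of c f "fext f (sigty A B)" "resec f (sigty A B) c"]
  show "reix f (reix c C) = reix (resec f (sigty A B) c) (reix (fext f (sigty A B)) C)"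
    by (rule n(1)) (use A B C assms c in simp_all)
  have "resec f (reix c C) (resec c C (elim (sigin A B) (sigret A B) (sigcell A B) C d)) =
    resec (resec f (sigty A B) c) (reix (fext f (sigty A B)) C)
      (resec (fext f (sigty A B)) C (elim (sigin A B) (sigret A B) (sigcell A B) C d))"
    by (rule n(2)) (use A B C assms c in simp_all)
  then show "resec f (reix c C) (Esec A B C d c) =
      Esec (reix f A) (reix (fext f A) B) (reix (fext f (sigty A B)) C)
        (resec (fext (fext f A) B) (reix (sigin A B) C) d) (resec f (sigty A B) c)"
    unfolding Esec_def E_elim_reix[OF assms(2,3)] .
qed

end

lemma Emap_elim:
  assumes "isty A" "isty B" "cx B = ext A" "isty C" "cx C = ext (sigty A B)"
    "arr d" "dm d = ext B" "cd d = ext C" "disp C \<odot> d = sigin A B"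
  shows "Emap M A B C d =
    elim (sigin A B) (sigret A B) (sigcell A B) C (sec (sigin A B) C d)"
  using sec_facts(2)[of "sigin A B" C d] assms retractionD[OF retraction_sum(1)[OF assms(1-3)]]
  by (simp add: Emap_def canonical_filler_def elim_def fil_def)

section \<open>Products\<close>

lemma fcells_iff [simp]:
  "\<alpha> \<in> fcells X h k \<longleftrightarrow> \<alpha> \<in> Cell (fam M) \<and> Src (fam M) \<alpha> = h \<and> Tgt (fam M) \<alpha> = k \<and>
     F2 (proj M) \<alpha> = id2 (ide X)"
  by (auto simp: fcells_def)

text \<open>Lifting of 2-cells through cartesian maps gives a unique candidate. Its two ends satisfy
  the equations that characterise \<open>reix1 f h\<close> and \<open>reix1 f k\<close>, so it has
  the ends that the definite description in \<open>reix2\<close> asks for.\<close>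

lemma reix2_facts:
  assumes "\<alpha> \<in> fcells X h k" "h \<in> fhom X A B" "k \<in> fhom X A B" "cx A = X" "cx B = X"
    "arr f" "cd f = X"
  shows "reix2 f \<alpha> \<in> fcells (dm f) (reix1 f h) (reix1 f k)"
    "fext f B \<rhd> upper2 (reix2 f \<alpha>) = upper2 \<alpha> \<lhd> fext f A"
proof -
  have AB: "isty A" "isty B" using assms(2) fam.dom_ob fam.cod_ob by auto
  have fAB: "cd f = cx A" "cd f = cx B" using assms by simp_all
  note a = clift_facts[OF assms(6) AB(1) fAB(1)] and b = clift_facts[OF assms(6) AB(2) fAB(2)]
  note H = reix1_facts[OF assms(2,4-7)] and K = reix1_facts[OF assms(3,4-7)]
  have \<alpha>: "\<alpha> \<in> Cell (fam M)" "Src (fam M) \<alpha> = h" "Tgt (fam M) \<alpha> = k" "F2 (proj M) \<alpha> = id2 (ide X)"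
    using assms(1) by simp_all
  have h: "h \<in> Arr (fam M)" "Dom (fam M) h = A" "Cod (fam M) h = B"
    and k: "k \<in> Arr (fam M)" "Dom (fam M) k = A" "Cod (fam M) k = B" using assms(2,3) by simp_all
  have Y: "dm f \<in> Ob (base M)" using assms(6) by simp
  let ?w = "\<alpha> \<lhd>\<^sub>T clift f A" and ?g = "id2 (ide (dm f))"
  have w: "?w \<in> Cell (fam M)" "Src (fam M) ?w = h \<odot>\<^sub>T clift f A" "Tgt (fam M) ?w = k \<odot>\<^sub>T clift f A"
    using \<alpha> h k a(2-4) by simp_all
  have "F2 (proj M) ?w = HCmp (base M) (F2 (proj M) \<alpha>) (F2 (proj M) (Id2 (fam M) (clift f A)))"
    by (rule proj.fun_hcmp[of _ "clift f A" "clift f A" _ h k]) (use \<alpha> h a(2-4) in simp_all)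
  then have pw: "F2 (proj M) ?w = f \<rhd> ?g"
    unfolding \<alpha>(4) proj.fun_id2[OF a(2)] a(5) using assms(6,7) by simp
  have "\<forall>f \<alpha> \<gamma>. cartesian (fam M) (base M) (proj M) f \<and> \<alpha> \<in> Cell (fam M) \<and>
        Cod (fam M) (Src (fam M) \<alpha>) = Cod (fam M) f \<and> \<gamma> \<in> Cell (base M) \<and>
        cd (sr \<gamma>) = cx (Dom (fam M) f) \<and> F2 (proj M) \<alpha> = F1 (proj M) f \<rhd> \<gamma> \<longrightarrow>
        (\<exists>!\<beta>. \<beta> \<in> Cell (fam M) \<and> Cod (fam M) (Src (fam M) \<beta>) = Dom (fam M) f \<and>
             f \<rhd>\<^sub>T \<beta> = \<alpha> \<and> F2 (proj M) \<beta> = \<gamma>)"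
    using fibred unfolding fibred_def cartesian_cells_def by blast
  from this[rule_format, of "clift f B" ?w ?g, unfolded b(3-5)]
  have u: "\<exists>!\<beta>. \<beta> \<in> Cell (fam M) \<and> Cod (fam M) (Src (fam M) \<beta>) = reix f B \<and>
      clift f B \<rhd>\<^sub>T \<beta> = ?w \<and> F2 (proj M) \<beta> = ?g"
    using b(1) w pw h a(2-4) AB fAB assms(6) Y by simp
  then obtain \<beta> where be: "\<beta> \<in> Cell (fam M)" "Cod (fam M) (Src (fam M) \<beta>) = reix f B"
      "clift f B \<rhd>\<^sub>T \<beta> = ?w" "F2 (proj M) \<beta> = ?g" by blast
  have s: "clift f B \<odot>\<^sub>T Src (fam M) \<beta> = h \<odot>\<^sub>T clift f A"
    using arg_cong[OF be(3), of "Src (fam M)"] be(1,2) b(2,3) w by simp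
  have t: "clift f B \<odot>\<^sub>T Tgt (fam M) \<beta> = k \<odot>\<^sub>T clift f A"
    using arg_cong[OF be(3), of "Tgt (fam M)"] be(1,2) b(2,3) w by simp
  have d: "Dom (fam M) (Src (fam M) \<beta>) = reix f A"
    using arg_cong[OF s, of "Dom (fam M)"] be(1,2) b(2,3) a(2-4) h by simp
  have ps: "F1 (proj M) (Src (fam M) \<beta>) = ide (dm f)" "F1 (proj M) (Tgt (fam M) \<beta>) = ide (dm f)"
    unfolding proj_cell(2,3)[OF be(1), symmetric] be(4) using Y by simp_all
  have "Src (fam M) \<beta> \<in> fhom (dm f) (reix f A) (reix f B) \<and> clift f B \<odot>\<^sub>T Src (fam M) \<beta> = h \<odot>\<^sub>T clift f A"
    using be(1,2) d ps s by simp
  then have sb: "Src (fam M) \<beta> = reix1 f h"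
    using reix1_ex1[OF assms(2,4-7)] H(1,2) by blast
  have "Tgt (fam M) \<beta> \<in> fhom (dm f) (reix f A) (reix f B) \<and> clift f B \<odot>\<^sub>T Tgt (fam M) \<beta> = k \<odot>\<^sub>T clift f A"
    using be(1,2) d ps t by simp
  then have tb: "Tgt (fam M) \<beta> = reix1 f k"
    using reix1_ex1[OF assms(3,4-7)] K(1,2) by blast
  let ?P = "\<lambda>\<beta>. \<beta> \<in> fcells (dm f) (reix1 f h) (reix1 f k) \<and> clift f B \<rhd>\<^sub>T \<beta> = ?w"
  have P: "?P \<beta>" using be sb tb by simp
  have "?P (THE \<beta>. ?P \<beta>)"
  proof (rule theI[of ?P, OF P])
    fix \<gamma> assume g: "?P \<gamma>"
    have "Cod (fam M) (reix1 f h) = reix f B" using H(1) by simp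
    then have "\<gamma> \<in> Cell (fam M) \<and> Cod (fam M) (Src (fam M) \<gamma>) = reix f B \<and>
        clift f B \<rhd>\<^sub>T \<gamma> = ?w \<and> F2 (proj M) \<gamma> = ?g"
      using g by auto
    then show "\<gamma> = \<beta>" using u be by blast
  qed
  then have R: "?P (reix2 f \<alpha>)" unfolding reix2_def Let_def \<alpha>(2,3) h(2,3) .
  then show "reix2 f \<alpha> \<in> fcells (dm f) (reix1 f h) (reix1 f k)" by blast
  have r: "reix2 f \<alpha> \<in> Cell (fam M)" "Src (fam M) (reix2 f \<alpha>) = reix1 f h" using R by simp_all
  have "upper2 (clift f B \<rhd>\<^sub>T reix2 f \<alpha>) = upper2 (Id2 (fam M) (clift f B)) \<star>\<^bsub>base M\<^esub> upper2 (reix2 f \<alpha>)"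
    by (rule upper2_hcmp) (use r b(2-4) H(1) in simp_all)
  moreover have "upper2 ?w = upper2 \<alpha> \<star>\<^bsub>base M\<^esub> upper2 (Id2 (fam M) (clift f A))"
    by (rule upper2_hcmp) (use \<alpha> h a(2-4) in simp_all)
  moreover have "clift f B \<rhd>\<^sub>T reix2 f \<alpha> = ?w" using R by blast
  ultimately show "fext f B \<rhd> upper2 (reix2 f \<alpha>) = upper2 \<alpha> \<lhd> fext f A"
    using a(2,6) b(2,6) by (simp add: upper2_id2)
qed

lemma upper2_fcells:
  assumes "\<alpha> \<in> fcells X h k" "h \<in> fhom X A B" "cx A = X" "X \<in> Ob (base M)"
  shows "cell (upper2 \<alpha>)" "sr (upper2 \<alpha>) = upper h" "tg (upper2 \<alpha>) = upper k"
    "disp B \<rhd> upper2 \<alpha> = id2 (disp A)"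
proof -
  have AB: "isty A" using assms(2) fam.dom_ob by auto
  have \<alpha>: "\<alpha> \<in> Cell (fam M)" "Src (fam M) \<alpha> = h" "Tgt (fam M) \<alpha> = k" "F2 (proj M) \<alpha> = id2 (ide X)"
    using assms(1) by simp_all
  have h: "h \<in> Arr (fam M)" "Dom (fam M) h = A" "Cod (fam M) h = B" using assms(2) by simp_all
  show "cell (upper2 \<alpha>)" "sr (upper2 \<alpha>) = upper h" "tg (upper2 \<alpha>) = upper k"
    using upper2_facts(2-4)[OF \<alpha>(1)] \<alpha>(2,3) by simp_all
  show "disp B \<rhd> upper2 \<alpha> = id2 (disp A)"
    using upper2_facts(5)[OF \<alpha>(1), unfolded \<alpha>(2,4) h(2,3)] AB assms(3,4) by simp
qed

section \<open>Sections as maps out of the unit type\<close>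

lemma fibmap_facts:
  assumes "isty A" "isty B" "cx A = X" "cx B = X" "arr u" "dm u = ext A" "cd u = ext B"
    "disp B \<odot> u = disp A"
  shows "fibmap M A B u \<in> fhom X A B" "upper (fibmap M A B u) = u"
proof -
  have X: "X \<in> Ob (base M)" using cx_ob[OF assms(1)] assms(3) by simp
  obtain h where h: "h \<in> hom (fam M) A B" "upper h = u" "F1 (proj M) h = ide X"
    by (rule upper_surj[of A B u "ide X"]) (use assms X in simp_all)
  have "fibmap M A B u \<in> fhom (cx A) A B \<and> upper (fibmap M A B u) = u"
    unfolding fibmap_def
  proof (rule theI[of _ h])
    show "h \<in> fhom (cx A) A B \<and> upper h = u" using h assms(3) by simp
    show "k = h" if "k \<in> fhom (cx A) A B \<and> upper k = u" for k
      by (rule upper_inj) (use that h assms(3) in simp_all)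
  qed
  then show "fibmap M A B u \<in> fhom X A B" "upper (fibmap M A B u) = u" using assms(3) by simp_all
qed

lemma elt_facts:
  assumes "isty A" "gsection A a" "cx A = X"
  shows "elt A a \<in> fhom X (unty X) A" "upper (elt A a) = unbar A a"
    "upper (elt A a) \<odot> unmap X = a"
proof -
  have X: "X \<in> Ob (base M)" using cx_ob[OF assms(1)] assms(3) by simp
  note f = fibmap_facts[of "unty X" A X "unbar A a"]
  show 1: "elt A a \<in> fhom X (unty X) A" "upper (elt A a) = unbar A a"
    unfolding elt_def using f unbar_simps[OF assms(1,2)] assms X by simp_all
  show "upper (elt A a) \<odot> unmap X = a"
    unfolding 1(2) using unbar_simps(5)[OF assms(1,2)] assms(3) by simp
qed

text \<open>Both upper maps have the same pullback projections; for the second projection this is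
  the stability of \<open>unbar\<close>.\<close>

lemma elt_reix:
  assumes "isty A" "gsection A a" "arr f" "cd f = cx A"
  shows "reix1 f (elt A a) = elt (reix f A) (resec f A a)"
proof -
  let ?A = "reix f A" and ?a = "resec f A a"
  have X: "cx A \<in> Ob (base M)" using assms by simp
  have A: "isty ?A" "gsection ?A ?a" "cx ?A = dm f" using assms by simp_all
  note e = elt_facts[OF assms(1,2) refl] and e' = elt_facts[OF A]
  note r = reix1_facts[OF e(1) _ refl assms(3,4)]
  note u = unty_reix[OF assms(3), unfolded assms(4)]
  have r1: "reix1 f (elt A a) \<in> fhom (dm f) (unty (dm f)) ?A" using r(1) X u(1) by simp
  have Y: "dm f \<in> Ob (base M)" using assms by simp
  note ur = upper_fhom[OF r1] and ue = upper_fhom[OF e'(1)]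
  have "upper (reix1 f (elt A a)) = upper (elt ?A ?a)"
  proof (rule pullback_eqI[of f A])
    have "fext f A \<odot> upper (reix1 f (elt A a)) = unbar A a \<odot> fext f (unty (cx A))"
      using r(3) e(2) X by simp
    also have "\<dots> = fext f A \<odot> upper (elt ?A ?a)"
      unfolding e'(2) using u(3)[of A a] assms by simp
    finally show "fext f A \<odot> upper (reix1 f (elt A a)) = fext f A \<odot> upper (elt ?A ?a)" .
  qed (use assms ur ue A Y in simp_all)
  then show ?thesis by (intro upper_inj) (use r1 e'(1) in simp_all)
qed

text \<open>Evaluation at the unit element trades maps out of the unit type for sections, compatibly
  with reindexing since \<open>unty\<close> and \<open>unmap\<close> are stable.\<close>

lemma section_upper:
  assumes "h \<in> fhom X (unty X) A" "cx A = X" "X \<in> Ob (base M)"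
  shows "gsection A (upper h \<odot> unmap X)"
    "arr f \<Longrightarrow> cd f = X \<Longrightarrow> resec f A (upper h \<odot> unmap X) = upper (reix1 f h) \<odot> unmap (dm f)"
proof -
  have A: "isty A" using assms(1) fam.cod_ob by auto
  have hx: "cx (unty X) = X" using assms(3) by simp
  note u = upper_fhom[OF assms(1) hx assms(2)]
  have "disp A \<odot> upper h \<odot> unmap X = (disp A \<odot> upper h) \<odot> unmap X"
    by (rule base.cmp_assoc'[symmetric]) (use A u(1-3) assms in simp_all)
  then show s: "gsection A (upper h \<odot> unmap X)"
    unfolding u(4) using u(1-3) assms A by (simp add: gsection_iff)
  assume f: "arr f" "cd f = X"
  have Y: "dm f \<in> Ob (base M)" using f by simp
  note r = reix1_facts[OF assms(1) hx assms(2) f]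
  note U = unty_reix(1,2)[OF f(1), unfolded f(2)]
  have r1: "reix1 f h \<in> fhom (dm f) (unty (dm f)) (reix f A)" using r(1) U(1) by simp
  have A': "cx (reix f A) = dm f" "cx (unty (dm f)) = dm f" using A assms f Y by simp_all
  note u' = upper_fhom[OF r1 A'(2,1)]
  show "resec f A (upper h \<odot> unmap X) = upper (reix1 f h) \<odot> unmap (dm f)"
    unfolding resec_def
  proof (rule sec_unique)
    have "disp (reix f A) \<odot> upper (reix1 f h) \<odot> unmap (dm f) =
        (disp (reix f A) \<odot> upper (reix1 f h)) \<odot> unmap (dm f)"
      by (rule base.cmp_assoc'[symmetric]) (use A A' u'(1-3) assms f Y in simp_all)
    then show "gsection (reix f A) (upper (reix1 f h) \<odot> unmap (dm f))"
      unfolding u'(4) using u'(1-3) assms f Y A by (simp add: gsection_iff)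
    have "fext f A \<odot> upper (reix1 f h) \<odot> unmap (dm f) = (fext f A \<odot> upper (reix1 f h)) \<odot> unmap (dm f)"
      by (rule base.cmp_assoc'[symmetric]) (use A u'(1-3) assms f Y in simp_all)
    also have "\<dots> = upper h \<odot> fext f (unty X) \<odot> unmap (dm f)"
      unfolding r(3) by (rule base.cmp_assoc') (use A u(1-3) U assms f Y in simp_all)
    finally show "fext f A \<odot> upper (reix1 f h) \<odot> unmap (dm f) = (upper h \<odot> unmap X) \<odot> f"
      unfolding U(2) using u(1-3) assms f by simp
  qed (use assms f A in simp_all)
qed

section \<open>Dependent products, application and abstraction\<close>

lemma pity_facts:
  assumes "isty A" "isty B" "cx B = ext A"
  shows "isty (pity A B)" "cx (pity A B) = cx A"
    "picounit A B \<in> fhom (ext A) (reix (disp A) (pity A B)) B"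
    "isty C \<Longrightarrow> cx C = cx A \<Longrightarrow> g \<in> fhom (ext A) (reix (disp A) C) B \<Longrightarrow>
       pibar A B C g \<in> fhom (cx A) C (pity A B)"
    "isty C \<Longrightarrow> cx C = cx A \<Longrightarrow> g \<in> fhom (ext A) (reix (disp A) C) B \<Longrightarrow>
       picounit A B \<odot>\<^sub>T reix1 (disp A) (pibar A B C g) = g"
    "isty C \<Longrightarrow> cx C = cx A \<Longrightarrow> h \<in> fhom (cx A) C (pity A B) \<Longrightarrow> k \<in> fhom (cx A) C (pity A B) \<Longrightarrow>
       \<alpha> \<in> fcells (ext A) (picounit A B \<odot>\<^sub>T reix1 (disp A) h) (picounit A B \<odot>\<^sub>T reix1 (disp A) k) \<Longrightarrow>
       \<exists>!\<beta>. \<beta> \<in> fcells (cx A) h k \<and> picounit A B \<rhd>\<^sub>T reix2 (disp A) \<beta> = \<alpha>"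
proof -
  have 1: "\<forall>X A B. A \<in> fib M X \<and> B \<in> fib M (ext A) \<longrightarrow>
        pity A B \<in> fib M X \<and>
        picounit A B \<in> fhom (ext A) (reix (disp A) (pity A B)) B \<and>
        (\<forall>C f. C \<in> fib M X \<and> f \<in> fhom (ext A) (reix (disp A) C) B \<longrightarrow>
           pibar A B C f \<in> fhom X C (pity A B) \<and>
           picounit A B \<odot>\<^sub>T reix1 (disp A) (pibar A B C f) = f) \<and>
        (\<forall>C h k \<alpha>. C \<in> fib M X \<and> h \<in> fhom X C (pity A B) \<and> k \<in> fhom X C (pity A B) \<and>
           \<alpha> \<in> fcells (ext A) (picounit A B \<odot>\<^sub>T reix1 (disp A) h)
                 (picounit A B \<odot>\<^sub>T reix1 (disp A) k) \<longrightarrow>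
           (\<exists>!\<beta>. \<beta> \<in> fcells X h k \<and> picounit A B \<rhd>\<^sub>T reix2 (disp A) \<beta> = \<alpha>))"
    using products unfolding products_def by blast
  have AB: "A \<in> fib M (cx A) \<and> B \<in> fib M (ext A)" using assms by simp
  note 2 = 1[rule_format, OF AB]
  from 2 have "pity A B \<in> fib M (cx A)" by blast
  then show "isty (pity A B)" "cx (pity A B) = cx A" by simp_all
  show "picounit A B \<in> fhom (ext A) (reix (disp A) (pity A B)) B" using 2 by blast
  show "pibar A B C g \<in> fhom (cx A) C (pity A B)"
    if "isty C" "cx C = cx A" "g \<in> fhom (ext A) (reix (disp A) C) B"
  proof -
    have "C \<in> fib M (cx A)" using that by simp
    then show ?thesis using 2 that(3) by blast
  qed
  show "picounit A B \<odot>\<^sub>T reix1 (disp A) (pibar A B C g) = g"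
    if "isty C" "cx C = cx A" "g \<in> fhom (ext A) (reix (disp A) C) B"
  proof -
    have "C \<in> fib M (cx A)" using that by simp
    then show ?thesis using 2 that(3) by blast
  qed
  show "\<exists>!\<beta>. \<beta> \<in> fcells (cx A) h k \<and> picounit A B \<rhd>\<^sub>T reix2 (disp A) \<beta> = \<alpha>"
    if "isty C" "cx C = cx A" "h \<in> fhom (cx A) C (pity A B)" "k \<in> fhom (cx A) C (pity A B)"
      "\<alpha> \<in> fcells (ext A) (picounit A B \<odot>\<^sub>T reix1 (disp A) h) (picounit A B \<odot>\<^sub>T reix1 (disp A) k)"
  proof -
    have "C \<in> fib M (cx A)" using that by simp
    then show ?thesis using 2 that(3-5) by blast
  qed
qed

lemmas pity_simps [simp] = pity_facts(1,2)

lemma pity_reix: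
  assumes "isty A" "isty B" "cx B = ext A" "arr f" "cd f = cx A"
  shows "reix f (pity A B) = pity (reix f A) (reix (fext f A) B)"
    "reix1 (fext f A) (picounit A B) = picounit (reix f A) (reix (fext f A) B)"
    "isty C \<Longrightarrow> cx C = cx A \<Longrightarrow> g \<in> fhom (ext A) (reix (disp A) C) B \<Longrightarrow>
      reix1 f (pibar A B C g) =
        pibar (reix f A) (reix (fext f A) B) (reix f C) (reix1 (fext f A) g)"
proof -
  let ?A = "reix f A" and ?B = "reix (fext f A) B"
  have 1: "\<forall>X Y f A B. f \<in> hom (base M) X Y \<and> A \<in> fib M Y \<and> B \<in> fib M (ext A) \<longrightarrow>
      reix f (pity A B) = pity (reix f A) (reix (fext f A) B) \<and>
      reix1 (fext f A) (picounit A B) = picounit (reix f A) (reix (fext f A) B) \<and>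
      (\<forall>C g. C \<in> fib M Y \<and> g \<in> fhom (ext A) (reix (disp A) C) B \<longrightarrow>
            reix1 f (pibar A B C g) = pibar (reix f A) (reix (fext f A) B) (reix f C) (reix1 (fext f A) g))"
    using products unfolding products_def Let_def by blast
  have AB: "f \<in> hom (base M) (dm f) (cx A) \<and> A \<in> fib M (cx A) \<and> B \<in> fib M (ext A)" using assms by simp
  note 2 = 1[rule_format, OF AB]
  show "reix f (pity A B) = pity ?A ?B"
    "reix1 (fext f A) (picounit A B) = picounit ?A ?B" using 2 by blast+
  show "reix1 f (pibar A B C g) = pibar ?A ?B (reix f C) (reix1 (fext f A) g)"
    if "isty C" "cx C = cx A" "g \<in> fhom (ext A) (reix (disp A) C) B"
  proof -
    have "C \<in> fib M (cx A)" using that by simp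
    then show ?thesis using 2 that(3) by blast
  qed
qed

lemma appmap_simps [simp]:
  assumes "isty A" "isty B" "cx B = ext A"
  shows "arr (appmap A B)" "dm (appmap A B) = ext (reix (disp A) (pity A B))"
    "cd (appmap A B) = ext B" "disp B \<odot> appmap A B = disp (reix (disp A) (pity A B))"
    "arr h \<Longrightarrow> cd h = ext (reix (disp A) (pity A B)) \<Longrightarrow>
      disp B \<odot> appmap A B \<odot> h = disp (reix (disp A) (pity A B)) \<odot> h"
proof -
  note u = upper_fhom[OF pity_facts(3)[OF assms] _ assms(3), folded appmap_def]
  show 1: "arr (appmap A B)" "dm (appmap A B) = ext (reix (disp A) (pity A B))"
    "cd (appmap A B) = ext B"
    and 2: "disp B \<odot> appmap A B = disp (reix (disp A) (pity A B))"
    using u assms by simp_all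
  assume h: "arr h" "cd h = ext (reix (disp A) (pity A B))"
  have "(disp B \<odot> appmap A B) \<odot> h = disp B \<odot> appmap A B \<odot> h"
    by (rule base.cmp_assoc') (use 1 h assms in simp_all)
  then show "disp B \<odot> appmap A B \<odot> h = disp (reix (disp A) (pity A B)) \<odot> h"
    unfolding 2 by simp
qed

lemma appmap_reix:
  assumes "isty A" "isty B" "cx B = ext A" "arr f" "cd f = cx A"
  shows "fext (fext f A) B \<odot> appmap (reix f A) (reix (fext f A) B) =
    appmap A B \<odot> fext (fext f A) (reix (disp A) (pity A B))"
  using reix1_facts(3)[OF pity_facts(3)[OF assms(1-3)] _ assms(3) reix_simps(3)[OF assms(4,1,5)]
      , unfolded pity_reix(2)[OF assms], folded appmap_def] assms by simp

lemma appsec_section: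
  assumes "isty A" "isty B" "cx B = ext A" "gsection (pity A B) m"
  shows "gsection B (appsec A B m)"
  using assms by (simp add: appsec_def gsection_iff[of B])

lemma appsec_reix:
  assumes "isty A" "isty B" "cx B = ext A" "gsection (pity A B) m" "arr f" "cd f = cx A"
  shows "resec (fext f A) B (appsec A B m) =
    appsec (reix f A) (reix (fext f A) B) (resec f (pity A B) m)"
proof -
  let ?A = "reix f A" and ?B = "reix (fext f A) B" and ?P = "pity A B"
    and ?m = "resec f (pity A B) m" and ?q = "resec (disp A) (pity A B) m"
  note p = pity_reix(1)[OF assms(1-3,5,6)]
  have ab: "isty ?A" "isty ?B" "cx ?B = ext ?A" "gsection (pity ?A ?B) ?m"
    using assms p[symmetric] by simp_all
  have q: "resec (disp ?A) (reix f ?P) ?m = resec (fext f A) (reix (disp A) ?P) ?q"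
    using assms by simp
  have e: "reix (disp ?A) (reix f ?P) = reix (fext f A) (reix (disp A) ?P)" using assms by simp
  note aq = resec_simps[of "fext f A" "reix (disp A) ?P" ?q]
  have "fext (fext f A) B \<odot> appmap ?A ?B \<odot> resec (fext f A) (reix (disp A) ?P) ?q =
     (fext (fext f A) B \<odot> appmap ?A ?B) \<odot> resec (fext f A) (reix (disp A) ?P) ?q"
    by (rule base.cmp_assoc'[symmetric]) (use assms ab p[symmetric] in simp_all)
  also have "\<dots> = appmap A B \<odot> fext (fext f A) (reix (disp A) ?P) \<odot> resec (fext f A) (reix (disp A) ?P) ?q"
    unfolding appmap_reix[OF assms(1-3,5,6)] by (rule base.cmp_assoc') (use assms in simp_all)
  also have "\<dots> = appmap A B \<odot> ?q \<odot> fext f A"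
    using aq(6) assms by simp
  finally have "fext (fext f A) B \<odot> appsec ?A ?B ?m = appsec A B m \<odot> fext f A"
    unfolding appsec_def p[symmetric] q using assms by simp
  then show ?thesis
    unfolding resec_def[of M "fext f A" B]
    by (intro sec_unique) (use assms appsec_section[OF ab] in simp_all)
qed

text \<open>Application to the generic element of \<open>A\<close>, given by \<open>appsec\<close>,
  instantiated at \<open>a\<close>.\<close>

definition Asec :: "'a \<Rightarrow> 'a \<Rightarrow> 'm \<Rightarrow> 'm \<Rightarrow> 'm" where
  "Asec A B m a = resec a B (appsec A B m)"

lemma Asec_section:
  assumes "isty A" "isty B" "cx B = ext A" "gsection (pity A B) m" "gsection A a"
  shows "gsection (reix a B) (Asec A B m a)"
  unfolding Asec_def using appsec_section[OF assms(1-4)] gsectionD[OF assms(5)] assms(2,3) by simp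

lemma Asec_reix:
  assumes "isty A" "isty B" "cx B = ext A" "gsection (pity A B) m" "gsection A a"
    "arr f" "cd f = cx A"
  shows "resec f (reix a B) (Asec A B m a) =
    Asec (reix f A) (reix (fext f A) B) (resec f (pity A B) m) (resec f A a)"
  unfolding Asec_def appsec_reix[OF assms(1-4,6,7), symmetric]
  by (rule resec_natural(2)) (use assms gsectionD[OF assms(5)] appsec_section[OF assms(1-4)] in simp_all)

text \<open>The universal property of \<open>pity\<close> returns the fibre map
  \<open>elt B b\<close>; evaluating it at the unit element gives \<open>b\<close>, which is the
  beta rule for the generic argument. Stability combines that of \<open>pibar\<close> with
  \<open>elt_reix\<close>.\<close>

lemma lam_facts:
  assumes "isty A" "isty B" "cx B = ext A" "gsection B b"
  shows "gsection (pity A B) (lammap A B b)" "appsec A B (lammap A B b) = b"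
    "arr f \<Longrightarrow> cd f = cx A \<Longrightarrow> resec f (pity A B) (lammap A B b) =
      lammap (reix f A) (reix (fext f A) B) (resec (fext f A) B b)"
proof -
  let ?X = "cx A" and ?P = "pity A B"
  let ?h = "pibar A B (unty ?X) (elt B b)"
  have X: "?X \<in> Ob (base M)" using assms(1) by simp
  have U: "isty (unty ?X)" "cx (unty ?X) = cx A" using X by simp_all
  have uA: "reix (disp A) (unty ?X) = unty (ext A)"
    using unty_reix(1)[of "disp A"] assms(1) by simp
  note e = elt_facts[OF assms(2,4,3)]
  have eb: "elt B b \<in> fhom (ext A) (reix (disp A) (unty ?X)) B" unfolding uA by (rule e(1))
  note h = pity_facts(4)[OF assms(1-3) U eb] and c = pity_facts(5)[OF assms(1-3) U eb]
  have l: "lammap A B b = upper ?h \<odot> unmap ?X" by (simp add: lammap_def Let_def)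
  note s = section_upper[OF h pity_facts(2)[OF assms(1-3)] X]
  show "gsection ?P (lammap A B b)" unfolding l by (rule s(1))
  have r1: "reix1 (disp A) ?h \<in> fhom (ext A) (unty (ext A)) (reix (disp A) ?P)"
    using reix1_facts(1)[OF h U(2) pity_facts(2)[OF assms(1-3)], of "disp A"] assms(1) uA by simp
  have EA: "ext A \<in> Ob (base M)" using assms(1) by simp
  have u1: "arr (upper (reix1 (disp A) ?h))" "dm (upper (reix1 (disp A) ?h)) = ext (unty (ext A))"
    "cd (upper (reix1 (disp A) ?h)) = ext (reix (disp A) ?P)"
    using upper_fhom[OF r1] EA assms(1-3) by simp_all
  have "upper (picounit A B \<odot>\<^sub>T reix1 (disp A) ?h) = appmap A B \<odot> upper (reix1 (disp A) ?h)"
    unfolding appmap_def by (rule upper_cmp) (use pity_facts(3)[OF assms(1-3)] r1 in simp_all)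
  then have up: "appmap A B \<odot> upper (reix1 (disp A) ?h) = upper (elt B b)" unfolding c by simp
  have "appsec A B (lammap A B b) = appmap A B \<odot> upper (reix1 (disp A) ?h) \<odot> unmap (ext A)"
    unfolding appsec_def l using s(2)[of "disp A"] assms(1) by simp
  also have "\<dots> = (appmap A B \<odot> upper (reix1 (disp A) ?h)) \<odot> unmap (ext A)"
    by (rule base.cmp_assoc'[symmetric]) (use u1 EA assms(1-3) in simp_all)
  also have "\<dots> = b" unfolding up by (rule e(3))
  finally show "appsec A B (lammap A B b) = b" .
  assume f: "arr f" "cd f = cx A"
  let ?A = "reix f A" and ?B = "reix (fext f A) B" and ?b = "resec (fext f A) B b"
  have "reix1 (fext f A) (elt B b) = elt ?B ?b"
    by (rule elt_reix) (use assms f in simp_all)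
  moreover have "reix1 f ?h = pibar ?A ?B (reix f (unty ?X)) (reix1 (fext f A) (elt B b))"
    by (rule pity_reix(3)[OF assms(1-3) f U eb])
  moreover have "reix f (unty ?X) = unty (dm f)" using unty_reix(1)[OF f(1)] f(2) by simp
  ultimately have r: "reix1 f ?h = pibar ?A ?B (unty (dm f)) (elt ?B ?b)" by simp
  show "resec f ?P (lammap A B b) = lammap ?A ?B ?b"
    unfolding l s(2)[OF f] r using assms f by (simp add: lammap_def Let_def)
qed

subsection \<open>Function extensionality\<close>

text \<open>The unit type extends the cell uniquely in the base, and bijectivity of comprehension on
  2-cells makes the extension come from a unique fibre cell.\<close>

lemma unit_fcell:
  assumes "h \<in> fhom X (unty X) A" "k \<in> fhom X (unty X) A" "cx A = X" "X \<in> Ob (base M)"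
    "cell \<alpha>" "sr \<alpha> = upper h \<odot> unmap X" "tg \<alpha> = upper k \<odot> unmap X"
    "disp A \<rhd> \<alpha> = id2 (ide X)"
  shows "\<exists>!\<beta>. \<beta> \<in> fcells X h k \<and> upper2 \<beta> \<lhd> unmap X = \<alpha>"
proof -
  have A: "isty A" using assms(1) fam.cod_ob by auto
  have U: "cx (unty X) = X" using assms(4) by simp
  note h = upper_fhom[OF assms(1) U assms(3)] and k = upper_fhom[OF assms(2) U assms(3)]
  have u: "\<exists>!c. c \<in> cells (base M) (upper h) (upper k) \<and> disp A \<rhd> c = id2 (disp (unty X)) \<and> c \<lhd> unmap X = \<alpha>"
    by (rule unit_cell) (use A assms h k in simp_all)
  from ex1_implies_ex[OF u] obtain c where c: "cell c" "sr c = upper h" "tg c = upper k" "disp A \<rhd> c = id2 (disp (unty X))"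
    "c \<lhd> unmap X = \<alpha>" unfolding cells_iff by blast
  obtain \<beta> where b: "\<beta> \<in> cells (fam M) h k" "upper2 \<beta> = c" "F2 (proj M) \<beta> = id2 (ide X)"
  proof (rule upper2_surj[of h k c "id2 (ide X)"])
    show "disp (Cod (fam M) h) \<rhd> c = id2 (ide X) \<lhd> disp (Dom (fam M) h)"
      using assms(1,3,4) c(4) by simp
  qed (use assms(1-4) c(1-3) in simp_all)
  show ?thesis
  proof (rule ex1I[of _ \<beta>])
    show "\<beta> \<in> fcells X h k \<and> upper2 \<beta> \<lhd> unmap X = \<alpha>" using b c(5) by simp
    fix \<gamma> assume g: "\<gamma> \<in> fcells X h k \<and> upper2 \<gamma> \<lhd> unmap X = \<alpha>"
    note G = upper2_fcells[OF conjunct1[OF g] assms(1) U assms(4)]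
    have "upper2 \<gamma> \<in> cells (base M) (upper h) (upper k) \<and>
        disp A \<rhd> upper2 \<gamma> = id2 (disp (unty X)) \<and> upper2 \<gamma> \<lhd> unmap X = \<alpha>"
      using conjunct2[OF g] G unfolding cells_iff by blast
    moreover have "c \<in> cells (base M) (upper h) (upper k) \<and>
        disp A \<rhd> c = id2 (disp (unty X)) \<and> c \<lhd> unmap X = \<alpha>"
      using c unfolding cells_iff by blast
    ultimately have "upper2 \<gamma> = c" using u by blast
    then show "\<gamma> = \<beta>" by (intro upper2_inj) (use g b in simp_all)
  qed
qed

text \<open>A homotopy \<open>p\<close> between the sections \<open>m \<cdot> x\<close> and \<open>n \<cdot> x\<close> extends along \<open>\<epsilon>\<close> to a unique 2-cell
  \<open>e\<close>; here \<open>e'\<close> is the reindexing of \<open>e\<close> along the display map of \<open>A\<close>.\<close>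

definition extends :: "'a \<Rightarrow> 'a \<Rightarrow> 'm \<Rightarrow> 'm \<Rightarrow> 'c \<Rightarrow> 'c \<Rightarrow> bool" where
  "extends A B m n p e \<longleftrightarrow> e \<in> cells (base M) m n \<and> disp (pity A B) \<rhd> e = id2 (ide (cx A)) \<and>
     (\<exists>e'. e' \<in> cells (base M) (resec (disp A) (pity A B) m) (resec (disp A) (pity A B) n) \<and>
        disp (reix (disp A) (pity A B)) \<rhd> e' = id2 (ide (ext A)) \<and>
        fext (disp A) (pity A B) \<rhd> e' = e \<lhd> disp A \<and> appmap A B \<rhd> e' = p)"

text \<open>This replaces the construction of \<open>extcell\<close>, through two extensions along
  the unit type and the product, by a property phrased in the base alone. Everything later uses only
  the property and its uniqueness clause.\<close>

lemma extcell_extends: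
  assumes "isty A" "isty B" "cx B = ext A" "gsection (pity A B) m" "gsection (pity A B) n"
    "cell p" "sr p = appsec A B m" "tg p = appsec A B n" "disp B \<rhd> p = id2 (ide (ext A))"
  shows "extends A B m n p (extcell A B m n p)"
    "extends A B m n p e \<Longrightarrow> e = extcell A B m n p"
proof -
  let ?X = "cx A" and ?P = "pity A B" and ?d = "disp A" and ?E = "ext A"
  let ?U = "unty ?X" and ?PA = "reix (disp A) (pity A B)" and ?c = "picounit A B"
  have X: "?X \<in> Ob (base M)" "?E \<in> Ob (base M)" using assms(1) by simp_all
  have d: "arr ?d" "cd ?d = ?X" "dm ?d = ?E" using assms(1) by simp_all
  have P: "isty ?P" "cx ?P = ?X" using assms(1-3) by simp_all
  have U: "isty ?U" "cx ?U = ?X" using X by simp_all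
  have uA: "reix ?d ?U = unty ?E" using unty_reix(1)[of ?d] assms(1) by simp
  define mb nb where "mb = elt ?P m" and "nb = elt ?P n"
  note m = elt_facts[OF P(1) assms(4) P(2), folded mb_def] and n = elt_facts[OF P(1) assms(5) P(2), folded nb_def]
  define m1 n1 where "m1 = reix1 ?d mb" and "n1 = reix1 ?d nb"
  have m1: "m1 \<in> fhom ?E (unty ?E) ?PA" and n1: "n1 \<in> fhom ?E (unty ?E) ?PA"
    using reix1_facts(1)[OF m(1) U(2) P(2) d(1,2)] reix1_facts(1)[OF n(1) U(2) P(2) d(1,2)] d uA
    unfolding m1_def n1_def by simp_all
  note c = pity_facts(3)[OF assms(1-3)]
  have UE: "cx (unty ?E) = ?E" "cx ?PA = ?E" using X P d by simp_all
  note um = upper_fhom[OF m1 UE] and un = upper_fhom[OF n1 UE]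
  note rm = section_upper(2)[OF m(1) P(2) X(1) d(1,2), unfolded m(3) d(3), folded m1_def]
  note rn = section_upper(2)[OF n(1) P(2) X(1) d(1,2), unfolded n(3) d(3), folded n1_def]
  let ?h = "?c \<odot>\<^sub>T m1" and ?k = "?c \<odot>\<^sub>T n1"
  have um1: "upper ?h = appmap A B \<odot> upper m1"
    unfolding appmap_def by (rule upper_cmp) (use c m1 in simp_all)
  have un1: "upper ?k = appmap A B \<odot> upper n1"
    unfolding appmap_def by (rule upper_cmp) (use c n1 in simp_all)
  have ph: "F1 (proj M) ?h = ide ?E"
    using proj.fun_cmp[of m1 "unty ?E" ?PA ?c B] c m1 X by simp
  have pk: "F1 (proj M) ?k = ide ?E"
    using proj.fun_cmp[of n1 "unty ?E" ?PA ?c B] c n1 X by simp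
  have h: "?h \<in> fhom ?E (unty ?E) B" and k: "?k \<in> fhom ?E (unty ?E) B"
    using c m1 n1 ph pk by simp_all
  have sp: "sr p = upper ?h \<odot> unmap ?E" "tg p = upper ?k \<odot> unmap ?E"
    unfolding assms(7,8) appsec_def rm rn um1 un1 using assms(1-3) um(1-3) un(1-3) X by simp_all
  note pbu = unit_fcell[OF h k assms(3) X(2) assms(6) sp assms(9)]
  define pb where "pb = (THE \<beta>. \<beta> \<in> fcells ?E ?h ?k \<and> upper2 \<beta> \<lhd> unmap ?E = p)"
  have pb: "pb \<in> fcells ?E ?h ?k" "upper2 pb \<lhd> unmap ?E = p"
    using theI'[OF pbu, folded pb_def] by blast+
  note pbbu = pity_facts(6)[OF assms(1-3) U m(1) n(1), folded m1_def n1_def, OF pb(1)]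
  define pbb where "pbb = (THE \<gamma>. \<gamma> \<in> fcells ?X mb nb \<and> ?c \<rhd>\<^sub>T reix2 ?d \<gamma> = pb)"
  have pbb: "pbb \<in> fcells ?X mb nb" "?c \<rhd>\<^sub>T reix2 ?d pbb = pb"
    using theI'[OF pbbu, folded pbb_def] by blast+
  have ec: "extcell A B m n p = upper2 pbb \<lhd> unmap ?X"
    unfolding extcell_def Let_def pbb_def pb_def m1_def n1_def mb_def nb_def ..
  \<comment> \<open>Any fibre cell \<open>\<gamma>\<close> between the maps named by
    \<open>m\<close> and \<open>n\<close> yields, at the unit element, a candidate for
    \<open>e\<close>; its reindexing \<open>reix2 ?d \<gamma>\<close> yields the corresponding
    \<open>e'\<close>. Existence uses this for \<open>pbb\<close>, uniqueness for an unknown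
    cell.\<close>
  have gen: "cell (upper2 \<gamma> \<lhd> unmap ?X) \<and> sr (upper2 \<gamma> \<lhd> unmap ?X) = m \<and> tg (upper2 \<gamma> \<lhd> unmap ?X) = n \<and>
      disp ?P \<rhd> (upper2 \<gamma> \<lhd> unmap ?X) = id2 (ide ?X) \<and>
      upper2 (reix2 ?d \<gamma>) \<lhd> unmap ?E \<in> cells (base M) (resec ?d ?P m) (resec ?d ?P n) \<and>
      disp ?PA \<rhd> (upper2 (reix2 ?d \<gamma>) \<lhd> unmap ?E) = id2 (ide ?E) \<and>
      fext ?d ?P \<rhd> (upper2 (reix2 ?d \<gamma>) \<lhd> unmap ?E) = (upper2 \<gamma> \<lhd> unmap ?X) \<lhd> ?d \<and>
      appmap A B \<rhd> (upper2 (reix2 ?d \<gamma>) \<lhd> unmap ?E) = upper2 (?c \<rhd>\<^sub>T reix2 ?d \<gamma>) \<lhd> unmap ?E \<and>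
      ?c \<rhd>\<^sub>T reix2 ?d \<gamma> \<in> fcells ?E ?h ?k"
    if g: "\<gamma> \<in> fcells ?X mb nb" for \<gamma>
  proof -
    note G = upper2_fcells[OF g m(1) U(2) X(1)]
    note R = reix2_facts[OF g m(1) n(1) U(2) P(2) d(1,2), folded m1_def n1_def, unfolded d(3)]
    note RU = upper2_fcells[OF R(1) m1 UE(1) X(2)]
    note um' = upper_fhom[OF m(1) U(2) P(2)]
    let ?r = "upper2 (reix2 ?d \<gamma>)"
    have 1: "disp ?P \<rhd> (upper2 \<gamma> \<lhd> unmap ?X) = (disp ?P \<rhd> upper2 \<gamma>) \<lhd> unmap ?X"
      by (rule base.hcmp_assoc'[symmetric]) (use G um' X P in simp_all)
    have 2: "disp ?PA \<rhd> (?r \<lhd> unmap ?E) = (disp ?PA \<rhd> ?r) \<lhd> unmap ?E"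
      by (rule base.hcmp_assoc'[symmetric]) (use RU um X P d in simp_all)
    have "fext ?d ?P \<rhd> (?r \<lhd> unmap ?E) = (fext ?d ?P \<rhd> ?r) \<lhd> unmap ?E"
      by (rule base.hcmp_assoc'[symmetric]) (use RU um X P d in simp_all)
    also have "\<dots> = upper2 \<gamma> \<lhd> (fext ?d ?U \<odot> unmap ?E)"
      unfolding R(2) using G um' X U d uA by simp
    also have "fext ?d ?U \<odot> unmap ?E = unmap ?X \<odot> ?d"
      using unty_reix(2)[OF d(1)] d by simp
    also have "upper2 \<gamma> \<lhd> (unmap ?X \<odot> ?d) = (upper2 \<gamma> \<lhd> unmap ?X) \<lhd> ?d"
      using G um' X d by simp
    finally have 3: "fext ?d ?P \<rhd> (?r \<lhd> unmap ?E) = (upper2 \<gamma> \<lhd> unmap ?X) \<lhd> ?d" .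
    have "upper2 (?c \<rhd>\<^sub>T reix2 ?d \<gamma>) = upper2 (Id2 (fam M) ?c) \<star>\<^bsub>base M\<^esub> ?r"
      by (rule upper2_hcmp) (use R(1) c m1 in simp_all)
    then have 4: "upper2 (?c \<rhd>\<^sub>T reix2 ?d \<gamma>) = appmap A B \<rhd> ?r"
      using upper2_id2[of ?c] c by (simp add: appmap_def)
    have 5: "(appmap A B \<rhd> ?r) \<lhd> unmap ?E = appmap A B \<rhd> (?r \<lhd> unmap ?E)"
      by (rule base.hcmp_assoc') (use RU um X assms(1-3) in simp_all)
    have "F2 (proj M) (?c \<rhd>\<^sub>T reix2 ?d \<gamma>) = F2 (proj M) (Id2 (fam M) ?c) \<star>\<^bsub>base M\<^esub> F2 (proj M) (reix2 ?d \<gamma>)"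
      by (rule proj.fun_hcmp[of _ m1 n1 _ ?c ?c]) (use R(1) c m1 in simp_all)
    then have 6: "?c \<rhd>\<^sub>T reix2 ?d \<gamma> \<in> fcells ?E ?h ?k"
      using R(1) c m1 n1 X proj.fun_id2[of ?c] by simp
    have 7: "cell (upper2 \<gamma> \<lhd> unmap ?X)" "sr (upper2 \<gamma> \<lhd> unmap ?X) = m" "tg (upper2 \<gamma> \<lhd> unmap ?X) = n"
      using G(1-3) um' X m(3) n(3) by simp_all
    have 8: "?r \<lhd> unmap ?E \<in> cells (base M) (resec ?d ?P m) (resec ?d ?P n)"
      unfolding rm rn using RU um X by simp
    show ?thesis using 1 2 3 4 5 6 7 8 G(4) RU(4) X by simp
  qed
  show "extends A B m n p (extcell A B m n p)"
    using gen[OF pbb(1)] pb(2) unfolding pbb(2) ec extends_def by auto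
  assume e: "extends A B m n p e"
  then obtain e' where E: "cell e" "sr e = m" "tg e = n" "disp ?P \<rhd> e = id2 (ide ?X)"
    and e': "cell e'" "sr e' = resec ?d ?P m" "tg e' = resec ?d ?P n" "disp ?PA \<rhd> e' = id2 (ide ?E)"
      "fext ?d ?P \<rhd> e' = e \<lhd> ?d" "appmap A B \<rhd> e' = p"
    unfolding extends_def by auto
  obtain \<gamma> where g: "\<gamma> \<in> fcells ?X mb nb" "upper2 \<gamma> \<lhd> unmap ?X = e"
    using ex1_implies_ex[OF unit_fcell[OF m(1) n(1) P(2) X(1) E(1) _ _ E(4)]]
    unfolding m(3) n(3) using E(2,3) by blast
  note G = gen[OF g(1), unfolded g(2)]
  \<comment> \<open>The witness \<open>e'\<close> is itself determined by its pullback projections,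
    so it can only be the reindexing of the fibre cell of \<open>e\<close>.\<close>
  have "upper2 (reix2 ?d \<gamma>) \<lhd> unmap ?E = e'"
    by (rule pullback_cell_eqI[of ?d ?P]) (use G e' P d X assms(4) in simp_all)
  then have "upper2 (?c \<rhd>\<^sub>T reix2 ?d \<gamma>) \<lhd> unmap ?E = p" using G e'(6) by simp
  then have "?c \<rhd>\<^sub>T reix2 ?d \<gamma> = pb" using pbu pb G by blast
  then have "\<gamma> = pbb" using pbbu pbb g(1) by blast
  then show "e = extcell A B m n p" using ec g(2) by simp
qed

text \<open>The reindexing of a 2-cell between sections, produced by the two-dimensional pullback
  property.\<close>

lemma reix_cell_ex:
  assumes "isty C" "gsection C m" "gsection C n" "cell e" "sr e = m" "tg e = n"
    "disp C \<rhd> e = id2 (ide (cx C))" "arr f" "cd f = cx C"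
  obtains e' where "cell e'" "sr e' = resec f C m" "tg e' = resec f C n"
    "disp (reix f C) \<rhd> e' = id2 (ide (dm f))" "fext f C \<rhd> e' = e \<lhd> f"
proof -
  note m = gsectionD[OF assms(2)]
  have "disp C \<rhd> (e \<lhd> f) = (disp C \<rhd> e) \<lhd> f"
    by (rule base.hcmp_assoc'[symmetric]) (use assms(1,4-6,8,9) m in simp_all)
  then have o: "disp C \<rhd> (e \<lhd> f) = id2 f" unfolding assms(7) using assms(1,8,9) by simp
  have X: "dm f \<in> Ob (base M)" using assms(8) by simp
  have "\<exists>!\<gamma>. \<gamma> \<in> cells (base M) (resec f C m) (resec f C n) \<and>
     disp (reix f C) \<rhd> \<gamma> = id2 (ide (dm f)) \<and> fext f C \<rhd> \<gamma> = e \<lhd> f"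
    by (rule pullback_cell) (use assms(1-6,8,9) m o X in simp_all)
  from ex1_implies_ex[OF this] show ?thesis using that by auto
qed

text \<open>Stability of the extensionality cell is not assumed; being characterised by
  \<open>extends\<close>, it only needs this property to be stable, after which uniqueness
  concludes.\<close>

lemma extends_reix:
  assumes "isty A" "isty B" "cx B = ext A" "gsection (pity A B) m" "gsection (pity A B) n"
    "extends A B m n p e" "arr f" "cd f = cx A"
    "cell p'" "sr p' = appsec (reix f A) (reix (fext f A) B) (resec f (pity A B) m)"
    "tg p' = appsec (reix f A) (reix (fext f A) B) (resec f (pity A B) n)"
    "disp (reix (fext f A) B) \<rhd> p' = id2 (ide (ext (reix f A)))"
    "fext (fext f A) B \<rhd> p' = p \<lhd> fext f A"
    "cell \<beta>" "sr \<beta> = resec f (pity A B) m" "tg \<beta> = resec f (pity A B) n"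
    "disp (reix f (pity A B)) \<rhd> \<beta> = id2 (ide (dm f))" "fext f (pity A B) \<rhd> \<beta> = e \<lhd> f"
  shows "extends (reix f A) (reix (fext f A) B) (resec f (pity A B) m)
    (resec f (pity A B) n) p' \<beta>"
proof -
  let ?A = "reix f A" and ?B = "reix (fext f A) B" and ?P = "pity A B"
    and ?m = "resec f (pity A B) m" and ?n = "resec f (pity A B) n"
    and ?PA = "reix (disp A) (pity A B)"
  have P: "isty ?P" "cx ?P = cx A" using assms(1-3) by simp_all
  note p = pity_reix(1)[OF assms(1-3,7,8)]
  have ab: "isty ?A" "isty ?B" "cx ?B = ext ?A" "cx ?A = dm f" using assms(1-3,7,8) by simp_all
  have P': "isty (reix f ?P)" "cx (reix f ?P) = dm f" using P assms(7,8) by simp_all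
  have mn: "gsection (reix f ?P) ?m" "gsection (reix f ?P) ?n" using assms(1-5,7,8) by simp_all
  note m = gsectionD[OF assms(4)] and n = gsectionD[OF assms(5)]
  from assms(6) obtain e' where E: "cell e" "sr e = m" "tg e = n" "disp ?P \<rhd> e = id2 (ide (cx A))"
    and e': "cell e'" "sr e' = resec (disp A) ?P m" "tg e' = resec (disp A) ?P n"
      "disp ?PA \<rhd> e' = id2 (ide (ext A))" "fext (disp A) ?P \<rhd> e' = e \<lhd> disp A"
      "appmap A B \<rhd> e' = p"
    unfolding extends_def by auto
  obtain b where b: "cell b" "sr b = resec (disp ?A) (reix f ?P) ?m"
    "tg b = resec (disp ?A) (reix f ?P) ?n"
    "disp (reix (disp ?A) (reix f ?P)) \<rhd> b = id2 (ide (ext ?A))"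
    "fext (disp ?A) (reix f ?P) \<rhd> b = \<beta> \<lhd> disp ?A"
    by (rule reix_cell_ex[OF P'(1) mn assms(14-16), of "disp ?A"])
      (use assms(17) P' ab in simp_all)
  have PA: "reix (disp ?A) (reix f ?P) = reix (fext f A) ?PA" using assms(1-3,7,8) by simp
  have PA': "isty ?PA" "cx ?PA = ext A" using assms(1) P by simp_all
  let ?F = "fext (fext f A) ?PA"
  have F: "arr ?F" "dm ?F = ext (reix (disp ?A) (reix f ?P))" "cd ?F = ext ?PA"
    unfolding PA using assms(1,7,8) PA' by simp_all
  have cb: "cd (sr b) = ext (reix (disp ?A) (reix f ?P))" "dm (sr b) = ext ?A"
    unfolding b(2) using ab P' mn by simp_all
  have ce: "cd (sr e') = ext ?PA" "dm (sr e') = ext A"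
    unfolding e'(2) using assms(1,4) P by simp_all
  have sb: "?F \<odot> resec (disp ?A) (reix f ?P) (resec f ?P k) = resec (disp A) ?P k \<odot> fext f A"
    if k: "gsection ?P k" for k
  proof -
    have "resec (disp ?A) (reix f ?P) (resec f ?P k) = resec (f \<odot> disp ?A) ?P k"
      by (rule resec_cmp) (use assms(1,7,8) P k in simp_all)
    also have "f \<odot> disp ?A = disp A \<odot> fext f A" using assms(1,7,8) by simp
    also have "resec (disp A \<odot> fext f A) ?P k = resec (fext f A) ?PA (resec (disp A) ?P k)"
      by (rule resec_cmp[symmetric]) (use assms(1,7,8) P k in simp_all)
    finally have e: "resec (disp ?A) (reix f ?P) (resec f ?P k) = resec (fext f A) ?PA (resec (disp A) ?P k)" .
    have s: "gsection ?PA (resec (disp A) ?P k)" by (rule resec_facts(1)) (use assms(1) P k in simp_all)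
    have fA: "arr (fext f A)" "cd (fext f A) = cx ?PA"
      unfolding PA'(2) by (rule reix_simps[OF assms(7,1,8)])+
    show ?thesis unfolding e by (rule resec_facts(2)[OF fA(1) PA'(1) fA(2) s])
  qed
  \<comment> \<open>Weakening the reindexed cell and reindexing the weakened cell agree, since
    reindexing along \<open>f \<odot> disp ?A\<close> and along
    \<open>disp A \<odot> fext f A\<close> is the same.\<close>
  have Fb: "?F \<rhd> b = e' \<lhd> fext f A"
  proof (rule pullback_cell_eqI[of "disp A" ?P])
    have 1: "sr (?F \<rhd> b) = ?F \<odot> sr b" "tg (?F \<rhd> b) = ?F \<odot> tg b"
      using b(1) F cb by simp_all
    have 2: "sr (e' \<lhd> fext f A) = sr e' \<odot> fext f A" "tg (e' \<lhd> fext f A) = tg e' \<odot> fext f A"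
      using e'(1) ce assms(1,7,8) by simp_all
    show "sr (?F \<rhd> b) = sr (e' \<lhd> fext f A)" "tg (?F \<rhd> b) = tg (e' \<lhd> fext f A)"
      unfolding 1 2 b(2,3) e'(2,3) sb[OF assms(4)] sb[OF assms(5)] by (rule refl)+
    have "disp ?PA \<rhd> (?F \<rhd> b) = (disp ?PA \<odot> ?F) \<rhd> b"
      by (rule base.hcmp_id2_merge(2)) (use PA' F b cb in simp_all)
    also have "\<dots> = (fext f A \<odot> disp (reix (disp ?A) (reix f ?P))) \<rhd> b"
      unfolding PA using PA' assms(1,7,8) by simp
    also have "\<dots> = fext f A \<rhd> (disp (reix (disp ?A) (reix f ?P)) \<rhd> b)"
      by (rule base.hcmp_id2_merge(2)[symmetric]) (use P' ab assms(1,7,8) b cb in simp_all)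
    also have "\<dots> = id2 (fext f A)" unfolding b(4) using assms(1,7,8) ab by simp
    also have "\<dots> = (disp ?PA \<rhd> e') \<lhd> fext f A" unfolding e'(4) using assms(1,7,8) by simp
    also have "\<dots> = disp ?PA \<rhd> (e' \<lhd> fext f A)"
      by (rule base.hcmp_assoc') (use PA' e'(1) ce assms(1,7,8) in simp_all)
    finally show "disp ?PA \<rhd> (?F \<rhd> b) = disp ?PA \<rhd> (e' \<lhd> fext f A)" .
    have "fext (disp A) ?P \<rhd> (?F \<rhd> b) = (fext (disp A) ?P \<odot> ?F) \<rhd> b"
      by (rule base.hcmp_id2_merge(2)) (use P assms(1) F b cb in simp_all)
    also have "fext (disp A) ?P \<odot> ?F = fext f ?P \<odot> fext (disp ?A) (reix f ?P)"
      using assms(1,7,8) P by simp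
    also have "(fext f ?P \<odot> fext (disp ?A) (reix f ?P)) \<rhd> b =
        fext f ?P \<rhd> (fext (disp ?A) (reix f ?P) \<rhd> b)"
      by (rule base.hcmp_id2_merge(2)[symmetric]) (use P' P ab assms(7,8) b cb in simp_all)
    also have "\<dots> = fext f ?P \<rhd> (\<beta> \<lhd> disp ?A)" unfolding b(5) ..
    also have "\<dots> = (fext f ?P \<rhd> \<beta>) \<lhd> disp ?A"
      by (rule base.hcmp_assoc'[symmetric]) (use P ab assms(4,7,8,14,15) in simp_all)
    also have "\<dots> = e \<lhd> (f \<odot> disp ?A)"
      unfolding assms(18) using E m P ab assms(7,8) by simp
    also have "f \<odot> disp ?A = disp A \<odot> fext f A" using assms(1,7,8) by simp
    also have "e \<lhd> (disp A \<odot> fext f A) = (e \<lhd> disp A) \<lhd> fext f A"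
      using E m P assms(1,7,8) by (simp del: reix_simps(6))
    also have "\<dots> = (fext (disp A) ?P \<rhd> e') \<lhd> fext f A" unfolding e'(5) ..
    also have "\<dots> = fext (disp A) ?P \<rhd> (e' \<lhd> fext f A)"
      by (rule base.hcmp_assoc') (use P e'(1) ce assms(1,7,8) in simp_all)
    finally show "fext (disp A) ?P \<rhd> (?F \<rhd> b) = fext (disp A) ?P \<rhd> (e' \<lhd> fext f A)" .
  qed (use assms(1,7,8) P b(1) cb F e'(1) ce in simp_all)
  note a' = appmap_simps[OF ab(1-3), folded p]
  have "appmap ?A ?B \<rhd> b = p'"
  proof (rule pullback_cell_eqI[of "fext f A" B])
    have "disp ?B \<rhd> (appmap ?A ?B \<rhd> b) = (disp ?B \<odot> appmap ?A ?B) \<rhd> b"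
      by (rule base.hcmp_id2_merge(2)) (use ab a' b(1) cb in simp_all)
    then show "disp ?B \<rhd> (appmap ?A ?B \<rhd> b) = disp ?B \<rhd> p'"
      unfolding a'(4) b(4) assms(12) .
    have "fext (fext f A) B \<rhd> (appmap ?A ?B \<rhd> b) = (fext (fext f A) B \<odot> appmap ?A ?B) \<rhd> b"
      by (rule base.hcmp_id2_merge(2)) (use ab a' b(1) cb assms(1-3,7,8) in simp_all)
    also have "\<dots> = appmap A B \<rhd> (?F \<rhd> b)"
      unfolding appmap_reix[OF assms(1-3,7,8)]
      by (rule base.hcmp_id2_merge(2)[symmetric]) (use b(1) cb F assms(1-3) in simp_all)
    also have "\<dots> = (appmap A B \<rhd> e') \<lhd> fext f A"
      unfolding Fb by (rule base.hcmp_assoc'[symmetric]) (use e'(1) ce assms(1-3,7,8) in simp_all)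
    finally show "fext (fext f A) B \<rhd> (appmap ?A ?B \<rhd> b) = fext (fext f A) B \<rhd> p'"
      unfolding e'(6) assms(13) .
    have "sr (appmap ?A ?B \<rhd> b) = appmap ?A ?B \<odot> sr b" "tg (appmap ?A ?B \<rhd> b) = appmap ?A ?B \<odot> tg b"
      using b(1) cb a'(1,2) by simp_all
    then show "sr (appmap ?A ?B \<rhd> b) = sr p'" "tg (appmap ?A ?B \<rhd> b) = tg p'"
      unfolding b(2,3) assms(10,11) appsec_def p[symmetric] by blast+
  qed (use assms(1-3,7-9) b(1) cb a'(1-3) ab in simp_all)
  then show ?thesis
    unfolding extends_def p[symmetric] ab(4) cells_iff using b assms(14-17) by blast
qed

definition Extsec :: "'a \<Rightarrow> 'a \<Rightarrow> 'm \<Rightarrow> 'm \<Rightarrow> 'm \<Rightarrow> 'm" where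
  "Extsec A B m n p = cell_sec (pity A B) m n
     (extcell A B m n (sec_cell B (appsec A B m) (appsec A B n) p))"

context
  fixes A B m n
  assumes A: "isty A" and B: "isty B" "cx B = ext A"
    and m: "gsection (pity A B) m" and n: "gsection (pity A B) n"
begin

lemma Extsec_extends:
  assumes "gsection (IdT B (appsec A B m) (appsec A B n)) p"
  shows "extends A B m n (sec_cell B (appsec A B m) (appsec A B n) p)
    (extcell A B m n (sec_cell B (appsec A B m) (appsec A B n) p))"
proof -
  note s = appsec_section[OF A B m] appsec_section[OF A B n]
  show ?thesis
    by (rule extcell_extends(1)[OF A B m n]) (use sec_cell_simps[OF B(1) s assms] B in simp_all)
qed

lemma Extsec_section:
  assumes "gsection (IdT B (appsec A B m) (appsec A B n)) p"
  shows "gsection (IdT (pity A B) m n) (Extsec A B m n p)"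
    "sec_cell (pity A B) m n (Extsec A B m n p) =
      extcell A B m n (sec_cell B (appsec A B m) (appsec A B n) p)"
  unfolding Extsec_def
  using cell_sec_facts(1,3)[OF pity_facts(1)[OF A B] m n] Extsec_extends[OF assms] A B
  by (simp_all add: extends_def)

text \<open>The reindexed cell \<open>\<beta>\<close> extends the reindexed homotopy, hence is the
  extensionality cell of the reindexed data.\<close>

lemma Extsec_reix:
  assumes "gsection (IdT B (appsec A B m) (appsec A B n)) p" "arr f" "cd f = cx A"
  shows "resec f (IdT (pity A B) m n) (Extsec A B m n p) =
    Extsec (reix f A) (reix (fext f A) B) (resec f (pity A B) m) (resec f (pity A B) n)
      (resec (fext f A) (IdT B (appsec A B m) (appsec A B n)) p)"
proof -
  let ?A = "reix f A" and ?B = "reix (fext f A) B" and ?P = "pity A B"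
    and ?m = "resec f (pity A B) m" and ?n = "resec f (pity A B) n"
    and ?am = "appsec A B m" and ?an = "appsec A B n"
    and ?p = "resec (fext f A) (IdT B (appsec A B m) (appsec A B n)) p"
  let ?am' = "appsec ?A ?B ?m" and ?an' = "appsec ?A ?B ?n"
  let ?e = "extcell A B m n (sec_cell B ?am ?an p)"
  have P: "isty ?P" "cx ?P = cx A" using A B by simp_all
  note q = pity_reix(1)[OF A B assms(2,3)]
  have ab: "isty ?A" "isty ?B" "cx ?B = ext ?A" "cx ?A = dm f" using A B assms(2,3) by simp_all
  have mn: "gsection (pity ?A ?B) ?m" "gsection (pity ?A ?B) ?n"
    unfolding q[symmetric] using P m n assms(2,3) by simp_all
  note s = appsec_section[OF A B m] appsec_section[OF A B n]
  note s' = appsec_section[OF ab(1-3) mn(1)] appsec_section[OF ab(1-3) mn(2)]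
  have fA: "arr (fext f A)" "cd (fext f A) = cx B" using A B assms by simp_all
  have p': "gsection (IdT ?B ?am' ?an') ?p"
    using resec_facts(1)[OF fA(1) _ _ assms(1)] IdT_reix[OF B(1) s fA]
      appsec_reix[OF A B m assms(2,3)] appsec_reix[OF A B n assms(2,3)] B s fA by simp
  note x = Extsec_extends[OF assms(1)]
  have E: "cell ?e" "sr ?e = m" "tg ?e = n" "disp ?P \<rhd> ?e = id2 (ide (cx A))"
    using x by (simp_all add: extends_def)
  obtain \<beta> where b: "cell \<beta>" "sr \<beta> = ?m" "tg \<beta> = ?n" "disp (reix f ?P) \<rhd> \<beta> = id2 (ide (dm f))"
      "fext f ?P \<rhd> \<beta> = ?e \<lhd> f"
    by (rule reix_cell_ex[OF P(1) m n E(1-3), of f]) (use E(4) P assms in simp_all)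
  note c' = sec_cell_simps[OF ab(2) s' p']
  have f': "fext (fext f A) B \<rhd> sec_cell ?B ?am' ?an' ?p = sec_cell B ?am ?an p \<lhd> fext f A"
    using sec_cell_reix[OF B(1) s assms(1) fA]
    unfolding appsec_reix[OF A B m assms(2,3)] appsec_reix[OF A B n assms(2,3)] .
  have "extends ?A ?B ?m ?n (sec_cell ?B ?am' ?an' ?p) \<beta>"
    by (rule extends_reix[OF A B m n x assms(2,3) c'(1-3) _ f' b]) (use c'(4) ab in simp)
  then have "\<beta> = extcell ?A ?B ?m ?n (sec_cell ?B ?am' ?an' ?p)"
    by (intro extcell_extends(2)[OF ab(1-3) mn c'(1-3)]) (use c'(4) ab in simp_all)
  moreover have "resec f (IdT ?P m n) (cell_sec ?P m n ?e) = cell_sec (reix f ?P) ?m ?n \<beta>"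
    by (rule cell_sec_reix[OF P(1) m n assms(2) _ E(1-3)]) (use E(4) P assms b in simp_all)
  ultimately show ?thesis unfolding Extsec_def q by simp
qed

end

text \<open>The identity 2-cell of \<open>m\<close> extends the identity homotopy; uniqueness
  identifies it with \<open>extcell\<close>.\<close>

lemma Extsec_refl:
  assumes "isty A" "isty B" "cx B = ext A" "gsection (pity A B) m"
  shows "Extsec A B m m (reflsec B (appsec A B m)) = reflsec (pity A B) m"
proof -
  let ?P = "pity A B" and ?am = "appsec A B m"
  have P: "isty ?P" "cx ?P = cx A" using assms by simp_all
  note a = appsec_section[OF assms]
  note A = gsectionD[OF a] and m = gsectionD[OF assms(4)]
  have c: "sec_cell B ?am ?am (reflsec B ?am) = id2 ?am" by (rule reflsec_facts(2)[OF assms(2) a])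
  have "extends A B m m (id2 ?am) (id2 m)"
    unfolding extends_def
  proof (intro conjI exI[of _ "id2 (resec (disp A) ?P m)"])
    show "appmap A B \<rhd> id2 (resec (disp A) ?P m) = id2 ?am"
      unfolding appsec_def using assms P by simp
  qed (use assms m P in simp_all)
  then have "id2 m = extcell A B m m (id2 ?am)"
    by (intro extcell_extends(2)[OF assms assms(4)]) (use A assms in simp_all)
  then show ?thesis unfolding Extsec_def c reflsec_def[of ?P] by simp
qed

lemma cellty_IdT:
  assumes "isty A" "gsection A a" "gsection A b" "cell \<alpha>" "sr \<alpha> = a" "tg \<alpha> = b"
    "disp A \<rhd> \<alpha> = id2 (ide (cx A))"
  shows "cellty A \<alpha> = IdT A a b" "cellsec A \<alpha> = cell_sec A a b \<alpha>"
  using cell_sec_facts(4)[OF assms] by (simp_all add: cellty_def cellsec_def IdT_def cell_sec_def)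

text \<open>Transport in a constant family of identity types is whiskering. The proof evaluates naturality of the
  section \<open>j\<close> given by the eliminator against the contraction \<open>\<theta>\<close> of \<open>P\<close>'s path object.\<close>

lemma Jsec_whisker:
  assumes "isty P" "isty D" "cx D = cx P" "gsection (reix (disp P) D) g"
    "gsection P m" "gsection P n" "gsection (IdT P m n) q"
  defines "w \<equiv> disp P \<odot> idsrc P"
  defines "u \<equiv> resec (idsrc P) (reix (disp P) D) g"
    and "v \<equiv> resec (idtgt P) (reix (disp P) D) g"
  defines "C \<equiv> IdT (reix w D) u v" and "d \<equiv> reflsec (reix (disp P) D) g"
  defines "G \<equiv> fext (disp P) D \<odot> g"
  shows "isty C" "cx C = ext (idty P)" "gsection (reix (reflmap P) C) d"
    "resec m (reix (disp P) D) g = G \<odot> m" "resec n (reix (disp P) D) g = G \<odot> n"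
    "reix (idmap P m n q) C = IdT D (G \<odot> m) (G \<odot> n)"
    "gsection D (G \<odot> m)" "gsection D (G \<odot> n)"
    "sec_cell D (G \<odot> m) (G \<odot> n) (Jsec P C d m n q) = G \<rhd> sec_cell P m n q"
proof -
  let ?DP = "reix (disp P) D" and ?D = "reix w D" and ?s = "idsrc P" and ?t = "idtgt P"
    and ?r = "reflmap P" and ?\<theta> = "reflcell P" and ?i = "idmap P m n q"
  note th = reflcell_facts[OF assms(1)]
  note g = gsectionD[OF assms(4)] and m = gsectionD[OF assms(5)] and n = gsectionD[OF assms(6)]
  have DP: "isty ?DP" "cx ?DP = ext P" using assms(1-3) by simp_all
  have w: "arr w" "dm w = ext (idty P)" "cd w = cx D" using assms(1,3) by (simp_all add: w_def)
  have D: "isty ?D" "cx ?D = ext (idty P)" using w assms(2) by simp_all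
  have rs: "reix ?s ?DP = ?D" unfolding w_def using assms(1-3) by simp
  have rt: "reix ?t ?DP = ?D" unfolding w_def using assms(1-3) by simp
  have u: "gsection ?D u" "fext ?s ?DP \<odot> u = g \<odot> ?s"
    using resec_facts[of ?s ?DP g] DP assms(1,4) unfolding u_def rs by simp_all
  have v: "gsection ?D v" "fext ?t ?DP \<odot> v = g \<odot> ?t"
    using resec_facts[of ?t ?DP g] DP assms(1,4) unfolding v_def rt by simp_all
  note U = gsectionD[OF u(1)] and V = gsectionD[OF v(1)]
  have G: "arr G" "dm G = ext P" "cd G = ext D" "disp D \<odot> G = disp P"
    using g DP assms(1-3) by (simp_all add: G_def)
  have wu: "fext w D \<odot> u = G \<odot> ?s"
  proof -
    have "fext w D \<odot> u = fext (disp P) D \<odot> fext ?s ?DP \<odot> u"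
      unfolding w_def by (rule reix_cmp(3)[symmetric]) (use assms(1-3) U in \<open>simp_all add: w_def\<close>)
    then show ?thesis unfolding u(2) G_def using g assms(1-3) by simp
  qed
  have wv: "fext w D \<odot> v = G \<odot> ?t"
  proof -
    have w': "w = disp P \<odot> ?t" using assms(1) by (simp add: w_def)
    have "fext w D \<odot> v = fext (disp P) D \<odot> fext ?t ?DP \<odot> v"
      unfolding w' by (rule reix_cmp(3)[symmetric]) (use assms(1-3) V in \<open>simp_all add: w_def\<close>)
    then show ?thesis unfolding v(2) G_def using g assms(1-3) by simp
  qed
  show C: "isty C" "cx C = ext (idty P)" unfolding C_def using D u(1) v(1) by simp_all
  have wr: "w \<odot> ?r = disp P" unfolding w_def using assms(1) by simp
  have rD: "reix ?r ?D = ?DP" using w wr assms(1,2) by simp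
  have ru: "resec ?r ?D u = g" "resec ?r ?D v = g"
  proof -
    have "resec ?r (reix ?s ?DP) (resec ?s ?DP g) = g" "resec ?r (reix ?t ?DP) (resec ?t ?DP g) = g"
      using DP assms(1,4) by (simp_all del: reix_cmp)
    then show "resec ?r ?D u = g" "resec ?r ?D v = g" unfolding rs rt u_def v_def by simp_all
  qed
  have rC: "reix ?r C = IdT ?DP g g"
    unfolding C_def by (subst IdT_reix) (use D u(1) v(1) assms(1) rD ru in simp_all)
  show d: "gsection (reix ?r C) d"
    unfolding rC d_def by (rule reflsec_facts(1)[OF DP(1) assms(4)])
  have mk: "gsection D (G \<odot> k)" "resec k ?DP g = G \<odot> k" if k: "gsection P k" for k
  proof -
    note K = gsectionD[OF k]
    have "disp D \<odot> G \<odot> k = (disp D \<odot> G) \<odot> k"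
      by (rule base.cmp_assoc'[symmetric]) (use G(1-3) K assms(1-3) in simp_all)
    then show s: "gsection D (G \<odot> k)" unfolding G(4) using G(1-3) K assms(1-3) by (simp add: gsection_iff)
    have x: "reix k ?DP = D" using K assms(1-3) by simp
    note R = resec_facts[of k ?DP g]
    have r: "gsection D (resec k ?DP g)" "fext k ?DP \<odot> resec k ?DP g = g \<odot> k"
      using R K DP assms(1,4) x by simp_all
    note r1 = gsectionD[OF r(1)]
    have "resec k ?DP g = fext (disp P \<odot> k) D \<odot> resec k ?DP g" using K r1 assms(1-3) by simp
    also have "\<dots> = fext (disp P) D \<odot> fext k ?DP \<odot> resec k ?DP g"
      by (rule reix_cmp(3)[symmetric]) (use K r1 assms(1-3) in simp_all)
    also have "\<dots> = G \<odot> k" unfolding r(2) G_def using K g assms(1-3) by simp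
    finally show "resec k ?DP g = G \<odot> k" .
  qed
  show "resec m ?DP g = G \<odot> m" "resec n ?DP g = G \<odot> n" "gsection D (G \<odot> m)" "gsection D (G \<odot> n)"
    using mk assms(5,6) by simp_all
  have i: "arr ?i" "dm ?i = cx P" "cd ?i = ext (idty P)" "?s \<odot> ?i = m" "?t \<odot> ?i = n"
    using assms(1,5-7) by simp_all
  have wi: "w \<odot> ?i = ide (cx P)" unfolding w_def using i assms(1) m by simp
  have iD: "reix ?i ?D = D" using w wi i assms(1-3) by simp
  have iu: "resec ?i ?D u = G \<odot> m" "resec ?i ?D v = G \<odot> n"
  proof -
    have "resec ?i (reix ?s ?DP) (resec ?s ?DP g) = resec m ?DP g"
      "resec ?i (reix ?t ?DP) (resec ?t ?DP g) = resec n ?DP g"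
      using DP assms(1,4) i by (simp_all del: reix_cmp)
    then show "resec ?i ?D u = G \<odot> m" "resec ?i ?D v = G \<odot> n"
      unfolding rs rt u_def v_def using mk(2) assms(5,6) by simp_all
  qed
  show iC: "reix ?i C = IdT D (G \<odot> m) (G \<odot> n)"
    unfolding C_def by (subst IdT_reix) (use D u(1) v(1) i iD iu in simp_all)
  let ?j = "elim ?r ?t ?\<theta> C d"
  note ret = retraction_J[OF assms(1)]
  have j: "gsection (IdT ?D u v) ?j"
    unfolding C_def[symmetric] by (rule elim_section[OF ret C(1)]) (use C d assms(1) in simp_all)
  have jr: "resec ?r (IdT ?D u v) ?j = d"
    unfolding C_def[symmetric] by (rule elim_comp(2)[OF ret C(1)]) (use C d assms(1) in simp_all)
  let ?S = "sec_cell ?D u v ?j"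
  note S = sec_cell_simps[OF D(1) u(1) v(1) j]
  \<comment> \<open>The computation rule for the eliminator \<open>?j\<close>, read as a statement
    on 2-cells: \<open>?S\<close> is an identity along reflexivity.\<close>
  have "fext ?r ?D \<rhd> sec_cell (reix ?r ?D) (resec ?r ?D u) (resec ?r ?D v) (resec ?r (IdT ?D u v) ?j) =
      ?S \<lhd> ?r"
    by (rule sec_cell_reix[OF D(1) u(1) v(1) j]) (use D assms(1) in simp_all)
  then have "fext ?r ?D \<rhd> sec_cell ?DP g g d = ?S \<lhd> ?r" unfolding rD ru jr .
  moreover have "sec_cell ?DP g g d = id2 g" unfolding d_def by (rule reflsec_facts(2)[OF DP(1) assms(4)])
  ultimately have "fext ?r ?D \<rhd> id2 g = ?S \<lhd> ?r" by (simp only:)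
  moreover have "fext ?r ?D \<rhd> id2 g = id2 (fext ?r ?D \<odot> g)"
    by (rule base.hcmp_id2_merge(1)) (use g(1,3) DP D assms(1,2) rD wr w in simp_all)
  ultimately have Sr: "?S \<lhd> ?r = id2 (fext ?r ?D \<odot> g)" by (simp only:)
  have vr: "v \<odot> ?r = fext ?r ?D \<odot> g"
    using arg_cong[OF Sr, of tg] S(1-3) U V D g DP rD wr w assms(1,2) by simp
  have "?S \<lhd> (?r \<odot> ?t) = (?S \<lhd> ?r) \<lhd> ?t" using S(1-3) U D assms(1) by simp
  also have "\<dots> = id2 (v \<odot> ?r \<odot> ?t)" unfolding Sr vr[symmetric] using V D assms(1) by simp
  finally have Srt: "?S \<lhd> (?r \<odot> ?t) = id2 (v \<odot> ?r \<odot> ?t)" .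
  \<comment> \<open>The contraction goes from the identity to \<open>?r \<odot> ?t\<close>, where
    \<open>?S\<close> is already known to be trivial. Interchange thus expresses \<open>?S\<close>
    itself through whiskerings of the contraction.\<close>
  have "VCmp (base M) (?S \<lhd> (?r \<odot> ?t)) (u \<rhd> ?\<theta>) = VCmp (base M) (v \<rhd> ?\<theta>) (?S \<lhd> ide (ext (idty P)))"
    using base.whisker_exchange[of ?\<theta> ?S] th(1-3) S U D disp_simps(4)[OF idty_facts(1)[OF assms(1)]] by simp
  moreover have "?S \<lhd> ide (ext (idty P)) = ?S" using S U D by simp
  moreover have "u \<odot> ?r \<odot> ?t = v \<odot> ?r \<odot> ?t"
    using arg_cong[OF Srt, of sr] S U V D assms(1) by simp
  ultimately have ex: "u \<rhd> ?\<theta> = VCmp (base M) (v \<rhd> ?\<theta>) ?S"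
    unfolding Srt using th(1-3) U V D assms(1) by simp
  have Fw: "arr (fext w D)" "dm (fext w D) = ext ?D" "cd (fext w D) = ext D" using w assms(2) by simp_all
  \<comment> \<open>Projecting to \<open>D\<close> turns \<open>u\<close> and \<open>v\<close> into
    \<open>G\<close> after the source and after the target. The source projection of the contraction
    is \<open>idcell P\<close> and the target projection an identity, which leaves
    \<open>G \<rhd> idcell P\<close>.\<close>
  have "fext w D \<rhd> (u \<rhd> ?\<theta>) = VCmp (base M) (fext w D \<rhd> (v \<rhd> ?\<theta>)) (fext w D \<rhd> ?S)"
    unfolding ex by (rule base.whisker_vcmp) (use Fw th(1-3) U V D S assms(1) in simp_all)
  moreover have "fext w D \<rhd> (u \<rhd> ?\<theta>) = (fext w D \<odot> u) \<rhd> ?\<theta>"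
    by (rule base.hcmp_id2_merge(2)) (use Fw U D th(1-3) assms(1) in simp_all)
  moreover have "(fext w D \<odot> u) \<rhd> ?\<theta> = G \<rhd> (?s \<rhd> ?\<theta>)"
    unfolding wu by (rule base.hcmp_id2_merge(2)[symmetric]) (use G th(1-3) assms(1) in simp_all)
  moreover have "fext w D \<rhd> (v \<rhd> ?\<theta>) = (fext w D \<odot> v) \<rhd> ?\<theta>"
    by (rule base.hcmp_id2_merge(2)) (use Fw V D th(1-3) assms(1) in simp_all)
  moreover have "(fext w D \<odot> v) \<rhd> ?\<theta> = G \<rhd> (?t \<rhd> ?\<theta>)"
    unfolding wv by (rule base.hcmp_id2_merge(2)[symmetric]) (use G th(1-3) assms(1) in simp_all)
  ultimately have "G \<rhd> idcell P = VCmp (base M) (G \<rhd> id2 ?t) (fext w D \<rhd> ?S)"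
    unfolding th(4,5) by simp
  then have FS: "fext w D \<rhd> ?S = G \<rhd> idcell P"
    using S Fw V U D wv G assms(1) by simp
  have "fext ?i ?D \<rhd> sec_cell (reix ?i ?D) (resec ?i ?D u) (resec ?i ?D v) (resec ?i (IdT ?D u v) ?j) = ?S \<lhd> ?i"
    by (rule sec_cell_reix[OF D(1) u(1) v(1) j]) (use D i in simp_all)
  then have T: "fext ?i ?D \<rhd> sec_cell D (G \<odot> m) (G \<odot> n) (Jsec P C d m n q) = ?S \<lhd> ?i"
    unfolding iD iu Jsec_def C_def .
  have J: "gsection (IdT D (G \<odot> m) (G \<odot> n)) (Jsec P C d m n q)"
    unfolding iC[symmetric] by (rule Jsec_section) (use C d assms(1,5-7) in simp_all)
  note c = sec_cell_simps[OF assms(2) mk(1)[OF assms(5)] mk(1)[OF assms(6)] J]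
  have Fi: "fext w D \<odot> fext ?i ?D = ide (ext D)" using w i wi assms(2,3) by simp
  have fi: "arr (fext ?i ?D)" "dm (fext ?i ?D) = ext D" "cd (fext ?i ?D) = ext ?D"
    using reix_simps(3-5)[OF i(1) D(1)] unfolding iD using i(3) D(2) by simp_all
  have "(fext w D \<odot> fext ?i ?D) \<rhd> sec_cell D (G \<odot> m) (G \<odot> n) (Jsec P C d m n q) =
      fext w D \<rhd> (fext ?i ?D \<rhd> sec_cell D (G \<odot> m) (G \<odot> n) (Jsec P C d m n q))"
    by (rule base.hcmp_id2_merge(2)[symmetric]) (use Fw fi c(1,2) G m assms(1) in simp_all)
  also have "\<dots> = (fext w D \<rhd> ?S) \<lhd> ?i"
    unfolding T by (rule base.hcmp_assoc'[symmetric]) (use Fw S U D i in simp_all)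
  also have "\<dots> = G \<rhd> (idcell P \<lhd> ?i)"
    unfolding FS by (rule base.hcmp_assoc') (use G i assms(1) in simp_all)
  finally show "sec_cell D (G \<odot> m) (G \<odot> n) (Jsec P C d m n q) = G \<rhd> sec_cell P m n q"
    unfolding Fi using c(1,2) G m assms(1) by (simp add: sec_cell_def[of P])
qed

section \<open>The computation rule of function extensionality\<close>

lemma resec_diag:
  assumes "isty A" "gsection A a"
  shows "resec a (reix (disp A) A) (diag A) = a"
proof -
  note a = gsectionD[OF assms(2)]
  have "resec a (reix (disp A) A) (diag A) = sec (disp A \<odot> a) A (ide (ext A) \<odot> a)"
    unfolding diag_def by (rule resec_sec) (use assms a in simp_all)
  also have "\<dots> = a" by (rule sec_unique) (use assms a in simp_all)
  finally show ?thesis .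
qed

text \<open>\<open>g\<close> is the denotation of \<open>x \<cdot> a\<close> for a variable
  \<open>x\<close> of the product type; instantiating \<open>x\<close> by \<open>k\<close> gives
  \<open>k \<cdot> a\<close>.\<close>

lemma Asec_generic:
  assumes "isty A" "isty B" "cx B = ext A" "gsection A a"
  defines "P \<equiv> pity A B"
  defines "g \<equiv> Asec (reix (disp P) A) (reix (fext (disp P) A) B) (diag P) (resec (disp P) A a)"
  shows "gsection (reix (disp P) (reix a B)) g"
    "gsection P k \<Longrightarrow> resec k (reix (disp P) (reix a B)) g = Asec A B k a"
proof -
  let ?d = "disp P"
  let ?A = "reix ?d A" and ?B = "reix (fext ?d A) B" and ?a = "resec ?d A a"
  note a = gsectionD[OF assms(4)]
  have P: "isty P" "cx P = cx A" using assms(1-3) by (simp_all add: P_def)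
  have d: "arr ?d" "cd ?d = cx A" "dm ?d = ext P" using P by simp_all
  have p: "reix ?d P = pity ?A ?B" using pity_reix(1)[OF assms(1-3) d(1,2)] unfolding P_def .
  have ab: "isty ?A" "isty ?B" "cx ?B = ext ?A" using assms(1-3) d by simp_all
  have dg: "gsection (pity ?A ?B) (diag P)" unfolding p[symmetric] by (rule diag_simps(1)[OF P(1)])
  have a3: "gsection ?A ?a" by (rule resec_facts(1)) (use assms(1,4) d in simp_all)
  note A3 = gsectionD[OF a3]
  have e: "reix ?a ?B = reix ?d (reix a B)"
    using assms(1-4) a d A3 by simp
  show "gsection (reix ?d (reix a B)) g"
    unfolding g_def e[symmetric] by (rule Asec_section[OF ab dg a3])
  assume k: "gsection P k"
  note K = gsectionD[OF k]
  have dk: "?d \<odot> k = ide (cx A)" using K(4) P(2) by simp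
  have x: "arr k" "cd k = cx ?A" using K P assms(1) d by simp_all
  have 1: "reix k ?A = A" "fext ?d A \<odot> fext k ?A = ide (ext A)"
    using assms(1) d K P dk by simp_all
  have fk: "arr (fext k ?A)" "dm (fext k ?A) = ext A" "cd (fext k ?A) = ext ?A"
    using x reix_simps(3-5)[OF x(1) ab(1) x(2)] unfolding 1(1) by simp_all
  have "reix (fext k ?A) ?B = reix (fext ?d A \<odot> fext k ?A) B"
    by (rule reix_cmp(1)) (use fk d assms(1-3) in simp_all)
  then have 2: "reix (fext k ?A) ?B = B" unfolding 1(2) using assms(2,3) by simp
  have 3: "resec k (pity ?A ?B) (diag P) = k" unfolding p[symmetric] by (rule resec_diag[OF P(1) k])
  have "resec k ?A ?a = resec (?d \<odot> k) A a"
    by (rule resec_cmp) (use K P d assms(1,4) in simp_all)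
  then have 4: "resec k ?A ?a = a" unfolding dk using assms(1,4) by simp
  have "resec k (reix ?a ?B) g = Asec (reix k ?A) (reix (fext k ?A) ?B)
      (resec k (pity ?A ?B) (diag P)) (resec k ?A ?a)"
    unfolding g_def by (rule Asec_reix[OF ab dg a3 x])
  then show "resec k (reix ?d (reix a B)) g = Asec A B k a" unfolding e 1(1) 2 3 4 .
qed

text \<open>By \<open>Jsec_whisker\<close> the left side is the extensionality cell whiskered with
  the map \<open>?G\<close> sending \<open>x\<close> to \<open>x \<cdot> a\<close>. Since
  \<open>x \<cdot> a\<close> is \<epsilon> at the argument \<open>a\<close>, this whiskering is
  \<epsilon> applied to the weakened cell and restricted along \<open>a\<close>; by
  \<open>extends\<close> that is the homotopy at \<open>a\<close>.\<close>

lemma Extsec_comp: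
  assumes "isty A" "isty B" "cx B = ext A" "gsection (pity A B) m" "gsection (pity A B) n"
    "gsection (IdT B (appsec A B m) (appsec A B n)) p" "gsection A a"
  defines "P \<equiv> pity A B" and "D \<equiv> reix a B"
  defines "g \<equiv> Asec (reix (disp P) A) (reix (fext (disp P) A) B) (diag P) (resec (disp P) A a)"
  shows "Jsec P (IdT (reix (disp P \<odot> idsrc P) D) (resec (idsrc P) (reix (disp P) D) g)
        (resec (idtgt P) (reix (disp P) D) g)) (reflsec (reix (disp P) D) g) m n (Extsec A B m n p) =
      resec a (IdT B (appsec A B m) (appsec A B n)) p"
    (is "Jsec P ?C ?br m n ?q = ?r")
    "reix a (IdT B (appsec A B m) (appsec A B n)) = IdT D (Asec A B m a) (Asec A B n a)"
proof -
  let ?d = "disp P"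
  let ?A = "reix ?d A" and ?B = "reix (fext ?d A) B" and ?a = "resec ?d A a"
    and ?PA = "reix (disp A) P" and ?P3 = "reix (disp P) P"
  note a = gsectionD[OF assms(7)]
  have P: "isty P" "cx P = cx A" using assms(1-3) by (simp_all add: P_def)
  have mn: "gsection P m" "gsection P n" using assms(4,5) by (simp_all add: P_def)
  have d: "arr ?d" "cd ?d = cx A" "dm ?d = ext P" using P by simp_all
  have p: "?P3 = pity ?A ?B" using pity_reix(1)[OF assms(1-3) d(1,2)] unfolding P_def .
  have ab: "isty ?A" "isty ?B" "cx ?B = ext ?A" "cx ?A = ext P" using assms(1-3) d by simp_all
  have dg: "gsection ?P3 (diag P)" by (rule diag_simps(1)[OF P(1)])
  have P3: "isty ?P3" "cx ?P3 = ext P" using P by simp_all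
  have a3: "gsection ?A ?a" by (rule resec_facts(1)) (use assms(1,7) d in simp_all)
  note A3 = gsectionD[OF a3]
  have D: "isty D" "cx D = cx P" using assms(2,3) a P by (simp_all add: D_def)
  note gg = Asec_generic[OF assms(1-3,7), folded P_def D_def, folded g_def]
  have q: "gsection (IdT P m n) ?q"
    and qc: "sec_cell P m n ?q = extcell A B m n (sec_cell B (appsec A B m) (appsec A B n) p)"
    using Extsec_section[OF assms(1-6)] unfolding P_def .
  let ?G = "fext ?d D \<odot> g" and ?e = "sec_cell P m n ?q" and ?pc = "sec_cell B (appsec A B m) (appsec A B n) p"
  note w = Jsec_whisker[OF P(1) D gg(1) mn q]
  note G1 = gsectionD[OF gg(1)]
  have Gd: "arr ?G" "dm ?G = ext P" "cd ?G = ext D" using G1 D P d by simp_all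
  have Gm: "?G \<odot> m = Asec A B m a" and Gn: "?G \<odot> n = Asec A B n a"
    using gg(2)[OF mn(1)] gg(2)[OF mn(2)] w(4,5) by simp_all
  note s = appsec_section[OF assms(1-4)] appsec_section[OF assms(1-3,5)]
  have acx: "arr a" "cd a = cx B" using a assms(3) by simp_all
  show IdD: "reix a (IdT B (appsec A B m) (appsec A B n)) = IdT D (Asec A B m a) (Asec A B n a)"
    unfolding D_def Asec_def by (rule IdT_reix[OF assms(2) s acx])
  have r: "gsection (IdT D (Asec A B m a) (Asec A B n a)) ?r"
    unfolding IdD[symmetric] by (rule resec_facts(1)) (use acx assms(2,6) s in simp_all)
  have "extends A B m n ?pc (extcell A B m n ?pc)" by (rule Extsec_extends[OF assms(1-6)])
  then have "extends A B m n ?pc ?e" unfolding qc .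
  then obtain e' where E: "cell ?e" "sr ?e = m" "tg ?e = n" "disp P \<rhd> ?e = id2 (ide (cx A))"
    and e': "cell e'" "sr e' = resec (disp A) P m" "tg e' = resec (disp A) P n"
      "disp ?PA \<rhd> e' = id2 (ide (ext A))" "fext (disp A) P \<rhd> e' = ?e \<lhd> disp A"
      "appmap A B \<rhd> e' = ?pc"
    unfolding extends_def P_def[symmetric] by auto
  let ?R = "resec (disp ?A) ?P3 (diag P)" and ?F = "fext (fext ?d A) ?PA"
  \<comment> \<open>The map from \<Gamma>.P to \<Gamma>.A.P that adds the fixed argument
    \<open>a\<close> and keeps the function: \<open>?a\<close> supplies the argument,
    \<open>?R\<close> the function as a weakened variable, and \<open>?F\<close> forgets the extra
    copy of \<open>P\<close>. \<open>Q1\<close> and \<open>Q2\<close> are its two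
    components.\<close>
  let ?Q = "?F \<odot> ?R \<odot> ?a"
  have PA: "isty ?PA" "cx ?PA = ext A" using P assms(1) by simp_all
  have RPA: "reix (disp ?A) ?P3 = reix (fext ?d A) ?PA" using P assms(1) d by simp
  have R: "arr ?R" "dm ?R = ext ?A" "cd ?R = ext (reix (disp ?A) ?P3)"
    using resec_simps(2-4)[of "disp ?A" ?P3 "diag P"] ab P3 dg by simp_all
  have F: "arr ?F" "dm ?F = ext (reix (disp ?A) ?P3)" "cd ?F = ext ?PA"
    unfolding RPA using PA assms(1) d by simp_all
  have Ra: "arr (?R \<odot> ?a)" "dm (?R \<odot> ?a) = ext P" "cd (?R \<odot> ?a) = ext (reix (disp ?A) ?P3)"
    using R A3 ab by simp_all
  have Q: "arr ?Q" "dm ?Q = ext P" "cd ?Q = ext ?PA" using F Ra by simp_all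
  have fa: "fext ?d A \<odot> ?a = a \<odot> ?d" by (rule resec_facts(2)) (use assms(1,7) d in simp_all)
  have dRa: "disp (reix (disp ?A) ?P3) \<odot> ?R \<odot> ?a = ?a"
    by (rule resec_cmp_simps(1)) (use ab P3 dg A3 in simp_all)
  have fRa: "fext (disp ?A) ?P3 \<odot> ?R \<odot> ?a = diag P \<odot> disp ?A \<odot> ?a"
    by (rule resec_cmp_simps(2)) (use ab P3 dg A3 in simp_all)
  have Q1: "disp ?PA \<odot> ?Q = a \<odot> ?d"
  proof -
    have "disp ?PA \<odot> ?Q = fext ?d A \<odot> disp (reix (fext ?d A) ?PA) \<odot> ?R \<odot> ?a"
      by (rule disp_fext_cmp) (use PA assms(1) d Ra[unfolded RPA] in simp_all)
    then show ?thesis unfolding RPA[symmetric] dRa fa .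
  qed
  have Q2: "fext (disp A) P \<odot> ?Q = ide (ext P)"
  proof -
    have "fext (disp A) P \<odot> ?Q = fext (disp A \<odot> fext ?d A) P \<odot> ?R \<odot> ?a"
      by (rule reix_cmp(3)) (use P assms(1) d Ra in simp_all)
    also have "disp A \<odot> fext ?d A = ?d \<odot> disp ?A" using assms(1) d by simp
    also have "fext (?d \<odot> disp ?A) P \<odot> ?R \<odot> ?a = fext ?d P \<odot> fext (disp ?A) ?P3 \<odot> ?R \<odot> ?a"
      by (rule reix_cmp(3)[symmetric]) (use P assms(1) d Ra in simp_all)
    also have "\<dots> = fext ?d P \<odot> diag P" unfolding fRa using A3(4) ab P by simp
    also have "\<dots> = ide (ext P)" by (rule diag_simps(6)[OF P(1)])
    finally show ?thesis .
  qed
  have "fext a B \<odot> ?G = fext (a \<odot> ?d) B \<odot> g"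
    unfolding D_def by (rule reix_cmp(3)) (use a d assms(2,3) G1 in \<open>simp_all add: D_def\<close>)
  also have "\<dots> = fext (fext ?d A) B \<odot> fext ?a ?B \<odot> g"
    unfolding fa[symmetric]
    by (rule reix_cmp(3)[symmetric]) (use A3 a fa d assms(1-3) G1 in \<open>simp_all add: D_def\<close>)
  also have "fext ?a ?B \<odot> g = appsec ?A ?B (diag P) \<odot> ?a"
    unfolding g_def Asec_def
    by (rule resec_facts(2)) (use A3 ab appsec_section[OF ab(1-3) dg[unfolded p]] in simp_all)
  also have "appsec ?A ?B (diag P) \<odot> ?a = appmap ?A ?B \<odot> ?R \<odot> ?a"
    unfolding appsec_def p[symmetric]
    by (rule base.cmp_assoc') (use R A3 ab appmap_simps[OF ab(1-3), folded p] in simp_all)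
  also have "fext (fext ?d A) B \<odot> appmap ?A ?B \<odot> ?R \<odot> ?a = (fext (fext ?d A) B \<odot> appmap ?A ?B) \<odot> ?R \<odot> ?a"
    by (rule base.cmp_assoc'[symmetric]) (use Ra d assms(1-3) ab appmap_simps(1-3)[OF ab(1-3), folded p] in simp_all)
  also have "\<dots> = appmap A B \<odot> ?Q"
    unfolding appmap_reix[OF assms(1-3) d(1,2), folded P_def]
    by (rule base.cmp_assoc') (use Ra F assms(1-3) appmap_simps(1-3)[OF assms(1-3), folded P_def] in simp_all)
  finally have GQ: "fext a B \<odot> ?G = appmap A B \<odot> ?Q" .
  have cm: "dm m = cx A" "cd m = ext P" using gsectionD[OF mn(1)] P by simp_all
  have ce: "cd (sr e') = ext ?PA" "dm (sr e') = ext A"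
    unfolding e'(2) using assms(1) P mn(1) by simp_all
  \<comment> \<open>Adding the argument \<open>a\<close> to \<open>k\<close> is the same as
    weakening \<open>k\<close> by a variable of \<open>A\<close> and then putting \<open>a\<close>
    for it. \<open>Qe\<close> is the analogue for the cell.\<close>
  have Qm: "?Q \<odot> k = resec (disp A) P k \<odot> a" if k: "gsection P k" for k
  proof (rule pullback_eqI[of "disp A" P])
    note K = gsectionD[OF k]
    note rk = resec_simps[of "disp A" P k] resec_cmp_simps[of "disp A" P k a]
    have rka: "arr (resec (disp A) P k)" "dm (resec (disp A) P k) = ext A"
      "cd (resec (disp A) P k) = ext ?PA" using rk assms(1) P k by simp_all
    have "disp ?PA \<odot> ?Q \<odot> k = (disp ?PA \<odot> ?Q) \<odot> k"
      by (rule base.cmp_assoc'[symmetric]) (use Q K PA in simp_all)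
    also have "\<dots> = a" unfolding Q1 using a d K P by simp
    also have "\<dots> = disp ?PA \<odot> resec (disp A) P k \<odot> a" using rk(7) assms(1) P k a by simp
    finally show "disp ?PA \<odot> ?Q \<odot> k = disp ?PA \<odot> resec (disp A) P k \<odot> a" .
    have "fext (disp A) P \<odot> ?Q \<odot> k = (fext (disp A) P \<odot> ?Q) \<odot> k"
      by (rule base.cmp_assoc'[symmetric]) (use Q K P assms(1) in simp_all)
    also have "\<dots> = k" unfolding Q2 using K by simp
    also have "\<dots> = fext (disp A) P \<odot> resec (disp A) P k \<odot> a"
      using rk(8) assms(1) P k a K by simp
    finally show "fext (disp A) P \<odot> ?Q \<odot> k = fext (disp A) P \<odot> resec (disp A) P k \<odot> a" .
    show "arr (?Q \<odot> k)" "cd (?Q \<odot> k) = ext ?PA" "dm (?Q \<odot> k) = dm (resec (disp A) P k \<odot> a)"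
      using base.cmp_simps[OF K(1) Q(1)] Q K P a rka by simp_all
    show "arr (resec (disp A) P k \<odot> a)" "cd (resec (disp A) P k \<odot> a) = ext ?PA"
      using a rka by simp_all
  qed (use assms(1) P in simp_all)
  have Qe: "?Q \<rhd> ?e = e' \<lhd> a"
  proof (rule pullback_cell_eqI[of "disp A" P])
    have 1: "sr (?Q \<rhd> ?e) = ?Q \<odot> m" "tg (?Q \<rhd> ?e) = ?Q \<odot> n" "cell (?Q \<rhd> ?e)"
      using base.hcmp_simps[of ?e "id2 ?Q"] base.id2_simps[OF Q(1)] E(1-3) Q(2) cm(2) by simp_all
    have 2: "sr (e' \<lhd> a) = sr e' \<odot> a" "tg (e' \<lhd> a) = tg e' \<odot> a" "cell (e' \<lhd> a)" using e'(1) ce a by simp_all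
    show "sr (?Q \<rhd> ?e) = sr (e' \<lhd> a)" "tg (?Q \<rhd> ?e) = tg (e' \<lhd> a)"
      unfolding 1 2 e'(2,3) Qm[OF mn(1)] Qm[OF mn(2)] by (rule refl)+
    show "cell (?Q \<rhd> ?e)" "cell (e' \<lhd> a)" by (rule 1 2)+
    show "cd (sr (?Q \<rhd> ?e)) = ext ?PA" unfolding 1 using base.cmp_simps(3)[OF _ Q(1), of m] cm Q gsectionD(1)[OF mn(1)] by simp
    have "disp ?PA \<rhd> (?Q \<rhd> ?e) = (disp ?PA \<odot> ?Q) \<rhd> ?e"
      by (rule base.hcmp_id2_merge(2)) (use Q PA E(1-3) cm in simp_all)
    also have "\<dots> = a \<rhd> (?d \<rhd> ?e)"
      unfolding Q1 by (rule base.hcmp_id2_merge(2)[symmetric]) (use a d E(1-3) cm in simp_all)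
    also have "\<dots> = (disp ?PA \<rhd> e') \<lhd> a" unfolding E(4) e'(4) using a assms(1) by simp
    also have "\<dots> = disp ?PA \<rhd> (e' \<lhd> a)"
      by (rule base.hcmp_assoc') (use a PA e'(1) ce in simp_all)
    finally show "disp ?PA \<rhd> (?Q \<rhd> ?e) = disp ?PA \<rhd> (e' \<lhd> a)" .
    have "fext (disp A) P \<rhd> (?Q \<rhd> ?e) = (fext (disp A) P \<odot> ?Q) \<rhd> ?e"
      by (rule base.hcmp_id2_merge(2)) (use Q P assms(1) E(1-3) cm in simp_all)
    also have "\<dots> = ?e \<lhd> (disp A \<odot> a)" unfolding Q2 a(4) using E(1,2) cm by simp
    also have "\<dots> = (?e \<lhd> disp A) \<lhd> a"
    proof -
      have "id2 (disp A) \<lhd> a = id2 (disp A \<odot> a)"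
        by (rule base.hcmp_id2_merge(1)) (use a assms(1) in simp_all)
      moreover have "(?e \<lhd> disp A) \<lhd> a = HCmp (base M) ?e (id2 (disp A) \<lhd> a)"
        by (rule base.hcmp_assoc') (use E(1,2) cm a assms(1) in simp_all)
      ultimately show ?thesis by (simp only:)
    qed
    also have "\<dots> = fext (disp A) P \<rhd> (e' \<lhd> a)"
      unfolding e'(5)[symmetric] by (rule base.hcmp_assoc') (use a P assms(1) e'(1) ce in simp_all)
    finally show "fext (disp A) P \<rhd> (?Q \<rhd> ?e) = fext (disp A) P \<rhd> (e' \<lhd> a)" .
  qed (use assms(1) P in simp_all)
  have fB: "arr (fext a B)" "dm (fext a B) = ext D" "cd (fext a B) = ext B"
    using acx assms(2,3) by (simp_all add: D_def)
  have am: "arr (appmap A B)" "dm (appmap A B) = ext ?PA"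
    using appmap_simps(1-2)[OF assms(1-3)] by (simp_all add: P_def)
  \<comment> \<open>Only this second pullback projection carries content: both cells are vertical
    over \<Gamma>, so the first projections agree.\<close>
  have "fext a B \<rhd> (?G \<rhd> ?e) = (fext a B \<odot> ?G) \<rhd> ?e"
    by (rule base.hcmp_id2_merge(2)) (use fB Gd E(1-3) cm in simp_all)
  also have "\<dots> = appmap A B \<rhd> (?Q \<rhd> ?e)"
    unfolding GQ by (rule base.hcmp_id2_merge(2)[symmetric]) (use am Q E(1-3) cm in simp_all)
  also have "\<dots> = ?pc \<lhd> a"
    unfolding Qe e'(6)[symmetric] by (rule base.hcmp_assoc'[symmetric]) (use am e'(1) ce a in simp_all)
  also have "\<dots> = fext a B \<rhd> sec_cell D (Asec A B m a) (Asec A B n a) ?r"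
    unfolding D_def Asec_def by (rule sec_cell_reix[OF assms(2) s assms(6) acx, symmetric])
  finally have fin: "fext a B \<rhd> sec_cell D (Asec A B m a) (Asec A B n a) (Jsec P ?C ?br m n ?q) =
      fext a B \<rhd> sec_cell D (Asec A B m a) (Asec A B n a) ?r"
    unfolding w(9)[symmetric] Gm Gn .
  have As: "gsection D (Asec A B m a)" "gsection D (Asec A B n a)"
    using w(7,8) unfolding Gm Gn .
  have J: "gsection (IdT D (Asec A B m a) (Asec A B n a)) (Jsec P ?C ?br m n ?q)"
    using Jsec_section[OF P(1) w(1-3) mn q] unfolding w(6) Gm Gn .
  note c1 = sec_cell_simps[OF D(1) As J] and c2 = sec_cell_simps[OF D(1) As r]
  have "sec_cell D (Asec A B m a) (Asec A B n a) (Jsec P ?C ?br m n ?q) =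
      sec_cell D (Asec A B m a) (Asec A B n a) ?r"
  proof (rule pullback_cell_eqI[OF acx(1) assms(2) acx(2), folded D_def])
    show "disp D \<rhd> sec_cell D (Asec A B m a) (Asec A B n a) (Jsec P ?C ?br m n ?q) =
      disp D \<rhd> sec_cell D (Asec A B m a) (Asec A B n a) ?r" unfolding c1(4) c2(4) ..
    show "cd (sr (sec_cell D (Asec A B m a) (Asec A B n a) (Jsec P ?C ?br m n ?q))) = ext D"
      unfolding c1(2) by (rule gsectionD(3)[OF As(1)])
    show "cell (sec_cell D (Asec A B m a) (Asec A B n a) (Jsec P ?C ?br m n ?q))"
      "cell (sec_cell D (Asec A B m a) (Asec A B n a) ?r)" by (rule c1(1) c2(1))+
    show "sr (sec_cell D (Asec A B m a) (Asec A B n a) (Jsec P ?C ?br m n ?q)) = sr (sec_cell D (Asec A B m a) (Asec A B n a) ?r)"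
      unfolding c1(2) c2(2) ..
    show "tg (sec_cell D (Asec A B m a) (Asec A B n a) (Jsec P ?C ?br m n ?q)) = tg (sec_cell D (Asec A B m a) (Asec A B n a) ?r)"
      unfolding c1(3) c2(3) ..
    show "fext a B \<rhd> sec_cell D (Asec A B m a) (Asec A B n a) (Jsec P ?C ?br m n ?q) =
      fext a B \<rhd> sec_cell D (Asec A B m a) (Asec A B n a) ?r" by (rule fin)
  qed
  then show "Jsec P ?C ?br m n ?q = ?r"
    by (rule sec_cell_inj[OF D(1) As J r])
qed

section \<open>Interpretation of the raw syntax\<close>

text \<open>The interpretation is a partial function, presented as a relation: \<open>ity X \<rho> A S\<close> says that \<open>A\<close>
  denotes the type \<open>S\<close> over \<open>X\<close> when the variables denote the sections \<open>\<rho>\<close>. Substitution then is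
  a change of \<open>\<rho>\<close>, and no telescope of contexts has to be carried along.\<close>

inductive ity :: "'o \<Rightarrow> ('a, 'm) env \<Rightarrow> ('a, 'm) ty \<Rightarrow> 'a \<Rightarrow> bool"
  and itm :: "'o \<Rightarrow> ('a, 'm) env \<Rightarrow> ('a, 'm) tm \<Rightarrow> 'a \<Rightarrow> 'm \<Rightarrow> bool"
  and isub :: "'o \<Rightarrow> ('a, 'm) env \<Rightarrow> 'a list \<Rightarrow> ('a, 'm) tm list \<Rightarrow> 'm \<Rightarrow> bool"
where
  i_TCon: "ctel As \<Longrightarrow> isty A \<Longrightarrow> cx A = cend As \<Longrightarrow> isub X \<rho> As ts g \<Longrightarrow>
    ity X \<rho> (TCon As A ts) (reix g A)"
| i_Sigma: "ity X \<rho> A S \<Longrightarrow> ity (ext S) (xenv S \<rho>) B T \<Longrightarrow> ity X \<rho> (Sigma A B) (sigty S T)"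
| i_Unit: "ity X \<rho> Unit (unty X)"
| i_Id: "ity X \<rho> A S \<Longrightarrow> itm X \<rho> a S s \<Longrightarrow> itm X \<rho> b S t \<Longrightarrow> ity X \<rho> (Id A a b) (IdT S s t)"
| i_Pi: "ity X \<rho> A S \<Longrightarrow> ity (ext S) (xenv S \<rho>) B T \<Longrightarrow> ity X \<rho> (Pi A B) (pity S T)"
| i_Var: "S = fst (\<rho> n) \<Longrightarrow> s = snd (\<rho> n) \<Longrightarrow> itm X \<rho> (Var n) S s"
| i_Con: "ctel As \<Longrightarrow> isty A \<Longrightarrow> cx A = cend As \<Longrightarrow> gsection A a \<Longrightarrow>
    isub X \<rho> As ts g \<Longrightarrow> itm X \<rho> (Con As A a ts) (reix g A) (resec g A a)"
| i_Pair: "ity X \<rho> A S \<Longrightarrow> ity (ext S) (xenv S \<rho>) B T \<Longrightarrow> itm X \<rho> a S s \<Longrightarrow>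
    itm X \<rho> b (reix s T) t \<Longrightarrow> itm X \<rho> (Pair A B a b) (sigty S T) (pairsec S T s t)"
| i_SplitE: "ity X \<rho> A S \<Longrightarrow> ity (ext S) (xenv S \<rho>) B T \<Longrightarrow>
    ity (ext (sigty S T)) (xenv (sigty S T) \<rho>) C U \<Longrightarrow>
    itm (ext T) (xenv T (xenv S \<rho>)) d (reix (sigin S T) U) e \<Longrightarrow>
    itm X \<rho> c (sigty S T) t \<Longrightarrow> itm X \<rho> (SplitE A B C d c) (reix t U) (Esec S T U e t)"
| i_Star: "itm X \<rho> Star (unty X) (unmap X)"
| i_UnitE: "ity (ext (unty X)) (xenv (unty X) \<rho>) C U \<Longrightarrow>
    itm X \<rho> d (reix (unmap X) U) e \<Longrightarrow> itm X \<rho> c (unty X) t \<Longrightarrow>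
    itm X \<rho> (UnitE C d c) (reix t U) (Usec U e t)"
| i_Refl: "ity X \<rho> A S \<Longrightarrow> itm X \<rho> a S s \<Longrightarrow> itm X \<rho> (Refl A a) (IdT S s s) (reflsec S s)"
| i_J: "ity X \<rho> A S \<Longrightarrow>
    ity (ext (idty S)) (xenv (idty S) (xenv (wkself S) (xenv S \<rho>))) C U \<Longrightarrow>
    itm (ext S) (xenv S \<rho>) d (reix (reflmap S) U) e \<Longrightarrow>
    itm X \<rho> a S s \<Longrightarrow> itm X \<rho> b S t \<Longrightarrow> itm X \<rho> p (IdT S s t) q \<Longrightarrow>
    itm X \<rho> (J A C d a b p) (reix (idmap S s t q) U) (Jsec S U e s t q)"
| i_Lam: "ity X \<rho> A S \<Longrightarrow> ity (ext S) (xenv S \<rho>) B T \<Longrightarrow> itm (ext S) (xenv S \<rho>) f T e \<Longrightarrow>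
    itm X \<rho> (Lam A B f) (pity S T) (lammap S T e)"
| i_App: "ity X \<rho> A S \<Longrightarrow> ity (ext S) (xenv S \<rho>) B T \<Longrightarrow> itm X \<rho> m (pity S T) s \<Longrightarrow>
    itm X \<rho> a S t \<Longrightarrow> itm X \<rho> (App A B m a) (reix t T) (Asec S T s t)"
| i_Ext: "ity X \<rho> A S \<Longrightarrow> ity (ext S) (xenv S \<rho>) B T \<Longrightarrow> itm X \<rho> m (pity S T) s \<Longrightarrow>
    itm X \<rho> n (pity S T) t \<Longrightarrow>
    itm (ext S) (xenv S \<rho>) p (IdT T (appsec S T s) (appsec S T t)) e \<Longrightarrow>
    itm X \<rho> (Ext A B m n p) (IdT (pity S T) s t) (Extsec S T s t e)"
| i_nil: "arr g \<Longrightarrow> dm g = X \<Longrightarrow> cd g = top1 M \<Longrightarrow> isub X \<rho> [] [] g"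
| i_cons: "isub X \<rho> As ts g \<Longrightarrow> isty A \<Longrightarrow> cx A = cend As \<Longrightarrow> itm X \<rho> t (reix g A) a \<Longrightarrow>
    isub X \<rho> (A # As) (t # ts) (fext g A \<odot> a)"

inductive_cases ity_TConE: "ity X \<rho> (TCon As A ts) S"
inductive_cases ity_SigmaE: "ity X \<rho> (Sigma A B) S"
inductive_cases ity_UnitE: "ity X \<rho> Unit S"
inductive_cases ity_IdE: "ity X \<rho> (Id A a b) S"
inductive_cases ity_PiE: "ity X \<rho> (Pi A B) S"
inductive_cases itm_VarE: "itm X \<rho> (Var n) S s"
inductive_cases itm_ConE: "itm X \<rho> (Con As A a ts) S s"
inductive_cases itm_PairE: "itm X \<rho> (Pair A B a b) S s"
inductive_cases itm_SplitEE: "itm X \<rho> (SplitE A B C d c) S s"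
inductive_cases itm_StarE: "itm X \<rho> Star S s"
inductive_cases itm_UnitEE: "itm X \<rho> (UnitE C d c) S s"
inductive_cases itm_ReflE: "itm X \<rho> (Refl A a) S s"
inductive_cases itm_JE: "itm X \<rho> (J A C d a b p) S s"
inductive_cases itm_LamE: "itm X \<rho> (Lam A B f) S s"
inductive_cases itm_AppE: "itm X \<rho> (App A B m a) S s"
inductive_cases itm_ExtE: "itm X \<rho> (Ext A B m n p) S s"
inductive_cases isub_nilE: "isub X \<rho> [] ts g"
inductive_cases isub_consE: "isub X \<rho> (A # As) ts g"

section \<open>The interpretation is functional, well typed and stable\<close>

lemma terminal_unique:
  assumes "arr f" "arr g" "dm f = dm g" "cd f = top1 M" "cd g = top1 M"
  shows "f = g"
proof -
  have "\<forall>x \<in> Ob (base M). \<exists>!f. f \<in> hom (base M) x (top1 M)"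
    using fibred unfolding fibred_def two_terminal_def by blast
  then have "\<exists>!h. h \<in> hom (base M) (dm f) (top1 M)" using assms(1) base.dom_ob by blast
  moreover have "f \<in> hom (base M) (dm f) (top1 M)" "g \<in> hom (base M) (dm f) (top1 M)" using assms by auto
  ultimately show ?thesis by blast
qed

lemma top_ob: "top1 M \<in> Ob (base M)"
  using fibred unfolding fibred_def two_terminal_def by blast

text \<open>Each raw form is interpreted by one rule, and the annotations supply every type that the
  rule mentions, so inversion and the induction hypotheses suffice. For an empty argument list,
  uniqueness of the map into the terminal object is used.\<close>

lemma interp_functional:
  "ity X \<rho> T S \<Longrightarrow> ity X \<rho> T S' \<Longrightarrow> S = S'"
  "itm X \<rho> t A a \<Longrightarrow> itm X \<rho> t A' a' \<Longrightarrow> A = A' \<and> a = a'"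
  "isub X \<rho> As ts g \<Longrightarrow> isub X \<rho> As ts g' \<Longrightarrow> g = g'"
proof (induction arbitrary: S' and A' a' and g' rule: ity_itm_isub.inducts)
  case (i_TCon As A X \<rho> ts g) from i_TCon(6) show ?case by (elim ity_TConE) (auto dest!: i_TCon(5))
next
  case (i_Sigma X \<rho> A S B T) from i_Sigma(5) show ?case by (elim ity_SigmaE) (auto dest!: i_Sigma(2,4))
next
  case (i_Unit X \<rho>) then show ?case by (rule ity_UnitE) simp
next
  case (i_Id X \<rho> A S a s b t) from i_Id(7) show ?case by (elim ity_IdE) (auto dest!: i_Id(2,4,6))
next
  case (i_Pi X \<rho> A S B T) from i_Pi(5) show ?case by (elim ity_PiE) (auto dest!: i_Pi(2,4))
next
  case (i_Var S \<rho> n s X) from i_Var show ?case by (elim itm_VarE) simp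
next
  case (i_Con As A a X \<rho> ts g) from i_Con(7) show ?case by (elim itm_ConE) (auto dest!: i_Con(6))
next
  case (i_Pair X \<rho> A S B T a s b t) from i_Pair(9) show ?case by (elim itm_PairE) (auto dest!: i_Pair(2,4,6,8))
next
  case (i_SplitE X \<rho> A S B T C U d e c t) from i_SplitE(11) show ?case by (elim itm_SplitEE) (auto dest!: i_SplitE(2,4,6,8,10))
next
  case (i_Star X \<rho>) then show ?case by (rule itm_StarE) simp
next
  case (i_UnitE X \<rho> C U d e c t) from i_UnitE(7) show ?case by (elim itm_UnitEE) (auto dest!: i_UnitE(2,4,6))
next
  case (i_Refl X \<rho> A S a s) from i_Refl(5) show ?case by (elim itm_ReflE) (auto dest!: i_Refl(2,4))
next
  case (i_J X \<rho> A S C U d e a s b t p q) from i_J(13) show ?case by (elim itm_JE) (auto dest!: i_J(2,4,6,8,10,12)[unfolded wkself_def])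
next
  case (i_Lam X \<rho> A S B T f e) from i_Lam(7) show ?case by (elim itm_LamE) (auto dest!: i_Lam(2,4,6))
next
  case (i_App X \<rho> A S B T m s a t) from i_App(9) show ?case by (elim itm_AppE) (auto dest!: i_App(2,4,6,8))
next
  case (i_Ext X \<rho> A S B T m s n t p e) from i_Ext(11) show ?case by (elim itm_ExtE) (auto dest!: i_Ext(2,4,6,8,10))
next
  case (i_nil g X \<rho>) from i_nil(4) show ?case by (rule isub_nilE) (rule terminal_unique, use i_nil(1-3) in simp_all)
next
  case (i_cons X \<rho> As ts g A t a) from i_cons(7) show ?case by (elim isub_consE) (auto dest!: i_cons(2,6))
qed

text \<open>The relation imposes few side conditions; typing of the denotations follows from that of
  the environment, form by form, by the section lemmas for the semantic operations.\<close>

lemma interp_wf: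
  "ity X \<rho> T S \<Longrightarrow> wfenv X \<rho> \<Longrightarrow> isty S \<and> cx S = X"
  "itm X \<rho> t A a \<Longrightarrow> wfenv X \<rho> \<Longrightarrow> isty A \<and> cx A = X \<and> gsection A a"
  "isub X \<rho> As ts g \<Longrightarrow> wfenv X \<rho> \<Longrightarrow> arr g \<and> dm g = X \<and> cd g = cend As"
proof (induction rule: ity_itm_isub.inducts)
  case (i_Sigma X \<rho> A S B T) then show ?case using wfenv_xenv[of S \<rho>] by simp
next
  case (i_Unit X \<rho>) then show ?case using wfenv_ob by simp
next
  case (i_Pi X \<rho> A S B T) then show ?case using wfenv_xenv[of S \<rho>] by simp
next
  case (i_Var S \<rho> n s X) then show ?case using wfenvD by simp
next
  case (i_Pair X \<rho> A S B T a s b t) then show ?case using wfenv_xenv[of S \<rho>] pairsec_section by simp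
next
  case (i_SplitE X \<rho> A S B T C U d e c t)
  then have 1: "isty S" "cx S = X" "isty T" "cx T = ext S" using wfenv_xenv[of S \<rho>] by simp_all
  then have 2: "isty U" "cx U = ext (sigty S T)" using i_SplitE wfenv_xenv[of "sigty S T" \<rho>] by simp_all
  have 3: "gsection (reix (sigin S T) U) e"
    using i_SplitE 1 wfenv_xenv[of S \<rho>] wfenv_xenv[of T "xenv S \<rho>"] by simp
  have 4: "gsection (sigty S T) t" using i_SplitE by blast
  show ?case using Esec_section[OF 1(1,3,4) 2 3 4] gsectionD[OF 4] 1 2 by simp
next
  case (i_Star X \<rho>) then show ?case using wfenv_ob by simp
next
  case (i_UnitE X \<rho> C U d e c t)
  have X: "X \<in> Ob (base M)" using i_UnitE wfenv_ob by simp
  then have 2: "isty U" "cx U = ext (unty X)" using i_UnitE wfenv_xenv[of "unty X" \<rho>] by simp_all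
  have 4: "gsection (unty X) t" "gsection (reix (unmap X) U) e" using i_UnitE by blast+
  show ?case using Usec_section[OF X 2 4(2,1)] gsectionD[OF 4(1)] X 2 by simp
next
  case (i_Refl X \<rho> A S a s) then show ?case using reflsec_facts(1) by simp
next
  case (i_J X \<rho> A S C U d e a s b t p q)
  then have 1: "isty S" "cx S = X" "wfenv (ext S) (xenv S \<rho>)" using wfenv_xenv[of S \<rho>] by simp_all
  then have "wfenv (ext (idty S)) (xenv (idty S) (xenv (wkself S) (xenv S \<rho>)))"
    using wfenv_xenv[of "wkself S" "xenv S \<rho>"] wfenv_xenv[of "idty S" "xenv (wkself S) (xenv S \<rho>)"] by simp
  then have 2: "isty U" "cx U = ext (idty S)" using i_J by blast+
  have 3: "gsection (reix (reflmap S) U) e" using i_J 1 by blast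
  have 4: "gsection S s" "gsection S t" "gsection (IdT S s t) q" using i_J by blast+
  show ?case using Jsec_section[OF 1(1) 2 3 4] 1 2 4 by simp
next
  case (i_Lam X \<rho> A S B T f e) then show ?case using wfenv_xenv[of S \<rho>] lam_facts(1) by simp
next
  case (i_App X \<rho> A S B T m s a t)
  then have 1: "isty S" "cx S = X" "isty T" "cx T = ext S" using wfenv_xenv[of S \<rho>] by simp_all
  have 4: "gsection (pity S T) s" "gsection S t" using i_App by blast+
  show ?case using Asec_section[OF 1(1,3,4) 4] gsectionD[OF 4(2)] 1 by simp
next
  case (i_Ext X \<rho> A S B T m s n t p e)
  then have 1: "isty S" "cx S = X" "isty T" "cx T = ext S" using wfenv_xenv[of S \<rho>] by simp_all
  have 4: "gsection (pity S T) s" "gsection (pity S T) t" using i_Ext by blast+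
  have 5: "gsection (IdT T (appsec S T s) (appsec S T t)) e" using i_Ext 1 wfenv_xenv[of S \<rho>] by simp
  show ?case using Extsec_section(1)[OF 1(1,3,4) 4 5] 1 4 by simp
next
  case (i_cons X \<rho> As ts g A t a) then show ?case using gsectionD[of "reix g A" a] by simp
qed (simp_all add: wfenvD)

lemma fext_resec:
  assumes "arr f" "arr g" "isty A" "cd f = dm g" "cd g = cx A" "gsection (reix g A) a"
  shows "fext (g \<odot> f) A \<odot> resec f (reix g A) a = (fext g A \<odot> a) \<odot> f"
proof -
  note a = gsectionD[OF assms(6)]
  note r = resec_facts[of f "reix g A" a] and r' = resec_simps(2-4)[of f "reix g A" a]
  have "fext (g \<odot> f) A \<odot> resec f (reix g A) a = fext g A \<odot> fext f (reix g A) \<odot> resec f (reix g A) a"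
    by (rule reix_cmp(3)[symmetric]) (use assms r' in simp_all)
  also have "\<dots> = fext g A \<odot> a \<odot> f" using r(2) assms by simp
  also have "\<dots> = (fext g A \<odot> a) \<odot> f" using assms a by simp
  finally show ?thesis .
qed

text \<open>Stability of every semantic operation, assembled by induction. The map \<open>f\<close>
  is quantified in the conclusion because a binder applies the hypothesis to
  \<open>fext f S\<close>, with \<open>renv_xenv_fext\<close> rewriting the environment.\<close>

lemma interp_reix:
  "ity X \<rho> T S \<Longrightarrow> wfenv X \<rho> \<Longrightarrow> \<forall>f. arr f \<longrightarrow> cd f = X \<longrightarrow> ity (dm f) (renv f \<rho>) T (reix f S)"
  "itm X \<rho> t A a \<Longrightarrow> wfenv X \<rho> \<Longrightarrow>
     \<forall>f. arr f \<longrightarrow> cd f = X \<longrightarrow> itm (dm f) (renv f \<rho>) t (reix f A) (resec f A a)"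
  "isub X \<rho> As ts g \<Longrightarrow> wfenv X \<rho> \<Longrightarrow> \<forall>f. arr f \<longrightarrow> cd f = X \<longrightarrow> isub (dm f) (renv f \<rho>) As ts (g \<odot> f)"
proof (induction rule: ity_itm_isub.inducts)
  case (i_TCon As A X \<rho> ts g)
  note g = interp_wf(3)[OF i_TCon(4,6)]
  show ?case
  proof (intro allI impI)
    fix f assume f: "arr f" "cd f = X"
    have "ity (dm f) (renv f \<rho>) (TCon As A ts) (reix (g \<odot> f) A)"
      by (rule ity_itm_isub.i_TCon) (use i_TCon f in blast)+
    then show "ity (dm f) (renv f \<rho>) (TCon As A ts) (reix f (reix g A))" using f g i_TCon(2,3) by simp
  qed
next
  case (i_Sigma X \<rho> A S B T)
  have S: "isty S" "cx S = X" using interp_wf(1)[OF i_Sigma(1,5)] by simp_all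
  have w: "wfenv (ext S) (xenv S \<rho>)" using wfenv_xenv i_Sigma(5) S by simp
  have T: "isty T" "cx T = ext S" using interp_wf(1)[OF i_Sigma(3) w] by simp_all
  show ?case
  proof (intro allI impI)
    fix f assume f: "arr f" "cd f = X"
    have "ity (dm (fext f S)) (renv (fext f S) (xenv S \<rho>)) B (reix (fext f S) T)"
      using i_Sigma(4)[OF w, rule_format, of "fext f S"] f S by simp
    then have "ity (ext (reix f S)) (xenv (reix f S) (renv f \<rho>)) B (reix (fext f S) T)"
      using f S i_Sigma(5) by (simp add: renv_xenv_fext)
    moreover have "ity (dm f) (renv f \<rho>) A (reix f S)" using i_Sigma(2)[OF i_Sigma(5)] f by blast
    ultimately show "ity (dm f) (renv f \<rho>) (Sigma A B) (reix f (sigty S T))"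
      using sigty_reix(1)[OF S(1) T f(1)] f S ity_itm_isub.i_Sigma by simp
  qed
next
  case (i_Unit X \<rho>)
  show ?case using unty_reix(1) ity_itm_isub.i_Unit by auto
next
  case (i_Id X \<rho> A S a s b t)
  note a = interp_wf(2)[OF i_Id(3,7)] and b = interp_wf(2)[OF i_Id(5,7)]
  show ?case
  proof (intro allI impI)
    fix f assume f: "arr f" "cd f = X"
    have "ity (dm f) (renv f \<rho>) (Id A a b) (IdT (reix f S) (resec f S s) (resec f S t))"
      by (rule ity_itm_isub.i_Id) (use i_Id f in blast)+
    then show "ity (dm f) (renv f \<rho>) (Id A a b) (reix f (IdT S s t))"
      using IdT_reix[of S s t f] f a b by simp
  qed
next
  case (i_Pi X \<rho> A S B T)
  have S: "isty S" "cx S = X" using interp_wf(1)[OF i_Pi(1,5)] by simp_all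
  have w: "wfenv (ext S) (xenv S \<rho>)" using wfenv_xenv i_Pi(5) S by simp
  have T: "isty T" "cx T = ext S" using interp_wf(1)[OF i_Pi(3) w] by simp_all
  show ?case
  proof (intro allI impI)
    fix f assume f: "arr f" "cd f = X"
    have "ity (dm (fext f S)) (renv (fext f S) (xenv S \<rho>)) B (reix (fext f S) T)"
      using i_Pi(4)[OF w, rule_format, of "fext f S"] f S by simp
    then have "ity (ext (reix f S)) (xenv (reix f S) (renv f \<rho>)) B (reix (fext f S) T)"
      using f S i_Pi(5) by (simp add: renv_xenv_fext)
    moreover have "ity (dm f) (renv f \<rho>) A (reix f S)" using i_Pi(2)[OF i_Pi(5)] f by blast
    ultimately show "ity (dm f) (renv f \<rho>) (Pi A B) (reix f (pity S T))"
      using pity_reix(1)[OF S(1) T f(1)] f S ity_itm_isub.i_Pi by simp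
  qed
next
  case (i_Var S \<rho> n s X)
  show ?case by (intro allI impI ity_itm_isub.i_Var) (use i_Var in \<open>simp_all add: renv_def\<close>)
next
  case (i_Con As A a X \<rho> ts g)
  note g = interp_wf(3)[OF i_Con(5,7)]
  show ?case
  proof (intro allI impI)
    fix f assume f: "arr f" "cd f = X"
    have "itm (dm f) (renv f \<rho>) (Con As A a ts) (reix (g \<odot> f) A) (resec (g \<odot> f) A a)"
      by (rule ity_itm_isub.i_Con) (use i_Con f in blast)+
    then show "itm (dm f) (renv f \<rho>) (Con As A a ts) (reix f (reix g A)) (resec f (reix g A) (resec g A a))"
      using f g i_Con(2-4) by simp
  qed
next
  case (i_Pair X \<rho> A S B T a s b t)
  have S: "isty S" "cx S = X" using interp_wf(1)[OF i_Pair(1,9)] by simp_all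
  have w: "wfenv (ext S) (xenv S \<rho>)" using wfenv_xenv i_Pair(9) S by simp
  have T: "isty T" "cx T = ext S" using interp_wf(1)[OF i_Pair(3) w] by simp_all
  have s: "gsection S s" "gsection (reix s T) t"
    using interp_wf(2)[OF i_Pair(5,9)] interp_wf(2)[OF i_Pair(7,9)] by simp_all
  show ?case
  proof (intro allI impI)
    fix f assume f: "arr f" "cd f = X"
    have fS: "cd f = cx S" using f S by simp
    have 1: "ity (ext (reix f S)) (xenv (reix f S) (renv f \<rho>)) B (reix (fext f S) T)"
      using i_Pair(4)[OF w, rule_format, of "fext f S"] f S i_Pair(9) by (simp add: renv_xenv_fext)
    note p = pairsec_reix[OF S(1) T s f(1) fS]
    have "itm (dm f) (renv f \<rho>) (Pair A B a b) (sigty (reix f S) (reix (fext f S) T))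
       (pairsec (reix f S) (reix (fext f S) T) (resec f S s) (resec f (reix s T) t))"
      by (rule ity_itm_isub.i_Pair) (use i_Pair f 1 p(2)[symmetric] in simp_all)
    then show "itm (dm f) (renv f \<rho>) (Pair A B a b) (reix f (sigty S T)) (resec f (sigty S T) (pairsec S T s t))"
      unfolding p(1) sigty_reix(1)[OF S(1) T f(1) fS] .
  qed
next
  case (i_SplitE X \<rho> A S B T C U d e c t)
  let ?P = "sigty S T"
  have S: "isty S" "cx S = X" using interp_wf(1)[OF i_SplitE(1,11)] by simp_all
  have w: "wfenv (ext S) (xenv S \<rho>)" using wfenv_xenv i_SplitE(11) S by simp
  have T: "isty T" "cx T = ext S" using interp_wf(1)[OF i_SplitE(3) w] by simp_all
  have P: "isty ?P" "cx ?P = X" using S T by simp_all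
  have wP: "wfenv (ext ?P) (xenv ?P \<rho>)" using wfenv_xenv i_SplitE(11) P by simp
  have wT: "wfenv (ext T) (xenv T (xenv S \<rho>))" using wfenv_xenv w T by simp
  have U: "isty U" "cx U = ext ?P" using interp_wf(1)[OF i_SplitE(5) wP] by simp_all
  have e: "gsection (reix (sigin S T) U) e" and t: "gsection ?P t"
    using interp_wf(2)[OF i_SplitE(7) wT] interp_wf(2)[OF i_SplitE(9,11)] by simp_all
  show ?case
  proof (intro allI impI)
    fix f assume f: "arr f" "cd f = X"
    let ?S = "reix f S" and ?T = "reix (fext f S) T" and ?U = "reix (fext f ?P) U"
    have fS: "cd f = cx S" using f S by simp
    note sg = sigty_reix[OF S(1) T f(1) fS]
    have 1: "ity (ext ?S) (xenv ?S (renv f \<rho>)) B ?T"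
      using i_SplitE(4)[OF w, rule_format, of "fext f S"] f S i_SplitE(11) by (simp add: renv_xenv_fext)
    have "ity (ext (reix f ?P)) (xenv (reix f ?P) (renv f \<rho>)) C ?U"
      using i_SplitE(6)[OF wP, rule_format, of "fext f ?P"] f P i_SplitE(11) by (simp add: renv_xenv_fext)
    then have 2: "ity (ext (sigty ?S ?T)) (xenv (sigty ?S ?T) (renv f \<rho>)) C ?U" unfolding sg(1) .
    let ?F = "fext (fext f S) T"
    have F: "arr ?F" "dm ?F = ext ?T" "cd ?F = ext T" using S T f by simp_all
    have "renv ?F (xenv T (xenv S \<rho>)) = xenv ?T (renv (fext f S) (xenv S \<rho>))"
      by (rule renv_xenv_fext) (use w S T f in simp_all)
    also have "renv (fext f S) (xenv S \<rho>) = xenv ?S (renv f \<rho>)"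
      by (rule renv_xenv_fext) (use i_SplitE(11) S f in simp_all)
    finally have r: "renv ?F (xenv T (xenv S \<rho>)) = xenv ?T (xenv ?S (renv f \<rho>))" .
    have "reix ?F (reix (sigin S T) U) = reix (sigin S T \<odot> ?F) U"
      by (rule reix_cmp(1)) (use F S T U in simp_all)
    also have "\<dots> = reix (sigin ?S ?T) ?U"
      unfolding sg(2)[symmetric] by (rule reix_cmp(1)[symmetric]) (use S T U f sg(1)[symmetric] P in simp_all)
    \<comment> \<open>The reindexed branch has to be a section of the type expected for the
      reindexed data; naturality of \<open>sigin\<close> makes the two types strictly equal. The
      cases of the unit and of \<open>J\<close> need the same step.\<close>
    finally have ty: "reix ?F (reix (sigin S T) U) = reix (sigin ?S ?T) ?U" .
    have 3: "itm (ext ?T) (xenv ?T (xenv ?S (renv f \<rho>))) d (reix (sigin ?S ?T) ?U)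
        (resec ?F (reix (sigin S T) U) e)"
      using i_SplitE(8)[OF wT, rule_format, OF F(1,3)] unfolding F(2) r ty .
    have 4: "itm (dm f) (renv f \<rho>) c (sigty ?S ?T) (resec f ?P t)"
      using i_SplitE(10)[OF i_SplitE(11), rule_format, OF f] unfolding sg(1) .
    have 5: "ity (dm f) (renv f \<rho>) A ?S" using i_SplitE(2)[OF i_SplitE(11), rule_format, OF f] .
    show "itm (dm f) (renv f \<rho>) (SplitE A B C d c) (reix f (reix t U)) (resec f (reix t U) (Esec S T U e t))"
      unfolding Esec_reix[OF S(1) T U e t f(1) fS]
      by (rule ity_itm_isub.i_SplitE[OF 5 1 2 3 4])
  qed
next
  case (i_Star X \<rho>)
  show ?case using unty_reix(1) unmap_reix ity_itm_isub.i_Star by auto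
next
  case (i_UnitE X \<rho> C U d e c t)
  let ?P = "unty X"
  have X: "X \<in> Ob (base M)" using i_UnitE(7) wfenv_ob by simp
  have P: "isty ?P" "cx ?P = X" using X by simp_all
  have wP: "wfenv (ext ?P) (xenv ?P \<rho>)" using wfenv_xenv i_UnitE(7) P by simp
  have U: "isty U" "cx U = ext ?P" using interp_wf(1)[OF i_UnitE(1) wP] by simp_all
  have e: "gsection (reix (unmap X) U) e" and t: "gsection ?P t"
    using interp_wf(2)[OF i_UnitE(3,7)] interp_wf(2)[OF i_UnitE(5,7)] by simp_all
  show ?case
  proof (intro allI impI)
    fix f assume f: "arr f" "cd f = X"
    let ?U = "reix (fext f ?P) U"
    note u = unty_reix(1,2)[OF f(1), unfolded f(2)]
    have "ity (ext (reix f ?P)) (xenv (reix f ?P) (renv f \<rho>)) C ?U"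
      using i_UnitE(2)[OF wP, rule_format, of "fext f ?P"] f P i_UnitE(7) by (simp add: renv_xenv_fext)
    then have 2: "ity (ext (unty (dm f))) (xenv (unty (dm f)) (renv f \<rho>)) C ?U" unfolding u(1) .
    have "reix f (reix (unmap X) U) = reix (unmap X \<odot> f) U"
      by (rule reix_cmp(1)) (use f X U in simp_all)
    also have "\<dots> = reix (unmap (dm f)) ?U"
      unfolding u(2)[symmetric] by (rule reix_cmp(1)[symmetric]) (use X U f u(1) P in simp_all)
    finally have ty: "reix f (reix (unmap X) U) = reix (unmap (dm f)) ?U" .
    have 3: "itm (dm f) (renv f \<rho>) d (reix (unmap (dm f)) ?U) (resec f (reix (unmap X) U) e)"
      using i_UnitE(4)[OF i_UnitE(7), rule_format, OF f] unfolding ty .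
    have 4: "itm (dm f) (renv f \<rho>) c (unty (dm f)) (resec f ?P t)"
      using i_UnitE(6)[OF i_UnitE(7), rule_format, OF f] unfolding u(1) .
    show "itm (dm f) (renv f \<rho>) (UnitE C d c) (reix f (reix t U)) (resec f (reix t U) (Usec U e t))"
      unfolding Usec_reix[OF X U e t f] by (rule ity_itm_isub.i_UnitE[OF 2 3 4])
  qed
next
  case (i_Refl X \<rho> A S a s)
  note a = interp_wf(2)[OF i_Refl(3,5)]
  show ?case
  proof (intro allI impI)
    fix f assume f: "arr f" "cd f = X"
    have "itm (dm f) (renv f \<rho>) (Refl A a) (IdT (reix f S) (resec f S s) (resec f S s)) (reflsec (reix f S) (resec f S s))"
      by (rule ity_itm_isub.i_Refl) (use i_Refl f in blast)+
    then show "itm (dm f) (renv f \<rho>) (Refl A a) (reix f (IdT S s s)) (resec f (IdT S s s) (reflsec S s))"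
      using IdT_reix[of S s s f] reflsec_reix[of S s f] f a by simp
  qed
next
  case (i_J X \<rho> A S C U d e a s b t p q)
  let ?W = "reix (disp S) S" and ?I = "idty S"
  have S: "isty S" "cx S = X" using interp_wf(1)[OF i_J(1,13)] by simp_all
  have w: "wfenv (ext S) (xenv S \<rho>)" using wfenv_xenv i_J(13) S by simp
  have wW: "wfenv (ext ?W) (xenv ?W (xenv S \<rho>))" using wfenv_xenv[of ?W] w S by simp
  have wI: "wfenv (ext ?I) (xenv ?I (xenv (wkself S) (xenv S \<rho>)))"
    unfolding wkself_def using wfenv_xenv[of ?I] wW S by simp
  have U: "isty U" "cx U = ext ?I" using interp_wf(1)[OF i_J(3) wI] by simp_all
  have e: "gsection (reix (reflmap S) U) e" using interp_wf(2)[OF i_J(5) w] by simp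
  have st: "gsection S s" "gsection S t" "gsection (IdT S s t) q"
    using interp_wf(2)[OF i_J(7,13)] interp_wf(2)[OF i_J(9,13)] interp_wf(2)[OF i_J(11,13)] by simp_all
  show ?case
  proof (intro allI impI)
    fix f assume f: "arr f" "cd f = X"
    let ?S = "reix f S" and ?U = "reix (idext f S) U"
    have fS: "cd f = cx S" using f S by simp
    have x: "arr (idext f S)" "dm (idext f S) = ext (idty ?S)" "cd (idext f S) = ext ?I"
      using idext_simps[OF S(1) f(1) fS] .
    have r1: "renv (fext f S) (xenv S \<rho>) = xenv ?S (renv f \<rho>)"
      by (rule renv_xenv_fext) (use i_J(13) S f in simp_all)
    have W: "reix (fext f S) ?W = wkself ?S" using S f by simp
    have "renv (fext (fext f S) ?W) (xenv ?W (xenv S \<rho>)) = xenv (reix (fext f S) ?W) (renv (fext f S) (xenv S \<rho>))"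
      by (rule renv_xenv_fext) (use w S f in simp_all)
    then have r2: "renv (fext (fext f S) ?W) (xenv ?W (xenv S \<rho>)) = xenv (wkself ?S) (xenv ?S (renv f \<rho>))"
      unfolding W r1 .
    have "renv (idext f S) (xenv ?I (xenv ?W (xenv S \<rho>))) =
        xenv (reix (fext (fext f S) ?W) ?I) (renv (fext (fext f S) ?W) (xenv ?W (xenv S \<rho>)))"
      unfolding idext_def by (rule renv_xenv_fext) (use wW S f in simp_all)
    then have r3: "renv (idext f S) (xenv ?I (xenv (wkself S) (xenv S \<rho>))) =
        xenv (idty ?S) (xenv (wkself ?S) (xenv ?S (renv f \<rho>)))"
      unfolding idty_reix(1)[OF S(1) f(1) fS] r2 unfolding wkself_def .
    have 2: "ity (ext (idty ?S)) (xenv (idty ?S) (xenv (wkself ?S) (xenv ?S (renv f \<rho>)))) C ?U"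
      using i_J(4)[OF wI, rule_format, OF x(1,3)] unfolding x(2) r3 .
    have ty: "reix (fext f S) (reix (reflmap S) U) = reix (reflmap ?S) ?U"
    proof -
      have "reix (fext f S) (reix (reflmap S) U) = reix (reflmap S \<odot> fext f S) U"
        by (rule reix_cmp(1)) (use S U f in simp_all)
      also have "\<dots> = reix (reflmap ?S) ?U"
        unfolding reflmap_reix[OF S(1) f(1) fS, symmetric] by (rule reix_cmp(1)[symmetric]) (use S U f x in simp_all)
      finally show ?thesis .
    qed
    have F: "arr (fext f S)" "dm (fext f S) = ext ?S" "cd (fext f S) = ext S" using S f by simp_all
    have 3: "itm (ext ?S) (xenv ?S (renv f \<rho>)) d (reix (reflmap ?S) ?U)
        (resec (fext f S) (reix (reflmap S) U) e)"
      using i_J(6)[OF w, rule_format, OF F(1,3)] unfolding F(2) r1 ty .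
    have 4: "itm (dm f) (renv f \<rho>) p (IdT ?S (resec f S s) (resec f S t)) (resec f (IdT S s t) q)"
      using i_J(12)[OF i_J(13), rule_format, OF f] unfolding IdT_reix[OF S(1) st(1,2) f(1) fS] .
    show "itm (dm f) (renv f \<rho>) (J A C d a b p) (reix f (reix (idmap S s t q) U)) (resec f (reix (idmap S s t q) U) (Jsec S U e s t q))"
      unfolding Jsec_reix[OF S(1) U e st f(1) fS]
      by (rule ity_itm_isub.i_J[OF _ 2 3 _ _ 4]) (use i_J(2,8,10,13) f in blast)+
  qed
next
  case (i_Lam X \<rho> A S B T g e)
  have S: "isty S" "cx S = X" using interp_wf(1)[OF i_Lam(1,7)] by simp_all
  have w: "wfenv (ext S) (xenv S \<rho>)" using wfenv_xenv i_Lam(7) S by simp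
  have T: "isty T" "cx T = ext S" using interp_wf(1)[OF i_Lam(3) w] by simp_all
  have e: "gsection T e" using interp_wf(2)[OF i_Lam(5) w] by simp
  show ?case
  proof (intro allI impI)
    fix f assume f: "arr f" "cd f = X"
    let ?F = "fext f S"
    have fS: "cd f = cx S" using f S by simp
    have F: "arr ?F" "dm ?F = ext (reix f S)" "cd ?F = ext S" using S f by simp_all
    have r: "renv ?F (xenv S \<rho>) = xenv (reix f S) (renv f \<rho>)"
      by (rule renv_xenv_fext) (use i_Lam(7) S f in simp_all)
    show "itm (dm f) (renv f \<rho>) (Lam A B g) (reix f (pity S T)) (resec f (pity S T) (lammap S T e))"
      unfolding lam_facts(3)[OF S(1) T e f(1) fS] pity_reix(1)[OF S(1) T f(1) fS]
      by (rule ity_itm_isub.i_Lam)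
        (use i_Lam(2)[OF i_Lam(7), rule_format, OF f] i_Lam(4,6)[OF w, rule_format, OF F(1,3)] in \<open>simp_all add: F r\<close>)
  qed
next
  case (i_App X \<rho> A S B T m s a t)
  have S: "isty S" "cx S = X" using interp_wf(1)[OF i_App(1,9)] by simp_all
  have w: "wfenv (ext S) (xenv S \<rho>)" using wfenv_xenv i_App(9) S by simp
  have T: "isty T" "cx T = ext S" using interp_wf(1)[OF i_App(3) w] by simp_all
  have st: "gsection (pity S T) s" "gsection S t"
    using interp_wf(2)[OF i_App(5,9)] interp_wf(2)[OF i_App(7,9)] by simp_all
  show ?case
  proof (intro allI impI)
    fix f assume f: "arr f" "cd f = X"
    let ?F = "fext f S"
    have fS: "cd f = cx S" using f S by simp
    have F: "arr ?F" "dm ?F = ext (reix f S)" "cd ?F = ext S" using S f by simp_all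
    have r: "renv ?F (xenv S \<rho>) = xenv (reix f S) (renv f \<rho>)"
      by (rule renv_xenv_fext) (use i_App(9) S f in simp_all)
    have ty: "reix f (reix t T) = reix (resec f S t) (reix ?F T)"
      using gsectionD[OF st(2)] st(2) S T f by simp
    show "itm (dm f) (renv f \<rho>) (App A B m a) (reix f (reix t T)) (resec f (reix t T) (Asec S T s t))"
      unfolding Asec_reix[OF S(1) T st f(1) fS] ty
      by (rule ity_itm_isub.i_App[where S = "reix f S"])
        (use i_App(2,6,8)[OF i_App(9), rule_format, OF f] i_App(4)[OF w, rule_format, OF F(1,3)]
          pity_reix(1)[OF S(1) T f(1) fS, symmetric] in \<open>simp_all only: F r\<close>)
  qed
next
  case (i_Ext X \<rho> A S B T m s n t p e)
  have S: "isty S" "cx S = X" using interp_wf(1)[OF i_Ext(1,11)] by simp_all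
  have w: "wfenv (ext S) (xenv S \<rho>)" using wfenv_xenv i_Ext(11) S by simp
  have T: "isty T" "cx T = ext S" using interp_wf(1)[OF i_Ext(3) w] by simp_all
  have st: "gsection (pity S T) s" "gsection (pity S T) t"
    using interp_wf(2)[OF i_Ext(5,11)] interp_wf(2)[OF i_Ext(7,11)] by simp_all
  have e: "gsection (IdT T (appsec S T s) (appsec S T t)) e" using interp_wf(2)[OF i_Ext(9) w] by simp
  show ?case
  proof (intro allI impI)
    fix f assume f: "arr f" "cd f = X"
    let ?F = "fext f S"
    have fS: "cd f = cx S" using f S by simp
    have fP: "cd f = cx (pity S T)" using f S T by simp
    have F: "arr ?F" "dm ?F = ext (reix f S)" "cd ?F = ext S" using S f by simp_all
    have r: "renv ?F (xenv S \<rho>) = xenv (reix f S) (renv f \<rho>)"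
      by (rule renv_xenv_fext) (use i_Ext(11) S f in simp_all)
    have FT: "cd ?F = cx T" using F T by simp
    have ty: "reix ?F (IdT T (appsec S T s) (appsec S T t)) =
        IdT (reix ?F T) (appsec (reix f S) (reix ?F T) (resec f (pity S T) s))
          (appsec (reix f S) (reix ?F T) (resec f (pity S T) t))"
      using IdT_reix[OF T(1) appsec_section[OF S(1) T st(1)] appsec_section[OF S(1) T st(2)] F(1) FT]
      unfolding appsec_reix[OF S(1) T st(1) f(1) fS] appsec_reix[OF S(1) T st(2) f(1) fS] .
    note P = pity_reix(1)[OF S(1) T f(1) fS]
    have 1: "itm (ext (reix f S)) (xenv (reix f S) (renv f \<rho>)) p
        (IdT (reix ?F T) (appsec (reix f S) (reix ?F T) (resec f (pity S T) s))
          (appsec (reix f S) (reix ?F T) (resec f (pity S T) t)))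
        (resec ?F (IdT T (appsec S T s) (appsec S T t)) e)"
      using i_Ext(10)[OF w, rule_format, OF F(1,3)] unfolding F(2) r ty .
    have 2: "ity (ext (reix f S)) (xenv (reix f S) (renv f \<rho>)) B (reix ?F T)"
      using i_Ext(4)[OF w, rule_format, OF F(1,3)] unfolding F(2) r .
    have 3: "itm (dm f) (renv f \<rho>) m (pity (reix f S) (reix ?F T)) (resec f (pity S T) s)"
      "itm (dm f) (renv f \<rho>) n (pity (reix f S) (reix ?F T)) (resec f (pity S T) t)"
      using i_Ext(6,8)[OF i_Ext(11), rule_format, OF f] unfolding P .
    have 4: "ity (dm f) (renv f \<rho>) A (reix f S)" using i_Ext(2)[OF i_Ext(11), rule_format, OF f] .
    show "itm (dm f) (renv f \<rho>) (Ext A B m n p) (reix f (IdT (pity S T) s t)) (resec f (IdT (pity S T) s t) (Extsec S T s t e))"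
      unfolding Extsec_reix[OF S(1) T st e f(1) fS] IdT_reix[OF pity_facts(1)[OF S(1) T] st f(1) fP] P
      by (rule ity_itm_isub.i_Ext[OF 4 2 3 1])
  qed
next
  case (i_nil g X \<rho>)
  show ?case by (intro allI impI ity_itm_isub.i_nil) (use i_nil in simp_all)
next
  case (i_cons X \<rho> As ts g A t a)
  have g: "arr g" "dm g = X" "cd g = cend As" using interp_wf(3)[OF i_cons(1,7)] by simp_all
  have a: "gsection (reix g A) a" using interp_wf(2)[OF i_cons(5,7)] by simp
  show ?case
  proof (intro allI impI)
    fix f assume f: "arr f" "cd f = X"
    have e: "fext (g \<odot> f) A \<odot> resec f (reix g A) a = (fext g A \<odot> a) \<odot> f"
      by (rule fext_resec) (use f g a i_cons(3,4) in simp_all)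
    have ty: "reix f (reix g A) = reix (g \<odot> f) A" using f g i_cons(3,4) by simp
    show "isub (dm f) (renv f \<rho>) (A # As) (t # ts) ((fext g A \<odot> a) \<odot> f)"
      unfolding e[symmetric]
      by (rule ity_itm_isub.i_cons[OF i_cons(2)[OF i_cons(7), rule_format, OF f] i_cons(3,4)])
        (use i_cons(6)[OF i_cons(7), rule_format, OF f] ty in simp)
  qed
qed

end

text \<open>From here on environments are composed with renamings and must stay in the form
  \<open>\<rho> \<circ> r\<close> to be matched; iterated liftings are to unfold only when
  applied.\<close>

declare comp_apply [simp del] funpow.simps(2) [simp del]

lemma funpow_Suc_apply [simp]: "(f ^^ Suc n) x = f ((f ^^ n) x)"
  by (simp add: funpow.simps(2) comp_apply)

section \<open>Renaming and substitution\<close>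

lemma upr_simps [simp]: "upr r 0 = 0" "upr r (Suc n) = Suc (r n)"
  by (simp_all add: upr_def)

lemma ups_simps [simp]: "ups s 0 = Var 0" "ups s (Suc n) = ren_tm Suc (s n)"
  by (simp_all add: ups_def)

lemma upr_comp: "upr r \<circ> upr r' = upr (r \<circ> r')"
proof
  show "(upr r \<circ> upr r') n = upr (r \<circ> r') n" for n by (cases n) (simp_all add: comp_apply)
qed

lemma ren_ren:
  fixes A :: "('a, 'm) ty" and a :: "('a, 'm) tm"
  shows "ren_ty r (ren_ty r' A) = ren_ty (r \<circ> r') A" "ren_tm r (ren_tm r' a) = ren_tm (r \<circ> r') a"
proof (induction A and a arbitrary: r r' and r r')
  case (Sigma A B) then show ?case by (simp add: upr_comp)
next
  case (Pi A B) then show ?case by (simp add: upr_comp)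
next
  case (Pair A B a b) then show ?case by (simp add: upr_comp)
next
  case (SplitE A B C d c) then show ?case by (simp add: upr_comp)
next
  case (UnitE C d c) then show ?case by (simp add: upr_comp)
next
  case (J A C d a b p) then show ?case by (simp add: upr_comp)
next
  case (Lam A B f) then show ?case by (simp add: upr_comp)
next
  case (App A B m a) then show ?case by (simp add: upr_comp)
next
  case (Ext A B m n p) then show ?case by (simp add: upr_comp)
qed (simp_all add: comp_apply)

lemma ups_Var: "ups (Var \<circ> r) = Var \<circ> upr r"
proof
  show "ups (Var \<circ> r) n = (Var \<circ> upr r) n" for n by (cases n) (simp_all add: comp_apply)
qed

lemma ups_pow_Var: "(ups ^^ n) (Var \<circ> r) = Var \<circ> (upr ^^ n) r"
  by (induction n) (simp_all add: ups_Var)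

text \<open>Renamings are substitutions of variables, so weakening, contraction and exchange can
  share the treatment of substitution.\<close>

lemma ren_eq_sub:
  fixes A :: "('a, 'm) ty" and a :: "('a, 'm) tm"
  shows "ren_ty r A = sub_ty (Var \<circ> r) A" "ren_tm r a = sub_tm (Var \<circ> r) a"
  by (induction A and a arbitrary: r and r) (simp_all add: ups_Var comp_apply[of Var])

lemma ren_ctx_eq_sub: "ren_ctx r D = sub_ctx (Var \<circ> r) D"
  by (induction D) (simp_all add: ren_eq_sub ups_pow_Var)

lemma ren_jdg_eq_sub: "ren_jdg r \<J> = sub_jdg (Var \<circ> r) \<J>"
  by (cases \<J>) (simp_all add: ren_eq_sub)

context model begin

lemma xenv_upr: "xenv S (\<rho> \<circ> r) = xenv S \<rho> \<circ> upr r"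
proof
  show "xenv S (\<rho> \<circ> r) n = (xenv S \<rho> \<circ> upr r) n" for n
    by (cases n) (simp_all add: xenv_def renv_def comp_apply)
qed

text \<open>Renaming syntax is precomposing the environment, with the denotation unchanged and no
  reindexing involved. It is proved before substitution because \<open>ups\<close> contains a
  renaming.\<close>

lemma interp_ren:
  "ity X \<rho>' T S \<Longrightarrow> \<rho>' = \<rho> \<circ> r \<Longrightarrow> ity X \<rho> (ren_ty r T) S"
  "itm X \<rho>' t A a \<Longrightarrow> \<rho>' = \<rho> \<circ> r \<Longrightarrow> itm X \<rho> (ren_tm r t) A a"
  "isub X \<rho>' As ts g \<Longrightarrow> \<rho>' = \<rho> \<circ> r \<Longrightarrow> isub X \<rho> As (map (ren_tm r) ts) g"
proof (induction arbitrary: \<rho> r and \<rho> r and \<rho> r rule: ity_itm_isub.inducts)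
  case (i_TCon As A X \<rho>' ts g)
  show ?case unfolding ren_ty.simps by (rule ity_itm_isub.i_TCon) (use i_TCon in auto)
next
  case (i_Sigma X \<rho>' A S B T)
  show ?case unfolding ren_ty.simps
    by (rule ity_itm_isub.i_Sigma[OF i_Sigma(2,4)]) (use i_Sigma(5) in \<open>simp_all add: xenv_upr\<close>)
next
  case (i_Unit X \<rho>') show ?case unfolding ren_ty.simps by (rule ity_itm_isub.i_Unit)
next
  case (i_Id X \<rho>' A S a s b t)
  show ?case unfolding ren_ty.simps
    by (rule ity_itm_isub.i_Id[OF i_Id(2,4,6)]) (use i_Id(7) in simp_all)
next
  case (i_Pi X \<rho>' A S B T)
  show ?case unfolding ren_ty.simps
    by (rule ity_itm_isub.i_Pi[OF i_Pi(2,4)]) (use i_Pi(5) in \<open>simp_all add: xenv_upr\<close>)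
next
  case (i_Var S \<rho>' n s X)
  show ?case unfolding ren_tm.simps by (rule ity_itm_isub.i_Var) (use i_Var in \<open>simp_all add: comp_apply\<close>)
next
  case (i_Con As A a X \<rho>' ts g)
  show ?case unfolding ren_tm.simps by (rule ity_itm_isub.i_Con) (use i_Con in auto)
next
  case (i_Pair X \<rho>' A S B T a s b t)
  show ?case unfolding ren_tm.simps
    by (rule ity_itm_isub.i_Pair[OF i_Pair(2,4,6,8)]) (use i_Pair(9) in \<open>simp_all add: xenv_upr\<close>)
next
  case (i_SplitE X \<rho>' A S B T C U d e c t)
  show ?case unfolding ren_tm.simps
    by (rule ity_itm_isub.i_SplitE[OF i_SplitE(2,4,6,8,10)]) (use i_SplitE(11) in \<open>simp_all add: xenv_upr\<close>)
next
  case (i_Star X \<rho>') show ?case unfolding ren_tm.simps by (rule ity_itm_isub.i_Star)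
next
  case (i_UnitE X \<rho>' C U d e c t)
  show ?case unfolding ren_tm.simps
    by (rule ity_itm_isub.i_UnitE[OF i_UnitE(2,4,6)]) (use i_UnitE(7) in \<open>simp_all add: xenv_upr\<close>)
next
  case (i_Refl X \<rho>' A S a s)
  show ?case unfolding ren_tm.simps
    by (rule ity_itm_isub.i_Refl[OF i_Refl(2,4)]) (use i_Refl(5) in simp_all)
next
  case (i_J X \<rho>' A S C U d e a s b t p q)
  show ?case unfolding ren_tm.simps
    by (rule ity_itm_isub.i_J[OF i_J(2,4,6,8,10,12)]) (use i_J(13) in \<open>simp_all add: xenv_upr\<close>)
next
  case (i_Lam X \<rho>' A S B T f e)
  show ?case unfolding ren_tm.simps
    by (rule ity_itm_isub.i_Lam[OF i_Lam(2,4,6)]) (use i_Lam(7) in \<open>simp_all add: xenv_upr\<close>)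
next
  case (i_App X \<rho>' A S B T m s a t)
  show ?case unfolding ren_tm.simps
    by (rule ity_itm_isub.i_App[OF i_App(2,4,6,8)]) (use i_App(9) in \<open>simp_all add: xenv_upr\<close>)
next
  case (i_Ext X \<rho>' A S B T m s n t p e)
  show ?case unfolding ren_tm.simps
    by (rule ity_itm_isub.i_Ext[OF i_Ext(2,4,6,8,10)]) (use i_Ext(11) in \<open>simp_all add: xenv_upr\<close>)
next
  case (i_nil g X \<rho>') show ?case unfolding list.map by (rule ity_itm_isub.i_nil) (use i_nil in simp_all)
next
  case (i_cons X \<rho>' As ts g A t a)
  show ?case unfolding list.map
    by (rule ity_itm_isub.i_cons[OF i_cons(2) i_cons(3,4) i_cons(6)]) (use i_cons(7) in simp_all)
qed

text \<open>In the environment \<open>\<rho>\<close> the substitution \<open>s\<close> denotes the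
  environment \<open>\<rho>'\<close>. No source or target context is mentioned: the types recorded
  in \<open>\<rho>'\<close> take their place.\<close>

definition issub :: "'o \<Rightarrow> ('a, 'm) env \<Rightarrow> (nat \<Rightarrow> ('a, 'm) tm) \<Rightarrow> ('a, 'm) env \<Rightarrow> bool" where
  "issub X \<rho> s \<rho>' \<longleftrightarrow> wfenv X \<rho> \<and> (\<forall>n. itm X \<rho> (s n) (fst (\<rho>' n)) (snd (\<rho>' n)))"

lemma issub_wf: "issub X \<rho> s \<rho>' \<Longrightarrow> wfenv X \<rho>'"
  using interp_wf(2) wfenv_ob unfolding issub_def wfenv_def[of X \<rho>'] by blast

lemma issub_Var: "wfenv X \<rho> \<Longrightarrow> issub X \<rho> (Var \<circ> r) (\<rho> \<circ> r)"
  by (simp add: issub_def i_Var comp_apply)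

text \<open>Old variables are first reindexed along the display map, then renamed by
  \<open>Suc\<close>: weakening an environment is dropping the entry of the new variable from the
  extended one.\<close>

lemma issub_ups:
  assumes "issub X \<rho> s \<rho>'" "isty S" "cx S = X"
  shows "issub (ext S) (xenv S \<rho>) (ups s) (xenv S \<rho>')"
proof -
  have w: "wfenv X \<rho>" using assms(1) by (simp add: issub_def)
  have e: "renv (disp S) \<rho> = xenv S \<rho> \<circ> Suc" by (simp add: xenv_def)
  have "itm (ext S) (xenv S \<rho>) (ups s n) (fst (xenv S \<rho>' n)) (snd (xenv S \<rho>' n))" for n
  proof (cases n)
    case 0 then show ?thesis by (simp add: i_Var xenv_def)
  next
    case (Suc k)
    have "itm X \<rho> (s k) (fst (\<rho>' k)) (snd (\<rho>' k))" using assms(1) by (simp add: issub_def)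
    from interp_reix(2)[OF this w, rule_format, of "disp S"]
    have "itm (ext S) (renv (disp S) \<rho>) (s k) (reix (disp S) (fst (\<rho>' k))) (resec (disp S) (fst (\<rho>' k)) (snd (\<rho>' k)))"
      using assms(2,3) by simp
    from interp_ren(2)[OF this e] show ?thesis using Suc by (simp add: xenv_def renv_def)
  qed
  then show ?thesis using wfenv_xenv w assms(2,3) by (simp add: issub_def)
qed

text \<open>The syntactic substitution lemma: substituting in the syntax is changing the
  environment, and the denotation itself stays the same.\<close>

lemma interp_sub:
  "ity X \<rho>' T S \<Longrightarrow> issub X \<rho> \<sigma> \<rho>' \<Longrightarrow> ity X \<rho> (sub_ty \<sigma> T) S"
  "itm X \<rho>' t A a \<Longrightarrow> issub X \<rho> \<sigma> \<rho>' \<Longrightarrow> itm X \<rho> (sub_tm \<sigma> t) A a"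
  "isub X \<rho>' As ts g \<Longrightarrow> issub X \<rho> \<sigma> \<rho>' \<Longrightarrow> isub X \<rho> As (map (sub_tm \<sigma>) ts) g"
proof (induction arbitrary: \<rho> \<sigma> and \<rho> \<sigma> and \<rho> \<sigma> rule: ity_itm_isub.inducts)
  case (i_TCon As A X \<rho>' ts g)
  show ?case unfolding sub_ty.simps by (rule ity_itm_isub.i_TCon) (use i_TCon in auto)
next
  case (i_Sigma X \<rho>' A S B T)
  note S = interp_wf(1)[OF i_Sigma(1) issub_wf[OF i_Sigma(5)]]
  show ?case unfolding sub_ty.simps
    by (rule ity_itm_isub.i_Sigma[OF i_Sigma(2,4)]) (use i_Sigma(5) S in \<open>simp_all add: issub_ups\<close>)
next
  case (i_Unit X \<rho>') show ?case unfolding sub_ty.simps by (rule ity_itm_isub.i_Unit)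
next
  case (i_Id X \<rho>' A S a s b t)
  show ?case unfolding sub_ty.simps
    by (rule ity_itm_isub.i_Id[OF i_Id(2,4,6)]) (use i_Id(7) in simp_all)
next
  case (i_Pi X \<rho>' A S B T)
  note S = interp_wf(1)[OF i_Pi(1) issub_wf[OF i_Pi(5)]]
  show ?case unfolding sub_ty.simps
    by (rule ity_itm_isub.i_Pi[OF i_Pi(2,4)]) (use i_Pi(5) S in \<open>simp_all add: issub_ups\<close>)
next
  case (i_Var S \<rho>' n s X)
  then show ?case by (simp add: issub_def)
next
  case (i_Con As A a X \<rho>' ts g)
  show ?case unfolding sub_tm.simps by (rule ity_itm_isub.i_Con) (use i_Con in auto)
next
  case (i_Pair X \<rho>' A S B T a s b t)
  note S = interp_wf(1)[OF i_Pair(1) issub_wf[OF i_Pair(9)]]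
  show ?case unfolding sub_tm.simps
    by (rule ity_itm_isub.i_Pair[OF i_Pair(2,4,6,8)]) (use i_Pair(9) S in \<open>simp_all add: issub_ups\<close>)
next
  case (i_SplitE X \<rho>' A S B T C U d e c t)
  have S: "isty S" "cx S = X" using interp_wf(1)[OF i_SplitE(1) issub_wf[OF i_SplitE(11)]] by simp_all
  have w: "issub (ext S) (xenv S \<rho>) (ups \<sigma>) (xenv S \<rho>')" by (rule issub_ups[OF i_SplitE(11) S])
  have T: "isty T" "cx T = ext S" using interp_wf(1)[OF i_SplitE(3) issub_wf[OF w]] by simp_all
  show ?case unfolding sub_tm.simps
    by (rule ity_itm_isub.i_SplitE[OF i_SplitE(2)[OF i_SplitE(11)] i_SplitE(4)[OF w] i_SplitE(6) i_SplitE(8) i_SplitE(10)[OF i_SplitE(11)]])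
      (rule issub_ups w T i_SplitE(11) | use S T in simp)+
next
  case (i_Star X \<rho>') show ?case unfolding sub_tm.simps by (rule ity_itm_isub.i_Star)
next
  case (i_UnitE X \<rho>' C U d e c t)
  have "X \<in> Ob (base M)" using i_UnitE(7) wfenv_ob by (auto simp: issub_def)
  then show ?case unfolding sub_tm.simps
    by (intro ity_itm_isub.i_UnitE[OF i_UnitE(2,4,6)]) (use i_UnitE(7) in \<open>simp_all add: issub_ups\<close>)
next
  case (i_Refl X \<rho>' A S a s)
  show ?case unfolding sub_tm.simps
    by (rule ity_itm_isub.i_Refl[OF i_Refl(2,4)]) (use i_Refl(5) in simp_all)
next
  case (i_J X \<rho>' A S C U d e a s b t p q)
  have S: "isty S" "cx S = X" using interp_wf(1)[OF i_J(1) issub_wf[OF i_J(13)]] by simp_all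
  have w1: "issub (ext S) (xenv S \<rho>) (ups \<sigma>) (xenv S \<rho>')" by (rule issub_ups[OF i_J(13) S])
  have w2: "issub (ext (wkself S)) (xenv (wkself S) (xenv S \<rho>)) (ups (ups \<sigma>)) (xenv (wkself S) (xenv S \<rho>'))"
    by (rule issub_ups[OF w1]) (use S in simp_all)
  have w3: "issub (ext (idty S)) (xenv (idty S) (xenv (wkself S) (xenv S \<rho>))) (ups (ups (ups \<sigma>)))
      (xenv (idty S) (xenv (wkself S) (xenv S \<rho>')))"
    by (rule issub_ups[OF w2]) (use S in simp_all)
  show ?case unfolding sub_tm.simps
    by (rule ity_itm_isub.i_J[OF i_J(2)[OF i_J(13)] i_J(4)[OF w3] i_J(6)[OF w1] i_J(8)[OF i_J(13)] i_J(10)[OF i_J(13)] i_J(12)[OF i_J(13)]])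
next
  case (i_Lam X \<rho>' A S B T f e)
  note S = interp_wf(1)[OF i_Lam(1) issub_wf[OF i_Lam(7)]]
  show ?case unfolding sub_tm.simps
    by (rule ity_itm_isub.i_Lam[OF i_Lam(2,4,6)]) (use i_Lam(7) S in \<open>simp_all add: issub_ups\<close>)
next
  case (i_App X \<rho>' A S B T m s a t)
  note S = interp_wf(1)[OF i_App(1) issub_wf[OF i_App(9)]]
  show ?case unfolding sub_tm.simps
    by (rule ity_itm_isub.i_App[OF i_App(2,4,6,8)]) (use i_App(9) S in \<open>simp_all add: issub_ups\<close>)
next
  case (i_Ext X \<rho>' A S B T m s n t p e)
  note S = interp_wf(1)[OF i_Ext(1) issub_wf[OF i_Ext(11)]]
  show ?case unfolding sub_tm.simps
    by (rule ity_itm_isub.i_Ext[OF i_Ext(2,4,6,8,10)]) (use i_Ext(11) S in \<open>simp_all add: issub_ups\<close>)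
next
  case (i_nil g X \<rho>') show ?case unfolding list.map by (rule ity_itm_isub.i_nil) (use i_nil in simp_all)
next
  case (i_cons X \<rho>' As ts g A t a)
  show ?case unfolding list.map
    by (rule ity_itm_isub.i_cons[OF i_cons(2) i_cons(3,4) i_cons(6)]) (use i_cons(7) in simp_all)
qed

section \<open>Semantic judgements\<close>

text \<open>The variables beyond the context denote a fixed section, so that an environment of the empty context
  over \<open>X\<close> is unique.\<close>

primrec valid :: "('a, 'm) ctx \<Rightarrow> 'o \<Rightarrow> ('a, 'm) env \<Rightarrow> bool" where
  "valid [] X \<rho> \<longleftrightarrow> X \<in> Ob (base M) \<and> \<rho> = (\<lambda>_. (unty X, unmap X))"
| "valid (A # G) X \<rho> \<longleftrightarrow> valid G X (\<rho> \<circ> Suc) \<and> ity X (\<rho> \<circ> Suc) A (fst (\<rho> 0)) \<and>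
     gsection (fst (\<rho> 0)) (snd (\<rho> 0))"

lemma valid_wf: "valid G X \<rho> \<Longrightarrow> wfenv X \<rho>"
proof (induction G arbitrary: \<rho>)
  case Nil then show ?case by (simp add: wfenv_def)
next
  case (Cons A G)
  then have w: "wfenv X (\<rho> \<circ> Suc)" by simp
  have "isty (fst (\<rho> 0)) \<and> cx (fst (\<rho> 0)) = X" using interp_wf(1)[OF _ w] Cons(2) by auto
  then have "wfenv X (scons (fst (\<rho> 0), snd (\<rho> 0)) (\<rho> \<circ> Suc))" by (intro wfenv_scons[OF w]) (use Cons(2) in simp_all)
  then show ?case by (simp add: scons_eta)
qed

lemma valid_renv: "valid G X \<rho> \<Longrightarrow> arr f \<Longrightarrow> cd f = X \<Longrightarrow> valid G (dm f) (renv f \<rho>)"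
proof (induction G arbitrary: \<rho>)
  case Nil then show ?case using unty_reix(1) unmap_reix by (auto simp: renv_def)
next
  case (Cons A G)
  have v: "valid G X (\<rho> \<circ> Suc)" and i: "ity X (\<rho> \<circ> Suc) A (fst (\<rho> 0))"
    and g: "gsection (fst (\<rho> 0)) (snd (\<rho> 0))" using Cons(2) by simp_all
  note w = valid_wf[OF v]
  show ?case
    using Cons(1)[OF v Cons(3,4)] interp_reix(1)[OF i w, rule_format, OF Cons(3,4)] interp_wf(1)[OF i w] g Cons(3,4)
    by (simp add: renv_comp) (simp add: renv_def)
qed

lemma valid_scons:
  "valid G X \<rho> \<Longrightarrow> ity X \<rho> A S \<Longrightarrow> gsection S s \<Longrightarrow> valid (A # G) X (scons (S, s) \<rho>)"
  by simp

lemma valid_xenv: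
  assumes "valid G X \<rho>" "ity X \<rho> A S"
  shows "valid (A # G) (ext S) (xenv S \<rho>)"
proof -
  note w = valid_wf[OF assms(1)]
  have S: "isty S" "cx S = X" using interp_wf(1)[OF assms(2) w] by simp_all
  show ?thesis
    unfolding xenv_def
    by (rule valid_scons) (use S valid_renv[OF assms(1), of "disp S"] interp_reix(1)[OF assms(2) w, rule_format, of "disp S"] in simp_all)
qed

primrec semctx :: "('a, 'm) ctx \<Rightarrow> bool" where
  "semctx [] \<longleftrightarrow> True"
| "semctx (A # G) \<longleftrightarrow> semctx G \<and> (\<forall>X \<rho>. valid G X \<rho> \<longrightarrow> (\<exists>S. ity X \<rho> A S))"

text \<open>The judgements on terms also demand that the type denotes, and equality demands a common
  denotation. In \<open>HasTy\<close> the type of the term must be literally the denotation of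
  \<open>A\<close>, which strictness makes attainable.\<close>

primrec holds :: "'o \<Rightarrow> ('a, 'm) env \<Rightarrow> ('a, 'm) judgement \<Rightarrow> bool" where
  "holds X \<rho> (IsTy A) \<longleftrightarrow> (\<exists>S. ity X \<rho> A S)"
| "holds X \<rho> (HasTy a A) \<longleftrightarrow> (\<exists>S s. ity X \<rho> A S \<and> itm X \<rho> a S s)"
| "holds X \<rho> (EqTy A B) \<longleftrightarrow> (\<exists>S. ity X \<rho> A S \<and> ity X \<rho> B S)"
| "holds X \<rho> (EqTm a b A) \<longleftrightarrow> (\<exists>S s. ity X \<rho> A S \<and> itm X \<rho> a S s \<and> itm X \<rho> b S s)"

lemma holds_sub: "holds X \<rho>' \<J> \<Longrightarrow> issub X \<rho> \<sigma> \<rho>' \<Longrightarrow> holds X \<rho> (sub_jdg \<sigma> \<J>)"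
  by (cases \<J>) (auto intro: interp_sub)

lemma holds_renv:
  assumes "holds X \<rho> \<J>" "wfenv X \<rho>" "arr f" "cd f = X"
  shows "holds (dm f) (renv f \<rho>) \<J>"
  using assms interp_reix(1,2)[of X \<rho>] by (cases \<J>) (simp_all; blast)+

text \<open>Meaningfulness of the context is included because rules for a judgement in
  \<open>G\<close> need not have a premise about \<open>G\<close>.\<close>

definition sound :: "('a, 'm) ctx \<Rightarrow> ('a, 'm) judgement \<Rightarrow> bool" where
  "sound G \<J> \<longleftrightarrow> semctx G \<and> (\<forall>X \<rho>. valid G X \<rho> \<longrightarrow> holds X \<rho> \<J>)"

lemma sound_holds: "sound G \<J> \<Longrightarrow> valid G X \<rho> \<Longrightarrow> holds X \<rho> \<J>"
  and sound_semctx: "sound G \<J> \<Longrightarrow> semctx G"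
  by (auto simp: sound_def)

text \<open>Two substitutions are required to denote the same environment. Taking them equal serves
  the substitution rule, taking them different serves its congruence version.\<close>

definition ctxmor :: "(nat \<Rightarrow> ('a, 'm) tm) \<Rightarrow> (nat \<Rightarrow> ('a, 'm) tm) \<Rightarrow> ('a, 'm) ctx \<Rightarrow> ('a, 'm) ctx \<Rightarrow> bool" where
  "ctxmor \<sigma> \<sigma>' G H \<longleftrightarrow>
     (\<forall>X \<rho>. valid G X \<rho> \<longrightarrow> (\<exists>\<rho>'. valid H X \<rho>' \<and> issub X \<rho> \<sigma> \<rho>' \<and> issub X \<rho> \<sigma>' \<rho>'))"

text \<open>The common environment for \<open>H\<close> is extended along \<open>D\<close> one
  variable at a time, reusing the entries of the given environment.\<close>

lemma ctxmor_lift: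
  assumes "ctxmor \<sigma> \<sigma>' G H" "semctx G" "semctx (D @ H)"
  shows "semctx (sub_ctx \<sigma> D @ G) \<and>
    ctxmor ((ups ^^ length D) \<sigma>) ((ups ^^ length D) \<sigma>') (sub_ctx \<sigma> D @ G) (D @ H)"
  using assms(3)
proof (induction D)
  case Nil then show ?case using assms(1,2) by simp
next
  case (Cons A D)
  let ?s = "(ups ^^ length D) \<sigma>" and ?s' = "(ups ^^ length D) \<sigma>'" and ?G = "sub_ctx \<sigma> D @ G"
  have s: "semctx ?G" and c: "ctxmor ?s ?s' ?G (D @ H)" using Cons by simp_all
  have A: "\<exists>S. ity X \<rho> A S" if "valid (D @ H) X \<rho>" for X \<rho> using Cons(2) that by simp
  have 1: "\<exists>S. ity X \<rho> (sub_ty ?s A) S" if "valid ?G X \<rho>" for X \<rho>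
    using c A that interp_sub(1) unfolding ctxmor_def by meson
  have 2: "\<exists>\<rho>'. valid (A # D @ H) X \<rho>' \<and> issub X \<rho> (ups ?s) \<rho>' \<and> issub X \<rho> (ups ?s') \<rho>'"
    if v: "valid (sub_ty ?s A # ?G) X \<rho>" for X \<rho>
  proof -
    have v1: "valid ?G X (\<rho> \<circ> Suc)" and i: "ity X (\<rho> \<circ> Suc) (sub_ty ?s A) (fst (\<rho> 0))"
      and g: "gsection (fst (\<rho> 0)) (snd (\<rho> 0))" using v by simp_all
    obtain \<rho>' where r: "valid (D @ H) X \<rho>'" "issub X (\<rho> \<circ> Suc) ?s \<rho>'" "issub X (\<rho> \<circ> Suc) ?s' \<rho>'"
      using c v1 unfolding ctxmor_def by blast
    obtain S where S: "ity X \<rho>' A S" using A r(1) by blast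
    \<comment> \<open>The type recorded for the new variable is the denotation of the substituted
      type; by functionality it is also the denotation of \<open>A\<close> in
      \<open>\<rho>'\<close>, so the entry can be reused.\<close>
    have "S = fst (\<rho> 0)" using interp_functional(1)[OF interp_sub(1)[OF S r(2)] i] .
    then have "valid (A # D @ H) X (scons (\<rho> 0) \<rho>')" using r(1) S g by simp
    moreover have "issub X \<rho> (ups t) (scons (\<rho> 0) \<rho>')" if t: "issub X (\<rho> \<circ> Suc) t \<rho>'" for t
    proof -
      have "itm X \<rho> (ups t n) (fst (scons (\<rho> 0) \<rho>' n)) (snd (scons (\<rho> 0) \<rho>' n))" for n
      proof (cases n)
        case 0 then show ?thesis by (simp add: i_Var)
      next
        case (Suc k)
        have "itm X (\<rho> \<circ> Suc) (t k) (fst (\<rho>' k)) (snd (\<rho>' k))" using t by (simp add: issub_def)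
        from interp_ren(2)[OF this refl] show ?thesis using Suc by simp
      qed
      then show ?thesis using valid_wf[OF v] by (simp add: issub_def)
    qed
    ultimately show ?thesis using r(2,3) by blast
  qed
  show ?case using s 1 2 by (simp add: ctxmor_def)
qed

lemma sound_sub:
  assumes "sound (D @ H) \<J>" "ctxmor \<sigma> \<sigma> G H" "semctx G"
  shows "sound (sub_ctx \<sigma> D @ G) (sub_jdg ((ups ^^ length D) \<sigma>) \<J>)"
  using ctxmor_lift[OF assms(2,3) sound_semctx[OF assms(1)]] sound_holds[OF assms(1)] holds_sub
  unfolding sound_def ctxmor_def by meson

lemma sound_ren:
  assumes "sound (D @ H) \<J>" "semctx G" "\<And>X \<rho>. valid G X \<rho> \<Longrightarrow> valid H X (\<rho> \<circ> r)"
  shows "sound (ren_ctx r D @ G) (ren_jdg ((upr ^^ length D) r) \<J>)"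
proof -
  have "ctxmor (Var \<circ> r) (Var \<circ> r) G H"
    unfolding ctxmor_def using assms(3) issub_Var valid_wf by blast
  from sound_sub[OF assms(1) this assms(2)] show ?thesis
    by (simp add: ren_ctx_eq_sub ren_jdg_eq_sub ups_pow_Var)
qed

section \<open>Soundness of the structural rules\<close>

lemma wk1: "wk_ty 1 0 A = ren_ty Suc A" "wk_tm 1 0 a = ren_tm Suc a"
  by (simp_all add: wk_ty_def wk_tm_def Suc_eq_plus1[symmetric, abs_def])

lemma semctx_Cons: "semctx (D @ G) \<Longrightarrow> semctx G"
  by (induction D) simp_all

lemma sound_weakening:
  assumes "sound (D @ G) \<J>" "sound G (IsTy A)"
  shows "sound (ren_ctx Suc D @ A # G) (ren_jdg ((upr ^^ length D) Suc) \<J>)"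
  by (rule sound_ren[OF assms(1)]) (use assms(2) in \<open>auto simp: sound_def\<close>)

lemma sound_contraction:
  assumes "sound (D @ wk_ty 1 0 A # A # G) \<J>"
  shows "sound (ren_ctx contract D @ A # G) (ren_jdg ((upr ^^ length D) contract) \<J>)"
proof (rule sound_ren[OF assms])
  show "semctx (A # G)" using semctx_Cons[OF sound_semctx[OF assms]] by simp
  fix X \<rho> assume v: "valid (A # G) X \<rho>"
  have c: "\<rho> \<circ> contract \<circ> Suc = \<rho>" by (simp add: fun_eq_iff contract_def comp_apply)
  have "ity X \<rho> (ren_ty Suc A) (fst (\<rho> 0))" by (rule interp_ren(1)[OF _ refl]) (use v in simp)
  then show "valid (wk_ty 1 0 A # A # G) X (\<rho> \<circ> contract)"
    unfolding wk1 valid.simps(2)[of "ren_ty Suc A"] c using v by (simp add: contract_def comp_apply)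
qed

lemma sound_exchanging:
  assumes "sound (D @ wk_ty 1 0 B # A # G) \<J>" "sound G (IsTy B)"
  shows "sound (ren_ctx exchange D @ wk_ty 1 0 A # B # G) (ren_jdg ((upr ^^ length D) exchange) \<J>)"
proof (rule sound_ren[OF assms(1)])
  have s: "semctx (A # G)" using semctx_Cons[OF sound_semctx[OF assms(1)]] by simp
  then have A: "\<exists>S. ity X \<rho> A S" if "valid G X \<rho>" for X \<rho> using that by simp
  have "\<exists>S. ity X \<rho> (ren_ty Suc A) S" if "valid (B # G) X \<rho>" for X \<rho>
    using A[of X "\<rho> \<circ> Suc"] that interp_ren(1)[OF _ refl, of X \<rho> Suc] by auto
  then show "semctx (wk_ty 1 0 A # B # G)" using assms(2) unfolding wk1 by (simp add: sound_def)
  fix X \<rho> assume v: "valid (wk_ty 1 0 A # B # G) X \<rho>"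
  have e: "\<rho> \<circ> exchange \<circ> Suc \<circ> Suc = \<rho> \<circ> Suc \<circ> Suc" by (simp add: fun_eq_iff exchange_def comp_apply)
  have v': "valid G X (\<rho> \<circ> Suc \<circ> Suc)" "ity X (\<rho> \<circ> Suc \<circ> Suc) B (fst (\<rho> 1))"
    "gsection (fst (\<rho> 1)) (snd (\<rho> 1))" "ity X (\<rho> \<circ> Suc) (ren_ty Suc A) (fst (\<rho> 0))"
    "gsection (fst (\<rho> 0)) (snd (\<rho> 0))"
    \<comment> \<open>The last two entries of the environment are independent up to weakening, so
      after the swap each type has to be re-established over the shorter environment.\<close>
    using v unfolding wk1 by (simp_all add: comp_apply[of \<rho>])
  obtain S where S: "ity X (\<rho> \<circ> Suc \<circ> Suc) A S" using A v'(1) by blast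
  have "S = fst (\<rho> 0)" by (rule interp_functional(1)[OF interp_ren(1)[OF S refl] v'(4)])
  then have a: "valid (A # G) X (\<rho> \<circ> exchange \<circ> Suc)"
    using S v'(1,5) unfolding valid.simps e by (simp add: exchange_def comp_apply)
  have "ity X (\<rho> \<circ> exchange \<circ> Suc) (ren_ty Suc B) (fst (\<rho> 1))"
    by (rule interp_ren(1)[OF v'(2)]) (simp add: e)
  then show "valid (wk_ty 1 0 B # A # G) X (\<rho> \<circ> exchange)"
    unfolding wk1 valid.simps(2)[of "ren_ty Suc B"] using a v'(3) by (simp add: exchange_def comp_apply)
qed

lemma insts_simps [simp]: "insts [] = Var" "insts (t # ts) 0 = t" "insts (t # ts) (Suc n) = insts ts n"
  by (simp_all add: insts_def fun_eq_iff)

lemma issub_insts_Nil: "wfenv X \<rho> \<Longrightarrow> issub X \<rho> (insts []) \<rho>"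
  by (simp add: issub_def i_Var comp_apply)

lemma issub_insts_Cons:
  assumes "issub X \<rho> (insts ts) \<rho>'" "itm X \<rho> t S s"
  shows "issub X \<rho> (insts (t # ts)) (scons (S, s) \<rho>')"
proof -
  have "itm X \<rho> (insts (t # ts) n) (fst (scons (S, s) \<rho>' n)) (snd (scons (S, s) \<rho>' n))" for n
    using assms by (cases n) (simp_all add: issub_def)
  then show ?thesis using assms(1) by (simp add: issub_def)
qed

lemma ctxmor_insts:
  assumes "sound G (EqTm a a' A)"
  shows "ctxmor (insts [a]) (insts [a']) G (A # G)"
  unfolding ctxmor_def
proof (intro allI impI)
  fix X \<rho> assume v: "valid G X \<rho>"
  obtain S s where S: "ity X \<rho> A S" "itm X \<rho> a S s" "itm X \<rho> a' S s"
    using sound_holds[OF assms v] by auto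
  note w = valid_wf[OF v]
  have "gsection S s" using interp_wf(2)[OF S(2) w] by simp
  then have "valid (A # G) X (scons (S, s) \<rho>)" using v S(1) by simp
  then show "\<exists>\<rho>'. valid (A # G) X \<rho>' \<and> issub X \<rho> (insts [a]) \<rho>' \<and> issub X \<rho> (insts [a']) \<rho>'"
    using issub_insts_Cons[OF issub_insts_Nil[OF w]] S(2,3) by blast
qed

lemma sound_tm_refl: "sound G (HasTy a A) \<Longrightarrow> sound G (EqTm a a A)"
  by (auto simp: sound_def)

lemma sound_substitution:
  assumes "sound (D @ A # G) \<J>" "sound G (HasTy a A)"
  shows "sound (sub_ctx (insts [a]) D @ G) (sub_jdg ((ups ^^ length D) (insts [a])) \<J>)"
  by (rule sound_sub[OF assms(1) ctxmor_insts[OF sound_tm_refl[OF assms(2)]] sound_semctx[OF assms(2)]])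

text \<open>Since \<open>a\<close> and \<open>a'\<close> denote the same section, both substituted
  forms are interpreted in one and the same environment.\<close>

lemma sound_substitution_eq:
  assumes "sound G (EqTm a a' A)"
  shows "sound (D @ A # G) (IsTy B) \<Longrightarrow>
      sound (sub_ctx (insts [a]) D @ G) (EqTy (sub_ty ((ups ^^ length D) (insts [a])) B)
             (sub_ty ((ups ^^ length D) (insts [a'])) B))"
    "sound (D @ A # G) (HasTy b B) \<Longrightarrow>
      sound (sub_ctx (insts [a]) D @ G) (EqTm (sub_tm ((ups ^^ length D) (insts [a])) b)
             (sub_tm ((ups ^^ length D) (insts [a'])) b) (sub_ty ((ups ^^ length D) (insts [a])) B))"
proof -
  let ?s = "(ups ^^ length D) (insts [a])" and ?s' = "(ups ^^ length D) (insts [a'])"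
  note c = ctxmor_lift[OF ctxmor_insts[OF assms] sound_semctx[OF assms], of D]
  show "sound (sub_ctx (insts [a]) D @ G) (EqTy (sub_ty ?s B) (sub_ty ?s' B))" if B: "sound (D @ A # G) (IsTy B)"
    unfolding sound_def
  proof (intro conjI allI impI)
    show "semctx (sub_ctx (insts [a]) D @ G)" using c sound_semctx[OF B] by blast
    fix X \<rho> assume "valid (sub_ctx (insts [a]) D @ G) X \<rho>"
    then obtain \<rho>' where r: "valid (D @ A # G) X \<rho>'" "issub X \<rho> ?s \<rho>'" "issub X \<rho> ?s' \<rho>'"
      using c sound_semctx[OF B] unfolding ctxmor_def by blast
    obtain S where "ity X \<rho>' B S" using sound_holds[OF B r(1)] by auto
    then show "holds X \<rho> (EqTy (sub_ty ?s B) (sub_ty ?s' B))"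
      unfolding holds.simps using interp_sub(1)[OF _ r(2)] interp_sub(1)[OF _ r(3)] by blast
  qed
  show "sound (sub_ctx (insts [a]) D @ G) (EqTm (sub_tm ?s b) (sub_tm ?s' b) (sub_ty ?s B))"
    if B: "sound (D @ A # G) (HasTy b B)"
    unfolding sound_def
  proof (intro conjI allI impI)
    show "semctx (sub_ctx (insts [a]) D @ G)" using c sound_semctx[OF B] by blast
    fix X \<rho> assume "valid (sub_ctx (insts [a]) D @ G) X \<rho>"
    then obtain \<rho>' where r: "valid (D @ A # G) X \<rho>'" "issub X \<rho> ?s \<rho>'" "issub X \<rho> ?s' \<rho>'"
      using c sound_semctx[OF B] unfolding ctxmor_def by blast
    obtain S s where "ity X \<rho>' B S" "itm X \<rho>' b S s" using sound_holds[OF B r(1)] by auto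
    then show "holds X \<rho> (EqTm (sub_tm ?s b) (sub_tm ?s' b) (sub_ty ?s B))"
      unfolding holds.simps using interp_sub(1)[OF _ r(2)] interp_sub(2)[OF _ r(2)] interp_sub(2)[OF _ r(3)] by blast
  qed
qed

subsection \<open>Reindexing below a telescope\<close>

primrec xenvs :: "'a list \<Rightarrow> ('a, 'm) env \<Rightarrow> ('a, 'm) env" where
  "xenvs [] \<rho> = \<rho>"
| "xenvs (D # Ds) \<rho> = xenv D (xenvs Ds \<rho>)"

lemma tel_reindex:
  assumes "tel M X Ds" "arr h" "cd h = X"
  shows "tel M (dm h) (retel h Ds) \<and> arr (flift h Ds) \<and> dm (flift h Ds) = tend M (dm h) (retel h Ds) \<and>
    cd (flift h Ds) = tend M X Ds"
  using assms by (induction Ds) simp_all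

lemma length_retel [simp]: "length (retel h Ds) = length Ds"
  by (induction Ds) simp_all

lemma wfenv_xenvs: "wfenv X \<rho> \<Longrightarrow> tel M X Ds \<Longrightarrow> wfenv (tend M X Ds) (xenvs Ds \<rho>)"
  by (induction Ds) (simp_all add: wfenv_xenv)

lemma renv_xenvs:
  assumes "wfenv X \<rho>" "tel M X Ds" "arr h" "cd h = X"
  shows "renv (flift h Ds) (xenvs Ds \<rho>) = xenvs (retel h Ds) (renv h \<rho>)"
  using assms
proof (induction Ds)
  case (Cons D Ds)
  then have D: "isty D" "cx D = tend M X Ds" "tel M X Ds" by simp_all
  note f = tel_reindex[OF D(3) assms(3,4)]
  have "renv (fext (flift h Ds) D) (xenv D (xenvs Ds \<rho>)) = xenv (reix (flift h Ds) D) (renv (flift h Ds) (xenvs Ds \<rho>))"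
    by (rule renv_xenv_fext) (use D f wfenv_xenvs[OF assms(1) D(3)] in simp_all)
  then show ?case using Cons D by simp
qed simp

lemma issub_xenvs:
  assumes "issub X \<rho> s \<rho>'" "tel M X Ds"
  shows "issub (tend M X Ds) (xenvs Ds \<rho>) ((ups ^^ length Ds) s) (xenvs Ds \<rho>')"
  using assms by (induction Ds) (simp_all add: issub_ups)

text \<open>Reindexing along \<open>h\<close> below a telescope is matched with any substitution
  \<open>s\<close> that denotes the reindexed environment. Weakenings under binders and all
  structural axioms of the model are instances.\<close>

lemma interp_reindex:
  assumes "issub Y \<rho>' s (renv h \<rho>)" "wfenv X \<rho>" "arr h" "dm h = Y" "cd h = X" "tel M X Ds"
  shows "ity (tend M X Ds) (xenvs Ds \<rho>) B T \<Longrightarrow>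
      ity (tend M Y (retel h Ds)) (xenvs (retel h Ds) \<rho>') (sub_ty ((ups ^^ length Ds) s) B) (reix (flift h Ds) T)"
    "itm (tend M X Ds) (xenvs Ds \<rho>) b T t \<Longrightarrow>
      itm (tend M Y (retel h Ds)) (xenvs (retel h Ds) \<rho>') (sub_tm ((ups ^^ length Ds) s) b)
        (reix (flift h Ds) T) (resec (flift h Ds) T t)"
proof -
  note f = tel_reindex[OF assms(6,3,5), unfolded assms(4)]
  note w = wfenv_xenvs[OF assms(2,6)]
  have i: "issub (tend M Y (retel h Ds)) (xenvs (retel h Ds) \<rho>') ((ups ^^ length Ds) s)
      (renv (flift h Ds) (xenvs Ds \<rho>))"
    unfolding renv_xenvs[OF assms(2,6,3,5)] using issub_xenvs[OF assms(1), of "retel h Ds"] f by simp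
  show "ity (tend M Y (retel h Ds)) (xenvs (retel h Ds) \<rho>') (sub_ty ((ups ^^ length Ds) s) B) (reix (flift h Ds) T)"
    if "ity (tend M X Ds) (xenvs Ds \<rho>) B T"
    by (rule interp_sub(1)[OF _ i]) (use interp_reix(1)[OF that w, rule_format, of "flift h Ds"] f in simp)
  show "itm (tend M Y (retel h Ds)) (xenvs (retel h Ds) \<rho>') (sub_tm ((ups ^^ length Ds) s) b)
        (reix (flift h Ds) T) (resec (flift h Ds) T t)"
    if "itm (tend M X Ds) (xenvs Ds \<rho>) b T t"
    by (rule interp_sub(2)[OF _ i]) (use interp_reix(2)[OF that w, rule_format, of "flift h Ds"] f in simp)
qed

lemma wk_eq_sub:
  "wk_ty n j A = sub_ty ((ups ^^ j) (Var \<circ> (\<lambda>i. i + n))) A" "wk_tm n j a = sub_tm ((ups ^^ j) (Var \<circ> (\<lambda>i. i + n))) a"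
  by (simp_all add: wk_ty_def wk_tm_def ren_eq_sub ups_pow_Var)

lemma interp_wk:
  assumes "wfenv Y \<rho>'" "\<rho>' \<circ> (\<lambda>i. i + n) = renv h \<rho>" "wfenv X \<rho>" "arr h" "dm h = Y" "cd h = X" "tel M X Ds"
  shows "ity (tend M X Ds) (xenvs Ds \<rho>) B T \<Longrightarrow> j = length Ds \<Longrightarrow>
      ity (tend M Y (retel h Ds)) (xenvs (retel h Ds) \<rho>') (wk_ty n j B) (reix (flift h Ds) T)"
    "itm (tend M X Ds) (xenvs Ds \<rho>) b T t \<Longrightarrow> j = length Ds \<Longrightarrow>
      itm (tend M Y (retel h Ds)) (xenvs (retel h Ds) \<rho>') (wk_tm n j b)
        (reix (flift h Ds) T) (resec (flift h Ds) T t)"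
  unfolding wk_eq_sub
  using interp_reindex[OF issub_Var[OF assms(1), of "\<lambda>i. i + n", unfolded assms(2)] assms(3-7)] by simp_all

section \<open>Denotations of the derived forms\<close>

lemma renv_xenv_pair:
  assumes "wfenv (cx A) \<rho>" "isty A" "arr g" "cd g = cx A" "gsection (reix g A) a"
  shows "renv (fext g A \<odot> a) (xenv A \<rho>) = scons (reix g A, a) (renv g \<rho>)"
proof -
  note a = gsectionD[OF assms(5)]
  have "disp A \<odot> fext g A \<odot> a = g" using assms(2-4) a by simp
  moreover have "sec g A (fext g A \<odot> a) = a" by (rule sec_unique) (use assms in simp_all)
  ultimately show ?thesis using renv_xenv[OF assms(1,2), of "fext g A \<odot> a"] assms(2-4) a by simp
qed

text \<open>\<open>x\<close> is what \<open>Var 1\<close> denotes in the context extended by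
  \<open>S\<close> and \<open>T\<close>. The map it names forgets only the last variable.\<close>

lemma pair_var:
  assumes "isty S" "isty T" "cx T = ext S"
  defines "h \<equiv> disp S \<odot> disp T"
  defines "x \<equiv> resec (disp T) (reix (disp S) S) (diag S)"
  shows "gsection (reix h S) x" "fext h S \<odot> x = disp T"
proof -
  have "reix (disp T) (reix (disp S) S) = reix h S" unfolding h_def using assms(1-3) by simp
  then show g: "gsection (reix h S) x"
    unfolding x_def using resec_facts(1)[of "disp T" "reix (disp S) S" "diag S"] assms(1-3) by simp
  have "fext h S \<odot> x = fext (disp S) S \<odot> fext (disp T) (reix (disp S) S) \<odot> x"
    unfolding h_def by (rule reix_cmp(3)[symmetric]) (use assms(1-3) gsectionD[OF g] in \<open>simp_all add: h_def\<close>)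
  also have "fext (disp T) (reix (disp S) S) \<odot> x = diag S \<odot> disp T"
    unfolding x_def using assms(1-3) by simp
  also have "fext (disp S) S \<odot> diag S \<odot> disp T = (fext (disp S) S \<odot> diag S) \<odot> disp T"
    by (rule base.cmp_assoc'[symmetric]) (use assms(1-3) in simp_all)
  also have "\<dots> = disp T" using assms(1-3) by simp
  finally show "fext h S \<odot> x = disp T" .
qed

text \<open>The pair of the two generic variables names the semantic pairing map: put together, the
  variables name the identity of \<Gamma>.S.T.\<close>

lemma pairsec_var:
  assumes "isty S" "isty T" "cx T = ext S"
  defines "h \<equiv> disp S \<odot> disp T" and "P \<equiv> sigty S T"
  defines "x \<equiv> resec (disp T) (reix (disp S) S) (diag S)"
  shows "reix x (reix (fext h S) T) = reix (disp T) T"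
    "pairsec (reix h S) (reix (fext h S) T) x (diag T) = sec h P (sigin S T)"
    "fext h P \<odot> sec h P (sigin S T) = sigin S T"
proof -
  note x = pair_var[OF assms(1-3), folded h_def x_def]
  note X = gsectionD[OF x(1)]
  have h: "arr h" "dm h = ext T" "cd h = cx S" using assms(1-3) by (simp_all add: h_def)
  let ?S = "reix h S" and ?T = "reix (fext h S) T"
  have P: "isty P" "cx P = cx S" using assms(1-3) by (simp_all add: P_def)
  have S: "isty ?S" "isty ?T" "cx ?T = ext ?S" "cx ?S = ext T" using assms(1-3) h by simp_all
  have "reix x ?T = reix (fext h S \<odot> x) T" by (rule reix_cmp(1)) (use assms(1-3) h X S in simp_all)
  then show ty: "reix x ?T = reix (disp T) T" unfolding x(2) .
  have dT: "gsection (reix x ?T) (diag T)" unfolding ty by (rule diag_simps(1)[OF assms(2)])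
  note sg = sigty_reix[OF assms(1-3) h(1,3), folded P_def]
  have p: "gsection (sigty ?S ?T) (pairsec ?S ?T x (diag T))"
    by (rule pairsec_section) (use S x dT in simp_all)
  have f: "arr (fext x ?T)" "dm (fext x ?T) = ext (reix (disp T) T)" "cd (fext x ?T) = ext ?T"
    using X S ty by simp_all
  have i: "arr (sigin ?S ?T)" "dm (sigin ?S ?T) = ext ?T" "cd (sigin ?S ?T) = ext (sigty ?S ?T)"
    using S(1-3) by simp_all
  have d: "arr (diag T)" "dm (diag T) = ext T" "cd (diag T) = ext (reix (disp T) T)"
    using assms(2) by simp_all
  have F: "arr (fext (fext h S) T)" "dm (fext (fext h S) T) = ext ?T" "cd (fext (fext h S) T) = ext T"
    using assms(1-3) h by simp_all
  have FP: "arr (fext h P)" "dm (fext h P) = ext (sigty ?S ?T)" "cd (fext h P) = ext P"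
    using P h sg(1)[symmetric] by simp_all
  have "fext h P \<odot> pairsec ?S ?T x (diag T) = (fext h P \<odot> sigin ?S ?T) \<odot> fext x ?T \<odot> diag T"
    unfolding pairsec_def by (rule base.cmp_assoc'[symmetric]) (use FP i f d in simp_all)
  also have "\<dots> = sigin S T \<odot> fext (fext h S) T \<odot> fext x ?T \<odot> diag T"
    unfolding sg(2) by (rule base.cmp_assoc') (use F f d assms(1-3) in simp_all)
  also have "fext (fext h S) T \<odot> fext x ?T \<odot> diag T = fext (fext h S \<odot> x) T \<odot> diag T"
    by (rule reix_cmp(3)) (use assms(1-3) h X S d x(2) in simp_all)
  also have "\<dots> = ide (ext T)" unfolding x(2) by (rule diag_simps(6)[OF assms(2)])
  finally have e: "fext h P \<odot> pairsec ?S ?T x (diag T) = sigin S T" using assms(1-3) by simp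
  have "sec h P (sigin S T) = pairsec ?S ?T x (diag T)"
    by (rule sec_unique) (use P h p e sg(1) in simp_all)
  then show "pairsec ?S ?T x (diag T) = sec h P (sigin S T)" ..
  then show "fext h P \<odot> sec h P (sigin S T) = sigin S T" using e by simp
qed

text \<open>If \<open>x\<close> and \<open>y\<close> name the two components of a map
  \<open>k\<close> into \<Gamma>.S.S, then pairing them gives back \<open>k\<close>; both sides are
  compared on the pullback projections.\<close>

lemma pairmap_var:
  assumes "isty S" "arr k" "cd k = ext (reix (disp S) S)"
    "h = disp S \<odot> disp (reix (disp S) S) \<odot> k"
    "gsection (reix h S) x" "fext h S \<odot> x = disp (reix (disp S) S) \<odot> k"
    "gsection (reix h S) y" "fext h S \<odot> y = fext (disp S) S \<odot> k"
  shows "fext (fext h S) (reix (disp S) S) \<odot> pairmap (reix h S) x y = k"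
proof (rule pullback_eqI[of "disp S" S])
  let ?W = "reix (disp S) S" and ?S = "reix h S"
  have h: "arr h" "cd h = cx S" "dm h = dm k" unfolding assms(4) using assms(1-3) by simp_all
  have S: "isty ?S" "cx ?S = dm k" using assms(1) h by simp_all
  note p = pairmap_simps[OF S(1) assms(5,7)]
  have w: "reix (fext h S) ?W = reix (disp ?S) ?S" using assms(1) h by simp
  have F: "arr (fext (fext h S) ?W)" "dm (fext (fext h S) ?W) = ext (reix (disp ?S) ?S)"
    "cd (fext (fext h S) ?W) = ext ?W" using w assms(1) h by simp_all
  show "arr (fext (fext h S) ?W \<odot> pairmap ?S x y)" "cd (fext (fext h S) ?W \<odot> pairmap ?S x y) = ext ?W"
    "dm (fext (fext h S) ?W \<odot> pairmap ?S x y) = dm k"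
    using F p S by simp_all
  have "disp ?W \<odot> fext (fext h S) ?W \<odot> pairmap ?S x y = (disp ?W \<odot> fext (fext h S) ?W) \<odot> pairmap ?S x y"
    by (rule base.cmp_assoc'[symmetric]) (use F p assms(1) in simp_all)
  also have "\<dots> = (fext h S \<odot> disp (reix (disp ?S) ?S)) \<odot> pairmap ?S x y"
    using assms(1) h w by simp
  also have "\<dots> = fext h S \<odot> disp (reix (disp ?S) ?S) \<odot> pairmap ?S x y"
    by (rule base.cmp_assoc') (use p assms(1) h S in simp_all)
  finally show "disp ?W \<odot> fext (fext h S) ?W \<odot> pairmap ?S x y = disp ?W \<odot> k" unfolding p(4) assms(6) .
  have "fext (disp S) S \<odot> fext (fext h S) ?W \<odot> pairmap ?S x y = fext (disp S \<odot> fext h S) S \<odot> pairmap ?S x y"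
    by (rule reix_cmp(3)) (use p assms(1) h w in simp_all)
  also have "disp S \<odot> fext h S = h \<odot> disp ?S" using assms(1) h by simp
  also have "fext (h \<odot> disp ?S) S \<odot> pairmap ?S x y = fext h S \<odot> fext (disp ?S) ?S \<odot> pairmap ?S x y"
    by (rule reix_cmp(3)[symmetric]) (use p assms(1) h S in simp_all)
  finally show "fext (disp S) S \<odot> fext (fext h S) ?W \<odot> pairmap ?S x y = fext (disp S) S \<odot> k"
    unfolding p(5) assms(8) .
qed (use assms(1-3) in simp_all)

lemma IdT_var:
  assumes "isty S" "arr k" "cd k = ext (reix (disp S) S)"
    "h = disp S \<odot> disp (reix (disp S) S) \<odot> k"
    "gsection (reix h S) x" "fext h S \<odot> x = disp (reix (disp S) S) \<odot> k"
    "gsection (reix h S) y" "fext h S \<odot> y = fext (disp S) S \<odot> k"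
  shows "IdT (reix h S) x y = reix k (idty S)"
    "gsection (IdT (reix h S) x y) q \<Longrightarrow> idext h S \<odot> idmap (reix h S) x y q = fext k (idty S) \<odot> q"
proof -
  let ?W = "reix (disp S) S" and ?S = "reix h S"
  have h: "arr h" "cd h = cx S" "dm h = dm k" unfolding assms(4) using assms(1-3) by simp_all
  have S: "isty ?S" "cx ?S = dm k" using assms(1) h by simp_all
  note p = pairmap_simps[OF S(1) assms(5,7)] and v = pairmap_var[OF assms]
  note I = idty_reix(1)[OF assms(1) h(1,2)]
  have w: "reix (fext h S) ?W = reix (disp ?S) ?S" using assms(1) h by simp
  have F: "arr (fext (fext h S) ?W)" "dm (fext (fext h S) ?W) = ext (reix (disp ?S) ?S)"
    "cd (fext (fext h S) ?W) = ext ?W" using w assms(1) h by simp_all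
  have "IdT ?S x y = reix (fext (fext h S) ?W \<odot> pairmap ?S x y) (idty S)"
    unfolding IdT_def I[symmetric] by (rule reix_cmp(1)) (use F p assms(1) in simp_all)
  then show i: "IdT ?S x y = reix k (idty S)" unfolding v .
  assume q: "gsection (IdT ?S x y) q"
  note Q = gsectionD[OF q]
  have "idext h S \<odot> idmap ?S x y q = fext (fext (fext h S) ?W) (idty S) \<odot>
      fext (pairmap ?S x y) (reix (fext (fext h S) ?W) (idty S)) \<odot> q"
    unfolding idext_def idmap_def I ..
  also have "\<dots> = fext (fext (fext h S) ?W \<odot> pairmap ?S x y) (idty S) \<odot> q"
    by (rule reix_cmp(3)) (use F p Q i v assms(1) in simp_all)
  finally show "idext h S \<odot> idmap ?S x y q = fext k (idty S) \<odot> q" unfolding v .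
qed

text \<open>Taking the single variable of \<open>S\<close> for both endpoints gives the diagonal.
  Naturality of \<open>reflmap\<close> then removes the weakening, since the diagonal followed by
  \<open>fext (disp S) S\<close> is an identity.\<close>

lemma refl_var:
  assumes "isty S"
  defines "S1 \<equiv> reix (disp S) S" and "\<delta> \<equiv> diag S"
  shows "IdT S1 \<delta> \<delta> = reix \<delta> (idty S)"
    "idext (disp S) S \<odot> idmap S1 \<delta> \<delta> (reflsec S1 \<delta>) = reflmap S"
    "reflsec S1 \<delta> = sec \<delta> (idty S) (reflmap S)"
proof -
  have d: "arr \<delta>" "dm \<delta> = ext S" "cd \<delta> = ext S1" "disp S1 \<odot> \<delta> = ide (ext S)"
    "fext (disp S) S \<odot> \<delta> = ide (ext S)" "gsection S1 \<delta>"
    unfolding S1_def \<delta>_def using assms(1) by simp_all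
  have h: "disp S = disp S \<odot> disp S1 \<odot> \<delta>" using d assms(1) by simp
  have e: "fext (disp S) S \<odot> \<delta> = disp S1 \<odot> \<delta>" using d by simp
  have S1: "isty S1" "cx S1 = ext S" unfolding S1_def using assms(1) by simp_all
  note v = IdT_var[where k = \<delta> and h = "disp S" and x = \<delta> and y = \<delta> and S = S, folded S1_def,
    OF assms(1) d(1,3) h d(6) e d(6) refl]
  show i: "IdT S1 \<delta> \<delta> = reix \<delta> (idty S)" by (rule v(1))
  have r: "gsection (IdT S1 \<delta> \<delta>) (reflsec S1 \<delta>)" by (rule reflsec_facts(1)[OF S1(1) d(6)])
  have f: "arr (disp S)" "cd (disp S) = cx S" using assms(1) by simp_all
  have "idext (disp S) S \<odot> idmap S1 \<delta> \<delta> (reflsec S1 \<delta>) = idext (disp S) S \<odot> reflmap S1 \<odot> \<delta>"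
    unfolding idmap_reflsec[OF S1(1) d(6)] ..
  also have "\<dots> = (idext (disp S) S \<odot> reflmap S1) \<odot> \<delta>"
    by (rule base.cmp_assoc'[symmetric]) (use idext_simps[OF assms(1) f] S1 d in \<open>simp_all add: S1_def\<close>)
  also have "\<dots> = (reflmap S \<odot> fext (disp S) S) \<odot> \<delta>"
    unfolding S1_def reflmap_reix[OF assms(1) f] ..
  also have "\<dots> = reflmap S \<odot> fext (disp S) S \<odot> \<delta>"
    by (rule base.cmp_assoc') (use assms(1) d in \<open>simp_all add: S1_def\<close>)
  also have "\<dots> = reflmap S" unfolding d(5) using assms(1) by simp
  finally show m: "idext (disp S) S \<odot> idmap S1 \<delta> \<delta> (reflsec S1 \<delta>) = reflmap S" .
  have "sec \<delta> (idty S) (reflmap S) = reflsec S1 \<delta>"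
    by (rule sec_unique) (use d assms(1) r i v(2)[OF r] m in \<open>simp_all add: S1_def\<close>)
  then show "reflsec S1 \<delta> = sec \<delta> (idty S) (reflmap S)" ..
qed

lemma id_var:
  assumes "isty S"
  defines "W \<equiv> reix (disp S) S" and "h \<equiv> disp S \<odot> disp (reix (disp S) S)"
  defines "x \<equiv> resec (disp W) W (diag S)"
  shows "gsection (reix h S) x" "fext h S \<odot> x = disp W" "reix (disp W) W = reix h S"
    "gsection (reix h S) (diag W)" "fext h S \<odot> diag W = fext (disp S) S"
    "IdT (reix h S) x (diag W) = idty S"
proof -
  have W: "isty W" "cx W = ext S" using assms(1) by (simp_all add: W_def)
  show x: "gsection (reix h S) x" "fext h S \<odot> x = disp W"
    using pair_var[OF assms(1) W] unfolding h_def x_def W_def .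
  show w: "reix (disp W) W = reix h S" using assms(1) by (simp add: W_def h_def)
  show y: "gsection (reix h S) (diag W)" unfolding w[symmetric] by (rule diag_simps(1)[OF W(1)])
  have "fext h S \<odot> diag W = fext (disp S) S \<odot> fext (disp W) W \<odot> diag W"
    unfolding h_def W_def by (rule reix_cmp(3)[symmetric]) (use assms(1) in simp_all)
  also have "\<dots> = fext (disp S) S" using diag_simps(6)[OF W(1)] assms(1) by (simp add: W_def)
  finally show z: "fext h S \<odot> diag W = fext (disp S) S" .
  have "IdT (reix h S) x (diag W) = reix (ide (ext W)) (idty S)"
    by (rule IdT_var(1)[OF assms(1), where k = "ide (ext W)"])
      (use assms(1) W x y z in \<open>simp_all add: W_def h_def\<close>)
  then show "IdT (reix h S) x (diag W) = idty S" using assms(1) by (simp add: W_def)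
qed

section \<open>Instantiation and weakening of denotations\<close>

lemma interp_inst:
  assumes "issub X \<rho> s (renv g \<rho>0)" "wfenv Y \<rho>0" "arr g" "dm g = X" "cd g = Y"
  shows "ity Y \<rho>0 B T \<Longrightarrow> ity X \<rho> (sub_ty s B) (reix g T)"
    "itm Y \<rho>0 b T t \<Longrightarrow> itm X \<rho> (sub_tm s b) (reix g T) (resec g T t)"
proof -
  have "Y \<in> Ob (base M)" using assms(2) wfenv_ob by blast
  then have "tel M Y []" by simp
  from interp_reindex[OF assms this]
  show "ity Y \<rho>0 B T \<Longrightarrow> ity X \<rho> (sub_ty s B) (reix g T)"
    "itm Y \<rho>0 b T t \<Longrightarrow> itm X \<rho> (sub_tm s b) (reix g T) (resec g T t)" by simp_all
qed

lemma issub_inst1: "wfenv X \<rho> \<Longrightarrow> itm X \<rho> a S s \<Longrightarrow> issub X \<rho> (insts [a]) (scons (S, s) \<rho>)"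
  by (rule issub_insts_Cons[OF issub_insts_Nil])

lemma interp_inst1:
  assumes "wfenv X \<rho>" "itm X \<rho> a S s"
  shows "ity (ext S) (xenv S \<rho>) B T \<Longrightarrow> ity X \<rho> (sub_ty (insts [a]) B) (reix s T)"
    "itm (ext S) (xenv S \<rho>) b T t \<Longrightarrow> itm X \<rho> (sub_tm (insts [a]) b) (reix s T) (resec s T t)"
proof -
  have S: "isty S" "cx S = X" "gsection S s" using interp_wf(2)[OF assms(2,1)] by simp_all
  have w: "wfenv (ext S) (xenv S \<rho>)" using wfenv_xenv assms(1) S by simp
  have e: "renv s (xenv S \<rho>) = scons (S, s) \<rho>" by (rule renv_xenv_section) (use assms(1) S in simp_all)
  note i = interp_inst[OF issub_inst1[OF assms, folded e] w gsectionD(1)[OF S(3)] gsectionD(2)[OF S(3), unfolded S(2)]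
      gsectionD(3)[OF S(3)]]
  show "ity (ext S) (xenv S \<rho>) B T \<Longrightarrow> ity X \<rho> (sub_ty (insts [a]) B) (reix s T)"
    "itm (ext S) (xenv S \<rho>) b T t \<Longrightarrow> itm X \<rho> (sub_tm (insts [a]) b) (reix s T) (resec s T t)"
    by (rule i; assumption)+
qed

lemma interp_inst2:
  assumes "wfenv X \<rho>" "itm X \<rho> a S s" "isty T" "cx T = ext S" "itm X \<rho> b (reix s T) t"
  shows "issub X \<rho> (insts [b, a]) (renv (fext s T \<odot> t) (xenv T (xenv S \<rho>)))"
    "itm (ext T) (xenv T (xenv S \<rho>)) d U u \<Longrightarrow>
      itm X \<rho> (sub_tm (insts [b, a]) d) (reix (fext s T \<odot> t) U) (resec (fext s T \<odot> t) U u)"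
proof -
  have S: "isty S" "cx S = X" "gsection S s" using interp_wf(2)[OF assms(2,1)] by simp_all
  have w: "wfenv (ext S) (xenv S \<rho>)" using wfenv_xenv assms(1) S by simp
  have wT: "wfenv (ext T) (xenv T (xenv S \<rho>))" using wfenv_xenv[of T] assms(3,4) w by simp
  note s = gsectionD[OF S(3)]
  have t: "gsection (reix s T) t" using interp_wf(2)[OF assms(5,1)] by simp
  have e: "renv (fext s T \<odot> t) (xenv T (xenv S \<rho>)) = scons (reix s T, t) (scons (S, s) \<rho>)"
    using renv_xenv_pair[of T "xenv S \<rho>" s t] renv_xenv_section[of S \<rho> s] w t s S assms(1,3,4) by simp
  show i: "issub X \<rho> (insts [b, a]) (renv (fext s T \<odot> t) (xenv T (xenv S \<rho>)))"
    unfolding e by (rule issub_insts_Cons[OF issub_inst1[OF assms(1,2)] assms(5)])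
  show "itm X \<rho> (sub_tm (insts [b, a]) d) (reix (fext s T \<odot> t) U) (resec (fext s T \<odot> t) U u)"
    if "itm (ext T) (xenv T (xenv S \<rho>)) d U u"
    by (rule interp_inst(2)[OF i wT _ _ _ that]) (use s S(2) gsectionD[OF t] assms(3,4) in simp_all)
qed

text \<open>Instantiating endpoints and proof is reindexing the generic environment of the path
  object along \<open>idmap\<close>: its last entry comes from the proof, the other two from
  \<open>pairmap\<close>.\<close>

lemma interp_inst3:
  assumes "wfenv X \<rho>" "itm X \<rho> a S s" "itm X \<rho> b S t" "itm X \<rho> p (IdT S s t) q"
    "ity (ext (idty S)) (xenv (idty S) (xenv (wkself S) (xenv S \<rho>))) C U"
  shows "ity X \<rho> (sub_ty (insts [p, b, a]) C) (reix (idmap S s t q) U)"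
proof -
  let ?W = "wkself S"
  have S: "isty S" "cx S = X" "gsection S s" "gsection S t" and q: "gsection (IdT S s t) q"
    using interp_wf(2)[OF assms(2,1)] interp_wf(2)[OF assms(3,1)] interp_wf(2)[OF assms(4,1)] by simp_all
  note s = gsectionD[OF S(3)] and p = pairmap_simps[OF S(1,3,4)]
  have W: "isty ?W" "cx ?W = ext S" "reix s ?W = S" using S(1,2) s by simp_all
  have w: "wfenv (ext S) (xenv S \<rho>)" using wfenv_xenv assms(1) S by simp
  have wW: "wfenv (ext ?W) (xenv ?W (xenv S \<rho>))" by (rule wfenv_xenv) (simp_all only: W w)
  have I: "isty (idty S)" "cx (idty S) = ext ?W" using S(1) by simp_all
  have wI: "wfenv (ext (idty S)) (xenv (idty S) (xenv ?W (xenv S \<rho>)))"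
    using wfenv_xenv[of "idty S"] wW I by simp
  note Q = q[unfolded IdT_def]
  have cp: "cd (pairmap S s t) = cx (idty S)" using p(3) I by simp
  have "renv (fext (pairmap S s t) (idty S) \<odot> q) (xenv (idty S) (xenv ?W (xenv S \<rho>))) =
      scons (reix (pairmap S s t) (idty S), q) (renv (pairmap S s t) (xenv ?W (xenv S \<rho>)))"
    by (rule renv_xenv_pair) (use wW I p(1) cp Q in simp_all)
  then have e1: "renv (idmap S s t q) (xenv (idty S) (xenv ?W (xenv S \<rho>))) =
      scons (IdT S s t, q) (renv (pairmap S s t) (xenv ?W (xenv S \<rho>)))"
    unfolding idmap_def IdT_def .
  have "renv (fext s ?W \<odot> t) (xenv ?W (xenv S \<rho>)) = scons (reix s ?W, t) (renv s (xenv S \<rho>))"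
    by (rule renv_xenv_pair) (use w W s S(4) in simp_all)
  then have e2: "renv (pairmap S s t) (xenv ?W (xenv S \<rho>)) = scons (S, t) (scons (S, s) \<rho>)"
    unfolding pairmap_def W(3) using renv_xenv_section[of S \<rho> s] assms(1) S by simp
  have i: "issub X \<rho> (insts [p, b, a]) (renv (idmap S s t q) (xenv (idty S) (xenv ?W (xenv S \<rho>))))"
    unfolding e1 e2 by (rule issub_insts_Cons[OF issub_insts_Cons[OF issub_inst1[OF assms(1,2)] assms(3)] assms(4)])
  show ?thesis
    by (rule interp_inst(1)[OF i wI _ _ _ assms(5)]) (use idmap_simps[OF S(1,3,4) q] S(2) in simp_all)
qed

lemma xenv_shift: "xenv S \<rho> \<circ> (\<lambda>i. i + 1) = renv (disp S) \<rho>"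
  by (auto simp: fun_eq_iff comp_apply xenv_def)

lemma interp_wk0:
  assumes "wfenv Y \<rho>'" "\<rho>' \<circ> (\<lambda>i. i + n) = renv h \<rho>" "wfenv X \<rho>" "arr h" "dm h = Y" "cd h = X"
  shows "ity X \<rho> B T \<Longrightarrow> ity Y \<rho>' (wk_ty n 0 B) (reix h T)"
    "itm X \<rho> b T t \<Longrightarrow> itm Y \<rho>' (wk_tm n 0 b) (reix h T) (resec h T t)"
proof -
  have "tel M X []" using assms(3) wfenv_ob by simp
  from interp_wk[OF assms this] show "ity X \<rho> B T \<Longrightarrow> ity Y \<rho>' (wk_ty n 0 B) (reix h T)"
    "itm X \<rho> b T t \<Longrightarrow> itm Y \<rho>' (wk_tm n 0 b) (reix h T) (resec h T t)" by simp_all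
qed

lemma wk_self:
  assumes "wfenv X \<rho>" "ity X \<rho> A S"
  shows "ity (ext S) (xenv S \<rho>) (wk_ty 1 0 A) (wkself S)"
proof -
  have S: "isty S" "cx S = X" using interp_wf(1)[OF assms(2,1)] by simp_all
  have "wfenv (ext S) (xenv S \<rho>)" using wfenv_xenv assms(1) S by simp
  from interp_wk0(1)[OF this xenv_shift assms(1) _ _ _ assms(2)] show ?thesis using S by simp
qed

lemma interp_wk1:
  assumes "wfenv Y \<rho>'" "\<rho>' \<circ> (\<lambda>i. i + n) = renv h \<rho>" "wfenv X \<rho>" "arr h" "dm h = Y" "cd h = X"
    "isty S" "cx S = X"
  shows "ity (ext S) (xenv S \<rho>) B T \<Longrightarrow>
      ity (ext (reix h S)) (xenv (reix h S) \<rho>') (wk_ty n 1 B) (reix (fext h S) T)"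
    "itm (ext S) (xenv S \<rho>) b T t \<Longrightarrow> itm (ext (reix h S)) (xenv (reix h S) \<rho>') (wk_tm n 1 b)
      (reix (fext h S) T) (resec (fext h S) T t)"
proof -
  have "tel M X [S]" using assms(3,7,8) wfenv_ob by simp
  from interp_wk[OF assms(1-6) this]
  show "ity (ext S) (xenv S \<rho>) B T \<Longrightarrow>
      ity (ext (reix h S)) (xenv (reix h S) \<rho>') (wk_ty n 1 B) (reix (fext h S) T)"
    "itm (ext S) (xenv S \<rho>) b T t \<Longrightarrow> itm (ext (reix h S)) (xenv (reix h S) \<rho>') (wk_tm n 1 b)
      (reix (fext h S) T) (resec (fext h S) T t)" by simp_all
qed

lemma xenv2_shift:
  assumes "wfenv X \<rho>" "isty S" "cx S = X" "isty T" "cx T = ext S"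
  shows "xenv T (xenv S \<rho>) \<circ> (\<lambda>i. i + 2) = renv (disp S \<odot> disp T) \<rho>"
proof -
  have "xenv T (xenv S \<rho>) \<circ> (\<lambda>i. i + 2) = renv (disp T) (renv (disp S) \<rho>)"
    by (auto simp: fun_eq_iff comp_apply xenv_def renv_def)
  also have "\<dots> = renv (disp S \<odot> disp T) \<rho>" by (rule renv_cmp) (use assms in simp_all)
  finally show ?thesis .
qed

section \<open>Denotations of generic terms and branch types\<close>

lemma pair_generic:
  assumes "wfenv X \<rho>" "ity X \<rho> A S" "ity (ext S) (xenv S \<rho>) B T"
  defines "h \<equiv> disp S \<odot> disp T"
  shows "itm (ext T) (xenv T (xenv S \<rho>)) (Pair (wk_ty 2 0 A) (wk_ty 2 1 B) (Var 1) (Var 0))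
    (reix h (sigty S T)) (sec h (sigty S T) (sigin S T))"
proof -
  have S: "isty S" "cx S = X" using interp_wf(1)[OF assms(2,1)] by simp_all
  have w: "wfenv (ext S) (xenv S \<rho>)" using wfenv_xenv assms(1) S by simp
  have T: "isty T" "cx T = ext S" using interp_wf(1)[OF assms(3) w] by simp_all
  have wT: "wfenv (ext T) (xenv T (xenv S \<rho>))" using wfenv_xenv[of T] T w by simp
  have h: "arr h" "dm h = ext T" "cd h = X" "cd h = cx S" using S T by (simp_all add: h_def)
  note k = wT xenv2_shift[OF assms(1) S T, folded h_def] assms(1) h(1-3)
  note P = sigty_reix(1)[OF S(1) T h(1,4)] and v = pairsec_var[OF S(1) T, folded h_def]
  have t: "reix (disp T) (reix (disp S) S) = reix h S" using S T by (simp add: h_def)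
  have 1: "itm (ext T) (xenv T (xenv S \<rho>)) (Var 1) (reix h S) (resec (disp T) (reix (disp S) S) (diag S))"
    by (rule i_Var) (use t in \<open>simp_all add: xenv_def renv_def\<close>)
  have 0: "itm (ext T) (xenv T (xenv S \<rho>)) (Var 0) (reix (disp T) T) (diag T)"
    by (rule i_Var) (simp_all add: xenv_def)
  show ?thesis
    unfolding v(2)[symmetric] P
    by (rule i_Pair[OF interp_wk0(1)[OF k assms(2)] interp_wk1(1)[OF k S assms(3)] 1]) (unfold v(1), rule 0)
qed

text \<open>\<open>C\<close> at the generic pair is \<open>U\<close> reindexed along the map which
  that pair names, namely \<open>sigin S T\<close>. This is the type that the semantic eliminator
  expects of its branch.\<close>

lemma interp_split_branch:
  assumes "wfenv X \<rho>" "ity X \<rho> A S" "ity (ext S) (xenv S \<rho>) B T"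
    "ity (ext (sigty S T)) (xenv (sigty S T) \<rho>) C U"
  shows "ity (ext T) (xenv T (xenv S \<rho>)) (split_branch A B C) (reix (sigin S T) U)"
proof -
  define h where "h = disp S \<odot> disp T"
  let ?P = "sigty S T" and ?s = "sec h (sigty S T) (sigin S T)"
  have S: "isty S" "cx S = X" using interp_wf(1)[OF assms(2,1)] by simp_all
  have w: "wfenv (ext S) (xenv S \<rho>)" using wfenv_xenv assms(1) S by simp
  have T: "isty T" "cx T = ext S" using interp_wf(1)[OF assms(3) w] by simp_all
  have wT: "wfenv (ext T) (xenv T (xenv S \<rho>))" using wfenv_xenv[of T] T w by simp
  have P: "isty ?P" "cx ?P = X" using S T by simp_all
  have U: "isty U" "cx U = ext ?P" using interp_wf(1)[OF assms(4)] wfenv_xenv[of ?P \<rho>] P assms(1) by simp_all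
  have h: "arr h" "dm h = ext T" "cd h = X" using S T by (simp_all add: h_def)
  note k = wT xenv2_shift[OF assms(1) S T, folded h_def] assms(1) h(1-3)
  note p = pair_generic[OF assms(1-3), folded h_def]
  have s: "gsection (reix h ?P) ?s" using interp_wf(2)[OF p wT] by simp
  have "reix ?s (reix (fext h ?P) U) = reix (fext h ?P \<odot> ?s) U"
    by (rule reix_cmp(1)) (use gsectionD[OF s] h P U in simp_all)
  then have e: "reix ?s (reix (fext h ?P) U) = reix (sigin S T) U"
    unfolding pairsec_var(3)[OF S(1) T, folded h_def] .
  show ?thesis
    unfolding split_branch_def
    using interp_inst1(1)[OF wT p interp_wk1(1)[OF k P assms(4)]] unfolding e .
qed

lemma refl_generic:
  assumes "wfenv X \<rho>" "ity X \<rho> A S"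
  shows "itm (ext S) (xenv S \<rho>) (Refl (wk_ty 1 0 A) (Var 0))
    (IdT (wkself S) (diag S) (diag S)) (reflsec (wkself S) (diag S))"
  by (rule i_Refl[OF wk_self[OF assms]]) (rule i_Var, simp_all add: xenv_def)

lemma interp_wk3:
  assumes "wfenv Y \<rho>'" "\<rho>' \<circ> (\<lambda>i. i + n) = renv h \<rho>" "wfenv X \<rho>" "arr h" "dm h = Y" "cd h = X"
    "isty S" "cx S = X" "ity (ext (idty S)) (xenv (idty S) (xenv (wkself S) (xenv S \<rho>))) C U"
  shows "ity (ext (idty (reix h S)))
      (xenv (idty (reix h S)) (xenv (wkself (reix h S)) (xenv (reix h S) \<rho>'))) (wk_ty n 3 C)
      (reix (idext h S) U)"
proof -
  let ?W = "reix (disp S) S"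
  have t: "tel M X [idty S, ?W, S]" using assms(3,7,8) wfenv_ob by simp
  have W: "reix (fext h S) ?W = reix (disp (reix h S)) (reix h S)" using assms(4-8) by simp
  have "cd h = cx S" using assms(6,8) by simp
  note I = idty_reix(1)[OF assms(7,4) this]
  from interp_wk(1)[OF assms(1-6) t, of C U 3] assms(9) show ?thesis
    by (simp add: I W idext_def)
qed

text \<open>Instantiating \<open>C\<close> at \<open>x, x, r(x)\<close> reindexes along the map
  naming reflexivity of the generic element, which \<open>refl_var\<close> identifies with
  \<open>reflmap S\<close>.\<close>

lemma interp_J_branch:
  assumes "wfenv X \<rho>" "ity X \<rho> A S"
    "ity (ext (idty S)) (xenv (idty S) (xenv (wkself S) (xenv S \<rho>))) C U"
  shows "ity (ext S) (xenv S \<rho>) (J_branch A C) (reix (reflmap S) U)"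
proof -
  let ?d = "disp S" and ?W = "wkself S" and ?\<delta> = "diag S"
  have S: "isty S" "cx S = X" using interp_wf(1)[OF assms(2,1)] by simp_all
  have w: "wfenv (ext S) (xenv S \<rho>)" using wfenv_xenv assms(1) S by simp
  have W: "isty ?W" "cx ?W = ext S" using S by simp_all
  have wW: "wfenv (ext ?W) (xenv ?W (xenv S \<rho>))" by (rule wfenv_xenv) (simp_all only: W w)
  have I: "isty (idty S)" "cx (idty S) = ext ?W" using S(1) by simp_all
  have wI: "wfenv (ext (idty S)) (xenv (idty S) (xenv ?W (xenv S \<rho>)))"
    using wfenv_xenv[of "idty S"] wW I by simp
  have U: "isty U" "cx U = ext (idty S)" using interp_wf(1)[OF assms(3) wI] by simp_all
  have d: "arr ?d" "dm ?d = ext S" "cd ?d = X" "cd ?d = cx S" using S by simp_all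
  have \<delta>: "gsection ?W ?\<delta>" using S by simp
  have 3: "ity (ext (idty ?W)) (xenv (idty ?W) (xenv (wkself ?W) (xenv ?W (xenv S \<rho>))))
     (wk_ty 1 3 C) (reix (idext ?d S) U)"
    using interp_wk3[OF w xenv_shift assms(1) d(1-3) S assms(3), folded wkself_def] .
  have 0: "itm (ext S) (xenv S \<rho>) (Var 0) ?W ?\<delta>" by (rule i_Var) (simp_all add: xenv_def)
  note r = reflsec_facts(1)[OF W(1) \<delta>] and R = refl_var[OF S(1), folded wkself_def]
  have "reix (idmap ?W ?\<delta> ?\<delta> (reflsec ?W ?\<delta>)) (reix (idext ?d S) U) =
      reix (idext ?d S \<odot> idmap ?W ?\<delta> ?\<delta> (reflsec ?W ?\<delta>)) U"
    by (rule reix_cmp(1))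
      (use idmap_simps[OF W(1) \<delta> \<delta> r] idext_simps[OF S(1) d(1,4), folded wkself_def] U in \<open>simp_all only: wkself_def\<close>)
  then have e: "reix (idmap ?W ?\<delta> ?\<delta> (reflsec ?W ?\<delta>)) (reix (idext ?d S) U) = reix (reflmap S) U"
    unfolding R(2) .
  show ?thesis
    unfolding J_branch_def
    using interp_inst3[OF w 0 0 refl_generic[OF assms(1,2)] 3] unfolding e .
qed

text \<open>The identity type of the two generic variables is the object \<open>idty S\<close>
  itself, so that the context \<open>Id_tel A\<close> lives over the path object.\<close>

lemma interp_Id_generic:
  assumes "wfenv X \<rho>" "ity X \<rho> A S"
  shows "ity (ext (wkself S)) (xenv (wkself S) (xenv S \<rho>)) (Id (wk_ty 2 0 A) (Var 1) (Var 0)) (idty S)"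
proof -
  define h where "h = disp S \<odot> disp (reix (disp S) S)"
  let ?W = "reix (disp S) S"
  have S: "isty S" "cx S = X" using interp_wf(1)[OF assms(2,1)] by simp_all
  have w: "wfenv (ext S) (xenv S \<rho>)" using wfenv_xenv assms(1) S by simp
  have W: "isty ?W" "cx ?W = ext S" using S by simp_all
  have wW: "wfenv (ext ?W) (xenv ?W (xenv S \<rho>))" using wfenv_xenv[of ?W] w W by simp
  have h: "arr h" "dm h = ext ?W" "cd h = X" using S by (simp_all add: h_def)
  note k = wW xenv2_shift[OF assms(1) S W, folded h_def] assms(1) h
  note v = id_var[OF S(1), folded h_def]
  have 1: "itm (ext ?W) (xenv ?W (xenv S \<rho>)) (Var 1) (reix h S) (resec (disp ?W) ?W (diag S))"
    by (rule i_Var) (use v(3) in \<open>simp_all add: xenv_def renv_def\<close>)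
  have 0: "itm (ext ?W) (xenv ?W (xenv S \<rho>)) (Var 0) (reix h S) (diag ?W)"
    by (rule i_Var) (use v(3) in \<open>simp_all add: xenv_def\<close>)
  show ?thesis
    using i_Id[OF interp_wk0(1)[OF k assms(2)] 1 0] unfolding v(6) wkself_def .
qed

lemma valid_Id_tel:
  assumes "valid G X \<rho>" "ity X \<rho> A S"
  shows "valid (Id_tel A @ G) (ext (idty S)) (xenv (idty S) (xenv (wkself S) (xenv S \<rho>)))"
proof -
  note w = valid_wf[OF assms(1)]
  show ?thesis
    unfolding Id_tel_def append.simps
    by (rule valid_xenv[OF valid_xenv[OF valid_xenv[OF assms] wk_self[OF w assms(2)]] interp_Id_generic[OF w assms(2)]])
qed

text \<open>Applications in the rules and axioms carry weakened annotations; a general shift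
  \<open>n\<close> and map \<open>h\<close> cover those in \<open>appvar\<close>, in
  \<open>idapp\<close> and in the axiom for application.\<close>

lemma app_wk:
  assumes "wfenv Y \<rho>'" "\<rho>' \<circ> (\<lambda>i. i + n) = renv h \<rho>" "wfenv X \<rho>" "arr h" "dm h = Y" "cd h = X"
    "ity X \<rho> A S" "ity (ext S) (xenv S \<rho>) B T"
    "itm Y \<rho>' m (reix h (pity S T)) s" "itm Y \<rho>' a (reix h S) t"
  shows "itm Y \<rho>' (App (wk_ty n 0 A) (wk_ty n 1 B) m a) (reix (fext h S \<odot> t) T)
    (Asec (reix h S) (reix (fext h S) T) s t)"
proof -
  have S: "isty S" "cx S = X" using interp_wf(1)[OF assms(7,3)] by simp_all
  have w: "wfenv (ext S) (xenv S \<rho>)" using wfenv_xenv assms(3) S by simp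
  have T: "isty T" "cx T = ext S" using interp_wf(1)[OF assms(8) w] by simp_all
  have hS: "cd h = cx S" using assms(6) S by simp
  have t: "gsection (reix h S) t" using interp_wf(2)[OF assms(10,1)] by simp
  have "reix t (reix (fext h S) T) = reix (fext h S \<odot> t) T"
    by (rule reix_cmp(1)) (use gsectionD[OF t] S T hS assms(4) in simp_all)
  then show ?thesis
    using i_App[OF interp_wk0(1)[OF assms(1-6,7)] interp_wk1(1)[OF assms(1-6) S assms(8)]
        assms(9)[unfolded pity_reix(1)[OF S(1) T assms(4) hS]] assms(10)]
    by simp
qed

text \<open>Weakening \<open>m\<close> and applying it to the generic element undoes itself: the
  diagonal followed by \<open>fext (disp S) S\<close> is an identity, and \<open>appsec\<close> is
  left.\<close>

lemma interp_appvar: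
  assumes "wfenv X \<rho>" "ity X \<rho> A S" "ity (ext S) (xenv S \<rho>) B T" "itm X \<rho> m (pity S T) s"
  shows "itm (ext S) (xenv S \<rho>) (appvar A B m) T (appsec S T s)"
proof -
  have S: "isty S" "cx S = X" using interp_wf(1)[OF assms(2,1)] by simp_all
  have w: "wfenv (ext S) (xenv S \<rho>)" using wfenv_xenv assms(1) S by simp
  have T: "isty T" "cx T = ext S" using interp_wf(1)[OF assms(3) w] by simp_all
  have s: "gsection (pity S T) s" using interp_wf(2)[OF assms(4,1)] by simp
  have d: "arr (disp S)" "dm (disp S) = ext S" "cd (disp S) = X" "cd (disp S) = cx S" using S by simp_all
  let ?F = "fext (disp S) S"
  have F: "arr ?F" "cd ?F = ext S" "dm ?F = ext (reix (disp S) S)" using S by simp_all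
  note \<delta> = diag_simps[OF S(1)]
  note k = w xenv_shift assms(1) d(1-3)
  have 0: "itm (ext S) (xenv S \<rho>) (Var 0) (reix (disp S) S) (diag S)"
    by (rule i_Var) (simp_all add: xenv_def)
  have a: "Asec (reix (disp S) S) (reix ?F T) (resec (disp S) (pity S T) s) (diag S) = appsec S T s"
    unfolding Asec_def appsec_reix[OF S(1) T s d(1,4), symmetric]
    using resec_cmp[of "diag S" ?F T "appsec S T s"] \<delta> F T appsec_section[OF S(1) T s] by simp
  have t: "reix (?F \<odot> diag S) T = T" unfolding \<delta>(6) using T by simp
  show ?thesis
    unfolding appvar_def
    using app_wk[OF k assms(2,3) interp_wk0(2)[OF k assms(4)] 0] unfolding a t .
qed

text \<open>The raw \<open>J\<close>-term has to be matched with the semantic data of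
  \<open>Extsec_comp\<close>. The motive is the identity type between the two reindexings of the
  denotation \<open>g\<close> of \<open>x \<cdot> a\<close> along the projections of the path
  object.\<close>

lemma interp_idapp:
  assumes "wfenv X \<rho>" "ity X \<rho> A S" "ity (ext S) (xenv S \<rho>) B T"
    "itm X \<rho> m (pity S T) s" "itm X \<rho> n (pity S T) t" "itm X \<rho> a S u"
    "itm X \<rho> q (IdT (pity S T) s t) (Extsec S T s t e)"
    "gsection (IdT T (appsec S T s) (appsec S T t)) e"
  shows "itm X \<rho> (idapp A B m n q a) (reix u (IdT T (appsec S T s) (appsec S T t)))
      (resec u (IdT T (appsec S T s) (appsec S T t)) e)"
    "reix u (IdT T (appsec S T s) (appsec S T t)) = IdT (reix u T) (Asec S T s u) (Asec S T t u)"
proof -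
  have S: "isty S" "cx S = X" using interp_wf(1)[OF assms(2,1)] by simp_all
  have w: "wfenv (ext S) (xenv S \<rho>)" using wfenv_xenv assms(1) S by simp
  have T: "isty T" "cx T = ext S" using interp_wf(1)[OF assms(3) w] by simp_all
  have s: "gsection (pity S T) s" "gsection (pity S T) t" and u: "gsection S u"
    using interp_wf(2)[OF assms(4,1)] interp_wf(2)[OF assms(5,1)] interp_wf(2)[OF assms(6,1)] by simp_all
  note U = gsectionD[OF u]
  define P D where "P = pity S T" and "D = reix u T"
  define g where "g = Asec (reix (disp P) S) (reix (fext (disp P) S) T) (diag P) (resec (disp P) S u)"
  note X = Extsec_comp[OF S(1) T s assms(8) u, folded P_def D_def, folded g_def]
  show ii: "reix u (IdT T (appsec S T s) (appsec S T t)) = IdT (reix u T) (Asec S T s u) (Asec S T t u)"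
    using X(2) unfolding D_def .
  note G = Asec_generic[OF S(1) T u, folded P_def D_def, folded g_def]
  have P: "isty P" "cx P = X" using S T by (simp_all add: P_def)
  have D: "isty D" "cx D = X" using S T U by (simp_all add: D_def)
  let ?d = "disp P" and ?W = "wkself P"
  have d: "arr ?d" "dm ?d = ext P" "cd ?d = X" "cd ?d = cx S" using P S by simp_all
  have wP: "wfenv (ext P) (xenv P \<rho>)" using wfenv_xenv assms(1) P by simp
  have W: "isty ?W" "cx ?W = ext P" using P by simp_all
  have wW: "wfenv (ext ?W) (xenv ?W (xenv P \<rho>))" by (rule wfenv_xenv) (simp_all only: W wP)
  have I: "isty (idty P)" "cx (idty P) = ext ?W" using P(1) by simp_all
  let ?\<rho> = "xenv (idty P) (xenv ?W (xenv P \<rho>))" and ?Y = "ext (idty P)"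
  have wI: "wfenv ?Y ?\<rho>" using wfenv_xenv[of "idty P"] wW I by simp
  note k = wP xenv_shift assms(1) d(1-3)
  let ?ap = "App (wk_ty 1 0 A) (wk_ty 1 1 B) (Var 0) (wk_tm 1 0 a)"
  have 0: "itm (ext P) (xenv P \<rho>) (Var 0) (reix ?d P) (diag P)"
    by (rule i_Var) (simp_all add: xenv_def)
  have "fext ?d S \<odot> resec ?d S u = u \<odot> ?d" by (rule resec_facts(2)[OF d(1) S(1) d(4) u])
  moreover have "reix (u \<odot> ?d) T = reix ?d D" unfolding D_def
    by (rule reix_cmp(1)[symmetric]) (use U d S T in simp_all)
  ultimately have ap: "itm (ext P) (xenv P \<rho>) ?ap (reix ?d D) g"
    using app_wk[OF k assms(2,3) _ interp_wk0(2)[OF k assms(6)], folded P_def, OF 0] unfolding g_def by simp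
  have Da: "ity X \<rho> (sub_ty (insts [a]) B) D" unfolding D_def by (rule interp_inst1(1)[OF assms(1,6,3)])
  note Dw = interp_wk0(1)[OF k Da]
  let ?i = "idsrc P" and ?j = "idtgt P"
  have i: "arr ?i" "dm ?i = ?Y" "cd ?i = ext P" "arr ?j" "dm ?j = ?Y" "cd ?j = ext P" using P(1) by simp_all
  have ds: "dm (disp (idty P)) = ?Y" "cd (disp (idty P)) = ext ?W" "arr (disp (idty P))"
    "dm (disp ?W) = ext ?W" "cd (disp ?W) = ext P" "arr (disp ?W)" using I W P by simp_all
  \<comment> \<open>The source projection of the path object keeps the first of its three variables,
    so it acts as the shift by two, sending index 0 to 2. The target projection keeps the second:
    \<open>Suc \<circ> upr Suc\<close> sends 0 to 1 and every later index up by two.\<close>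
  have r1: "renv ?i (xenv P \<rho>) = ?\<rho> \<circ> (\<lambda>x. x + 2)"
    unfolding idsrc_def
    by (rule xenv2_shift[symmetric, OF wP W I])
  have "renv ?j (xenv P \<rho>) = renv (disp (idty P)) (renv (fext ?d P) (xenv P \<rho>))"
    unfolding idtgt_def by (rule renv_cmp[symmetric, OF wP]) (use P ds in simp_all)
  also have "renv (fext ?d P) (xenv P \<rho>) = xenv ?W (renv ?d \<rho>)"
    unfolding wkself_def by (rule renv_xenv_fext) (use P assms(1) in simp_all)
  also have "\<dots> = xenv ?W (xenv P \<rho>) \<circ> upr Suc"
    unfolding xenv_upr[symmetric] by (simp add: xenv_def)
  finally have r2: "renv ?j (xenv P \<rho>) = ?\<rho> \<circ> (Suc \<circ> upr Suc)"
    by (simp add: xenv_def[of "idty P"] renv_def[of "disp (idty P)"] fun_eq_iff comp_apply)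
  have e1: "(\<lambda>x. x + 2) \<circ> (\<lambda>i. i + 1) = (\<lambda>i. i + (3::nat))" "(Suc \<circ> upr Suc) \<circ> (\<lambda>i. i + 1) = (\<lambda>i. i + (3::nat))"
    by (auto simp: fun_eq_iff comp_apply)
  have wk: "ren_ty (\<lambda>x. x + 2) (wk_ty 1 0 Q) = wk_ty 3 0 Q" "ren_tm (\<lambda>x. x + 2) (wk_tm 1 0 y) = wk_tm 3 0 y"
    "ren_ty (Suc \<circ> upr Suc) (wk_ty 1 0 Q) = wk_ty 3 0 Q" "ren_tm (Suc \<circ> upr Suc) (wk_tm 1 0 y) = wk_tm 3 0 y"
    "ren_ty (upr (\<lambda>x. x + 2)) (wk_ty 1 1 Q) = wk_ty 3 1 Q" "ren_ty (upr (Suc \<circ> upr Suc)) (wk_ty 1 1 Q) = wk_ty 3 1 Q"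
    for Q :: "('a, 'm) ty" and y :: "('a, 'm) tm"
    using e1 by (simp_all add: wk_ty_def wk_tm_def ren_ren upr_comp)
  have t1: "ren_tm (\<lambda>x. x + 2) ?ap = App (wk_ty 3 0 A) (wk_ty 3 1 B) (Var 2) (wk_tm 3 0 a)"
    using wk(1,2,5) by simp
  have t2: "ren_tm (Suc \<circ> upr Suc) ?ap = App (wk_ty 3 0 A) (wk_ty 3 1 B) (Var 1) (wk_tm 3 0 a)"
    using wk(3,4,6) by (simp add: comp_apply)
  have td: "?d \<odot> ?j = ?d \<odot> ?i" by (rule idtgt_simps(4)[OF P(1)])
  have ti: "reix ?i (reix ?d D) = reix (?d \<odot> ?i) D" by (rule reix_cmp(1)) (use i d D in simp_all)
  have "reix ?j (reix ?d D) = reix (?d \<odot> ?j) D" by (rule reix_cmp(1)) (use i d D in simp_all)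
  then have tj: "reix ?j (reix ?d D) = reix (?d \<odot> ?i) D" unfolding td .
  have 1: "itm ?Y ?\<rho> (App (wk_ty 3 0 A) (wk_ty 3 1 B) (Var 2) (wk_tm 3 0 a)) (reix (?d \<odot> ?i) D) (resec ?i (reix ?d D) g)"
    unfolding t1[symmetric] ti[symmetric]
    by (rule interp_ren(2)[OF interp_reix(2)[OF ap wP, rule_format, OF i(1,3), unfolded i(2)] r1])
  have 2: "itm ?Y ?\<rho> (App (wk_ty 3 0 A) (wk_ty 3 1 B) (Var 1) (wk_tm 3 0 a)) (reix (?d \<odot> ?i) D) (resec ?j (reix ?d D) g)"
    unfolding t2[symmetric] tj[symmetric]
    by (rule interp_ren(2)[OF interp_reix(2)[OF ap wP, rule_format, OF i(4,6), unfolded i(5)] r2])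
  have 3: "ity ?Y ?\<rho> (wk_ty 3 0 (sub_ty (insts [a]) B)) (reix (?d \<odot> ?i) D)"
    unfolding wk(1)[symmetric] ti[symmetric]
    by (rule interp_ren(1)[OF interp_reix(1)[OF Dw wP, rule_format, OF i(1,3), unfolded i(2)] r1])
  define C where "C = IdT (reix (?d \<odot> ?i) D) (resec ?i (reix ?d D) g) (resec ?j (reix ?d D) g)"
  note C = i_Id[OF 3 1 2, folded C_def]
  have r: "itm (ext P) (xenv P \<rho>) (Refl (wk_ty 1 0 (sub_ty (insts [a]) B)) ?ap) (IdT (reix ?d D) g g) (reflsec (reix ?d D) g)"
    by (rule i_Refl[OF Dw ap])
  let ?r = "reflmap P"
  have DD: "isty (reix ?d D)" "cx (reix ?d D) = ext P" using D d by simp_all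
  have gi: "gsection (reix (?d \<odot> ?i) D) (resec ?i (reix ?d D) g)" "gsection (reix (?d \<odot> ?i) D) (resec ?j (reix ?d D) g)"
    using interp_wf(2)[OF 1 wI] interp_wf(2)[OF 2 wI] by simp_all
  have Di: "isty (reix (?d \<odot> ?i) D)" "cx (reix (?d \<odot> ?i) D) = ?Y" using D d i by simp_all
  have rr: "arr ?r" "dm ?r = ext P" "cd ?r = ?Y" "?i \<odot> ?r = ide (ext P)" "?j \<odot> ?r = ide (ext P)"
    using P(1) by simp_all
  have "reix ?r C = IdT (reix ?r (reix (?d \<odot> ?i) D)) (resec ?r (reix (?d \<odot> ?i) D) (resec ?i (reix ?d D) g))
      (resec ?r (reix (?d \<odot> ?i) D) (resec ?j (reix ?d D) g))"
    unfolding C_def by (rule IdT_reix) (use Di gi rr in simp_all)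
  also have "resec ?r (reix (?d \<odot> ?i) D) (resec ?i (reix ?d D) g) = resec (?i \<odot> ?r) (reix ?d D) g"
    unfolding ti[symmetric] by (rule resec_cmp) (use rr i DD G(1) in simp_all)
  also have "resec ?r (reix (?d \<odot> ?i) D) (resec ?j (reix ?d D) g) = resec (?j \<odot> ?r) (reix ?d D) g"
    unfolding tj[symmetric] by (rule resec_cmp) (use rr i DD G(1) in simp_all)
  also have "reix ?r (reix (?d \<odot> ?i) D) = reix (?i \<odot> ?r) (reix ?d D)"
    unfolding ti[symmetric] by (rule reix_cmp(1)) (use rr i DD in simp_all)
  finally have Cr: "reix ?r C = IdT (reix ?d D) g g"
    unfolding rr(4,5) using DD G(1) by simp
  have q: "gsection (IdT P s t) (Extsec S T s t e)" using interp_wf(2)[OF assms(7,1)] unfolding P_def by simp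
  note J = Jsec_whisker[OF P(1) D(1) D(2)[folded P(2)] G(1) s[folded P_def] q, folded C_def]
  \<comment> \<open>The type of the \<open>J\<close>-term and the type of \<open>p(a)\<close> are
    both the identity type of \<open>m \<cdot> a\<close> and \<open>n \<cdot> a\<close>.\<close>
  have Ct: "reix (idmap P s t (Extsec S T s t e)) C = reix u (IdT T (appsec S T s) (appsec S T t))"
    unfolding J(6) ii trans[OF J(4)[symmetric] G(2)[OF s(1)[folded P_def]]]
      trans[OF J(5)[symmetric] G(2)[OF s(2)[folded P_def]]]
    unfolding D_def ..
  have "itm X \<rho> (idapp A B m n q a) (reix (idmap P s t (Extsec S T s t e)) C)
      (Jsec P C (reflsec (reix ?d D) g) s t (Extsec S T s t e))"
    unfolding idapp_def Let_def
    by (rule i_J[OF i_Pi[OF assms(2,3), folded P_def] C r[folded Cr] assms(4,5,7)[folded P_def]])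
  then show "itm X \<rho> (idapp A B m n q a) (reix u (IdT T (appsec S T s) (appsec S T t)))
      (resec u (IdT T (appsec S T s) (appsec S T t)) e)"
    unfolding Ct unfolding C_def X(1) .
qed

section \<open>Soundness of the rules\<close>

text \<open>Formation, introduction and elimination rules thereby become reflexive instances of the
  congruence rules, which are the only ones proved directly.\<close>

lemma sound_IsTy: "sound G (IsTy A) \<longleftrightarrow> sound G (EqTy A A)"
  and sound_HasTy: "sound G (HasTy a A) \<longleftrightarrow> sound G (EqTm a a A)"
  by (auto simp: sound_def)

lemma sound_eqty:
  assumes "sound G (EqTy A A')" "valid G X \<rho>"
  obtains S where "ity X \<rho> A S" "ity X \<rho> A' S"
  using sound_holds[OF assms] by auto

lemma sound_eqtm:
  assumes "sound G (EqTm a a' A)" "valid G X \<rho>"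
  obtains S s where "ity X \<rho> A S" "itm X \<rho> a S s" "itm X \<rho> a' S s"
  using sound_holds[OF assms] by auto

lemma sound_eqtm_at:
  assumes "sound G (EqTm a a' A)" "valid G X \<rho>" "ity X \<rho> A S"
  obtains s where "itm X \<rho> a S s" "itm X \<rho> a' S s"
  using sound_eqtm[OF assms(1,2)] interp_functional(1)[OF assms(3)] by metis

lemma soundI:
  assumes "semctx G" "\<And>X \<rho>. wfenv X \<rho> \<Longrightarrow> valid G X \<rho> \<Longrightarrow> holds X \<rho> \<J>"
  shows "sound G \<J>"
  using assms valid_wf unfolding sound_def by blast

text \<open>Recovers the premise that \<open>A\<close> is a type, which rules with a premise in a
  context containing \<open>A\<close> leave implicit.\<close>

lemma sound_tail: "sound (D @ A # G) \<J> \<Longrightarrow> sound G (EqTy A A)"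
  using semctx_Cons[of D "A # G"] sound_semctx[of "D @ A # G" \<J>] unfolding sound_def by auto

lemmas sound_tail1 = sound_tail[where D = "[]", simplified] and sound_tail2 = sound_tail[where D = "[B]" for B, simplified]

lemma sound_var:
  assumes "semctx (A # G)"
  shows "sound (A # G) (HasTy (Var 0) (wk_ty 1 0 A))"
proof (rule soundI[OF assms])
  fix X \<rho> assume "valid (A # G) X \<rho>"
  then have "ity X (\<rho> \<circ> Suc) A (fst (\<rho> 0))" by simp
  from interp_ren(1)[OF this refl] have "ity X \<rho> (wk_ty 1 0 A) (fst (\<rho> 0))" unfolding wk1 .
  then show "holds X \<rho> (HasTy (Var 0) (wk_ty 1 0 A))" using i_Var[OF refl refl] unfolding holds.simps by blast
qed

lemma sound_ty_sym: "sound G (EqTy A B) \<Longrightarrow> sound G (EqTy B A)"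
  and sound_tm_sym: "sound G (EqTm a b A) \<Longrightarrow> sound G (EqTm b a A)"
  unfolding sound_def holds.simps by blast+

lemma sound_ty_trans:
  assumes "sound G (EqTy A B)" "sound G (EqTy B C)"
  shows "sound G (EqTy A C)"
proof (rule soundI[OF sound_semctx[OF assms(1)]])
  fix X \<rho> assume v: "valid G X \<rho>"
  obtain S where S: "ity X \<rho> A S" "ity X \<rho> B S" using sound_eqty[OF assms(1) v] .
  obtain T where T: "ity X \<rho> B T" "ity X \<rho> C T" using sound_eqty[OF assms(2) v] .
  show "holds X \<rho> (EqTy A C)" using S T interp_functional(1)[OF S(2) T(1)] by auto
qed

lemma sound_tm_trans:
  assumes "sound G (EqTm a b A)" "sound G (EqTm b c A)"
  shows "sound G (EqTm a c A)"
proof (rule soundI[OF sound_semctx[OF assms(1)]])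
  fix X \<rho> assume v: "valid G X \<rho>"
  obtain S s where S: "ity X \<rho> A S" "itm X \<rho> a S s" "itm X \<rho> b S s" using sound_eqtm[OF assms(1) v] .
  obtain t where T: "itm X \<rho> b S t" "itm X \<rho> c S t" using sound_eqtm_at[OF assms(2) v S(1)] .
  show "holds X \<rho> (EqTm a c A)" using S T interp_functional(2)[OF S(3) T(1)] by auto
qed

lemma sound_conv:
  assumes "sound G (EqTm a b A)" "sound G (EqTy A B)"
  shows "sound G (EqTm a b B)"
proof (rule soundI[OF sound_semctx[OF assms(1)]])
  fix X \<rho> assume v: "valid G X \<rho>"
  obtain S where S: "ity X \<rho> A S" "ity X \<rho> B S" using sound_eqty[OF assms(2) v] .
  obtain s where "itm X \<rho> a S s" "itm X \<rho> b S s" using sound_eqtm_at[OF assms(1) v S(1)] .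
  then show "holds X \<rho> (EqTm a b B)" using S by auto
qed

lemma sound_Sigma_cong:
  assumes "sound G (EqTy A A')" "sound (A # G) (EqTy B B')"
  shows "sound G (EqTy (Sigma A B) (Sigma A' B'))" "sound G (EqTy (Pi A B) (Pi A' B'))"
proof -
  have "\<exists>S T. ity X \<rho> A S \<and> ity X \<rho> A' S \<and> ity (ext S) (xenv S \<rho>) B T \<and> ity (ext S) (xenv S \<rho>) B' T"
    if v: "valid G X \<rho>" for X \<rho>
    using sound_eqty[OF assms(1) v] sound_eqty[OF assms(2) valid_xenv[OF v]] by metis
  then show "sound G (EqTy (Sigma A B) (Sigma A' B'))" "sound G (EqTy (Pi A B) (Pi A' B'))"
    using sound_semctx[OF assms(1)] i_Sigma i_Pi unfolding sound_def holds.simps by meson+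
qed

lemma sound_Pair_cong:
  assumes "sound G (EqTy A A')" "sound (A # G) (EqTy B B')" "sound G (EqTm a a' A)"
    "sound G (EqTm b b' (sub_ty (insts [a]) B))"
  shows "sound G (EqTm (Pair A B a b) (Pair A' B' a' b') (Sigma A B))"
proof (rule soundI[OF sound_semctx[OF assms(1)]])
  fix X \<rho> assume w: "wfenv X \<rho>" and v: "valid G X \<rho>"
  obtain S where S: "ity X \<rho> A S" "ity X \<rho> A' S" using sound_eqty[OF assms(1) v] .
  obtain T where T: "ity (ext S) (xenv S \<rho>) B T" "ity (ext S) (xenv S \<rho>) B' T"
    using sound_eqty[OF assms(2) valid_xenv[OF v S(1)]] .
  obtain s where s: "itm X \<rho> a S s" "itm X \<rho> a' S s" using sound_eqtm_at[OF assms(3) v S(1)] .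
  obtain t where t: "itm X \<rho> b (reix s T) t" "itm X \<rho> b' (reix s T) t"
    using sound_eqtm_at[OF assms(4) v interp_inst1(1)[OF w s(1) T(1)]] .
  show "holds X \<rho> (EqTm (Pair A B a b) (Pair A' B' a' b') (Sigma A B))"
    using i_Sigma[OF S(1) T(1)] i_Pair[OF S(1) T(1) s(1) t(1)] i_Pair[OF S(2) T(2) s(2) t(2)]
    unfolding holds.simps by blast
qed

lemma sound_SplitE_cong:
  assumes "sound G (EqTy A A')" "sound (A # G) (EqTy B B')" "sound (Sigma A B # G) (EqTy C C')"
    "sound (B # A # G) (EqTm d d' (split_branch A B C))" "sound G (EqTm c c' (Sigma A B))"
  shows "sound G (EqTm (SplitE A B C d c) (SplitE A' B' C' d' c') (sub_ty (insts [c]) C))"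
proof (rule soundI[OF sound_semctx[OF assms(1)]])
  fix X \<rho> assume w: "wfenv X \<rho>" and v: "valid G X \<rho>"
  obtain S where S: "ity X \<rho> A S" "ity X \<rho> A' S" using sound_eqty[OF assms(1) v] .
  note vS = valid_xenv[OF v S(1)]
  obtain T where T: "ity (ext S) (xenv S \<rho>) B T" "ity (ext S) (xenv S \<rho>) B' T"
    using sound_eqty[OF assms(2) vS] .
  note P = i_Sigma[OF S(1) T(1)]
  obtain U where U: "ity (ext (sigty S T)) (xenv (sigty S T) \<rho>) C U"
    "ity (ext (sigty S T)) (xenv (sigty S T) \<rho>) C' U"
    using sound_eqty[OF assms(3) valid_xenv[OF v P]] .
  obtain e where e: "itm (ext T) (xenv T (xenv S \<rho>)) d (reix (sigin S T) U) e"
    "itm (ext T) (xenv T (xenv S \<rho>)) d' (reix (sigin S T) U) e"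
    using sound_eqtm_at[OF assms(4) valid_xenv[OF vS T(1)] interp_split_branch[OF w S(1) T(1) U(1)]] .
  obtain t where t: "itm X \<rho> c (sigty S T) t" "itm X \<rho> c' (sigty S T) t"
    using sound_eqtm_at[OF assms(5) v P] .
  show "holds X \<rho> (EqTm (SplitE A B C d c) (SplitE A' B' C' d' c') (sub_ty (insts [c]) C))"
    using interp_inst1(1)[OF w t(1) U(1)] i_SplitE[OF S(1) T(1) U(1) e(1) t(1)] i_SplitE[OF S(2) T(2) U(2) e(2) t(2)]
    unfolding holds.simps by blast
qed

lemma sound_SplitE_comp:
  assumes "sound (Sigma A B # G) (EqTy C C)" "sound (B # A # G) (EqTm d d (split_branch A B C))"
    "sound G (EqTm a a A)" "sound G (EqTm b b (sub_ty (insts [a]) B))"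
  shows "sound G (EqTm (SplitE A B C d (Pair A B a b)) (sub_tm (insts [b, a]) d) (sub_ty (insts [Pair A B a b]) C))"
proof (rule soundI[OF sound_semctx[OF assms(3)]])
  fix X \<rho> assume w: "wfenv X \<rho>" and v: "valid G X \<rho>"
  obtain S where S: "ity X \<rho> A S" using sound_eqtm[OF assms(3) v] .
  note vS = valid_xenv[OF v S]
  obtain T where T: "ity (ext S) (xenv S \<rho>) B T" using sound_eqty[OF sound_tail1[OF assms(2)] vS] .
  note P = i_Sigma[OF S T]
  obtain U where U: "ity (ext (sigty S T)) (xenv (sigty S T) \<rho>) C U"
    using sound_eqty[OF assms(1) valid_xenv[OF v P]] .
  obtain e where e: "itm (ext T) (xenv T (xenv S \<rho>)) d (reix (sigin S T) U) e"
    using sound_eqtm_at[OF assms(2) valid_xenv[OF vS T] interp_split_branch[OF w S T U]] .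
  obtain s where s: "itm X \<rho> a S s" using sound_eqtm_at[OF assms(3) v S] .
  obtain t where t: "itm X \<rho> b (reix s T) t"
    using sound_eqtm_at[OF assms(4) v interp_inst1(1)[OF w s T]] .
  note p = i_Pair[OF S T s t]
  have S': "isty S" "cx S = X" using interp_wf(1)[OF S w] by simp_all
  have wS: "wfenv (ext S) (xenv S \<rho>)" using wfenv_xenv w S' by simp
  have T': "isty T" "cx T = ext S" using interp_wf(1)[OF T wS] by simp_all
  have wT: "wfenv (ext T) (xenv T (xenv S \<rho>))" using wfenv_xenv[of T] T' wS by simp
  have U': "isty U" "cx U = ext (sigty S T)" using interp_wf(1)[OF U] wfenv_xenv[of "sigty S T" \<rho>] S' T' w by simp_all
  have g: "gsection (reix (sigin S T) U) e" "gsection S s" "gsection (reix s T) t"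
    using interp_wf(2)[OF e wT] interp_wf(2)[OF s w] interp_wf(2)[OF t w] by simp_all
  note E = Esec_comp[OF S'(1) T' U' g]
  show "holds X \<rho> (EqTm (SplitE A B C d (Pair A B a b)) (sub_tm (insts [b, a]) d) (sub_ty (insts [Pair A B a b]) C))"
    using interp_inst1(1)[OF w p U] i_SplitE[OF S T U e p] interp_inst2(2)[OF w s T' t e]
    unfolding holds.simps E by blast
qed

lemma sound_Unit:
  assumes "semctx G"
  shows "sound G (EqTy Unit Unit)" "sound G (EqTm Star Star Unit)"
  using assms i_Unit i_Star unfolding sound_def holds.simps by blast+

lemma sound_UnitE_cong:
  assumes "sound (Unit # G) (EqTy C C')" "sound G (EqTm d d' (sub_ty (insts [Star]) C))" "sound G (EqTm c c' Unit)"
  shows "sound G (EqTm (UnitE C d c) (UnitE C' d' c') (sub_ty (insts [c]) C))"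
proof (rule soundI[OF sound_semctx[OF assms(2)]])
  fix X \<rho> assume w: "wfenv X \<rho>" and v: "valid G X \<rho>"
  let ?P = "unty X"
  obtain U where U: "ity (ext ?P) (xenv ?P \<rho>) C U" "ity (ext ?P) (xenv ?P \<rho>) C' U"
    using sound_eqty[OF assms(1) valid_xenv[OF v i_Unit]] .
  obtain e where e: "itm X \<rho> d (reix (unmap X) U) e" "itm X \<rho> d' (reix (unmap X) U) e"
    using sound_eqtm_at[OF assms(2) v interp_inst1(1)[OF w i_Star U(1)]] .
  obtain t where t: "itm X \<rho> c ?P t" "itm X \<rho> c' ?P t" using sound_eqtm_at[OF assms(3) v i_Unit] .
  show "holds X \<rho> (EqTm (UnitE C d c) (UnitE C' d' c') (sub_ty (insts [c]) C))"
    using interp_inst1(1)[OF w t(1) U(1)] i_UnitE[OF U(1) e(1) t(1)] i_UnitE[OF U(2) e(2) t(2)]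
    unfolding holds.simps by blast
qed

lemma sound_UnitE_comp:
  assumes "sound (Unit # G) (EqTy C C)" "sound G (EqTm d d (sub_ty (insts [Star]) C))"
  shows "sound G (EqTm (UnitE C d Star) d (sub_ty (insts [Star]) C))"
proof (rule soundI[OF sound_semctx[OF assms(2)]])
  fix X \<rho> assume w: "wfenv X \<rho>" and v: "valid G X \<rho>"
  let ?P = "unty X"
  obtain U where U: "ity (ext ?P) (xenv ?P \<rho>) C U"
    using sound_eqty[OF assms(1) valid_xenv[OF v i_Unit]] .
  obtain e where e: "itm X \<rho> d (reix (unmap X) U) e"
    using sound_eqtm_at[OF assms(2) v interp_inst1(1)[OF w i_Star U(1)]] .
  have X: "X \<in> Ob (base M)" using w wfenv_ob by simp
  have U': "isty U" "cx U = ext ?P" using interp_wf(1)[OF U] wfenv_xenv[of ?P \<rho>] X w by simp_all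
  have "gsection (reix (unmap X) U) e" using interp_wf(2)[OF e w] by simp
  note c = Usec_comp[OF X U' this]
  show "holds X \<rho> (EqTm (UnitE C d Star) d (sub_ty (insts [Star]) C))"
    using interp_inst1(1)[OF w i_Star U] i_UnitE[OF U e i_Star] e unfolding holds.simps c by blast
qed

lemma sound_Id_cong:
  assumes "sound G (EqTy A A')" "sound G (EqTm a a' A)"
  shows "sound G (EqTm b b' A) \<Longrightarrow> sound G (EqTy (Id A a b) (Id A' a' b'))"
    "sound G (EqTm (Refl A a) (Refl A' a') (Id A a a))"
proof -
  have *: "\<exists>S s. ity X \<rho> A S \<and> ity X \<rho> A' S \<and> itm X \<rho> a S s \<and> itm X \<rho> a' S s" if v: "valid G X \<rho>" for X \<rho>
    using sound_eqty[OF assms(1) v] sound_eqtm_at[OF assms(2) v] by metis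
  show "sound G (EqTm (Refl A a) (Refl A' a') (Id A a a))"
    using * sound_semctx[OF assms(1)] i_Id i_Refl unfolding sound_def holds.simps by meson
  assume b: "sound G (EqTm b b' A)"
  have "\<exists>S s t. ity X \<rho> A S \<and> ity X \<rho> A' S \<and> itm X \<rho> a S s \<and> itm X \<rho> a' S s \<and> itm X \<rho> b S t \<and> itm X \<rho> b' S t"
    if v: "valid G X \<rho>" for X \<rho>
    using *[OF v] sound_eqtm_at[OF b v] by metis
  then show "sound G (EqTy (Id A a b) (Id A' a' b'))"
    using sound_semctx[OF assms(1)] i_Id unfolding sound_def holds.simps by meson
qed

lemma sound_J_cong:
  assumes "sound G (EqTy A A')" "sound (Id_tel A @ G) (EqTy C C')" "sound (A # G) (EqTm d d' (J_branch A C))"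
    "sound G (EqTm a a' A)" "sound G (EqTm b b' A)" "sound G (EqTm p p' (Id A a b))"
  shows "sound G (EqTm (J A C d a b p) (J A' C' d' a' b' p') (sub_ty (insts [p, b, a]) C))"
proof (rule soundI[OF sound_semctx[OF assms(1)]])
  fix X \<rho> assume w: "wfenv X \<rho>" and v: "valid G X \<rho>"
  obtain S where S: "ity X \<rho> A S" "ity X \<rho> A' S" using sound_eqty[OF assms(1) v] .
  let ?Y = "ext (idty S)" and ?r = "xenv (idty S) (xenv (wkself S) (xenv S \<rho>))"
  obtain U where U: "ity ?Y ?r C U" "ity ?Y ?r C' U" using sound_eqty[OF assms(2) valid_Id_tel[OF v S(1)]] .
  obtain e where e: "itm (ext S) (xenv S \<rho>) d (reix (reflmap S) U) e"
      "itm (ext S) (xenv S \<rho>) d' (reix (reflmap S) U) e"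
    using sound_eqtm_at[OF assms(3) valid_xenv[OF v S(1)] interp_J_branch[OF w S(1) U(1)]] .
  obtain s where s: "itm X \<rho> a S s" "itm X \<rho> a' S s" using sound_eqtm_at[OF assms(4) v S(1)] .
  obtain t where t: "itm X \<rho> b S t" "itm X \<rho> b' S t" using sound_eqtm_at[OF assms(5) v S(1)] .
  obtain q where q: "itm X \<rho> p (IdT S s t) q" "itm X \<rho> p' (IdT S s t) q"
    using sound_eqtm_at[OF assms(6) v i_Id[OF S(1) s(1) t(1)]] .
  show "holds X \<rho> (EqTm (J A C d a b p) (J A' C' d' a' b' p') (sub_ty (insts [p, b, a]) C))"
    using interp_inst3[OF w s(1) t(1) q(1) U(1)] i_J[OF S(1) U(1) e(1) s(1) t(1) q(1)] i_J[OF S(2) U(2) e(2) s(2) t(2) q(2)]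
    unfolding holds.simps by blast
qed

lemma sound_J_comp:
  assumes "sound (Id_tel A @ G) (EqTy C C)" "sound (A # G) (EqTm d d (J_branch A C))" "sound G (EqTm a a A)"
  shows "sound G (EqTm (J A C d a a (Refl A a)) (sub_tm (insts [a]) d) (sub_ty (insts [Refl A a, a, a]) C))"
proof (rule soundI[OF sound_semctx[OF assms(3)]])
  fix X \<rho> assume w: "wfenv X \<rho>" and v: "valid G X \<rho>"
  obtain S s where S: "ity X \<rho> A S" and s: "itm X \<rho> a S s" using sound_eqtm[OF assms(3) v] .
  let ?Y = "ext (idty S)" and ?r = "xenv (idty S) (xenv (wkself S) (xenv S \<rho>))"
  note vI = valid_Id_tel[OF v S]
  obtain U where U: "ity ?Y ?r C U" using sound_eqty[OF assms(1) vI] .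
  note vS = valid_xenv[OF v S]
  obtain e where e: "itm (ext S) (xenv S \<rho>) d (reix (reflmap S) U) e"
    using sound_eqtm_at[OF assms(2) vS interp_J_branch[OF w S U]] .
  note q = i_Refl[OF S s]
  have S': "isty S" "gsection S s" using interp_wf(2)[OF s w] by simp_all
  have U': "isty U" "cx U = ?Y" using interp_wf(1)[OF U valid_wf[OF vI]] by simp_all
  have e': "gsection (reix (reflmap S) U) e" using interp_wf(2)[OF e valid_wf[OF vS]] by simp
  note J = Jsec_comp[OF S'(1) U' e' S'(2)]
  have "reix (idmap S s s (reflsec S s)) U = reix s (reix (reflmap S) U)"
    unfolding idmap_reflsec[OF S'] by (rule reix_cmp(1)[symmetric]) (use S' U' gsectionD[OF S'(2)] in simp_all)
  note E = this J
  show "holds X \<rho> (EqTm (J A C d a a (Refl A a)) (sub_tm (insts [a]) d) (sub_ty (insts [Refl A a, a, a]) C))"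
    using interp_inst3[OF w s s q U] i_J[OF S U e s s q] interp_inst1(2)[OF w s e]
    unfolding holds.simps E by blast
qed

text \<open>The denotation of \<open>Id A a b\<close> is by inversion an \<open>IdT\<close>, and an
  element of an identity type over it forces equality by \<open>discrete_section\<close>.\<close>

lemma sound_discrete:
  assumes "sound G (EqTm p p (Id A a b))" "sound G (EqTm q q (Id A a b))" "sound G (EqTm e e (Id (Id A a b) p q))"
  shows "sound G (EqTm p q (Id A a b))" "sound G (EqTm e (Refl (Id A a b) p) (Id (Id A a b) p q))"
proof -
  have "holds X \<rho> (EqTm p q (Id A a b)) \<and> holds X \<rho> (EqTm e (Refl (Id A a b) p) (Id (Id A a b) p q))"
    if v: "valid G X \<rho>" for X \<rho>
  proof -
    note w = valid_wf[OF v]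
    obtain I u where I: "ity X \<rho> (Id A a b) I" and u: "itm X \<rho> p I u" using sound_eqtm[OF assms(1) v] .
    obtain y where y: "itm X \<rho> q I y" using sound_eqtm_at[OF assms(2) v I] .
    obtain z where z: "itm X \<rho> e (IdT I u y) z" using sound_eqtm_at[OF assms(3) v i_Id[OF I u y]] .
    obtain S s t where S: "itm X \<rho> a S s" "itm X \<rho> b S t" "I = IdT S s t" using I by (rule ity_IdE)
    have g: "isty S" "gsection S s" "gsection S t" "gsection I u" "gsection I y" "gsection (IdT I u y) z"
      using interp_wf(2)[OF S(1) w] interp_wf(2)[OF S(2) w] interp_wf(2)[OF u w] interp_wf(2)[OF y w]
        interp_wf(2)[OF z w] by simp_all
    note d = discrete_section[OF g[unfolded S(3)], folded S(3)]
    show ?thesis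
      using I u y z i_Id[OF I u y] i_Refl[OF I u] unfolding holds.simps d(1) d(2)[unfolded d(1)] by blast
  qed
  then show "sound G (EqTm p q (Id A a b))" "sound G (EqTm e (Refl (Id A a b) p) (Id (Id A a b) p q))"
    using sound_semctx[OF assms(1)] unfolding sound_def by blast+
qed

lemma sound_Lam_cong:
  assumes "sound G (EqTy A A')" "sound (A # G) (EqTy B B')" "sound (A # G) (EqTm f f' B)"
  shows "sound G (EqTm (Lam A B f) (Lam A' B' f') (Pi A B))"
proof (rule soundI[OF sound_semctx[OF assms(1)]])
  fix X \<rho> assume w: "wfenv X \<rho>" and v: "valid G X \<rho>"
  obtain S where S: "ity X \<rho> A S" "ity X \<rho> A' S" using sound_eqty[OF assms(1) v] .
  note vS = valid_xenv[OF v S(1)]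
  obtain T where T: "ity (ext S) (xenv S \<rho>) B T" "ity (ext S) (xenv S \<rho>) B' T"
    using sound_eqty[OF assms(2) vS] .
  obtain e where e: "itm (ext S) (xenv S \<rho>) f T e" "itm (ext S) (xenv S \<rho>) f' T e"
    using sound_eqtm_at[OF assms(3) vS T(1)] .
  show "holds X \<rho> (EqTm (Lam A B f) (Lam A' B' f') (Pi A B))"
    using i_Pi[OF S(1) T(1)] i_Lam[OF S(1) T(1) e(1)] i_Lam[OF S(2) T(2) e(2)] unfolding holds.simps by blast
qed

text \<open>Rules that eliminate a function have no premises about \<open>A\<close> and
  \<open>B\<close>. Inverting the interpretation of \<open>Pi A B\<close> supplies their
  denotations.\<close>

lemma sound_Pi_inv:
  assumes "sound G (EqTm m m (Pi A B))"
  shows "sound G (EqTy A A)" "sound (A # G) (EqTy B B)"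
proof -
  have P: "\<exists>S T. ity X \<rho> A S \<and> ity (ext S) (xenv S \<rho>) B T" if v: "valid G X \<rho>" for X \<rho>
  proof -
    obtain P where "ity X \<rho> (Pi A B) P" using sound_eqtm[OF assms v] .
    then show ?thesis by (rule ity_PiE) blast
  qed
  then have 1: "semctx (A # G)" using sound_semctx[OF assms] by auto
  then show "sound G (EqTy A A)" by (auto simp: sound_def)
  show "sound (A # G) (EqTy B B)"
  proof (rule soundI[OF 1])
    fix X \<rho> assume "valid (A # G) X \<rho>"
    then have v: "valid G X (\<rho> \<circ> Suc)" and i: "ity X (\<rho> \<circ> Suc) A (fst (\<rho> 0))" and g: "gsection (fst (\<rho> 0)) (snd (\<rho> 0))"
      by simp_all
    note w = valid_wf[OF v]
    obtain S T where S: "ity X (\<rho> \<circ> Suc) A S" and T: "ity (ext S) (xenv S (\<rho> \<circ> Suc)) B T" using P[OF v] by blast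
    have e: "S = fst (\<rho> 0)" by (rule interp_functional(1)[OF S i])
    have S': "isty S" "cx S = X" using interp_wf(1)[OF S w] by simp_all
    note g' = gsectionD[OF g, folded e]
    have wS: "wfenv (ext S) (xenv S (\<rho> \<circ> Suc))" using wfenv_xenv[of S "\<rho> \<circ> Suc"] w S' by simp
    \<comment> \<open>Inversion interprets \<open>B\<close> in the generic extended environment
      only; an arbitrary environment of \<open>A # G\<close> is its reindexing along the section in
      its last entry.\<close>
    have "renv (snd (\<rho> 0)) (xenv S (\<rho> \<circ> Suc)) = scons (S, snd (\<rho> 0)) (\<rho> \<circ> Suc)"
      by (rule renv_xenv_section) (use w S' g e in simp_all)
    also have "\<dots> = \<rho>" unfolding e by (simp add: scons_eta)
    finally have "ity X \<rho> B (reix (snd (\<rho> 0)) T)"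
      using interp_reix(1)[OF T wS, rule_format, OF g'(1,3)] g'(2) S'(2) by simp
    then show "holds X \<rho> (EqTy B B)" by auto
  qed
qed

lemma sound_App_cong:
  assumes "sound G (EqTy A A')" "sound (A # G) (EqTy B B')" "sound G (EqTm m m' (Pi A B))" "sound G (EqTm a a' A)"
  shows "sound G (EqTm (App A B m a) (App A' B' m' a') (sub_ty (insts [a]) B))"
proof (rule soundI[OF sound_semctx[OF assms(1)]])
  fix X \<rho> assume w: "wfenv X \<rho>" and v: "valid G X \<rho>"
  obtain S where S: "ity X \<rho> A S" "ity X \<rho> A' S" using sound_eqty[OF assms(1) v] .
  note vS = valid_xenv[OF v S(1)]
  obtain T where T: "ity (ext S) (xenv S \<rho>) B T" "ity (ext S) (xenv S \<rho>) B' T"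
    using sound_eqty[OF assms(2) vS] .
  obtain s where s: "itm X \<rho> m (pity S T) s" "itm X \<rho> m' (pity S T) s"
    using sound_eqtm_at[OF assms(3) v i_Pi[OF S(1) T(1)]] .
  obtain t where t: "itm X \<rho> a S t" "itm X \<rho> a' S t" using sound_eqtm_at[OF assms(4) v S(1)] .
  show "holds X \<rho> (EqTm (App A B m a) (App A' B' m' a') (sub_ty (insts [a]) B))"
    using interp_inst1(1)[OF w t(1) T(1)] i_App[OF S(1) T(1) s(1) t(1)] i_App[OF S(2) T(2) s(2) t(2)]
    unfolding holds.simps by blast
qed

lemma sound_App_comp:
  assumes "sound (A # G) (EqTm f f B)" "sound G (EqTm a a A)"
  shows "sound G (EqTm (App A B (Lam A B f) a) (sub_tm (insts [a]) f) (sub_ty (insts [a]) B))"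
proof (rule soundI[OF sound_semctx[OF assms(2)]])
  fix X \<rho> assume w: "wfenv X \<rho>" and v: "valid G X \<rho>"
  obtain S t where S: "ity X \<rho> A S" and t: "itm X \<rho> a S t" using sound_eqtm[OF assms(2) v] .
  note vS = valid_xenv[OF v S]
  obtain T e where T: "ity (ext S) (xenv S \<rho>) B T" and e: "itm (ext S) (xenv S \<rho>) f T e"
    using sound_eqtm[OF assms(1) vS] .
  have S': "isty S" using interp_wf(1)[OF S w] by simp
  have T': "isty T" "cx T = ext S" "gsection T e" using interp_wf(2)[OF e valid_wf[OF vS]] by simp_all
  have E: "Asec S T (lammap S T e) t = resec t T e" unfolding Asec_def lam_facts(2)[OF S' T'] ..
  show "holds X \<rho> (EqTm (App A B (Lam A B f) a) (sub_tm (insts [a]) f) (sub_ty (insts [a]) B))"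
    using interp_inst1(1)[OF w t T] i_App[OF S T i_Lam[OF S T e] t] interp_inst1(2)[OF w t e]
    unfolding holds.simps E by blast
qed

lemma sound_Ext_cong:
  assumes "sound G (EqTy A A')" "sound (A # G) (EqTy B B')" "sound G (EqTm m m' (Pi A B))" "sound G (EqTm n n' (Pi A B))"
    "sound (A # G) (EqTm p p' (Id B (appvar A B m) (appvar A B n)))"
  shows "sound G (EqTm (Ext A B m n p) (Ext A' B' m' n' p') (Id (Pi A B) m n))"
proof (rule soundI[OF sound_semctx[OF assms(1)]])
  fix X \<rho> assume w: "wfenv X \<rho>" and v: "valid G X \<rho>"
  obtain S where S: "ity X \<rho> A S" "ity X \<rho> A' S" using sound_eqty[OF assms(1) v] .
  note vS = valid_xenv[OF v S(1)]
  obtain T where T: "ity (ext S) (xenv S \<rho>) B T" "ity (ext S) (xenv S \<rho>) B' T"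
    using sound_eqty[OF assms(2) vS] .
  note P = i_Pi[OF S(1) T(1)]
  obtain s where s: "itm X \<rho> m (pity S T) s" "itm X \<rho> m' (pity S T) s"
    using sound_eqtm_at[OF assms(3) v P] .
  obtain t where t: "itm X \<rho> n (pity S T) t" "itm X \<rho> n' (pity S T) t"
    using sound_eqtm_at[OF assms(4) v P] .
  note a = interp_appvar[OF w S(1) T(1)]
  obtain e where e: "itm (ext S) (xenv S \<rho>) p (IdT T (appsec S T s) (appsec S T t)) e"
    "itm (ext S) (xenv S \<rho>) p' (IdT T (appsec S T s) (appsec S T t)) e"
    using sound_eqtm_at[OF assms(5) vS i_Id[OF T(1) a[OF s(1)] a[OF t(1)]]] .
  show "holds X \<rho> (EqTm (Ext A B m n p) (Ext A' B' m' n' p') (Id (Pi A B) m n))"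
    using i_Id[OF P s(1) t(1)] i_Ext[OF S(1) T(1) s(1) t(1) e(1)] i_Ext[OF S(2) T(2) s(2) t(2) e(2)]
    unfolding holds.simps by blast
qed

lemma sound_Ext_refl:
  assumes "sound G (EqTm m m (Pi A B))"
  shows "sound G (EqTm (Ext A B m m (Refl B (appvar A B m))) (Refl (Pi A B) m) (Id (Pi A B) m m))"
proof (rule soundI[OF sound_semctx[OF assms(1)]])
  fix X \<rho> assume w: "wfenv X \<rho>" and v: "valid G X \<rho>"
  obtain S where S: "ity X \<rho> A S" using sound_eqty[OF sound_Pi_inv(1)[OF assms] v] .
  note vS = valid_xenv[OF v S(1)]
  obtain T where T: "ity (ext S) (xenv S \<rho>) B T" using sound_eqty[OF sound_Pi_inv(2)[OF assms] vS] .
  note P = i_Pi[OF S T]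
  obtain s where s: "itm X \<rho> m (pity S T) s" using sound_eqtm_at[OF assms v P] .
  note a = interp_appvar[OF w S T s]
  have S': "isty S" "gsection (pity S T) s" using interp_wf(1)[OF S w] interp_wf(2)[OF s w] by simp_all
  have T': "isty T" "cx T = ext S" using interp_wf(1)[OF T valid_wf[OF vS]] by simp_all
  note E = Extsec_refl[OF S'(1) T' S'(2)]
  show "holds X \<rho> (EqTm (Ext A B m m (Refl B (appvar A B m))) (Refl (Pi A B) m) (Id (Pi A B) m m))"
    using i_Id[OF P s s] i_Ext[OF S T s s i_Refl[OF T a]] i_Refl[OF P s] unfolding holds.simps E by blast
qed

lemma sound_Ext_comp:
  assumes "sound G (EqTm m m (Pi A B))" "sound G (EqTm n n (Pi A B))"
    "sound (A # G) (EqTm p p (Id B (appvar A B m) (appvar A B n)))" "sound G (EqTm a a A)"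
  shows "sound G (EqTm (idapp A B m n (Ext A B m n p) a) (sub_tm (insts [a]) p)
      (Id (sub_ty (insts [a]) B) (App A B m a) (App A B n a)))"
proof (rule soundI[OF sound_semctx[OF assms(1)]])
  fix X \<rho> assume w: "wfenv X \<rho>" and v: "valid G X \<rho>"
  obtain S u where S: "ity X \<rho> A S" and u: "itm X \<rho> a S u" using sound_eqtm[OF assms(4) v] .
  note vS = valid_xenv[OF v S]
  obtain T where T: "ity (ext S) (xenv S \<rho>) B T" using sound_eqty[OF sound_Pi_inv(2)[OF assms(1)] vS] .
  note P = i_Pi[OF S T]
  obtain s where s: "itm X \<rho> m (pity S T) s" using sound_eqtm_at[OF assms(1) v P] .
  obtain t where t: "itm X \<rho> n (pity S T) t" using sound_eqtm_at[OF assms(2) v P] .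
  note b = interp_appvar[OF w S T]
  obtain e where e: "itm (ext S) (xenv S \<rho>) p (IdT T (appsec S T s) (appsec S T t)) e"
    using sound_eqtm_at[OF assms(3) vS i_Id[OF T b[OF s] b[OF t]]] .
  have "gsection (IdT T (appsec S T s) (appsec S T t)) e" using interp_wf(2)[OF e valid_wf[OF vS]] by simp
  note i = interp_idapp[OF w S T s t u i_Ext[OF S T s t e] this]
  show "holds X \<rho> (EqTm (idapp A B m n (Ext A B m n p) a) (sub_tm (insts [a]) p)
      (Id (sub_ty (insts [a]) B) (App A B m a) (App A B n a)))"
    using i_Id[OF interp_inst1(1)[OF w u T] i_App[OF S T s u] i_App[OF S T t u], folded i(2)] i(1) interp_inst1(2)[OF w u e]
    unfolding holds.simps by blast
qed

section \<open>Soundness of the axioms\<close>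

text \<open>Every environment of a barred context is a reindexing of the generic one, whose variables denote
  the diagonal sections; so an axiom need only be checked there.\<close>

definition uenv :: "'a list \<Rightarrow> ('a, 'm) env" where
  "uenv As = xenvs As (\<lambda>_. (unty (top1 M), unmap (top1 M)))"

lemma uenv_simps: "uenv (A # As) = xenv A (uenv As)" "uenv (Ds @ As) = xenvs Ds (uenv As)"
  by (induction Ds) (simp_all add: uenv_def)

lemma tel_append: "tel M X (Ds @ As) \<longleftrightarrow> tel M X As \<and> tel M (tend M X As) Ds"
  "tend M X (Ds @ As) = tend M (tend M X As) Ds"
proof -
  have e: "tend M X (Ds @ As) = tend M (tend M X As) Ds" for Ds by (cases Ds) simp_all
  have o: "tel M X As \<Longrightarrow> tend M X As \<in> Ob (base M)" for As by (cases As) simp_all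
  show "tel M X (Ds @ As) \<longleftrightarrow> tel M X As \<and> tel M (tend M X As) Ds"
    using o by (induction Ds) (auto simp: e)
  show "tend M X (Ds @ As) = tend M (tend M X As) Ds" by (rule e)
qed

lemma wfenv_uenv: "ctel As \<Longrightarrow> wfenv (cend As) (uenv As)"
  unfolding uenv_def by (rule wfenv_xenvs) (use top_ob in \<open>simp_all add: wfenv_def\<close>)

lemma vars_Suc: "vars (Suc n) = Var 0 # map (ren_tm Suc) (vars n)"
  by (simp add: vars_def upt_conv_Cons map_Suc_upt[symmetric] comp_apply del: upt_Suc)

text \<open>The generic variables of \<Gamma> together name the identity of \<Gamma>. Consequently a
  constant applied to them denotes its own datum, without any reindexing.\<close>

lemma interp_vars: "ctel As \<Longrightarrow> isub (cend As) (uenv As) As (vars (length As)) (ide (cend As))"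
proof (induction As)
  case Nil then show ?case using i_nil[of "ide (top1 M)"] top_ob by (simp add: vars_def)
next
  case (Cons A As)
  then have A: "isty A" "cx A = cend As" and t: "ctel As" by simp_all
  have i: "isub (cend As) (uenv As) As (vars (length As)) (ide (cend As))" by (rule Cons(1)[OF t])
  have "isub (ext A) (renv (disp A) (uenv As)) As (vars (length As)) (ide (cend As) \<odot> disp A)"
    using interp_reix(3)[OF i wfenv_uenv[OF t], rule_format, of "disp A"] A by simp
  moreover have "renv (disp A) (uenv As) = xenv A (uenv As) \<circ> Suc" by (simp add: xenv_def)
  ultimately have "isub (ext A) (xenv A (uenv As)) As (map (ren_tm Suc) (vars (length As))) (ide (cend As) \<odot> disp A)"
    using interp_ren(3) by blast
  moreover have "ide (cend As) \<odot> disp A = disp A" using A base.cmp_ide_left[of "disp A"] by simp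
  ultimately have "isub (ext A) (xenv A (uenv As)) As (map (ren_tm Suc) (vars (length As))) (disp A)" by simp
  from i_cons[OF this A, of "Var 0" "diag A"] A
  show ?case by (simp add: vars_Suc uenv_simps i_Var xenv_def)
qed

lemma interp_bar:
  assumes "ctel As" "isty A" "cx A = cend As"
  shows "ity (cend As) (uenv As) (bar_ty As A) A"
    "gsection A a \<Longrightarrow> itm (cend As) (uenv As) (bar_tm As A a) A a"
  unfolding bar_ty_def bar_tm_def
  using i_TCon[OF assms interp_vars[OF assms(1)]] i_Con[OF assms _ interp_vars[OF assms(1)], of a] assms by simp_all

text \<open>The section in the last entry extends the map for the shorter telescope, by the pullback
  property. For the empty telescope the map is the one into the terminal object, and the default
  entries are stable because the unit type and its element are.\<close>

lemma valid_bar: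
  assumes "ctel As" "valid (bar_ctx As) X \<rho>"
  shows "\<exists>g. arr g \<and> dm g = X \<and> cd g = cend As \<and> \<rho> = renv g (uenv As)"
  using assms
proof (induction As arbitrary: \<rho>)
  case Nil
  have "\<forall>x \<in> Ob (base M). \<exists>!f. f \<in> hom (base M) x (top1 M)"
    using fibred unfolding fibred_def two_terminal_def by blast
  then obtain g where "g \<in> hom (base M) X (top1 M)" using Nil(2) by (auto dest!: bspec ex1_implies_ex)
  then have "arr g \<and> dm g = X \<and> cd g = top1 M \<and> \<rho> = renv g (uenv [])"
    using Nil(2) unty_reix(1)[of g] unmap_reix[of g] by (auto simp: renv_def uenv_def)
  then show ?case by auto
next
  case (Cons A As)
  then have A: "isty A" "cx A = cend As" and t: "ctel As" by simp_all
  have v: "valid (bar_ctx As) X (\<rho> \<circ> Suc)" and i: "ity X (\<rho> \<circ> Suc) (bar_ty As A) (fst (\<rho> 0))"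
    and g: "gsection (fst (\<rho> 0)) (snd (\<rho> 0))" using Cons(3) by simp_all
  obtain h where h: "arr h" "dm h = X" "cd h = cend As" "\<rho> \<circ> Suc = renv h (uenv As)"
    using Cons(1)[OF t v] by blast
  have "ity X (renv h (uenv As)) (bar_ty As A) (reix h A)"
    using interp_reix(1)[OF interp_bar(1)[OF t A] wfenv_uenv[OF t], rule_format, OF h(1,3)] h(2) by simp
  then have e: "fst (\<rho> 0) = reix h A" using interp_functional(1)[OF i[unfolded h(4)]] by simp
  note g = gsectionD[OF g[unfolded e]] g[unfolded e]
  have "renv (fext h A \<odot> snd (\<rho> 0)) (xenv A (uenv As)) = scons (reix h A, snd (\<rho> 0)) (renv h (uenv As))"
    by (rule renv_xenv_pair) (use A h g wfenv_uenv[OF t] in simp_all)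
  also have "\<dots> = \<rho>" unfolding h(4)[symmetric] e[symmetric] by (simp add: scons_eta)
  finally have "arr (fext h A \<odot> snd (\<rho> 0)) \<and> dm (fext h A \<odot> snd (\<rho> 0)) = X \<and> cd (fext h A \<odot> snd (\<rho> 0)) = ext A \<and>
      \<rho> = renv (fext h A \<odot> snd (\<rho> 0)) (uenv (A # As))"
    unfolding uenv_simps using A h(1-3) g by simp
  then show ?case unfolding tend.simps by blast
qed

lemma holds_bar:
  assumes "ctel As" "holds (cend As) (uenv As) \<J>" "valid (bar_ctx As) X \<rho>"
  shows "holds X \<rho> \<J>"
  using valid_bar[OF assms(1,3)] holds_renv[OF assms(2) wfenv_uenv[OF assms(1)]] by blast

lemma semctx_bar: "ctel As \<Longrightarrow> semctx (bar_ctx As)"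
proof (induction As)
  case (Cons A As)
  then have A: "isty A" "cx A = cend As" and t: "ctel As" by simp_all
  have "holds (cend As) (uenv As) (IsTy (bar_ty As A))" using interp_bar(1)[OF t A] by auto
  then show ?case using Cons(1)[OF t] holds_bar[OF t, of "IsTy (bar_ty As A)"] by simp
qed simp

lemma sound_bar:
  "ctel As \<Longrightarrow> holds (cend As) (uenv As) \<J> \<Longrightarrow> sound (bar_ctx As) \<J>"
  using semctx_bar holds_bar unfolding sound_def by blast

lemma valid_uenv: "ctel As \<Longrightarrow> valid (bar_ctx As) (cend As) (uenv As)"
proof (induction As)
  case Nil then show ?case using top_ob by (simp add: uenv_def)
next
  case (Cons A As)
  then have A: "isty A" "cx A = cend As" and t: "ctel As" by simp_all
  show ?case
    using valid_xenv[OF Cons(1)[OF t] interp_bar(1)[OF t A]] by (simp add: uenv_simps)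
qed

text \<open>All axioms equating a structural operation on bars with the bar of a reindexing have
  this form; they differ only in the map \<open>h\<close> and the substitution that denotes
  it.\<close>

lemma sound_reindex:
  assumes "ctel (Ds @ As)" "ctel As'" "arr h" "dm h = cend As'" "cd h = cend As"
    "issub (cend As') (uenv As') s (renv h (uenv As))" "B \<in> fib M (cend (Ds @ As))"
  shows "sound (bar_ctx (retel h Ds @ As')) (EqTy (sub_ty ((ups ^^ length Ds) s) (bar_ty (Ds @ As) B))
      (bar_ty (retel h Ds @ As') (reix (flift h Ds) B)))"
    "gsection B b \<Longrightarrow> sound (bar_ctx (retel h Ds @ As')) (EqTm (sub_tm ((ups ^^ length Ds) s) (bar_tm (Ds @ As) B b))
      (bar_tm (retel h Ds @ As') (reix (flift h Ds) B) (resec (flift h Ds) B b))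
      (bar_ty (retel h Ds @ As') (reix (flift h Ds) B)))"
proof -
  have t: "ctel As" "tel M (cend As) Ds" using assms(1) by (simp_all add: tel_append)
  note r = tel_reindex[OF t(2) assms(3,5), unfolded assms(4)]
  have t': "ctel (retel h Ds @ As')" using r assms(2) by (simp add: tel_append)
  have B: "isty B" "cx B = cend (Ds @ As)" using assms(7) by simp_all
  have f: "arr (flift h Ds)" "dm (flift h Ds) = cend (retel h Ds @ As')" "cd (flift h Ds) = cx B"
    using r B by (simp_all add: tel_append)
  have B': "isty (reix (flift h Ds) B)" "cx (reix (flift h Ds) B) = cend (retel h Ds @ As')"
    using f B by simp_all
  note i = interp_reindex[OF assms(6) wfenv_uenv[OF t(1)] assms(3,4,5) t(2)]
  have 1: "ity (cend (retel h Ds @ As')) (uenv (retel h Ds @ As')) (sub_ty ((ups ^^ length Ds) s) (bar_ty (Ds @ As) B))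
      (reix (flift h Ds) B)"
    using i(1)[of "bar_ty (Ds @ As) B" B] interp_bar(1)[OF assms(1) B] by (simp add: uenv_simps tel_append)
  note 2 = interp_bar(1)[OF t' B']
  show "sound (bar_ctx (retel h Ds @ As')) (EqTy (sub_ty ((ups ^^ length Ds) s) (bar_ty (Ds @ As) B))
      (bar_ty (retel h Ds @ As') (reix (flift h Ds) B)))"
    by (rule sound_bar[OF t']) (use 1 2 in auto)
  assume b: "gsection B b"
  have 3: "itm (cend (retel h Ds @ As')) (uenv (retel h Ds @ As')) (sub_tm ((ups ^^ length Ds) s) (bar_tm (Ds @ As) B b))
      (reix (flift h Ds) B) (resec (flift h Ds) B b)"
    using i(2)[of "bar_tm (Ds @ As) B b" B b] interp_bar(2)[OF assms(1) B b] by (simp add: uenv_simps tel_append)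
  have "gsection (reix (flift h Ds) B) (resec (flift h Ds) B b)" using f B b by simp
  note 4 = interp_bar(2)[OF t' B' this]
  show "sound (bar_ctx (retel h Ds @ As')) (EqTm (sub_tm ((ups ^^ length Ds) s) (bar_tm (Ds @ As) B b))
      (bar_tm (retel h Ds @ As') (reix (flift h Ds) B) (resec (flift h Ds) B b))
      (bar_ty (retel h Ds @ As') (reix (flift h Ds) B)))"
    by (rule sound_bar[OF t']) (use 2 3 4 in auto)
qed

lemma sound_reindex_ren:
  assumes "ctel (Ds @ As)" "ctel As'" "arr h" "dm h = cend As'" "cd h = cend As"
    "uenv As' \<circ> r = renv h (uenv As)" "B \<in> fib M (cend (Ds @ As))"
  shows "sound (bar_ctx (retel h Ds @ As')) (EqTy (ren_ty ((upr ^^ length Ds) r) (bar_ty (Ds @ As) B))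
      (bar_ty (retel h Ds @ As') (reix (flift h Ds) B)))"
    "gsection B b \<Longrightarrow> sound (bar_ctx (retel h Ds @ As')) (EqTm (ren_tm ((upr ^^ length Ds) r) (bar_tm (Ds @ As) B b))
      (bar_tm (retel h Ds @ As') (reix (flift h Ds) B) (resec (flift h Ds) B b))
      (bar_ty (retel h Ds @ As') (reix (flift h Ds) B)))"
  unfolding ren_eq_sub ups_pow_Var[symmetric]
  by (rule sound_reindex[OF assms(1-5) issub_Var[OF wfenv_uenv[OF assms(2)], of r, unfolded assms(6)] assms(7)]; assumption)+

section \<open>The symmetry and the exchange of variables\<close>

lemma symm_facts:
  assumes "isty A" "isty B" "cx A = cx B"
  defines "A' \<equiv> reix (disp B) A" and "B' \<equiv> reix (disp A) B" and "h \<equiv> symm M A B"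
  shows "arr h" "dm h = ext A'" "cd h = ext B'" "disp B' \<odot> h = fext (disp B) A"
    "fext (disp A) B \<odot> h = disp A'"
proof -
  have "\<exists>!h. h \<in> hom (base M) (dm (fext (disp B) A)) (ext (reix (disp A) B)) \<and>
    disp (reix (disp A) B) \<odot> h = fext (disp B) A \<and> fext (disp A) B \<odot> h = disp (reix (disp B) A)"
    by (rule pullback_ex1) (use assms(1-3) in simp_all)
  moreover have "dm (fext (disp B) A) = ext (reix (disp B) A)" using assms(1-3) by simp
  ultimately have "\<exists>!h. h \<in> hom (base M) (ext (reix (disp B) A)) (ext (reix (disp A) B)) \<and>
    disp (reix (disp A) B) \<odot> h = fext (disp B) A \<and> fext (disp A) B \<odot> h = disp (reix (disp B) A)"
    by (simp only:)
  from theI'[OF this] show "arr h" "dm h = ext A'" "cd h = ext B'" "disp B' \<odot> h = fext (disp B) A"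
    "fext (disp A) B \<odot> h = disp A'"
    unfolding symm_def[symmetric] A'_def B'_def h_def by simp_all
qed

text \<open>The symmetry names the two generic variables in the opposite order: its component in the
  type \<open>B\<close> is the weakened variable of \<open>B\<close>, and its other projection is
  the variable of \<open>A\<close>.\<close>

lemma xenv_exchange:
  assumes "isty A" "isty B" "cx A = cx B" "wfenv (cx B) \<rho>"
  shows "xenv (reix (disp B) A) (xenv B \<rho>) \<circ> exchange = renv (symm M A B) (xenv (reix (disp A) B) (xenv A \<rho>))"
proof -
  let ?A = "reix (disp B) A" and ?B = "reix (disp A) B" and ?h = "symm M A B" and ?F = "fext (disp B) A"
  let ?x = "resec (disp ?A) (reix (disp B) B) (diag B)"
  note h = symm_facts[OF assms(1-3)]
  have A: "isty ?A" "cx ?A = ext B" "isty ?B" "cx ?B = ext A" using assms(1-3) by simp_all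
  have F: "arr ?F" "dm ?F = ext ?A" "cd ?F = ext A" using assms(1-3) by simp_all
  have wA: "wfenv (ext A) (xenv A \<rho>)" using wfenv_xenv[of A \<rho>] assms by simp
  note v = pair_var[OF assms(2) A(1,2)]
  have d: "disp A \<odot> ?F = disp B \<odot> disp ?A" using assms(1-3) by simp
  have tB: "reix (disp ?A) (reix (disp B) B) = reix (disp B \<odot> disp ?A) B"
    by (rule reix_cmp(1)) (use assms(1-3) A in simp_all)
  have "reix ?F ?B = reix (disp A \<odot> ?F) B" by (rule reix_cmp(1)) (use assms(1-3) F in simp_all)
  then have t: "reix ?F ?B = reix (disp ?A) (reix (disp B) B)" unfolding d tB .
  have x: "gsection (reix ?F ?B) ?x" unfolding t tB by (rule v(1))
  note X = gsectionD[OF x]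
  have e: "sec ?F ?B ?h = ?x"
  proof (rule sec_unique[OF F(1) A(3) _ x])
    show "cd ?F = cx ?B" using F A by simp
    show "fext ?F ?B \<odot> ?x = ?h"
    proof (rule pullback_eqI[of "disp A" B])
      have "fext (disp A) B \<odot> fext ?F ?B \<odot> ?x = fext (disp A \<odot> ?F) B \<odot> ?x"
        by (rule reix_cmp(3)) (use assms(1-3) F X t tB d in simp_all)
      then show "fext (disp A) B \<odot> fext ?F ?B \<odot> ?x = fext (disp A) B \<odot> ?h" unfolding d v(2) h(5) .
      have FF: "arr (fext ?F ?B)" "dm (fext ?F ?B) = ext (reix ?F ?B)" "cd (fext ?F ?B) = ext ?B"
        "disp ?B \<odot> fext ?F ?B = ?F \<odot> disp (reix ?F ?B)" and cF: "cx (reix ?F ?B) = ext ?A" "isty (reix ?F ?B)"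
        using reix_simps[OF F(1) A(3)] F(2,3) A(4) by simp_all
      have "disp ?B \<odot> fext ?F ?B \<odot> ?x = (disp ?B \<odot> fext ?F ?B) \<odot> ?x"
        by (rule base.cmp_assoc'[symmetric]) (use FF(1-3) A X in simp_all)
      also have "\<dots> = ?F \<odot> disp (reix ?F ?B) \<odot> ?x"
        unfolding FF(4) by (rule base.cmp_assoc') (use F X cF in simp_all)
      also have "\<dots> = ?F" unfolding X(4) cF using base.cmp_ide_right[of ?F] F by simp
      finally show "disp ?B \<odot> fext ?F ?B \<odot> ?x = disp ?B \<odot> ?h" unfolding h(4) .
      show "arr (fext ?F ?B \<odot> ?x)" "cd (fext ?F ?B \<odot> ?x) = ext ?B" "dm (fext ?F ?B \<odot> ?x) = dm ?h"
        using FF(1-3) X cF h by simp_all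
    qed (use assms(1-3) h in simp_all)
  qed
  have "renv ?h (xenv ?B (xenv A \<rho>)) = scons (reix (disp ?B \<odot> ?h) ?B, sec (disp ?B \<odot> ?h) ?B ?h) (renv (disp ?B \<odot> ?h) (xenv A \<rho>))"
    by (rule renv_xenv) (use A wA h in simp_all)
  also have "\<dots> = scons (reix (disp ?A) (reix (disp B) B), ?x) (renv ?F (xenv A \<rho>))"
    unfolding h(4) e t ..
  also have "renv ?F (xenv A \<rho>) = xenv ?A (renv (disp B) \<rho>)"
    by (rule renv_xenv_fext) (use assms in simp_all)
  also have "scons (reix (disp ?A) (reix (disp B) B), ?x) (xenv ?A (renv (disp B) \<rho>)) = xenv ?A (xenv B \<rho>) \<circ> exchange"
  proof
    show "scons (reix (disp ?A) (reix (disp B) B), ?x) (xenv ?A (renv (disp B) \<rho>)) n = (xenv ?A (xenv B \<rho>) \<circ> exchange) n" for n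
      by (cases n; cases "n - 1") (simp_all add: comp_apply exchange_def xenv_def renv_def)
  qed
  finally show ?thesis ..
qed

section \<open>Axioms for the type formers\<close>

lemma sound_ax_Sigma_Pi:
  assumes "ctel (B # A # As)"
  shows "sound (bar_ctx As) (EqTy (Sigma (bar_ty As A) (bar_ty (A # As) B)) (bar_ty As (sigty A B)))"
    "sound (bar_ctx As) (EqTy (Pi (bar_ty As A) (bar_ty (A # As) B)) (bar_ty As (pity A B)))"
    "gsection B f \<Longrightarrow> sound (bar_ctx As) (EqTm (Lam (bar_ty As A) (bar_ty (A # As) B) (bar_tm (A # As) B f))
             (bar_tm As (pity A B) (lammap A B f)) (bar_ty As (pity A B)))"
proof -
  let ?X = "cend As"
  have t: "ctel As" "ctel (A # As)" and A: "isty A" "cx A = ?X" and B: "isty B" "cx B = ext A"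
    using assms by simp_all
  have P: "isty (sigty A B)" "cx (sigty A B) = ?X" "isty (pity A B)" "cx (pity A B) = ?X" using A B by simp_all
  note a = interp_bar(1)[OF t(1) A]
  have b: "ity (ext A) (xenv A (uenv As)) (bar_ty (A # As) B) B"
    using interp_bar(1)[OF t(2) B(1)] B by (simp add: uenv_simps)
  note p = interp_bar(1)[OF t(1) P(3,4)]
  show "sound (bar_ctx As) (EqTy (Sigma (bar_ty As A) (bar_ty (A # As) B)) (bar_ty As (sigty A B)))"
    by (rule sound_bar[OF t(1)]) (use i_Sigma[OF a b] interp_bar(1)[OF t(1) P(1,2)] in auto)
  show "sound (bar_ctx As) (EqTy (Pi (bar_ty As A) (bar_ty (A # As) B)) (bar_ty As (pity A B)))"
    by (rule sound_bar[OF t(1)]) (use i_Pi[OF a b] p in auto)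
  assume f: "gsection B f"
  have e: "itm (ext A) (xenv A (uenv As)) (bar_tm (A # As) B f) B f"
    using interp_bar(2)[OF t(2) B(1) _ f] B by (simp add: uenv_simps)
  show "sound (bar_ctx As) (EqTm (Lam (bar_ty As A) (bar_ty (A # As) B) (bar_tm (A # As) B f))
             (bar_tm As (pity A B) (lammap A B f)) (bar_ty As (pity A B)))"
    by (rule sound_bar[OF t(1)])
      (use i_Lam[OF a b e] p interp_bar(2)[OF t(1) P(3,4) lam_facts(1)[OF A(1) B f]] in auto)
qed

lemma sound_bar_tm:
  assumes "ctel As" "wfenv (cend As) (uenv As) \<Longrightarrow> itm (cend As) (uenv As) t A a"
  shows "sound (bar_ctx As) (EqTm t (bar_tm As A a) (bar_ty As A))"
proof -
  note w = wfenv_uenv[OF assms(1)]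
  have A: "isty A" "cx A = cend As" "gsection A a" using interp_wf(2)[OF assms(2)[OF w] w] by simp_all
  show ?thesis
    by (rule sound_bar[OF assms(1)]) (use assms(2)[OF w] interp_bar[OF assms(1) A(1,2)] A(3) in auto)
qed

lemma sound_ax_Pair:
  assumes "ctel (B # A # As)" "h = disp A \<odot> disp B"
  shows "sound (bar_ctx (B # A # As)) (EqTm (Pair (wk_ty 2 0 (bar_ty As A)) (wk_ty 2 1 (bar_ty (A # As) B)) (Var 1) (Var 0))
     (bar_tm (B # A # As) (reix h (sigty A B)) (sec h (sigty A B) (sigin A B)))
     (bar_ty (B # A # As) (reix h (sigty A B))))"
proof (rule sound_bar_tm[OF assms(1)])
  let ?X = "cend As"
  have t: "ctel As" "ctel (A # As)" and A: "isty A" "cx A = ?X" and B: "isty B" "cx B = ext A"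
    using assms(1) by simp_all
  have b: "ity (ext A) (xenv A (uenv As)) (bar_ty (A # As) B) B"
    using interp_bar(1)[OF t(2) B(1)] B by (simp add: uenv_simps)
  show "itm (cend (B # A # As)) (uenv (B # A # As))
     (Pair (wk_ty 2 0 (bar_ty As A)) (wk_ty 2 1 (bar_ty (A # As) B)) (Var 1) (Var 0))
     (reix h (sigty A B)) (sec h (sigty A B) (sigin A B))"
    using pair_generic[OF wfenv_uenv[OF t(1)] interp_bar(1)[OF t(1) A] b] unfolding assms(2) uenv_simps tend.simps .
qed

text \<open>The axioms for eliminators apply a weakened eliminator to the generic variable.
  Weakening and then instantiating by the diagonal cancel.\<close>

lemma diag_elim:
  assumes "isty S" "isty C" "cx C = ext S" "gsection C c"
  shows "reix (diag S) (reix (fext (disp S) S) C) = C"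
    "resec (diag S) (reix (fext (disp S) S) C) (resec (fext (disp S) S) C c) = c"
proof -
  have "reix (diag S) (reix (fext (disp S) S) C) = reix (fext (disp S) S \<odot> diag S) C"
    by (rule reix_cmp(1)) (use assms in simp_all)
  then show "reix (diag S) (reix (fext (disp S) S) C) = C"
    unfolding diag_simps(6)[OF assms(1)] using assms(2,3) by simp
  have "resec (diag S) (reix (fext (disp S) S) C) (resec (fext (disp S) S) C c) =
      resec (fext (disp S) S \<odot> diag S) C c"
    by (rule resec_cmp) (use assms in simp_all)
  then show "resec (diag S) (reix (fext (disp S) S) C) (resec (fext (disp S) S) C c) = c"
    unfolding diag_simps(6)[OF assms(1)] using assms(2-4) by simp
qed

text \<open>The raw term denotes the eliminator for the data weakened along \<open>disp S\<close>,
  taken at the diagonal. By stability this is the weakened \<open>Emap\<close> at the diagonal, and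
  \<open>diag_elim\<close> removes both.\<close>

lemma sound_ax_SplitE:
  assumes "ctel (B # A # As)" "S = sigty A B" "C \<in> fib M (ext S)" "d \<in> hom (base M) (ext B) (ext C)"
    "disp C \<odot> d = sigin A B"
  shows "sound (bar_ctx (S # As)) (EqTm (SplitE (wk_ty 1 0 (bar_ty As A)) (wk_ty 1 1 (bar_ty (A # As) B))
                (wk_ty 1 1 (bar_ty (S # As) C))
                (wk_tm 1 2 (bar_tm (B # A # As) (reix (sigin A B) C) (sec (sigin A B) C d)))
                (Var 0))
             (bar_tm (S # As) C (Emap M A B C d)) (bar_ty (S # As) C))"
proof -
  let ?X = "cend As" and ?\<rho> = "xenv S (uenv As)" and ?h = "disp S" and ?i = "sigin A B"
  have t: "ctel As" "ctel (A # As)" and A: "isty A" "cx A = ?X" and B: "isty B" "cx B = ext A"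
    using assms(1) by simp_all
  have S: "isty S" "cx S = ?X" and tS: "ctel (S # As)" unfolding assms(2) using A B t by simp_all
  have C: "isty C" "cx C = ext S" and d: "arr d" "dm d = ext B" "cd d = ext C" using assms(3,4) by simp_all
  let ?A = "reix ?h A" and ?B = "reix (fext ?h A) B" and ?C = "reix (fext ?h S) C"
  define c where "c = sec ?i C d"
  have i: "arr ?i" "dm ?i = ext B" "cd ?i = ext S" using A B by (simp_all add: assms(2))
  have c: "gsection (reix ?i C) c"
    unfolding c_def by (rule sec_facts(1)) (use i C d assms(5) in simp_all)
  note w = wfenv_uenv[OF t(1)]
  have wS: "wfenv (ext S) ?\<rho>" using wfenv_uenv[OF tS] by (simp add: uenv_simps)
  have h: "arr ?h" "dm ?h = ext S" "cd ?h = ?X" "cd ?h = cx A" using S A by simp_all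
  note k = wS xenv_shift w h(1-3)
  have a: "ity ?X (uenv As) (bar_ty As A) A" by (rule interp_bar(1)[OF t(1) A])
  have b: "ity (ext A) (xenv A (uenv As)) (bar_ty (A # As) B) B"
    using interp_bar(1)[OF t(2) B(1)] B by (simp add: uenv_simps)
  have u: "ity (ext S) (xenv S (uenv As)) (bar_ty (S # As) C) C"
    using interp_bar(1)[OF tS C(1)] C by (simp add: uenv_simps)
  have Ci: "isty (reix ?i C)" "cx (reix ?i C) = ext B" using C i by simp_all
  have e: "itm (ext B) (xenv B (xenv A (uenv As))) (bar_tm (B # A # As) (reix ?i C) c) (reix ?i C) c"
    using interp_bar(2)[OF assms(1) Ci(1) _ c] Ci by (simp add: uenv_simps)
  note sg = sigty_reix[OF A(1) B h(1,4), folded assms(2)]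
  have ab: "isty ?A" "isty ?B" "cx ?B = ext ?A" using A B h by simp_all
  have tel: "tel M ?X [B, A]" using t A B w wfenv_ob by simp
  let ?F = "fext (fext ?h A) B"
  have F: "arr ?F" "dm ?F = ext ?B" "cd ?F = ext B" using A B h by simp_all
  have "reix ?F (reix ?i C) = reix (?i \<odot> ?F) C" by (rule reix_cmp(1)) (use F i C in simp_all)
  also have "\<dots> = reix (sigin ?A ?B) ?C"
    unfolding sg(2)[symmetric] by (rule reix_cmp(1)[symmetric]) (use ab C S h sg(1)[symmetric] in simp_all)
  finally have ty: "reix ?F (reix ?i C) = reix (sigin ?A ?B) ?C" .
  have e': "itm (ext ?B) (xenv ?B (xenv ?A ?\<rho>)) (wk_tm 1 2 (bar_tm (B # A # As) (reix ?i C) c)) (reix (sigin ?A ?B) ?C)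
      (resec ?F (reix ?i C) c)"
    unfolding ty[symmetric] using interp_wk(2)[OF k tel, of _ _ _ 2] e by simp
  have v: "itm (ext S) ?\<rho> (Var 0) (reix ?h S) (diag S)" by (rule i_Var) (simp_all add: xenv_def)
  note E = E_elim_reix[OF A(1) B C[unfolded assms(2)] c h(1,4), folded assms(2)]
  have g: "gsection C (elim ?i (sigret A B) (sigcell A B) C c)"
    by (rule Emap_section[OF A(1) B C(1) C(2)[unfolded assms(2)] c])
  have m: "elim ?i (sigret A B) (sigcell A B) C c = Emap M A B C d"
    unfolding c_def by (rule Emap_elim[OF A(1) B C(1) C(2)[unfolded assms(2)] d assms(5), symmetric])
  note D = diag_elim[OF S(1) C g]
  have r: "itm (ext S) ?\<rho> (SplitE (wk_ty 1 0 (bar_ty As A)) (wk_ty 1 1 (bar_ty (A # As) B)) (wk_ty 1 1 (bar_ty (S # As) C))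
      (wk_tm 1 2 (bar_tm (B # A # As) (reix ?i C) c)) (Var 0)) (reix (diag S) ?C) (Esec ?A ?B ?C (resec ?F (reix ?i C) c) (diag S))"
    by (rule i_SplitE[OF interp_wk0(1)[OF k a] interp_wk1(1)[OF k A b]
        interp_wk1(1)[OF k S u, unfolded sg(1)] e' v[unfolded sg(1)]])
  show ?thesis
    unfolding c_def[symmetric]
    by (rule sound_bar_tm[OF tS]) (use r[unfolded Esec_def E, unfolded D, unfolded m] in \<open>simp add: uenv_simps\<close>)
qed

lemma sound_ax_UnitE:
  assumes "ctel As" "X = cend As" "P = unty X" "C \<in> fib M (ext P)" "d \<in> hom (base M) X (ext C)"
    "disp C \<odot> d = unmap X"
  shows "sound (bar_ctx (P # As)) (EqTm (UnitE (wk_ty 1 1 (bar_ty (P # As) C))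
                (wk_tm 1 0 (bar_tm As (reix (unmap X) C) (sec (unmap X) C d))) (Var 0))
             (bar_tm (P # As) C (Umap M X C d)) (bar_ty (P # As) C))"
proof -
  let ?\<rho> = "xenv P (uenv As)" and ?h = "disp P" and ?i = "unmap X"
  note w = wfenv_uenv[OF assms(1), folded assms(2)]
  have X: "X \<in> Ob (base M)" using w wfenv_ob by simp
  have P: "isty P" "cx P = X" and tP: "ctel (P # As)" unfolding assms(3) using assms(1,2) X by simp_all
  have C: "isty C" "cx C = ext P" and d: "arr d" "dm d = X" "cd d = ext C" using assms(4,5) by simp_all
  let ?C = "reix (fext ?h P) C"
  define c where "c = sec ?i C d"
  have i: "arr ?i" "dm ?i = X" "cd ?i = ext P" using X by (simp_all add: assms(3))
  have c: "gsection (reix ?i C) c"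
    unfolding c_def by (rule sec_facts(1)) (use i C d assms(6) in simp_all)
  have wP: "wfenv (ext P) ?\<rho>" using wfenv_uenv[OF tP] by (simp add: uenv_simps)
  have h: "arr ?h" "dm ?h = ext P" "cd ?h = X" using P by simp_all
  note k = wP xenv_shift w h(1-3)
  have u: "ity (ext P) (xenv P (uenv As)) (bar_ty (P # As) C) C"
    using interp_bar(1)[OF tP C(1)] C by (simp add: uenv_simps)
  have Ci: "isty (reix ?i C)" "cx (reix ?i C) = X" using C i by simp_all
  have e: "itm X (uenv As) (bar_tm As (reix ?i C) c) (reix ?i C) c"
    using interp_bar(2)[OF assms(1) Ci(1) _ c] Ci assms(2) by simp
  note un = unty_reix(1,2)[OF h(1), unfolded h(2,3), folded assms(3)]
  have "reix ?h (reix ?i C) = reix (?i \<odot> ?h) C" by (rule reix_cmp(1)) (use h i C in simp_all)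
  also have "\<dots> = reix (unmap (ext P)) ?C"
    unfolding un(2)[symmetric] by (rule reix_cmp(1)[symmetric]) (use C P h un(1) in simp_all)
  finally have ty: "reix ?h (reix ?i C) = reix (unmap (ext P)) ?C" .
  have v: "itm (ext P) ?\<rho> (Var 0) (reix ?h P) (diag P)" by (rule i_Var) (simp_all add: xenv_def)
  note C' = C(1) C(2)[unfolded assms(3)]
  note E = U_elim_reix[OF X C' c h(1,3), folded assms(3), unfolded h(2)]
  have g: "gsection C (elim ?i ?h (uncell X) C c)"
    unfolding assms(3) by (rule Umap_section[OF X C' c])
  have m: "elim ?i ?h (uncell X) C c = Umap M X C d"
    unfolding c_def assms(3) by (rule Umap_elim[OF X C' d assms(6), symmetric])
  note D = diag_elim[OF P(1) C g]
  have r: "itm (ext P) ?\<rho> (UnitE (wk_ty 1 1 (bar_ty (P # As) C)) (wk_tm 1 0 (bar_tm As (reix ?i C) c)) (Var 0))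
      (reix (diag P) ?C) (Usec ?C (resec ?h (reix ?i C) c) (diag P))"
    by (rule i_UnitE[OF interp_wk1(1)[OF k P u, unfolded un(1)] interp_wk0(2)[OF k e, unfolded ty] v[unfolded un(1)]])
  have dd: "dm (diag P) = ext P" using P by simp
  show ?thesis
    unfolding c_def[symmetric]
    by (rule sound_bar_tm[OF tP]) (use r[unfolded Usec_def Let_def dd E, unfolded D, unfolded m] in \<open>simp add: uenv_simps\<close>)
qed

lemma sound_ax_Id:
  assumes "ctel (A # As)"
  shows "sound (bar_ctx (wkself A # A # As)) (EqTy (Id (wk_ty 2 0 (bar_ty As A)) (Var 1) (Var 0))
     (bar_ty (wkself A # A # As) (idty A)))"
proof -
  let ?X = "cend As"
  have t: "ctel As" and A: "isty A" "cx A = ?X" using assms by simp_all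
  have tW: "ctel (wkself A # A # As)" using A t by simp
  show ?thesis
    by (rule sound_bar[OF tW])
      (use interp_Id_generic[OF wfenv_uenv[OF t] interp_bar(1)[OF t A]] interp_bar(1)[OF tW, of "idty A"] A in
        \<open>auto simp: uenv_simps\<close>)
qed

lemma sound_ax_Refl:
  assumes "ctel (A # As)" "I = reix (diag A) (idty A)"
  shows "sound (bar_ctx (A # As)) (EqTm (Refl (wk_ty 1 0 (bar_ty As A)) (Var 0))
     (bar_tm (A # As) I (sec (diag A) (idty A) (reflmap A))) (bar_ty (A # As) I))"
proof (rule sound_bar_tm[OF assms(1)])
  have t: "ctel As" and A: "isty A" "cx A = cend As" using assms(1) by simp_all
  note r = refl_var[OF A(1), folded wkself_def]
  show "itm (cend (A # As)) (uenv (A # As)) (Refl (wk_ty 1 0 (bar_ty As A)) (Var 0)) I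
     (sec (diag A) (idty A) (reflmap A))"
    using refl_generic[OF wfenv_uenv[OF t] interp_bar(1)[OF t A]]
    unfolding r(1,3) assms(2) uenv_simps tend.simps .
qed

lemma xenv3_shift:
  assumes "wfenv X \<rho>" "isty S" "cx S = X" "isty T" "cx T = ext S" "isty U" "cx U = ext T"
  shows "xenv U (xenv T (xenv S \<rho>)) \<circ> (\<lambda>i. i + 3) = renv (disp S \<odot> disp T \<odot> disp U) \<rho>"
proof -
  have "xenv U (xenv T (xenv S \<rho>)) \<circ> (\<lambda>i. i + 3) = renv (disp U) (xenv T (xenv S \<rho>) \<circ> (\<lambda>i. i + 2))"
    by (auto simp: fun_eq_iff comp_apply xenv_def renv_def numeral_3_eq_3)
  also have "\<dots> = renv (disp U) (renv (disp S \<odot> disp T) \<rho>)" unfolding xenv2_shift[OF assms(1-5)] ..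
  also have "\<dots> = renv ((disp S \<odot> disp T) \<odot> disp U) \<rho>" by (rule renv_cmp) (use assms in simp_all)
  also have "(disp S \<odot> disp T) \<odot> disp U = disp S \<odot> disp T \<odot> disp U"
    by (rule base.cmp_assoc') (use assms in simp_all)
  finally show ?thesis .
qed

text \<open>As for sums, the weakening of the data must cancel against instantiation at the generic
  variables; here there are three of them, living over the whole path object.\<close>

lemma sound_ax_J:
  assumes "ctel (A # As)" "Gs = idty A # wkself A # A # As" "C \<in> fib M (ext (idty A))"
    "d \<in> hom (base M) (ext A) (ext C)" "disp C \<odot> d = reflmap A"
  shows "sound (bar_ctx Gs) (EqTm (J (wk_ty 3 0 (bar_ty As A)) (wk_ty 3 3 (bar_ty Gs C))
                (wk_tm 3 1 (bar_tm (A # As) (reix (reflmap A) C) (sec (reflmap A) C d)))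
                (Var 2) (Var 1) (Var 0))
             (bar_tm Gs C (Jmap M A C d)) (bar_ty Gs C))"
proof -
  let ?X = "cend As" and ?W = "reix (disp A) A" and ?I = "idty A"
  let ?r = "reflmap A" and ?k = "disp ?I"
  have t: "ctel As" and A: "isty A" "cx A = ?X" using assms(1) by simp_all
  have W: "isty ?W" "cx ?W = ext A" and I: "isty ?I" "cx ?I = ext ?W" using A(1) by simp_all
  have tG: "ctel Gs" unfolding assms(2) using A t by simp
  have C: "isty C" "cx C = ext ?I" and d: "arr d" "dm d = ext A" "cd d = ext C" using assms(3,4) by simp_all
  let ?\<rho> = "xenv ?I (xenv ?W (xenv A (uenv As)))"
  note w = wfenv_uenv[OF t] and wA = wfenv_uenv[OF assms(1), unfolded uenv_simps tend.simps]
  have u: "uenv Gs = ?\<rho>" and e: "cend Gs = ext ?I" unfolding assms(2) by (simp_all add: uenv_simps)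
  have wI: "wfenv (ext ?I) ?\<rho>" using wfenv_uenv[OF tG] unfolding u e .
  define h where "h = disp A \<odot> disp ?W \<odot> ?k"
  have h: "arr h" "dm h = ext ?I" "cd h = ?X" "cd h = cx A" using A by (simp_all add: h_def)
  note k = wI xenv3_shift[OF w A W I, folded h_def] w h(1-3)
  define h2 where "h2 = disp A \<odot> disp ?W"
  have h2: "arr h2" "dm h2 = ext ?W" "cd h2 = ?X" using A by (simp_all add: h2_def)
  have hh: "h2 \<odot> ?k = h" unfolding h_def h2_def using A by simp
  have kk: "arr ?k" "dm ?k = ext ?I" "cd ?k = ext ?W" using I by simp_all
  define x y where "x = resec (disp ?W) ?W (diag A)" and "y = diag ?W"
  note v = id_var[OF A(1), folded h2_def, folded x_def, folded y_def]
  have A2: "isty (reix h2 A)" "cx (reix h2 A) = ext ?W" using A h2 by simp_all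
  have A3: "reix ?k (reix h2 A) = reix h A"
    unfolding hh[symmetric] by (rule reix_cmp(1)) (use kk h2 A in simp_all)
  have wk: "fext h A \<odot> resec ?k (reix h2 A) z = (fext h2 A \<odot> z) \<odot> ?k" "gsection (reix h A) (resec ?k (reix h2 A) z)"
    if z: "gsection (reix h2 A) z" for z
  proof -
    note r = resec_facts[OF kk(1) A2(1) _ z]
    show g: "gsection (reix h A) (resec ?k (reix h2 A) z)" using r(1) kk A2 A3 by simp
    note Z = gsectionD[OF z] and G = gsectionD[OF g]
    have "fext h A \<odot> resec ?k (reix h2 A) z = fext h2 A \<odot> fext ?k (reix h2 A) \<odot> resec ?k (reix h2 A) z"
      unfolding hh[symmetric] by (rule reix_cmp(3)[symmetric]) (use kk h2 A G A3 in \<open>simp_all add: hh\<close>)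
    also have "fext ?k (reix h2 A) \<odot> resec ?k (reix h2 A) z = z \<odot> ?k" using r(2) kk A2 by simp
    also have "fext h2 A \<odot> z \<odot> ?k = (fext h2 A \<odot> z) \<odot> ?k"
      by (rule base.cmp_assoc'[symmetric]) (use kk h2 A Z A2 in simp_all)
    finally show "fext h A \<odot> resec ?k (reix h2 A) z = (fext h2 A \<odot> z) \<odot> ?k" .
  qed
  \<comment> \<open>The endpoints \<open>Var 2\<close> and \<open>Var 1\<close>, obtained by
    weakening the two variables of \<Gamma>.A.A along the display map of the identity type.\<close>
  define s r where "s = resec ?k (reix h2 A) x" and "r = resec ?k (reix h2 A) y"
  have s: "gsection (reix h A) s" "fext h A \<odot> s = disp ?W \<odot> ?k"
    and r: "gsection (reix h A) r" "fext h A \<odot> r = fext (disp A) A \<odot> ?k"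
    unfolding s_def r_def using wk[OF v(1)] wk[OF v(4)] v(2,5) by simp_all
  note T = IdT_var[OF A(1) kk(1,3) h_def s r]
  have q: "gsection (IdT (reix h A) s r) (diag ?I)" unfolding T(1) by (rule diag_simps(1)[OF I(1)])
  \<comment> \<open>The generic endpoints and proof name the identity of the path object once the
    weakening is projected away.\<close>
  have id: "idext h A \<odot> idmap (reix h A) s r (diag ?I) = ide (ext ?I)"
    unfolding T(2)[OF q] by (rule diag_simps(6)[OF I(1)])
  have 2: "itm (ext ?I) ?\<rho> (Var 2) (reix h A) s"
    by (rule i_Var) (use A3 v(3) in \<open>simp_all add: xenv_def renv_def s_def x_def numeral_2_eq_2\<close>)
  have 1: "itm (ext ?I) ?\<rho> (Var 1) (reix h A) r"
    by (rule i_Var) (use A3 v(3) in \<open>simp_all add: xenv_def renv_def r_def y_def\<close>)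
  have 0: "itm (ext ?I) ?\<rho> (Var 0) (IdT (reix h A) s r) (diag ?I)"
    unfolding T(1) by (rule i_Var) (simp_all add: xenv_def)
  define c where "c = sec ?r C d"
  have c: "gsection (reix ?r C) c"
    unfolding c_def by (rule sec_facts(1)) (use A C d assms(5) in simp_all)
  have a: "ity ?X (uenv As) (bar_ty As A) A" by (rule interp_bar(1)[OF t A])
  have b: "ity (ext ?I) (xenv ?I (xenv (wkself A) (xenv A (uenv As)))) (bar_ty Gs C) C"
    using interp_bar(1)[OF tG C(1)] C e u by simp
  have Cr: "isty (reix ?r C)" "cx (reix ?r C) = ext A" using A C by simp_all
  have cc: "itm (ext A) (xenv A (uenv As)) (bar_tm (A # As) (reix ?r C) c) (reix ?r C) c"
    using interp_bar(2)[OF assms(1) Cr(1) _ c] Cr by (simp add: uenv_simps)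
  let ?A = "reix h A" and ?F = "fext h A" and ?C = "reix (idext h A) C"
  note x = idext_simps[OF A(1) h(1,4)]
  have "reix ?F (reix ?r C) = reix (?r \<odot> ?F) C" by (rule reix_cmp(1)) (use A C h in simp_all)
  also have "\<dots> = reix (reflmap ?A) ?C"
    unfolding reflmap_reix[OF A(1) h(1,4), symmetric] by (rule reix_cmp(1)[symmetric]) (use A C h x in simp_all)
  finally have ty: "reix ?F (reix ?r C) = reix (reflmap ?A) ?C" .
  have cw: "itm (ext ?A) (xenv ?A ?\<rho>) (wk_tm 3 1 (bar_tm (A # As) (reix ?r C) c)) (reix (reflmap ?A) ?C)
      (resec ?F (reix ?r C) c)"
    using interp_wk1(2)[OF k A cc] unfolding ty .
  have j: "itm (ext ?I) ?\<rho> (J (wk_ty 3 0 (bar_ty As A)) (wk_ty 3 3 (bar_ty Gs C))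
                (wk_tm 3 1 (bar_tm (A # As) (reix ?r C) c)) (Var 2) (Var 1) (Var 0))
      (reix (idmap ?A s r (diag ?I)) ?C) (Jsec ?A ?C (resec ?F (reix ?r C) c) s r (diag ?I))"
    by (rule i_J[OF interp_wk0(1)[OF k a] interp_wk3[OF k A b] cw 2 1 0])
  let ?e = "elim ?r (idtgt A) (reflcell A) C c"
  note E = J_elim_reix[OF A(1) C c h(1,4)]
  have g: "gsection C ?e" by (rule elim_section[OF retraction_J[OF A(1)] C(1)]) (use A C c in simp_all)
  have hA: "isty ?A" using A h by simp
  note im = idmap_simps[OF hA s(1) r(1) q]
  have hc: "cx ?A = ext ?I" using A h by simp
  have "reix (idmap ?A s r (diag ?I)) ?C = reix (ide (ext ?I)) C"
    unfolding id[symmetric] by (rule reix_cmp(1)) (use im x C hc in simp_all)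
  then have j1: "reix (idmap ?A s r (diag ?I)) ?C = C" using C by simp
  have "resec (idmap ?A s r (diag ?I)) ?C (resec (idext h A) C ?e) = resec (ide (ext ?I)) C ?e"
    unfolding id[symmetric] by (rule resec_cmp) (use im x C hc g in simp_all)
  also have "\<dots> = ?e" using C g by simp
  also have "\<dots> = Jmap M A C d" unfolding c_def by (rule Jmap_elim[OF A(1) C d assms(5), symmetric])
  finally have j2: "Jsec ?A ?C (resec ?F (reix ?r C) c) s r (diag ?I) = Jmap M A C d"
    unfolding Jsec_def E .
  show ?thesis
    unfolding c_def[symmetric]
    by (rule sound_bar_tm[OF tG]) (use j[unfolded j1 j2] in \<open>simp only: u e\<close>)
qed

text \<open>The generic function applied to the generic argument names \<epsilon> itself. Stability
  of \<epsilon> moves the weakening in front, where it cancels against the two variables.\<close>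

lemma app_var:
  assumes "isty A" "isty B" "cx B = ext A"
  defines "P \<equiv> reix (disp A) (pity A B)"
  defines "h \<equiv> disp A \<odot> disp P"
  defines "x \<equiv> resec (disp P) (reix (disp A) A) (diag A)"
  shows "Asec (reix h A) (reix (fext h A) B) (diag P) x = sec (disp P) B (appmap A B)"
proof -
  have P: "isty P" "cx P = ext A" using assms(1-3) by (simp_all add: P_def)
  have Q: "isty (pity A B)" "cx (pity A B) = cx A" using assms(1-3) by simp_all
  note x = pair_var[OF assms(1) P, folded h_def, folded x_def]
  have h: "arr h" "dm h = ext P" "cd h = cx A" using assms(1) P by (simp_all add: h_def)
  let ?A = "reix h A" and ?B = "reix (fext h A) B" and ?P = "reix (disp P) P" and ?F = "fext h A"
  have F: "arr ?F" "dm ?F = ext ?A" "cd ?F = ext A" using assms(1) h by simp_all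
  have A: "isty ?A" "cx ?A = ext P" "isty ?B" "cx ?B = ext ?A" using assms(1-3) h F by simp_all
  have "reix h (pity A B) = ?P" unfolding h_def P_def
    by (rule reix_cmp(1)[symmetric]) (use assms(1) P Q in \<open>simp_all add: P_def\<close>)
  then have p: "?P = pity ?A ?B" unfolding pity_reix(1)[OF assms(1-3) h(1,3)] ..
  have P2: "isty ?P" "cx ?P = ext P" using P by simp_all
  note \<delta> = diag_simps[OF P(1)]
  have dg: "gsection (pity ?A ?B) (diag P)" unfolding p[symmetric] by (rule \<delta>(1))
  note X = gsectionD[OF x(1)]
  let ?k = "appsec ?A ?B (diag P)" and ?y = "resec (disp ?A) ?P (diag P)"
  have k: "gsection ?B ?k" by (rule appsec_section[OF A(1,3,4) dg])
  note K = gsectionD[OF k]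
  have rt: "reix x ?B = reix (disp P) B"
    unfolding x(2)[symmetric] by (rule reix_cmp(1)) (use X A F assms(1-3) in simp_all)
  have y: "gsection (reix (disp ?A) ?P) ?y" by (rule resec_facts(1)) (use A P2 \<delta> in simp_all)
  note Y = gsectionD[OF y]
  have yt: "reix (disp ?A) ?P = reix ?F P"
  proof -
    have "reix (disp ?A) ?P = reix (disp P \<odot> disp ?A) P" by (rule reix_cmp(1)) (use A P in simp_all)
    also have "reix (disp P \<odot> disp ?A) P = reix (disp A \<odot> disp P \<odot> disp ?A) (pity A B)"
      unfolding P_def[symmetric] by (subst (2) P_def, rule reix_cmp(1)) (use A P Q assms(1) in simp_all)
    also have "disp A \<odot> disp P \<odot> disp ?A = disp A \<odot> ?F"
      using assms(1) h P A(2) by (simp add: h_def)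
    also have "reix (disp A \<odot> ?F) (pity A B) = reix ?F P"
      unfolding P_def by (rule reix_cmp(1)[symmetric]) (use F Q assms(1) in simp_all)
    finally show ?thesis .
  qed
  have FP: "arr (fext ?F P)" "dm (fext ?F P) = ext (reix (disp ?A) ?P)" "cd (fext ?F P) = ext P"
    unfolding yt using F P by simp_all
  have FB: "arr (fext ?F B)" "dm (fext ?F B) = ext ?B" "cd (fext ?F B) = ext B" using F assms(2,3) by simp_all
  have am: "arr (appmap ?A ?B)" "dm (appmap ?A ?B) = ext (reix (disp ?A) ?P)" "cd (appmap ?A ?B) = ext ?B"
    unfolding p using A by simp_all
  have am': "arr (appmap A B)" "dm (appmap A B) = ext P" "cd (appmap A B) = ext B"
    unfolding P_def using assms(1-3) by simp_all
  have yd: "dm ?y = ext ?A" "cd ?y = ext (reix (disp ?A) ?P)" using Y A P2 by simp_all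
  have "fext (disp P) B \<odot> resec x ?B ?k = fext ?F B \<odot> fext x ?B \<odot> resec x ?B ?k"
    unfolding x(2)[symmetric]
    by (rule reix_cmp(3)[symmetric]) (use F X A assms(2,3) k rt x(2) in simp_all)
  also have "fext x ?B \<odot> resec x ?B ?k = ?k \<odot> x" by (rule resec_facts(2)) (use X A k in simp_all)
  also have "?k \<odot> x = appmap ?A ?B \<odot> ?y \<odot> x"
    unfolding appsec_def p[symmetric] by (rule base.cmp_assoc') (use am Y(1) yd X A in simp_all)
  also have "fext ?F B \<odot> appmap ?A ?B \<odot> ?y \<odot> x = (fext ?F B \<odot> appmap ?A ?B) \<odot> ?y \<odot> x"
    by (rule base.cmp_assoc'[symmetric]) (use am FB Y(1) yd X A in simp_all)
  also have "\<dots> = appmap A B \<odot> fext ?F P \<odot> ?y \<odot> x"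
    unfolding appmap_reix[OF assms(1-3) h(1,3), folded P_def]
    by (rule base.cmp_assoc') (use am' FP Y(1) yd X A in simp_all)
  also have "?y \<odot> x = fext x (reix (disp ?A) ?P) \<odot> resec x (reix (disp ?A) ?P) ?y"
    by (rule resec_facts(2)[symmetric]) (use X A P2 y in simp_all)
  also have "resec x (reix (disp ?A) ?P) ?y = resec (disp ?A \<odot> x) ?P (diag P)"
    by (rule resec_cmp) (use X A P2 \<delta> in simp_all)
  also have "\<dots> = diag P" unfolding X(4) A(2) by (rule resec_ide) (use P2 \<delta> in simp_all)
  also have "fext ?F P \<odot> fext x (reix (disp ?A) ?P) \<odot> diag P = fext (?F \<odot> x) P \<odot> diag P"
    unfolding yt by (rule reix_cmp(3)) (use F X A P x(2) \<delta> in simp_all)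
  also have "\<dots> = ide (ext P)" unfolding x(2) by (rule \<delta>(6))
  also have "appmap A B \<odot> ide (ext P) = appmap A B" using am' base.cmp_ide_right[of "appmap A B"] by simp
  finally have e: "fext (disp P) B \<odot> resec x ?B ?k = appmap A B" .
  have g: "gsection (reix (disp P) B) (resec x ?B ?k)"
    unfolding rt[symmetric] by (rule resec_facts(1)) (use X A k in simp_all)
  show ?thesis unfolding Asec_def
    by (rule sec_unique[symmetric, OF _ assms(2) _ g e]) (use P assms(3) in simp_all)
qed

lemma sound_ax_App:
  assumes "ctel (B # A # As)" "P = reix (disp A) (pity A B)"
  shows "sound (bar_ctx (P # A # As)) (EqTm (App (wk_ty 2 0 (bar_ty As A)) (wk_ty 2 1 (bar_ty (A # As) B)) (Var 0) (Var 1))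
       (bar_tm (P # A # As) (reix (disp P) B) (sec (disp P) B (appmap A B)))
       (bar_ty (P # A # As) (reix (disp P) B)))"
proof -
  let ?X = "cend As" and ?\<rho> = "xenv P (xenv A (uenv As))"
  have t: "ctel As" "ctel (A # As)" and A: "isty A" "cx A = ?X" and B: "isty B" "cx B = ext A"
    using assms(1) by simp_all
  have Q: "isty (pity A B)" "cx (pity A B) = cx A" using A B by simp_all
  have P: "isty P" "cx P = ext A" unfolding assms(2) using A Q by simp_all
  have tP: "ctel (P # A # As)" using t P by simp
  have b: "ity (ext A) (xenv A (uenv As)) (bar_ty (A # As) B) B"
    using interp_bar(1)[OF t(2) B(1)] B by (simp add: uenv_simps)
  define h where "h = disp A \<odot> disp P"
  have h: "arr h" "dm h = ext P" "cd h = ?X" using A P by (simp_all add: h_def)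
  note w = wfenv_uenv[OF t(1)]
  have wP: "wfenv (ext P) ?\<rho>" using wfenv_uenv[OF tP] by (simp add: uenv_simps)
  note k = wP xenv2_shift[OF w A P, folded h_def] w h
  let ?x = "resec (disp P) (reix (disp A) A) (diag A)"
  have e1: "reix (disp P) (reix (disp A) A) = reix h A" unfolding h_def
    by (rule reix_cmp(1)) (use A P in simp_all)
  have "reix (disp P) (reix (disp A) (pity A B)) = reix h (pity A B)" unfolding h_def
    by (rule reix_cmp(1)) (use A P Q in simp_all)
  then have e0: "reix (disp P) P = reix h (pity A B)" unfolding assms(2)[symmetric] .
  have 1: "itm (ext P) ?\<rho> (Var 1) (reix h A) ?x"
    by (rule i_Var) (use e1 in \<open>simp_all add: xenv_def renv_def\<close>)
  have 0: "itm (ext P) ?\<rho> (Var 0) (reix h (pity A B)) (diag P)"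
    by (rule i_Var) (use e0 in \<open>simp_all add: xenv_def\<close>)
  note x = pair_var(2)[OF A(1) P, folded h_def] and v = app_var[OF A(1) B, folded assms(2), folded h_def]
  show ?thesis
    by (rule sound_bar_tm[OF tP])
      (use app_wk[OF k interp_bar(1)[OF t(1) A] b 0 1, unfolded x v] in \<open>simp only: uenv_simps tend.simps\<close>)
qed

text \<open>The axiom speaks of 2-cells through \<open>cellty\<close> and \<open>cellsec\<close>;
  for cells between sections these coincide with \<open>IdT\<close> and \<open>cell_sec\<close>, in
  terms of which \<open>Extsec\<close> is defined.\<close>

lemma sound_ax_Ext:
  assumes "ctel (B # A # As)" "gsection (pity A B) m" "gsection (pity A B) n"
    "p \<in> cells (base M) (appsec A B m) (appsec A B n)" "disp B \<rhd> p = id2 (ide (ext A))" "e = extcell A B m n p"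
  shows "sound (bar_ctx As) (EqTm (Ext (bar_ty As A) (bar_ty (A # As) B)
                (bar_tm As (pity A B) m) (bar_tm As (pity A B) n)
                (bar_tm (A # As) (cellty B p) (cellsec B p)))
             (bar_tm As (cellty (pity A B) e) (cellsec (pity A B) e))
             (bar_ty As (cellty (pity A B) e)))"
proof -
  let ?X = "cend As" and ?P = "pity A B" and ?am = "appsec A B m" and ?an = "appsec A B n"
  have t: "ctel As" "ctel (A # As)" and A: "isty A" "cx A = ?X" and B: "isty B" "cx B = ext A"
    using assms(1) by simp_all
  have P: "isty ?P" "cx ?P = ?X" using A B by simp_all
  have p: "cell p" "sr p = ?am" "tg p = ?an" "disp B \<rhd> p = id2 (ide (cx B))" using assms(4,5) B by simp_all
  note a = appsec_section[OF A(1) B assms(2)] appsec_section[OF A(1) B assms(3)]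
  note c = cellty_IdT[OF B(1) a p] and s = cell_sec_facts(1,3)[OF B(1) a p]
  have x: "extends A B m n p e" unfolding assms(6) by (rule extcell_extends(1)[OF A(1) B assms(2,3) p(1-3) assms(5)])
  have e: "cell e" "sr e = m" "tg e = n" "disp ?P \<rhd> e = id2 (ide (cx ?P))" using x P A unfolding extends_def by simp_all
  note c' = cellty_IdT[OF P(1) assms(2,3) e]
  have E: "Extsec A B m n (cell_sec B ?am ?an p) = cell_sec ?P m n e" unfolding Extsec_def s(2) assms(6)[symmetric] ..
  have b: "ity (ext A) (xenv A (uenv As)) (bar_ty (A # As) B) B"
    using interp_bar(1)[OF t(2) B(1)] B by (simp add: uenv_simps)
  have I: "isty (IdT B ?am ?an)" "cx (IdT B ?am ?an) = ext A" using B a by simp_all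
  have q: "itm (ext A) (xenv A (uenv As)) (bar_tm (A # As) (IdT B ?am ?an) (cell_sec B ?am ?an p)) (IdT B ?am ?an) (cell_sec B ?am ?an p)"
    using interp_bar(2)[OF t(2) I(1) _ s(1)] I by (simp add: uenv_simps)
  show ?thesis
    unfolding c c'
    by (rule sound_bar_tm[OF t(1)])
      (use i_Ext[OF interp_bar(1)[OF t(1) A] b interp_bar(2)[OF t(1) P assms(2)] interp_bar(2)[OF t(1) P assms(3)] q, unfolded E]
        in simp)
qed

lemma sound_tm_ty: "sound G (EqTm a b A) \<Longrightarrow> sound G (EqTy A A)"
  unfolding sound_def holds.simps by blast

lemma issub_section:
  assumes "ctel As" "A \<in> fib M (cend As)" "gsection A a"
  shows "issub (cend As) (uenv As) (insts [bar_tm As A a]) (renv a (uenv (A # As)))"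
proof -
  have A: "isty A" "cx A = cend As" using assms(2) by simp_all
  note w = wfenv_uenv[OF assms(1)]
  have "renv a (xenv A (uenv As)) = scons (A, a) (uenv As)" by (rule renv_xenv_section) (use A w assms(3) in simp_all)
  then show ?thesis unfolding uenv_simps using issub_inst1[OF w interp_bar(2)[OF assms(1) A assms(3)]] by simp
qed

text \<open>Reindexing along the diagonal instantiates the second copy of the variable by the first,
  which is what \<open>contract\<close> does to indices.\<close>

lemma uenv_contract:
  assumes "ctel (A # As)" "f = diag A"
  shows "uenv (A # As) \<circ> contract = renv f (uenv (wkself A # A # As))"
proof -
  have A: "isty A" using assms(1) by simp
  have "renv (diag A) (xenv (wkself A) (uenv (A # As))) = scons (wkself A, diag A) (uenv (A # As))"
    by (rule renv_xenv_section) (use wfenv_uenv[OF assms(1)] A in simp_all)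
  also have "\<dots> = uenv (A # As) \<circ> contract"
  proof
    show "scons (wkself A, diag A) (uenv (A # As)) n = (uenv (A # As) \<circ> contract) n" for n
      by (cases n) (simp_all add: comp_apply contract_def uenv_simps xenv_def)
  qed
  finally show ?thesis unfolding assms(2) by (simp only: uenv_simps)
qed

lemma uenv_exchange:
  assumes "ctel (A # As)" "ctel (B # As)" "f = symm M A B"
  shows "uenv (reix (disp B) A # B # As) \<circ> exchange = renv f (uenv (reix (disp A) B # A # As))"
  unfolding assms(3) uenv_simps by (rule xenv_exchange) (use assms(1,2) wfenv_uenv[of As] in simp_all)

text \<open>Rules without explicit equality are fed to the congruence lemmas with both sides equal.
  The premises on component types that a rule leaves implicit come from \<open>sound_tail1\<close>,
  \<open>sound_tail2\<close>, \<open>sound_tm_ty\<close> and \<open>sound_Pi_inv\<close>.\<close>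

theorem soundness:
  "is_ctx M G \<Longrightarrow> semctx G"
  "derivable M G \<J> \<Longrightarrow> sound G \<J>"
proof (induction rule: is_ctx_derivable.inducts)
  case (ctx_cons G A) then show ?case by (simp add: sound_def)
next
  case (assumption A G) then show ?case by (intro sound_var)
next
  case (weakening D G \<J> A) then show ?case by (intro sound_weakening)
next
  case (contraction D A G \<J>) then show ?case by (intro sound_contraction)
next
  case (exchanging D B A G \<J>) then show ?case by (intro sound_exchanging)
next
  case (substitution D A G \<J> a) then show ?case by (intro sound_substitution)
next
  case (substitution_eq_ty D A G B a a') then show ?case by (intro sound_substitution_eq(1))
next
  case (substitution_eq_tm D A G b B a a') then show ?case by (intro sound_substitution_eq(2))
next
  case (ty_refl G A) then show ?case by (simp only: sound_IsTy)
next
  case (ty_sym G A B) then show ?case by (metis sound_ty_sym)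
next
  case (ty_trans G A B C) then show ?case using sound_ty_trans by blast
next
  case (tm_refl G a A) then show ?case by (simp only: sound_HasTy)
next
  case (tm_sym G a b A) then show ?case by (metis sound_tm_sym)
next
  case (tm_trans G a b A c) then show ?case using sound_tm_trans by blast
next
  case (conv G a A B) then show ?case unfolding sound_HasTy using sound_conv by blast
next
  case (conv_eq G a b A B) then show ?case using sound_conv by blast
next
  case (Sigma_form G A B) then show ?case unfolding sound_IsTy by (intro sound_Sigma_cong(1))
next
  case (Sigma_cong G A A' B B') then show ?case by (intro sound_Sigma_cong(1))
next
  case (Pair_intro A G B a b) then show ?case
    unfolding sound_IsTy sound_HasTy by (metis sound_Pair_cong sound_tail1 sound_tm_ty)
next
  case (Pair_cong G A A' B B' a a' b b') then show ?case by (intro sound_Pair_cong)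
next
  case (SplitE_elim A B G C d c) then show ?case
    unfolding sound_IsTy sound_HasTy
    using sound_SplitE_cong[OF sound_tail2 sound_tail1] by metis
next
  case (SplitE_cong G A A' B B' C C' d d' c c') then show ?case by (intro sound_SplitE_cong)
next
  case (SplitE_comp A B G C d a b) then show ?case unfolding sound_IsTy sound_HasTy by (intro sound_SplitE_comp)
next
  case (Unit_form G) then show ?case unfolding sound_IsTy by (intro sound_Unit(1))
next
  case (Star_intro G) then show ?case unfolding sound_HasTy by (intro sound_Unit(2))
next
  case (UnitE_elim G C d c) then show ?case unfolding sound_IsTy sound_HasTy by (intro sound_UnitE_cong)
next
  case (UnitE_cong G C C' d d' c c') then show ?case by (intro sound_UnitE_cong)
next
  case (UnitE_comp G C d) then show ?case unfolding sound_IsTy sound_HasTy by (intro sound_UnitE_comp)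
next
  case (Id_form G a A b) then show ?case
    unfolding sound_IsTy sound_HasTy by (metis sound_Id_cong(1) sound_tm_ty)
next
  case (Id_cong G A A' a a' b b') then show ?case by (intro sound_Id_cong(1))
next
  case (Refl_intro G a A) then show ?case unfolding sound_HasTy by (metis sound_Id_cong(2) sound_tm_ty)
next
  case (Refl_cong G A A' a a') then show ?case by (intro sound_Id_cong(2))
next
  case (J_elim A G C d a b p) then show ?case
    unfolding sound_IsTy sound_HasTy by (metis sound_J_cong sound_tm_ty)
next
  case (J_cong G A A' C C' d d' a a' b b' p p') then show ?case by (intro sound_J_cong)
next
  case (J_comp A G C d a) then show ?case unfolding sound_IsTy sound_HasTy by (intro sound_J_comp)
next
  case (discrete_eq G p A a b q e) then show ?case unfolding sound_HasTy by (metis sound_discrete(1))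
next
  case (discrete_refl G p A a b q e) then show ?case unfolding sound_HasTy by (intro sound_discrete(2))
next
  case (Pi_form G A B) then show ?case unfolding sound_IsTy by (intro sound_Sigma_cong(2))
next
  case (Pi_cong G A A' B B') then show ?case by (intro sound_Sigma_cong(2))
next
  case (Lam_intro G A f B) then show ?case
    unfolding sound_IsTy sound_HasTy by (metis sound_Lam_cong sound_tm_ty)
next
  case (Lam_cong G A A' B B' f f') then show ?case by (intro sound_Lam_cong)
next
  case (App_elim G m A B a) then show ?case
    unfolding sound_HasTy by (metis sound_App_cong sound_Pi_inv)
next
  case (App_cong G A A' B B' m m' a a') then show ?case by (intro sound_App_cong)
next
  case (App_comp A G f B a) then show ?case unfolding sound_HasTy by (intro sound_App_comp)
next
  case (ext_intro G m A B n p) then show ?case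
    unfolding sound_HasTy by (metis sound_Ext_cong sound_Pi_inv)
next
  case (ext_cong G A A' B B' m m' n n' p p') then show ?case by (intro sound_Ext_cong)
next
  case (ext_refl G m A B) then show ?case unfolding sound_HasTy by (intro sound_Ext_refl)
next
  case (ext_comp G m A B n p a) then show ?case unfolding sound_HasTy by (intro sound_Ext_comp)
next
  case (ax_ty As A) then show ?case using interp_bar(1)[of As A] by (intro sound_bar) auto
next
  case (ax_tm As A a) then show ?case using interp_bar(1)[of As A] interp_bar(2)[of As A a] by (intro sound_bar) auto
next
  case (ax_var A As)
  then show ?case by (intro sound_bar_tm) (auto simp: uenv_simps xenv_def intro: i_Var)
next
  case (ax_subst_ty Ds A As a B)
  then show ?case by (intro sound_reindex(1) issub_section) (auto simp: tel_append gsection_iff)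
next
  case (ax_subst_tm Ds A As a B b)
  then show ?case by (intro sound_reindex(2) issub_section) (auto simp: tel_append gsection_iff)
next
  case (ax_weaken_ty Ds As A B f)
  then show ?case by (intro sound_reindex_ren(1)) (auto simp: tel_append uenv_simps xenv_def)
next
  case (ax_weaken_tm Ds As A B b f)
  then show ?case by (intro sound_reindex_ren(2)) (auto simp: tel_append uenv_simps xenv_def)
next
  case (ax_contract_ty Ds A As B f)
  then show ?case by (intro sound_reindex_ren(1) uenv_contract) (auto simp: tel_append)
next
  case (ax_contract_tm Ds A As B b f)
  then show ?case by (intro sound_reindex_ren(2) uenv_contract) (auto simp: tel_append)
next
  case (ax_exchange_ty A As B Ds C f)
  then show ?case using symm_facts(1-3)[of A B] by (intro sound_reindex_ren(1) uenv_exchange) (auto simp: tel_append)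
next
  case (ax_exchange_tm A As B Ds C c f)
  then show ?case using symm_facts(1-3)[of A B] by (intro sound_reindex_ren(2) uenv_exchange) (auto simp: tel_append)
next
  case (ax_Sigma B A As) then show ?case by (intro sound_ax_Sigma_Pi(1))
next
  case (ax_Pair B A As Gs f S) then show ?case by (simp only:) (rule sound_ax_Pair; simp only:)
next
  case (ax_SplitE B A As S C d) then show ?case by (intro sound_ax_SplitE)
next
  case (ax_Unit As X)
  then show ?case using interp_bar(1)[of As "unty X"] wfenv_ob[OF wfenv_uenv] i_Unit by (intro sound_bar) auto
next
  case (ax_Star As X)
  then show ?case by (intro sound_bar_tm) (auto intro: i_Star)
next
  case (ax_UnitE As X U C d) then show ?case by (intro sound_ax_UnitE)
next
  case (ax_Id A As Gs) then show ?case by (simp only:) (rule sound_ax_Id; simp only:)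
next
  case (ax_Refl A As I) then show ?case by (intro sound_ax_Refl)
next
  case (ax_J A As Gs C d) then show ?case by (intro sound_ax_J)
next
  case (ax_Pi B A As) then show ?case by (intro sound_ax_Sigma_Pi(2))
next
  case (ax_Lam B A As f) then show ?case by (intro sound_ax_Sigma_Pi(3))
next
  case (ax_App B A As P Gs B') then show ?case by (simp only:) (rule sound_ax_App; simp only:)
next
  case (ax_Ext B A As m n p e) then show ?case by (intro sound_ax_Ext)
qed simp_all

text \<open>In the generic environment each bar denotes its own datum, while soundness gives the two
  bars a common denotation; functionality of the interpretation identifies the data.\<close>

lemma bar_eq:
  assumes "ctel As"
  shows "B \<in> fib M (cend As) \<Longrightarrow> C \<in> fib M (cend As) \<Longrightarrow>
      derivable M (bar_ctx As) (EqTy (bar_ty As B) (bar_ty As C)) \<Longrightarrow> B = C"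
    "B \<in> fib M (cend As) \<Longrightarrow> gsection B b \<Longrightarrow> gsection B c \<Longrightarrow>
      derivable M (bar_ctx As) (EqTm (bar_tm As B b) (bar_tm As B c) (bar_ty As B)) \<Longrightarrow> b = c"
proof -
  note v = valid_uenv[OF assms]
  assume B: "B \<in> fib M (cend As)"
  note i = interp_bar[OF assms, of B]
  show "B = C" if C: "C \<in> fib M (cend As)" and d: "derivable M (bar_ctx As) (EqTy (bar_ty As B) (bar_ty As C))"
  proof -
    obtain S where "ity (cend As) (uenv As) (bar_ty As B) S" "ity (cend As) (uenv As) (bar_ty As C) S"
      using sound_eqty[OF soundness(2)[OF d] v] .
    then show ?thesis using interp_functional(1) i(1) interp_bar(1)[OF assms, of C] B C by auto metis
  qed
  show "b = c" if b: "gsection B b" "gsection B c"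
    and d: "derivable M (bar_ctx As) (EqTm (bar_tm As B b) (bar_tm As B c) (bar_ty As B))"
  proof -
    obtain S s where "itm (cend As) (uenv As) (bar_tm As B b) S s" "itm (cend As) (uenv As) (bar_tm As B c) S s"
      using sound_eqtm[OF soundness(2)[OF d] v] .
    moreover have "itm (cend As) (uenv As) (bar_tm As B b) B b" "itm (cend As) (uenv As) (bar_tm As B c) B c"
      using i(2) B b by simp_all
    ultimately show ?thesis using interp_functional(2) by metis
  qed
qed

end

theorem proposition5p6p1:
  fixes M :: "('o, 'm, 'c, 'a, 't, 'u) model_data" and As :: "'a list"
  assumes "two_dim_model M"
    and "tel M (top1 M) As"
  shows "(\<forall>B C. B \<in> fib M (tend M (top1 M) As) \<and> C \<in> fib M (tend M (top1 M) As) \<and>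
            derivable M (bar_ctx As) (EqTy (bar_ty As B) (bar_ty As C)) \<longrightarrow> B = C) \<and>
         (\<forall>B b c. B \<in> fib M (tend M (top1 M) As) \<and> gsection M B b \<and> gsection M B c \<and>
            derivable M (bar_ctx As) (EqTm (bar_tm As B b) (bar_tm As B c) (bar_ty As B)) \<longrightarrow>
            b = c)"
proof -
  interpret m: model M by unfold_locales (rule assms(1))
  show ?thesis using m.bar_eq[OF assms(2)] by blast
qed

end
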